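(* Let $\Omega\subset\mathbb{R}^d$ ($d\le 3$) be a bounded domain with $\partial\Omega\in C^{1,1}$, let $N\ge2$, and let $(D_{ij})\in\mathbb{R}^{(N+1)\times(N+1)}$ be a (constant) symmetric matrix with $D_{ij}>0$ for $i\ne j$. Then there exist constants $C>0$, depending only on $\Omega$, and $\lambda>0$, depending only on $\Omega$ and $(D_{ij})$, such that the following holds. Let $c_1^0,\ldots,c_N^0$ be nonnegative measurable functions on $\Omega$ with $\sum_{i=1}^Nc_i^0\le1$, let $c_{N+1}^0=1-\sum_{i=1}^Nc_i^0$, and suppose $\min_{i=1,\ldots,N+1}\|c_i^0\|_{L^1(\Omega)}>0$. Suppose that the production rates vanish, $r=(r_1,\ldots,r_{N+1})^\top=0$, and let $(c_1,\ldots,c_{N+1})$ be the weak solution, constructed as described in the context, to the Maxwell-Stefan system $$\partial_t c_i+\operatorname{div}J_i=0,\qquad \nabla c_i=-\sum_{j=1,\,j\ne i}^{N+1}\frac{c_jJ_i-c_iJ_j}{D_{ij}}\quad\text{in }\Omega,\ t>0,$$ $$\nabla c_i\cdot\nu=0\ \text{ on }\partial\Omega,\ t>0,\qquad c_i(\cdot,0)=c_i^0\ \text{ in }\Omega,\qquad i=1,\ldots,N+1.$$ Then, with $c^0=(c_1^0,\ldots,c_{N+1}^0)^\top$ and $\bar c_i^0=\operatorname{meas}(\Omega)^{-1}\int_\Omega c_i^0\,dx$, $$\|c_i(\cdot,t)-\bar c_i^0\|_{L^1(\Omega)}\le Ce^{-\lambda t}\sqrt{\mathcal{H}^*[c^0]},\qquad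 i=1,\ldots,N+1,\ t\ge0 .$$
   Context: Relative entropy: $\mathcal{H}^*[c]=\sum_{i=1}^{N+1}\int_\Omega c_i\log\frac{c_i}{\bar c_i^0}\,dx$ (with $0\log0=0$). Notation: $\nu$ is the exterior unit normal on $\partial\Omega$; $\mathcal{V}=\{u\in H^2(\Omega):\nabla u\cdot\nu=0\text{ on }\partial\Omega\}$ with dual $\mathcal{V}'$; $d_{ij}=1/D_{ij}$ for $i\ne j$; $c'=(c_1,\ldots,c_N)^\top$. The matrix $A_0=A_0(c')=(a_{ij}^0)\in\mathbb{R}^{N\times N}$ is $$a^0_{ij}=-(d_{ij}-d_{i,N+1})c_i\ (i\ne j),\qquad a^0_{ii}=\sum_{j=1,\,j\ne i}^N(d_{ij}-d_{i,N+1})c_j+d_{i,N+1},$$ invertible for $c_i\ge0$, $\sum_{i=1}^N c_i\le1$. For $w\in\mathbb{R}^N$ put $c_i(w)=e^{w_i}/(1+e^{w_1}+\cdots+e^{w_N})$, $i=1,\ldots,N$, $c_{N+1}(w)=1-\sum_{i=1}^Nc_i(w)$, $c'(w)=(c_1(w),\ldots,c_N(w))^\top$. Let $H=(h_{ij})\in\mathbb{R}^{N\times N}$, $h_{ij}=\frac1{c_{N+1}}+\frac{\delta_{ij}}{c_i}$, and $B(w)=(b_{ij}(w))=A_0(c'(w))^{-1}H(c'(w))^{-1}$. Weak solution: the system is understood as the reduced system $\partial_tc'-\operatorname{div}(A_0(c')^{-1}\nabla c')=0$ in $L^2(0,T;\mathcal{V}')$ for every $T>0$ (tested against $\phi\in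 L^2(0,T;\mathcal{V})^N$, no-flux boundary condition included), $c'(\cdot,0)=(c_1^0,\ldots,c_N^0)^\top$, with $c_{N+1}=1-\sum_{i=1}^Nc_i$, $0\le c_i\le1$ for $i=1,\ldots,N+1$, $c_i\in L^2_{\rm loc}(0,\infty;H^1(\Omega))$, $\partial_tc_i\in L^2_{\rm loc}(0,\infty;\mathcal{V}')$. Functions are identified with their representatives that are continuous in time with values in $\mathcal{V}'$, so that $c_i(\cdot,t)$ is defined for all $t\ge 0$. The constructed solution: (i) Assume first that there is $0<\eta<1$ with $c_i^0\ge\eta$ for $i=1,\ldots,N+1$, and set $w_i^0=\log(c_i^0/c_{N+1}^0)$. For a time step $\tau>0$ and $\varepsilon>0$, let $w^k\in\mathcal{V}^N$, $k=1,2,\ldots$, be successively chosen solutions of $$\frac1\tau\int_\Omega\big(c'(w^k)-c'(w^{k-1})\big)\cdot v\,dx+\int_\Omega\sum_{i,j=1}^Nb_{ij}(w^k)\nabla v_i\cdot\nabla w_j^k\,dx+\varepsilon\int_\Omega(\Delta w^k\cdot\Delta v+w^k\cdot v)\,dx=0\quad\text{for all }v\in\mathcal{V}^N,$$ and set $c^{(\tau)}(x,t)=c'(w^k(x))$ for $t\in((k-1)\tau,k\tau]$. The constructed $c'$ is a limit, along a sequence $(\varepsilon,\tau)\to0$, of $c^{(\tau)}$: strongly in $L^2(0,T;L^2(\Omega))$, with $\nabla c^{(\tau)}\rightharpoonup\nabla c'$ weakly in $L^2(0,T;L^2(\Omega))$, with the discrete time derivatives converging weakly to $\partial_tc'$ in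 $L^2(0,T;\mathcal{V}')$, and with $\varepsilon w^{(\tau)}\to0$ strongly in $L^2(0,T;H^2(\Omega))$, where $w^{(\tau)}(x,t)=w^k(x)$ for $t\in((k-1)\tau,k\tau]$, for every $T>0$. (ii) For general initial data, the solution is the limit, in the same senses and along a sequence $\eta\to0$, of solutions from (i) whose initial data have all $N+1$ components bounded below by $\eta$, sum to one, and converge to $c^0$ a.e. in $\Omega$. *)

theory Defs
  imports "HOL-Analysis.Analysis" "Jordan_Normal_Form.Gauss_Jordan_Elimination"
begin

section \<open>Domains with a boundary of class C11\<close>

text \<open>
  Near \<open>x\<close>, the set \<open>\<Omega>\<close> is the strict epigraph, in the direction of the unit vector \<open>e\<close>, of a
  function \<open>\<gamma>\<close> with Lipschitz continuous gradient \<open>g\<close>. Instead of being a function on the hyperplane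
  orthogonal to \<open>e\<close>, \<open>\<gamma>\<close> is defined on the whole space and constant in the direction \<open>e\<close>.
\<close>

definition C11_graph_at ::
  "'a::euclidean_space set \<Rightarrow> 'a \<Rightarrow> real \<Rightarrow> 'a \<Rightarrow> ('a \<Rightarrow> real) \<Rightarrow> ('a \<Rightarrow> 'a) \<Rightarrow> bool" where
  "C11_graph_at \<Omega> x r e \<gamma> g \<longleftrightarrow>
     r > 0 \<and> norm e = 1 \<and>
     (\<forall>y s. \<gamma> (y + s *\<^sub>R e) = \<gamma> y) \<and>
     (\<forall>y. GDERIV \<gamma> y :> g y) \<and> (\<exists>L. L-lipschitz_on UNIV g) \<and>
     \<Omega> \<inter> ball x r = {y \<in> ball x r. \<gamma> y < y \<bullet> e}"

definition C11_boundary :: "'a::euclidean_space set \<Rightarrow> bool" where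
  "C11_boundary \<Omega> \<longleftrightarrow> (\<forall>x\<in>frontier \<Omega>. \<exists>r e \<gamma> g. C11_graph_at \<Omega> x r e \<gamma> g)"

definition bounded_C11_domain :: "'a::euclidean_space set \<Rightarrow> bool" where
  "bounded_C11_domain \<Omega> \<longleftrightarrow>
     open \<Omega> \<and> connected \<Omega> \<and> \<Omega> \<noteq> {} \<and> bounded \<Omega> \<and> C11_boundary \<Omega>"

definition exterior_normal :: "'a::euclidean_space set \<Rightarrow> 'a \<Rightarrow> 'a" where
  "exterior_normal \<Omega> x =
     (THE n. \<exists>r e \<gamma> g. C11_graph_at \<Omega> x r e \<gamma> g \<and> n = sgn (g x - e))"

text \<open>
  Surface measure: Hausdorff measure of dimension \<open>d - 1\<close> on the boundary, up to the normalization
  constant, which is irrelevant since only null sets and convergence are used.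
\<close>

definition hausdorff_outer :: "nat \<Rightarrow> 'a::euclidean_space set \<Rightarrow> ennreal" where
  "hausdorff_outer s A =
     (SUP \<delta>\<in>{0<..}.
        INF K\<in>{K :: nat \<Rightarrow> 'a set. A \<subseteq> (\<Union>n. K n) \<and> (\<forall>n. bounded (K n) \<and> diameter (K n) \<le> \<delta>)}.
          \<Sum>n. if K n = {} then 0 else ennreal (diameter (K n) ^ s))"

definition surface_measure :: "'a::euclidean_space set \<Rightarrow> 'a measure" where
  "surface_measure \<Omega> =
     restrict_space (measure_of UNIV (sets borel) (hausdorff_outer (DIM('a) - 1))) (frontier \<Omega>)"


section \<open>Lebesgue and Sobolev spaces\<close>

text \<open>
  Elements of function spaces are represented by functions on the whole space; only their values
  almost everywhere in \<open>\<Omega>\<close> matter.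
\<close>

definition L1_norm :: "'a::euclidean_space set \<Rightarrow> ('a \<Rightarrow> real) \<Rightarrow> real" where
  "L1_norm \<Omega> f = (LINT x|lebesgue_on \<Omega>. \<bar>f x\<bar>)"

definition average :: "'a::euclidean_space set \<Rightarrow> ('a \<Rightarrow> real) \<Rightarrow> real" where
  "average \<Omega> f = (LINT x|lebesgue_on \<Omega>. f x) / measure lebesgue \<Omega>"

definition L2 :: "'a::euclidean_space set \<Rightarrow> ('a \<Rightarrow> real) set" where
  "L2 \<Omega> = {f \<in> borel_measurable (lebesgue_on \<Omega>). integrable (lebesgue_on \<Omega>) (\<lambda>x. (f x)\<^sup>2)}"

definition L2_norm :: "'a::euclidean_space set \<Rightarrow> ('a \<Rightarrow> real) \<Rightarrow> real" where
  "L2_norm \<Omega> f = sqrt (LINT x|lebesgue_on \<Omega>. (f x)\<^sup>2)"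

primrec Ck :: "nat \<Rightarrow> ('a::euclidean_space \<Rightarrow> real) \<Rightarrow> bool" where
  "Ck 0 f \<longleftrightarrow> continuous_on UNIV f"
| "Ck (Suc k) f \<longleftrightarrow>
     (\<forall>x. f differentiable at x) \<and> (\<forall>b\<in>Basis. Ck k (\<lambda>x. frechet_derivative f (at x) b))"

definition smooth :: "('a::euclidean_space \<Rightarrow> real) \<Rightarrow> bool" where
  "smooth f \<longleftrightarrow> (\<forall>k. Ck k f)"

definition test_functions :: "'a::euclidean_space set \<Rightarrow> ('a \<Rightarrow> real) set" where
  "test_functions \<Omega> =
     {\<phi>. smooth \<phi> \<and> compact (closure {x. \<phi> x \<noteq> 0}) \<and> closure {x. \<phi> x \<noteq> 0} \<subseteq> \<Omega>}"

definition has_weak_deriv ::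
  "'a::euclidean_space set \<Rightarrow> 'a \<Rightarrow> ('a \<Rightarrow> real) \<Rightarrow> ('a \<Rightarrow> real) \<Rightarrow> bool" where
  "has_weak_deriv \<Omega> b u g \<longleftrightarrow> u \<in> L2 \<Omega> \<and> g \<in> L2 \<Omega> \<and>
     (\<forall>\<phi>\<in>test_functions \<Omega>.
        (LINT x|lebesgue_on \<Omega>. u x * frechet_derivative \<phi> (at x) b) =
        - (LINT x|lebesgue_on \<Omega>. g x * \<phi> x))"

definition weak_deriv ::
  "'a::euclidean_space set \<Rightarrow> 'a \<Rightarrow> ('a \<Rightarrow> real) \<Rightarrow> ('a \<Rightarrow> real)" where
  "weak_deriv \<Omega> b u = (SOME g. has_weak_deriv \<Omega> b u g)"

definition H1 :: "'a::euclidean_space set \<Rightarrow> ('a \<Rightarrow> real) set" where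
  "H1 \<Omega> = {u \<in> L2 \<Omega>. \<forall>b\<in>Basis. \<exists>g. has_weak_deriv \<Omega> b u g}"

definition H2 :: "'a::euclidean_space set \<Rightarrow> ('a \<Rightarrow> real) set" where
  "H2 \<Omega> = {u \<in> H1 \<Omega>. \<forall>b\<in>Basis. weak_deriv \<Omega> b u \<in> H1 \<Omega>}"

definition H1_norm :: "'a::euclidean_space set \<Rightarrow> ('a \<Rightarrow> real) \<Rightarrow> real" where
  "H1_norm \<Omega> u = sqrt ((L2_norm \<Omega> u)\<^sup>2 + (\<Sum>b\<in>Basis. (L2_norm \<Omega> (weak_deriv \<Omega> b u))\<^sup>2))"

definition H2_norm :: "'a::euclidean_space set \<Rightarrow> ('a \<Rightarrow> real) \<Rightarrow> real" where
  "H2_norm \<Omega> u =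
     sqrt ((L2_norm \<Omega> u)\<^sup>2 + (\<Sum>b\<in>Basis. (L2_norm \<Omega> (weak_deriv \<Omega> b u))\<^sup>2)
       + (\<Sum>a\<in>Basis. \<Sum>b\<in>Basis. (L2_norm \<Omega> (weak_deriv \<Omega> a (weak_deriv \<Omega> b u)))\<^sup>2))"

definition grad_inner ::
  "'a::euclidean_space set \<Rightarrow> ('a \<Rightarrow> real) \<Rightarrow> ('a \<Rightarrow> real) \<Rightarrow> 'a \<Rightarrow> real" where
  "grad_inner \<Omega> u v x = (\<Sum>b\<in>Basis. weak_deriv \<Omega> b u x * weak_deriv \<Omega> b v x)"

definition laplacian :: "'a::euclidean_space set \<Rightarrow> ('a \<Rightarrow> real) \<Rightarrow> 'a \<Rightarrow> real" where
  "laplacian \<Omega> u x = (\<Sum>b\<in>Basis. weak_deriv \<Omega> b (weak_deriv \<Omega> b u) x)"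

text \<open>
  \<open>g\<close> is the boundary trace of \<open>v \<in> H1 \<Omega>\<close>: the trace operator is the continuous extension of the
  restriction of smooth functions to the boundary.
\<close>

definition has_trace ::
  "'a::euclidean_space set \<Rightarrow> ('a \<Rightarrow> real) \<Rightarrow> ('a \<Rightarrow> real) \<Rightarrow> bool" where
  "has_trace \<Omega> v g \<longleftrightarrow> v \<in> H1 \<Omega> \<and> g \<in> borel_measurable (surface_measure \<Omega>) \<and>
     (\<exists>s :: nat \<Rightarrow> 'a \<Rightarrow> real. (\<forall>n. smooth (s n)) \<and>
        (\<lambda>n. H1_norm \<Omega> (\<lambda>x. s n x - v x)) \<longlonglongrightarrow> 0 \<and>
        (\<lambda>n. \<integral>\<^sup>+x. ennreal ((s n x - g x)\<^sup>2) \<partial>surface_measure \<Omega>) \<longlonglongrightarrow> 0)"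

definition zero_normal_derivative :: "'a::euclidean_space set \<Rightarrow> ('a \<Rightarrow> real) \<Rightarrow> bool" where
  "zero_normal_derivative \<Omega> u \<longleftrightarrow>
     (\<exists>g. (\<forall>b\<in>Basis. has_trace \<Omega> (weak_deriv \<Omega> b u) (g b)) \<and>
          (AE x in surface_measure \<Omega>. (\<Sum>b\<in>Basis. g b x * (exterior_normal \<Omega> x \<bullet> b)) = 0))"

definition Neumann_H2 :: "'a::euclidean_space set \<Rightarrow> ('a \<Rightarrow> real) set" where
  "Neumann_H2 \<Omega> = {u \<in> H2 \<Omega>. zero_normal_derivative \<Omega> u}"

text \<open>The dual of \<open>Neumann_H2 \<Omega>\<close>; the values of a functional outside of \<open>Neumann_H2 \<Omega>\<close> are irrelevant.\<close>

definition Neumann_dual :: "'a::euclidean_space set \<Rightarrow> (('a \<Rightarrow> real) \<Rightarrow> real) set" where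
  "Neumann_dual \<Omega> = {F.
     (\<forall>u\<in>Neumann_H2 \<Omega>. \<forall>v\<in>Neumann_H2 \<Omega>. \<forall>a b. F (\<lambda>x. a * u x + b * v x) = a * F u + b * F v) \<and>
     (\<exists>K. \<forall>u\<in>Neumann_H2 \<Omega>. \<bar>F u\<bar> \<le> K * H2_norm \<Omega> u)}"

definition Neumann_dual_norm :: "'a::euclidean_space set \<Rightarrow> (('a \<Rightarrow> real) \<Rightarrow> real) \<Rightarrow> real" where
  "Neumann_dual_norm \<Omega> F = (SUP u\<in>{u \<in> Neumann_H2 \<Omega>. H2_norm \<Omega> u \<le> 1}. \<bar>F u\<bar>)"

definition L2_embed ::
  "'a::euclidean_space set \<Rightarrow> ('a \<Rightarrow> real) \<Rightarrow> (('a \<Rightarrow> real) \<Rightarrow> real)" where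
  "L2_embed \<Omega> f = (\<lambda>u. LINT x|lebesgue_on \<Omega>. f x * u x)"


section \<open>Time-dependent functions\<close>

text \<open>
  The Bochner space of square integrable functions on \<open>(0,T)\<close> with values in a space \<open>X\<close> of
  real-valued functions (or functionals) with norm \<open>nrm\<close>. Space-time integrals are iterated
  throughout: weak derivatives in space are chosen separately for each time, so that they need not
  be jointly measurable.
\<close>

definition bochner_L2 ::
  "real \<Rightarrow> ('b \<Rightarrow> real) set \<Rightarrow> (('b \<Rightarrow> real) \<Rightarrow> real) \<Rightarrow> (real \<Rightarrow> 'b \<Rightarrow> real) set" where
  "bochner_L2 T X nrm = {f.
     (AE t in lebesgue_on {0<..<T}. f t \<in> X) \<and>
     (\<exists>s :: nat \<Rightarrow> real \<Rightarrow> 'b \<Rightarrow> real.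
        (\<forall>n. simple_function (lebesgue_on {0<..<T}) (s n) \<and> s n ` {0<..<T} \<subseteq> X) \<and>
        (AE t in lebesgue_on {0<..<T}. (\<lambda>n. nrm (\<lambda>y. s n t y - f t y)) \<longlonglongrightarrow> 0)) \<and>
     integrable (lebesgue_on {0<..<T}) (\<lambda>t. (nrm (f t))\<^sup>2)}"

definition bochner_L2_norm ::
  "real \<Rightarrow> (('b \<Rightarrow> real) \<Rightarrow> real) \<Rightarrow> (real \<Rightarrow> 'b \<Rightarrow> real) \<Rightarrow> real" where
  "bochner_L2_norm T nrm f = sqrt (LINT t|lebesgue_on {0<..<T}. (nrm (f t))\<^sup>2)"

definition has_time_deriv ::
  "'a::euclidean_space set \<Rightarrow> (real \<Rightarrow> 'a \<Rightarrow> real) \<Rightarrow> (real \<Rightarrow> ('a \<Rightarrow> real) \<Rightarrow> real) \<Rightarrow> bool" where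
  "has_time_deriv \<Omega> u F \<longleftrightarrow>
     (\<forall>T>0. F \<in> bochner_L2 T (Neumann_dual \<Omega>) (Neumann_dual_norm \<Omega>)) \<and>
     (\<forall>\<psi>\<in>test_functions {0<..}. \<forall>v\<in>Neumann_H2 \<Omega>.
        (LINT t|lebesgue_on {0<..}. L2_embed \<Omega> (u t) v * deriv \<psi> t) =
        - (LINT t|lebesgue_on {0<..}. F t v * \<psi> t))"

definition time_deriv ::
  "'a::euclidean_space set \<Rightarrow> (real \<Rightarrow> 'a \<Rightarrow> real) \<Rightarrow> (real \<Rightarrow> ('a \<Rightarrow> real) \<Rightarrow> real)" where
  "time_deriv \<Omega> u = (SOME F. has_time_deriv \<Omega> u F)"


section \<open>The Maxwell--Stefan system without production\<close>

text \<open>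
  Components are numbered from \<open>0\<close> to \<open>N\<close>; the component that is eliminated is the one with index
  \<open>N\<close>.
\<close>

text \<open>Only meaningful for invertible matrices, which is the only way it is used.\<close>

definition minv :: "real Matrix.mat \<Rightarrow> real Matrix.mat" where
  "minv M = the (mat_inverse M)"

definition A0 :: "nat \<Rightarrow> real Matrix.mat \<Rightarrow> (nat \<Rightarrow> real) \<Rightarrow> real Matrix.mat" where
  "A0 N D c = (let d = (\<lambda>i j. 1 / D $$ (i, j)) in
     Matrix.mat N N (\<lambda>(i, j).
       if i = j then (\<Sum>k\<in>{..<N} - {i}. (d i k - d i N) * c k) + d i N
       else - (d i j - d i N) * c i))"

definition conc :: "nat \<Rightarrow> (nat \<Rightarrow> real) \<Rightarrow> nat \<Rightarrow> real" where
  "conc N w i =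
     (if i < N then exp (w i) / (1 + (\<Sum>j<N. exp (w j)))
      else 1 - (\<Sum>k<N. exp (w k) / (1 + (\<Sum>j<N. exp (w j)))))"

definition entropy_hessian :: "nat \<Rightarrow> (nat \<Rightarrow> real) \<Rightarrow> real Matrix.mat" where
  "entropy_hessian N c = Matrix.mat N N (\<lambda>(i, j). 1 / c N + (if i = j then 1 / c i else 0))"

definition diffusion_matrix :: "nat \<Rightarrow> real Matrix.mat \<Rightarrow> (nat \<Rightarrow> real) \<Rightarrow> real Matrix.mat" where
  "diffusion_matrix N D w = minv (A0 N D (conc N w)) * minv (entropy_hessian N (conc N w))"

definition initial_data :: "'a::euclidean_space set \<Rightarrow> nat \<Rightarrow> (nat \<Rightarrow> 'a \<Rightarrow> real) \<Rightarrow> bool" where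
  "initial_data \<Omega> N c0 \<longleftrightarrow>
     (\<forall>i\<le>N. c0 i \<in> borel_measurable (lebesgue_on \<Omega>)) \<and>
     (AE x in lebesgue_on \<Omega>. (\<forall>i<N. 0 \<le> c0 i x) \<and> (\<Sum>i<N. c0 i x) \<le> 1 \<and>
        c0 N x = 1 - (\<Sum>i<N. c0 i x))"

text \<open>
  The fluxes are eliminated: for \<open>c N = 1 - (\<Sum>i<N. c i)\<close> the Maxwell--Stefan relations with fluxes of
  zero total sum read \<open>\<nabla>c' = - A0(c') J'\<close> for the first \<open>N\<close> components. The no-flux condition is contained
  in the weak formulation. The values \<open>c i t\<close>, for every \<open>t \<ge> 0\<close>, are fixed (almost everywhere in
  \<open>\<Omega>\<close>) by the continuity in time with values in the dual of \<open>Neumann_H2 \<Omega>\<close>; the bounds on \<open>c\<close>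
  are only required for almost every time.
\<close>

definition weak_solution ::
  "'a::euclidean_space set \<Rightarrow> nat \<Rightarrow> real Matrix.mat \<Rightarrow> (nat \<Rightarrow> 'a \<Rightarrow> real) \<Rightarrow>
   (nat \<Rightarrow> real \<Rightarrow> 'a \<Rightarrow> real) \<Rightarrow> bool" where
  "weak_solution \<Omega> N D c0 c \<longleftrightarrow>
     (\<forall>i\<le>N. \<forall>t\<ge>0. c i t \<in> L2 \<Omega>) \<and>
     (\<forall>t\<ge>0. AE x in lebesgue_on \<Omega>. c N t x = 1 - (\<Sum>i<N. c i t x)) \<and>
     (AE t in lebesgue_on {0<..}. AE x in lebesgue_on \<Omega>. \<forall>i\<le>N. 0 \<le> c i t x \<and> c i t x \<le> 1) \<and>
     (\<forall>i\<le>N. \<forall>T>0. c i \<in> bochner_L2 T (H1 \<Omega>) (H1_norm \<Omega>)) \<and>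
     (\<forall>i\<le>N. \<exists>F. has_time_deriv \<Omega> (c i) F) \<and>
     (\<forall>i\<le>N. \<forall>t\<ge>0.
        ((\<lambda>s. Neumann_dual_norm \<Omega> (L2_embed \<Omega> (\<lambda>x. c i s x - c i t x))) \<longlongrightarrow> 0) (at t within {0..})) \<and>
     (\<forall>i\<le>N. AE x in lebesgue_on \<Omega>. c i 0 x = c0 i x) \<and>
     (\<forall>T>0. \<forall>\<phi>. (\<forall>i<N. \<phi> i \<in> bochner_L2 T (Neumann_H2 \<Omega>) (H2_norm \<Omega>)) \<longrightarrow>
        (LINT t|lebesgue_on {0<..<T}. (\<Sum>i<N. time_deriv \<Omega> (c i) t (\<phi> i t))) +
        (LINT t|lebesgue_on {0<..<T}. LINT x|lebesgue_on \<Omega>.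
           (\<Sum>i<N. \<Sum>j<N. minv (A0 N D (\<lambda>k. c k t x)) $$ (i, j) *
             grad_inner \<Omega> (c j t) (\<phi> i t) x)) = 0)"

text \<open>
  The convergence of approximations \<open>u n\<close> (with approximate time derivatives \<open>du n\<close>) to \<open>v\<close> on the
  time interval \<open>(0,T)\<close>. As \<open>Neumann_H2 \<Omega>\<close> is a Hilbert space, weak convergence with values in its dual is
  tested with \<open>Neumann_H2 \<Omega>\<close>-valued functions.
\<close>

definition converges_on ::
  "'a::euclidean_space set \<Rightarrow> real \<Rightarrow> (nat \<Rightarrow> real \<Rightarrow> 'a \<Rightarrow> real) \<Rightarrow>
   (nat \<Rightarrow> real \<Rightarrow> ('a \<Rightarrow> real) \<Rightarrow> real) \<Rightarrow> (real \<Rightarrow> 'a \<Rightarrow> real) \<Rightarrow> bool" where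
  "converges_on \<Omega> T u du v \<longleftrightarrow>
     (\<lambda>n. bochner_L2_norm T (L2_norm \<Omega>) (\<lambda>t x. u n t x - v t x)) \<longlonglongrightarrow> 0 \<and>
     (\<forall>b\<in>Basis. \<forall>\<psi>\<in>bochner_L2 T (L2 \<Omega>) (L2_norm \<Omega>).
        (\<lambda>n. LINT t|lebesgue_on {0<..<T}. LINT x|lebesgue_on \<Omega>. weak_deriv \<Omega> b (u n t) x * \<psi> t x)
        \<longlonglongrightarrow> (LINT t|lebesgue_on {0<..<T}. LINT x|lebesgue_on \<Omega>. weak_deriv \<Omega> b (v t) x * \<psi> t x)) \<and>
     (\<forall>\<phi>\<in>bochner_L2 T (Neumann_H2 \<Omega>) (H2_norm \<Omega>).
        (\<lambda>n. LINT t|lebesgue_on {0<..<T}. du n t (\<phi> t))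
        \<longlonglongrightarrow> (LINT t|lebesgue_on {0<..<T}. time_deriv \<Omega> v t (\<phi> t)))"

text \<open>
  \<open>w k i\<close> is component \<open>i\<close> of the entropy variable at time step \<open>k\<close>.
\<close>

definition discrete_solution ::
  "'a::euclidean_space set \<Rightarrow> nat \<Rightarrow> real Matrix.mat \<Rightarrow> (nat \<Rightarrow> 'a \<Rightarrow> real) \<Rightarrow> real \<Rightarrow> real \<Rightarrow>
   (nat \<Rightarrow> nat \<Rightarrow> 'a \<Rightarrow> real) \<Rightarrow> bool" where
  "discrete_solution \<Omega> N D c0 \<epsilon> \<tau> w \<longleftrightarrow>
     (\<forall>i<N. w 0 i = (\<lambda>x. ln (c0 i x / c0 N x))) \<and>
     (\<forall>k\<ge>1. (\<forall>i<N. w k i \<in> Neumann_H2 \<Omega>) \<and>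
        (\<forall>v. (\<forall>i<N. v i \<in> Neumann_H2 \<Omega>) \<longrightarrow>
           1 / \<tau> * (LINT x|lebesgue_on \<Omega>.
              (\<Sum>i<N. (conc N (\<lambda>l. w k l x) i - conc N (\<lambda>l. w (k - 1) l x) i) * v i x)) +
           (LINT x|lebesgue_on \<Omega>. (\<Sum>i<N. \<Sum>j<N.
              diffusion_matrix N D (\<lambda>l. w k l x) $$ (i, j) * grad_inner \<Omega> (v i) (w k j) x)) +
           \<epsilon> * (LINT x|lebesgue_on \<Omega>.
              (\<Sum>i<N. laplacian \<Omega> (w k i) x * laplacian \<Omega> (v i) x + w k i x * v i x)) = 0))"

definition step_index :: "real \<Rightarrow> real \<Rightarrow> nat" where
  "step_index \<tau> t = nat \<lceil>t / \<tau>\<rceil>"  \<comment> \<open>the \<open>k\<close> with \<open>(k - 1) * \<tau> < t \<le> k * \<tau>\<close>, for \<open>t > 0\<close>\<close>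

definition step_conc ::
  "nat \<Rightarrow> real \<Rightarrow> (nat \<Rightarrow> nat \<Rightarrow> 'a::euclidean_space \<Rightarrow> real) \<Rightarrow> nat \<Rightarrow> real \<Rightarrow> 'a \<Rightarrow> real" where
  "step_conc N \<tau> w i t x = conc N (\<lambda>l. w (step_index \<tau> t) l x) i"

definition discrete_time_deriv ::
  "'a::euclidean_space set \<Rightarrow> nat \<Rightarrow> real \<Rightarrow> (nat \<Rightarrow> nat \<Rightarrow> 'a \<Rightarrow> real) \<Rightarrow> nat \<Rightarrow> real \<Rightarrow>
   ('a \<Rightarrow> real) \<Rightarrow> real" where
  "discrete_time_deriv \<Omega> N \<tau> w i t =
     L2_embed \<Omega> (\<lambda>x. (conc N (\<lambda>l. w (step_index \<tau> t) l x) i -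
                        conc N (\<lambda>l. w (step_index \<tau> t - 1) l x) i) / \<tau>)"

definition constructed_from_positive_data ::
  "'a::euclidean_space set \<Rightarrow> nat \<Rightarrow> real Matrix.mat \<Rightarrow> real \<Rightarrow> (nat \<Rightarrow> 'a \<Rightarrow> real) \<Rightarrow>
   (nat \<Rightarrow> real \<Rightarrow> 'a \<Rightarrow> real) \<Rightarrow> bool" where
  "constructed_from_positive_data \<Omega> N D \<eta> c0 c \<longleftrightarrow>
     initial_data \<Omega> N c0 \<and> 0 < \<eta> \<and> \<eta> < 1 \<and>
     (\<forall>i\<le>N. AE x in lebesgue_on \<Omega>. \<eta> \<le> c0 i x) \<and>
     weak_solution \<Omega> N D c0 c \<and>
     (\<exists>\<epsilon> \<tau> w. (\<forall>n::nat. 0 < \<epsilon> n \<and> 0 < \<tau> n \<and> discrete_solution \<Omega> N D c0 (\<epsilon> n) (\<tau> n) (w n)) \<and>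
        \<epsilon> \<longlonglongrightarrow> 0 \<and> \<tau> \<longlonglongrightarrow> 0 \<and>
        (\<forall>T>0. \<forall>i<N.
           converges_on \<Omega> T (\<lambda>n. step_conc N (\<tau> n) (w n) i)
             (\<lambda>n. discrete_time_deriv \<Omega> N (\<tau> n) (w n) i) (c i) \<and>
           (\<lambda>n. bochner_L2_norm T (H2_norm \<Omega>) (\<lambda>t x. \<epsilon> n * w n (step_index (\<tau> n) t) i x))
             \<longlonglongrightarrow> 0))"

definition constructed_from_general_data ::
  "'a::euclidean_space set \<Rightarrow> nat \<Rightarrow> real Matrix.mat \<Rightarrow> (nat \<Rightarrow> 'a \<Rightarrow> real) \<Rightarrow>
   (nat \<Rightarrow> real \<Rightarrow> 'a \<Rightarrow> real) \<Rightarrow> bool" where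
  "constructed_from_general_data \<Omega> N D c0 c \<longleftrightarrow>
     initial_data \<Omega> N c0 \<and> weak_solution \<Omega> N D c0 c \<and>
     (\<exists>\<eta> c0' c'. (\<forall>n::nat. constructed_from_positive_data \<Omega> N D (\<eta> n) (c0' n) (c' n)) \<and>
        \<eta> \<longlonglongrightarrow> 0 \<and>
        (AE x in lebesgue_on \<Omega>. \<forall>i\<le>N. (\<lambda>n. c0' n i x) \<longlonglongrightarrow> c0 i x) \<and>
        (\<forall>T>0. \<forall>i<N.
           converges_on \<Omega> T (\<lambda>n. c' n i) (\<lambda>n. time_deriv \<Omega> (c' n i)) (c i)))"

definition constructed_weak_solution ::
  "'a::euclidean_space set \<Rightarrow> nat \<Rightarrow> real Matrix.mat \<Rightarrow> (nat \<Rightarrow> 'a \<Rightarrow> real) \<Rightarrow>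
   (nat \<Rightarrow> real \<Rightarrow> 'a \<Rightarrow> real) \<Rightarrow> bool" where
  "constructed_weak_solution \<Omega> N D c0 c \<longleftrightarrow>
     (\<exists>\<eta>. constructed_from_positive_data \<Omega> N D \<eta> c0 c) \<or> constructed_from_general_data \<Omega> N D c0 c"

text \<open>The convention \<open>0 * log 0 = 0\<close> holds automatically in the following.\<close>

definition relative_entropy ::
  "'a::euclidean_space set \<Rightarrow> nat \<Rightarrow> (nat \<Rightarrow> 'a \<Rightarrow> real) \<Rightarrow> (nat \<Rightarrow> 'a \<Rightarrow> real) \<Rightarrow> real" where
  "relative_entropy \<Omega> N c0 c =
     (\<Sum>i\<le>N. LINT x|lebesgue_on \<Omega>. c i x * ln (c i x / average \<Omega> (c0 i)))"

end

theory Submission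
  imports Defs "Jordan_Normal_Form.Determinant"
begin

text \<open>
  The decay is an entropy argument, carried out on the time-discrete scheme, where all functions
  are positive and the entropy variables are admissible test functions.

  Let \<open>m i\<close> be the average of the initial concentration \<open>c0 i\<close> and let \<open>E k\<close> be the relative
  entropy \<open>\<Sum>i\<le>N. \<integral> c i ln (c i / m i)\<close> after \<open>k\<close> time steps. The scheme is tested with
  \<open>w k i - ln (m i / m N)\<close>, the entropy variable relative to the constant equilibrium. By
  convexity the time difference contributes at least \<open>E k - E (k - 1)\<close>, the diffusion term is the
  entropy dissipation, and the regularization is bounded below by half of \<open>\<epsilon>\<close> times the square
  norm of \<open>w k\<close>, up to an error of order \<open>\<epsilon>\<close> (\<open>entropy_step\<close>). The Maxwell-Stefan structure makes
  the dissipation coercive: for all positive concentrations of sum one it is at least a multiple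
  of \<open>\<Sum>i\<le>N. |\<nabla> (sqrt (c i))|\<^sup>2\<close>, with a constant that involves only \<open>max 1 / D i j\<close>
  (\<open>diffusion_matrix_bounds\<close>). A logarithmic Sobolev inequality on \<open>\<Omega>\<close> (\<open>log_sobolev_C11_domain\<close>)
  bounds the relative entropy of the \<open>c i\<close> with respect to their own averages by this quantity.
  Testing with constants shows that the averages drift away from \<open>m i\<close> only by \<open>O (sqrt \<epsilon>)\<close> on
  bounded time intervals (\<open>mass_defect_bound\<close>). Hence \<open>(1 + \<kappa> \<tau>) E k \<le> E (k - 1) + \<tau> O (sqrt \<epsilon>)\<close>,
  which is exponential decay (\<open>entropy_decay\<close>). Finally \<open>c ln (c / m) \<ge> c - m + (c - m)\<^sup>2 / 2\<close> on
  \<open>(0,1]\<close>, so the entropy controls the \<open>L2\<close> distance to the equilibrium and thus the \<open>L1\<close> distance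
  with the constant \<open>sqrt (2 |\<Omega>|)\<close>.

  The logarithmic Sobolev inequality is applied to \<open>f = sqrt (c i)\<close>, a smooth function of several
  Sobolev functions. Everything that is needed about \<open>f\<close> is an \<open>L2\<close> estimate of the differences
  \<open>f (x + z) - f x\<close> (\<open>diff_bound\<close>), which follows from the absolute continuity of Sobolev
  functions along lines and a one-dimensional chain rule. Near each point of its closure a C11
  domain contains translates of a fixed cone. Averaging the differences over cones of size \<open>r\<close>
  bounds the part of \<open>\<integral> f\<^sup>2\<close> that lies above the level \<open>r\<close> to the power of minus the dimension by
  \<open>O (r\<^sup>2)\<close>; summation over dyadic \<open>r\<close> gives an estimate of \<open>\<integral> f\<^sup>2 ln f\<^sup>2\<close>. Together with the
  Poincare inequality and an elementary inequality for \<open>(m + g)\<^sup>2 ln (m + g)\<^sup>2\<close> this yields the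
  logarithmic Sobolev inequality.

  The limits are taken in the strong \<open>L2\<close> topology in space and time. They preserve the bound for
  almost every time along a subsequence; here the strong measurability of the solution is
  essential, because it makes the \<open>L2\<close> distance at time \<open>t\<close> a measurable function of \<open>t\<close>. At an
  arbitrary time, the continuity with values in the dual of \<open>Neumann_H2 \<Omega>\<close> together with the
  bounds \<open>0 \<le> c i \<le> 1\<close> gives convergence of the integrals over all Borel sets, and the \<open>L1\<close> norm
  is lower semicontinuous under this convergence (\<open>weak_solution_every_time\<close>). General initial
  data are reached by a second limit of the same kind, in which averages and entropies of the data
  converge by dominated convergence.
\<close>

no_notation Matrix.scalar_prod (infix "\<bullet>" 70)

section \<open>Smooth functions and test functions\<close>

text \<open>
  The family is closed under differentiation: the derivative replaces \<open>p\<close> by another polynomial.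
  This gives smoothness at \<open>0\<close> by induction, without computing higher derivatives.
\<close>

definition flat_exp :: "real poly \<Rightarrow> real \<Rightarrow> real" where
  "flat_exp p t = (if t > 0 then poly p (1 / t) * exp (- 1 / t) else 0)"

lemma poly_times_exp_minus_tendsto_0:
  fixes p :: "real poly"
  shows "((\<lambda>s. poly p s * exp (- s)) \<longlongrightarrow> 0) at_top"
proof -
  have "((\<lambda>s. \<Sum>i\<le>degree p. coeff p i * (s ^ i / exp s)) \<longlongrightarrow> (\<Sum>i\<le>degree p. coeff p i * 0)) at_top"
    by (intro tendsto_sum tendsto_mult tendsto_const tendsto_power_div_exp_0)
  moreover have "(\<lambda>s. poly p s * exp (- s)) = (\<lambda>s. \<Sum>i\<le>degree p. coeff p i * (s ^ i / exp s))"
    by (auto simp: poly_altdef sum_distrib_right exp_minus divide_simps)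
  ultimately show ?thesis by simp
qed

lemma flat_exp_tendsto_0: "((\<lambda>t. flat_exp p t) \<longlongrightarrow> 0) (at_right 0)"
proof -
  have "((\<lambda>t. poly p (1 / t) * exp (- (1 / t))) \<longlongrightarrow> 0) (at_right 0)"
    by (rule filterlim_compose[OF poly_times_exp_minus_tendsto_0])
       (use filterlim_inverse_at_top_right in \<open>simp add: inverse_eq_divide\<close>)
  then show ?thesis
    by (rule Lim_transform_eventually)
       (auto simp: flat_exp_def eventually_at_right_less eventually_at_right[of 0 "1::real"] intro: exI[of _ 1])
qed

lemma flat_exp_has_real_derivative:
  "(flat_exp p has_real_derivative flat_exp (monom 1 2 * (p - pderiv p)) t) (at t)"
proof -
  consider "t > 0" | "t < 0" | "t = 0" by linarith
  then show ?thesis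
  proof cases
    case 1
    have "((\<lambda>t. poly p (1 / t) * exp (- 1 / t)) has_real_derivative
        flat_exp (monom 1 2 * (p - pderiv p)) t) (at t)"
      using 1 by (auto intro!: derivative_eq_intros
        simp: flat_exp_def poly_monom field_simps power2_eq_square)
    then show ?thesis
      by (rule has_field_derivative_transform_within_open[of _ _ _ "{0<..}"])
         (use 1 in \<open>auto simp: flat_exp_def\<close>)
  next
    case 2
    have "((\<lambda>t. 0) has_real_derivative flat_exp (monom 1 2 * (p - pderiv p)) t) (at t)"
      using 2 by (auto simp: flat_exp_def)
    then show ?thesis
      by (rule has_field_derivative_transform_within_open[of _ _ _ "{..<0}"])
         (use 2 in \<open>auto simp: flat_exp_def\<close>)
  next
    case 3
    have "((\<lambda>h. (flat_exp p (0 + h) - flat_exp p 0) / h) \<longlongrightarrow> 0) (at 0)"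
    proof (rule filterlim_split_at)
      show "((\<lambda>h. (flat_exp p (0 + h) - flat_exp p 0) / h) \<longlongrightarrow> 0) (at_left 0)"
        by (rule tendsto_eventually)
           (auto simp: flat_exp_def eventually_at_left[of "-1" "0::real"] intro!: exI[of _ "-1"])
      show "((\<lambda>h. (flat_exp p (0 + h) - flat_exp p 0) / h) \<longlongrightarrow> 0) (at_right 0)"
        by (rule Lim_transform_eventually[OF flat_exp_tendsto_0[of "pCons 0 p"]])
           (auto simp: flat_exp_def eventually_at_right[of 0 "1::real"] intro!: exI[of _ 1])
    qed
    then show ?thesis
      using 3 by (simp add: DERIV_def flat_exp_def[of _ 0])
  qed
qed

lemma flat_exp_nonneg: "flat_exp 1 t \<ge> 0"
  and flat_exp_le_1: "flat_exp 1 t \<le> 1"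
  and flat_exp_eq_0: "flat_exp 1 t = 0 \<longleftrightarrow> t \<le> 0"
  by (auto simp: flat_exp_def)

lemma flat_exp_tendsto_1:
  assumes "t > 0"
  shows "(\<lambda>n. flat_exp 1 (real (Suc n) * t)) \<longlonglongrightarrow> 1"
proof -
  have "(\<lambda>n. exp (- (inverse (real (Suc n)) / t))) \<longlonglongrightarrow> exp (- (0 / t))"
    using assms by (intro tendsto_intros LIMSEQ_inverse_real_of_nat) auto
  then show ?thesis
    using assms by (simp add: flat_exp_def divide_inverse mult.commute)
qed

lemma Ck_SucD: "Ck (Suc k) f \<Longrightarrow> Ck k f"
proof (induction k arbitrary: f)
  case 0
  then show ?case
    by (auto intro!: continuous_at_imp_continuous_on differentiable_imp_continuous_within)
next
  case (Suc k)
  then show ?case by auto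
qed

lemma Ck_const: "Ck k (\<lambda>x. c)"
proof (induction k arbitrary: c)
  case (Suc k)
  then show ?case by (simp add: frechet_derivative_const)
qed simp

lemma frechet_derivative_real_add:
  fixes f g :: "'a::euclidean_space \<Rightarrow> real"
  assumes "f differentiable at x" "g differentiable at x"
  shows "frechet_derivative (\<lambda>x. f x + g x) (at x) b
    = frechet_derivative f (at x) b + frechet_derivative g (at x) b"
  by (simp add: frechet_derivative_at[OF has_derivative_add[OF assms[unfolded frechet_derivative_works]], symmetric])

lemma frechet_derivative_real_mult:
  fixes f g :: "'a::euclidean_space \<Rightarrow> real"
  assumes "f differentiable at x" "g differentiable at x"
  shows "frechet_derivative (\<lambda>x. f x * g x) (at x) b
    = f x * frechet_derivative g (at x) b + frechet_derivative f (at x) b * g x"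
  by (simp add: frechet_derivative_at[OF has_derivative_mult[OF assms[unfolded frechet_derivative_works]], symmetric])

lemma Ck_add: "Ck k f \<Longrightarrow> Ck k g \<Longrightarrow> Ck k (\<lambda>x. f x + g x)"
proof (induction k arbitrary: f g)
  case (Suc k)
  then have "frechet_derivative (\<lambda>x. f x + g x) (at x) b
      = frechet_derivative f (at x) b + frechet_derivative g (at x) b" for x b
    by (intro frechet_derivative_real_add) auto
  with Suc show ?case by (simp add: Suc.IH)
qed (auto intro: continuous_intros)

lemma Ck_mult: "Ck k f \<Longrightarrow> Ck k g \<Longrightarrow> Ck k (\<lambda>x. f x * g x)"
proof (induction k arbitrary: f g)
  case (Suc k)
  have "frechet_derivative (\<lambda>x. f x * g x) (at x) b
      = f x * frechet_derivative g (at x) b + frechet_derivative f (at x) b * g x" for x b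
    using Suc.prems by (intro frechet_derivative_real_mult) auto
  moreover have "Ck k f" "Ck k g"
    using Suc.prems Ck_SucD by blast+
  ultimately show ?case using Suc.prems by (auto intro!: Suc.IH Ck_add)
qed (auto intro: continuous_intros)

lemma frechet_derivative_shift:
  fixes f :: "'a::euclidean_space \<Rightarrow> real"
  assumes "\<And>x. f differentiable at x"
  shows "frechet_derivative (\<lambda>x. f (x + z)) (at x) = frechet_derivative f (at (x + z))"
proof -
  have "(f has_derivative frechet_derivative f (at (x + z))) (at (x + z))"
    using assms frechet_derivative_works by blast
  then have "((\<lambda>x. f (x + z)) has_derivative frechet_derivative f (at (x + z))) (at x)"
    by (auto intro!: derivative_eq_intros has_derivative_compose[of "\<lambda>x. x + z" _ x _ f])
  from frechet_derivative_at[OF this] show ?thesis by simp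
qed

lemma Ck_shift: "Ck k f \<Longrightarrow> Ck k (\<lambda>x. f (x + z))"
proof (induction k arbitrary: f)
  case 0
  then have "continuous_on UNIV f" by simp
  then have "continuous_on UNIV (\<lambda>x. f (x + z))"
    by (rule continuous_on_compose2) (auto intro: continuous_intros)
  then show ?case by simp
next
  case (Suc k)
  have "(\<lambda>x. f (x + z)) differentiable at x" for x
  proof (rule differentiable_compose[of f "\<lambda>x. x + z"])
    show "f differentiable at (x + z)" using Suc.prems by simp
  qed (intro differentiable_add differentiable_ident differentiable_const)
  moreover have "Ck k (\<lambda>x. frechet_derivative f (at (x + z)) b)" if "b \<in> Basis" for b
    using Suc.IH[of "\<lambda>x. frechet_derivative f (at x) b"] Suc.prems that by simp
  ultimately show ?case using Suc.prems by (simp add: frechet_derivative_shift)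
qed

text \<open>
  Only affine inner functions occur, because bumps are built as products of functions of one
  coordinate.
\<close>

lemma Ck_flat_exp_inner: "Ck k (\<lambda>x::'a::euclidean_space. flat_exp p (c * (x \<bullet> b) + d))"
proof (induction k arbitrary: p)
  case 0
  have "continuous_on UNIV (flat_exp p)"
    using flat_exp_has_real_derivative by (intro DERIV_continuous_on) (auto intro: has_field_derivative_at_within)
  then have "continuous_on UNIV (\<lambda>x::'a. flat_exp p (c * (x \<bullet> b) + d))"
    by (rule continuous_on_compose2) (auto intro!: continuous_intros)
  then show ?case by simp
next
  case (Suc k)
  have D: "((\<lambda>x::'a. flat_exp p (c * (x \<bullet> b) + d)) has_derivative
      (\<lambda>h. flat_exp (monom 1 2 * (p - pderiv p)) (c * (x \<bullet> b) + d) * (c * (h \<bullet> b)))) (at x)" for x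
    by (rule has_derivative_eq_rhs[OF has_derivative_compose[of "\<lambda>x. c * (x \<bullet> b) + d" _ x _ "flat_exp p",
          OF _ flat_exp_has_real_derivative[unfolded has_field_derivative_def]]])
       (auto intro!: derivative_eq_intros)
  have "frechet_derivative (\<lambda>x::'a. flat_exp p (c * (x \<bullet> b) + d)) (at x) =
      (\<lambda>h. flat_exp (monom 1 2 * (p - pderiv p)) (c * (x \<bullet> b) + d) * (c * (h \<bullet> b)))" for x
    using frechet_derivative_at[OF D] by simp
  then show ?case
    using D by (auto simp: differentiable_def intro!: Ck_mult Suc.IH Ck_const)
qed

lemma smooth_const: "smooth (\<lambda>x. c)"
  and smooth_add: "smooth f \<Longrightarrow> smooth g \<Longrightarrow> smooth (\<lambda>x. f x + g x)"
  and smooth_mult: "smooth f \<Longrightarrow> smooth g \<Longrightarrow> smooth (\<lambda>x. f x * g x)"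
  and smooth_shift: "smooth f \<Longrightarrow> smooth (\<lambda>x. f (x + z))"
  and smooth_flat_exp: "smooth (\<lambda>x::'a::euclidean_space. flat_exp p (c * (x \<bullet> b) + d))"
  by (simp_all add: smooth_def Ck_const Ck_add Ck_mult Ck_shift Ck_flat_exp_inner)

lemma smooth_prod: "(\<And>i. i \<in> I \<Longrightarrow> smooth (f i)) \<Longrightarrow> smooth (\<lambda>x. \<Prod>i\<in>I. f i x)"
  by (induction I rule: infinite_finite_induct) (auto intro: smooth_const smooth_mult)

lemma smooth_differentiable: "smooth f \<Longrightarrow> f differentiable at x"
  unfolding smooth_def by (drule spec[of _ "Suc 0"]) simp

lemma smooth_has_derivative: "smooth f \<Longrightarrow> (f has_derivative frechet_derivative f (at x)) (at x)"
  by (simp add: frechet_derivative_works[symmetric] smooth_differentiable)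

lemma smooth_continuous: "smooth f \<Longrightarrow> continuous_on S f"
  by (intro continuous_at_imp_continuous_on ballI differentiable_imp_continuous_within
      smooth_differentiable)

lemma smooth_frechet_derivative:
  "smooth f \<Longrightarrow> b \<in> Basis \<Longrightarrow> smooth (\<lambda>x. frechet_derivative f (at x) b)"
  unfolding smooth_def
proof
  fix k assume "\<forall>k. Ck k f" "b \<in> Basis"
  then have "Ck (Suc k) f" by blast
  then show "Ck k (\<lambda>x. frechet_derivative f (at x) b)" using \<open>b \<in> Basis\<close> by simp
qed

lemma test_functionI:
  assumes "smooth \<phi>" "compact K" "K \<subseteq> \<Omega>" "\<And>x. x \<notin> K \<Longrightarrow> \<phi> x = 0"
  shows "\<phi> \<in> test_functions \<Omega>"
proof -
  have "closure {x. \<phi> x \<noteq> 0} \<subseteq> K"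
    by (rule closure_minimal[OF _ compact_imp_closed[OF assms(2)]]) (use assms(4) in blast)
  moreover from this have "compact (closure {x. \<phi> x \<noteq> 0})"
    by (meson assms(2) bounded_subset closed_closure compact_eq_bounded_closed)
  ultimately show ?thesis
    using assms(1,3) unfolding test_functions_def by auto
qed

lemma test_functionD:
  assumes "\<phi> \<in> test_functions \<Omega>"
  shows "smooth \<phi>" "\<exists>K. compact K \<and> K \<subseteq> \<Omega> \<and> (\<forall>x. x \<notin> K \<longrightarrow> \<phi> x = 0)"
proof -
  let ?K = "closure {x. \<phi> x \<noteq> 0}"
  have "\<forall>x. x \<notin> ?K \<longrightarrow> \<phi> x = 0"
    using closure_subset[of "{x. \<phi> x \<noteq> 0}"] by blast
  moreover have "compact ?K \<and> ?K \<subseteq> \<Omega>"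
    using assms by (simp add: test_functions_def)
  ultimately show "\<exists>K. compact K \<and> K \<subseteq> \<Omega> \<and> (\<forall>x. x \<notin> K \<longrightarrow> \<phi> x = 0)" by blast
qed (use assms in \<open>simp add: test_functions_def\<close>)

lemma test_function_mult:
  assumes "\<phi> \<in> test_functions \<Omega>" "smooth \<psi>"
  shows "(\<lambda>x. \<phi> x * \<psi> x) \<in> test_functions \<Omega>"
proof -
  obtain K where "compact K" "K \<subseteq> \<Omega>" "\<forall>x. x \<notin> K \<longrightarrow> \<phi> x = 0"
    using test_functionD(2)[OF assms(1)] by blast
  then show ?thesis
    using assms test_functionD(1) by (intro test_functionI[of _ K] smooth_mult) auto
qed

lemma test_function_lincomb:
  assumes "\<phi> \<in> test_functions \<Omega>" "\<psi> \<in> test_functions \<Omega>"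
  shows "(\<lambda>x. a * \<phi> x + b * \<psi> x) \<in> test_functions \<Omega>"
proof -
  obtain K where K: "compact K" "K \<subseteq> \<Omega>" "\<forall>x. x \<notin> K \<longrightarrow> \<phi> x = 0"
    using test_functionD(2)[OF assms(1)] by blast
  obtain L where L: "compact L" "L \<subseteq> \<Omega>" "\<forall>x. x \<notin> L \<longrightarrow> \<psi> x = 0"
    using test_functionD(2)[OF assms(2)] by blast
  show ?thesis
    using K L assms[THEN test_functionD(1)]
    by (intro test_functionI[of _ "K \<union> L"]) (auto intro!: smooth_add smooth_mult smooth_const)
qed

lemma test_function_zero: "(\<lambda>x. 0) \<in> test_functions \<Omega>"
  by (rule test_functionI[of _ "{}"]) (auto intro: smooth_const)

lemma test_function_shift:
  assumes "\<phi> \<in> test_functions U" "\<And>x. x \<in> U \<Longrightarrow> x + z \<in> \<Omega>"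
  shows "(\<lambda>x. \<phi> (x - z)) \<in> test_functions \<Omega>"
proof -
  have smooth: "smooth \<phi>"
    using test_functionD(1)[OF assms(1)] .
  obtain K where K: "compact K" "K \<subseteq> U" "\<forall>x. x \<notin> K \<longrightarrow> \<phi> x = 0"
    using test_functionD(2)[OF assms(1)] by blast
  show ?thesis
  proof (rule test_functionI)
    show "smooth (\<lambda>x. \<phi> (x - z))"
      using smooth_shift[OF smooth, of "- z"] by simp
    show "compact ((\<lambda>x. x + z) ` K)"
      using K by (intro compact_continuous_image continuous_intros) auto
    show "(\<lambda>x. x + z) ` K \<subseteq> \<Omega>"
      using K assms by auto
    show "\<phi> (x - z) = 0" if "x \<notin> (\<lambda>x. x + z) ` K" for x
    proof (rule K(3)[rule_format])
      show "x - z \<notin> K"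
        using that image_eqI[of x "\<lambda>x. x + z" "x - z" K] by auto
    qed
  qed
qed

lemma test_function_frechet_derivative:
  assumes "\<phi> \<in> test_functions \<Omega>" "b \<in> Basis"
  shows "(\<lambda>x. frechet_derivative \<phi> (at x) b) \<in> test_functions \<Omega>"
proof -
  have smooth: "smooth \<phi>"
    using test_functionD(1)[OF assms(1)] .
  obtain K where K: "compact K" "K \<subseteq> \<Omega>" "\<forall>x. x \<notin> K \<longrightarrow> \<phi> x = 0"
    using test_functionD(2)[OF assms(1)] by blast
  show ?thesis
  proof (rule test_functionI)
    fix x assume "x \<notin> K"
    have "((\<lambda>x. 0) has_derivative (\<lambda>h. 0)) (at x)" by simp
    then have "(\<phi> has_derivative (\<lambda>h. 0)) (at x)"
      by (rule has_derivative_transform_within_open[of _ _ _ _ "- K"])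
         (use K \<open>x \<notin> K\<close> in \<open>auto simp: compact_imp_closed open_Compl\<close>)
    from frechet_derivative_at[OF this] show "frechet_derivative \<phi> (at x) b = 0"
      by (rule fun_cong[OF sym, of _ _ b])
  qed (use K smooth assms in \<open>auto intro: smooth_frechet_derivative\<close>)
qed

lemma continuous_compact_support_bounded:
  fixes \<phi> :: "'a::euclidean_space \<Rightarrow> real"
  assumes "continuous_on UNIV \<phi>" "compact K" "\<And>x. x \<notin> K \<Longrightarrow> \<phi> x = 0"
  shows "\<exists>M. \<forall>x. \<bar>\<phi> x\<bar> \<le> M"
proof -
  have "compact (\<phi> ` K)"
    by (rule compact_continuous_image[OF continuous_on_subset[OF assms(1)] assms(2)]) simp
  then have "bounded (\<phi> ` K)" by (rule compact_imp_bounded)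
  then obtain M where M: "M > 0" "\<forall>y\<in>\<phi> ` K. norm y \<le> M"
    unfolding bounded_pos by blast
  have "\<bar>\<phi> x\<bar> \<le> M" for x
    using M assms(3)[of x] by (cases "x \<in> K") auto
  then show ?thesis by blast
qed

lemma test_function_bounded:
  assumes "\<phi> \<in> test_functions \<Omega>"
  shows "\<exists>M. \<forall>x. \<bar>\<phi> x\<bar> \<le> M"
proof -
  have smooth: "smooth \<phi>"
    using test_functionD(1)[OF assms] .
  obtain K where K: "compact K" "K \<subseteq> \<Omega>" "\<forall>x. x \<notin> K \<longrightarrow> \<phi> x = 0"
    using test_functionD(2)[OF assms] by blast
  show ?thesis
    by (rule continuous_compact_support_bounded[OF smooth_continuous[OF smooth] K(1)]) (use K in blast)
qed

lemma test_function_outside: "\<phi> \<in> test_functions \<Omega> \<Longrightarrow> x \<notin> \<Omega> \<Longrightarrow> \<phi> x = 0"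
  using test_functionD(2)[of \<phi> \<Omega>] by blast

lemma test_function_borel: "\<phi> \<in> test_functions \<Omega> \<Longrightarrow> \<phi> \<in> borel_measurable borel"
  by (intro borel_measurable_continuous_onI smooth_continuous test_functionD(1))

text \<open>
  As \<open>n\<close> grows, the bumps increase to the indicator function of the open box with corners \<open>a\<close> and
  \<open>c\<close>; the argument of each factor is \<open>n + 1\<close> times the signed distance to a face.
\<close>

definition box_bump :: "nat \<Rightarrow> 'a::euclidean_space \<Rightarrow> 'a \<Rightarrow> 'a \<Rightarrow> real" where
  "box_bump n a c x = (\<Prod>b\<in>Basis. flat_exp 1 (real (Suc n) * (x \<bullet> b) + - real (Suc n) * (a \<bullet> b)) *
     flat_exp 1 (- real (Suc n) * (x \<bullet> b) + real (Suc n) * (c \<bullet> b)))"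

lemma smooth_box_bump: "smooth (box_bump n a c)"
proof -
  have "smooth (\<lambda>x. \<Prod>b\<in>Basis. flat_exp 1 (real (Suc n) * (x \<bullet> b) + - real (Suc n) * (a \<bullet> b)) *
     flat_exp 1 (- real (Suc n) * (x \<bullet> b) + real (Suc n) * (c \<bullet> b)))"
    by (intro smooth_prod smooth_mult smooth_flat_exp)
  then show ?thesis unfolding box_bump_def[abs_def] .
qed

lemma box_bump_bounds: "0 \<le> box_bump n a c x" "box_bump n a c x \<le> 1"
  unfolding box_bump_def
  by (intro prod_nonneg mult_nonneg_nonneg flat_exp_nonneg)
     (intro prod_le_1 conjI mult_nonneg_nonneg flat_exp_nonneg mult_le_one flat_exp_le_1)

lemma box_bump_eq_0_iff: "box_bump n a c x = 0 \<longleftrightarrow> x \<notin> box a c"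
proof -
  have "real (Suc n) * (x \<bullet> b) + - real (Suc n) * (a \<bullet> b) = real (Suc n) * (x \<bullet> b - a \<bullet> b)"
    and "- real (Suc n) * (x \<bullet> b) + real (Suc n) * (c \<bullet> b) = real (Suc n) * (c \<bullet> b - x \<bullet> b)" for b
    by (simp_all add: algebra_simps)
  then show ?thesis
    unfolding box_bump_def
    by (simp only: prod_zero_iff[OF finite_Basis] mult_eq_0_iff flat_exp_eq_0 mult_le_0_iff mem_box)
       (auto simp: not_less)
qed

lemma box_bump_tendsto_indicator:
  "(\<lambda>n. box_bump n a c x) \<longlonglongrightarrow> indicator (box a c) x"
proof (cases "x \<in> box a c")
  case True
  have eq: "real (Suc n) * (x \<bullet> b) + - real (Suc n) * (a \<bullet> b) = real (Suc n) * (x \<bullet> b - a \<bullet> b)"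
    "- real (Suc n) * (x \<bullet> b) + real (Suc n) * (c \<bullet> b) = real (Suc n) * (c \<bullet> b - x \<bullet> b)" for b n
    by (simp_all add: algebra_simps)
  have "(\<lambda>n. box_bump n a c x) \<longlonglongrightarrow> (\<Prod>b\<in>(Basis::'a set). 1 * 1)"
    unfolding box_bump_def eq
    by (intro tendsto_prod tendsto_mult flat_exp_tendsto_1) (use True in \<open>auto simp: mem_box\<close>)
  then show ?thesis using True by simp
next
  case False
  then have "box_bump n a c x = 0" for n
    by (simp add: box_bump_eq_0_iff)
  then show ?thesis using False by simp
qed

lemma box_bump_test_function: "cbox a c \<subseteq> \<Omega> \<Longrightarrow> box_bump n a c \<in> test_functions \<Omega>"
proof (rule test_functionI[of _ "cbox a c"])
  show "box_bump n a c x = 0" if "x \<notin> cbox a c" for x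
    unfolding box_bump_eq_0_iff using that box_subset_cbox by blast
qed (auto intro: smooth_box_bump)

text \<open>
  By the Lindelof property \<open>\<Omega>\<close> is a countable union of open boxes whose closures lie in \<open>\<Omega>\<close>; the
  cutoffs combine the bumps of the first \<open>n\<close> boxes.
\<close>

lemma test_function_cutoffs:
  assumes "open \<Omega>"
  shows "\<exists>cut. \<forall>n. cut n \<in> test_functions \<Omega> \<and> (\<forall>x. 0 \<le> cut n x \<and> cut n x \<le> 1) \<and>
    (\<forall>x. (\<lambda>n. cut n x) \<longlonglongrightarrow> indicator \<Omega> x)"
proof -
  define \<F> where "\<F> = {B. \<exists>a c. B = box a c \<and> cbox a c \<subseteq> \<Omega>}"
  have "open B" if "B \<in> \<F>" for B
    using that unfolding \<F>_def by auto
  then obtain \<G> where \<G>: "\<G> \<subseteq> \<F>" "countable \<G>" "\<Union>\<G> = \<Union>\<F>"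
    using Lindelof[of \<F>] by auto
  have "\<Union>\<F> = \<Omega>"
  proof
    show "\<Union>\<F> \<subseteq> \<Omega>"
      unfolding \<F>_def using box_subset_cbox by blast
    show "\<Omega> \<subseteq> \<Union>\<F>"
    proof
      fix x assume "x \<in> \<Omega>"
      then obtain a c where "cbox a c \<subseteq> \<Omega>" "x \<in> box a c"
        using open_contains_cbox[OF assms] by metis
      then show "x \<in> \<Union>\<F>" unfolding \<F>_def by blast
    qed
  qed
  obtain e :: 'a where "e \<in> Basis" using nonempty_Basis by blast
  \<comment> \<open>The empty box is added to the cover, so that it can be enumerated also for empty \<open>\<Omega>\<close>.\<close>
  then have emp: "cbox e 0 = {}" "box e 0 = {}"
    by (auto simp: box_eq_empty inner_Basis intro!: bexI[of _ e])
  then have "{} \<in> \<F>"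
    unfolding \<F>_def by (intro CollectI exI[of _ e] exI[of _ 0]) auto
  then have "insert {} \<G> \<subseteq> \<F>" "countable (insert {} \<G>)" "insert {} \<G> \<noteq> {}"
    using \<G> by auto
  then obtain B :: "nat \<Rightarrow> 'a set" where B: "range B = insert {} \<G>"
    using range_from_nat_into[of "insert {} \<G>"] by blast
  have "B k \<in> \<F>" for k
    using rangeI[of B k] \<open>insert {} \<G> \<subseteq> \<F>\<close> unfolding B by (rule rev_subsetD)
  then have "\<forall>k. \<exists>a c. B k = box a c \<and> cbox a c \<subseteq> \<Omega>"
    unfolding \<F>_def by simp
  then obtain a c where "\<forall>k. B k = box (a k) (c k) \<and> cbox (a k) (c k) \<subseteq> \<Omega>"
    unfolding choice_iff by blast
  then have ac: "\<And>k. B k = box (a k) (c k)" "\<And>k. cbox (a k) (c k) \<subseteq> \<Omega>"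
    by auto
  \<comment> \<open>This combination is smooth, stays in \<open>[0,1]\<close> and dominates each of the first \<open>n\<close> bumps.\<close>
  define cut where "cut n x = 1 - (\<Prod>k<n. 1 - box_bump n (a k) (c k) x)" for n x
  have partial: "(\<lambda>x. 1 - (\<Prod>k<m. 1 - box_bump n (a k) (c k) x)) \<in> test_functions \<Omega>" for n m
  proof (induction m)
    case 0
    show ?case by (simp add: test_function_zero)
  next
    case (Suc m)
    let ?f = "\<lambda>x. 1 - (\<Prod>k<m. 1 - box_bump n (a k) (c k) x)" and ?g = "box_bump n (a m) (c m)"
    have "(\<lambda>x. 1 * (1 * ?f x + 1 * ?g x) + (-1) * (?f x * ?g x)) \<in> test_functions \<Omega>"
      by (intro test_function_lincomb test_function_mult Suc.IH box_bump_test_function ac smooth_box_bump)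
    also have "(\<lambda>x. 1 * (1 * ?f x + 1 * ?g x) + (-1) * (?f x * ?g x)) =
        (\<lambda>x. 1 - (\<Prod>k<Suc m. 1 - box_bump n (a k) (c k) x))"
      by (auto simp: algebra_simps)
    finally show ?case .
  qed
  have bounds: "0 \<le> (\<Prod>k<m. 1 - box_bump n (a k) (c k) x)" "(\<Prod>k<m. 1 - box_bump n (a k) (c k) x) \<le> 1" for n m x
    by (auto intro!: prod_nonneg prod_le_1 simp: box_bump_bounds)
  have "(\<lambda>n. cut n x) \<longlonglongrightarrow> indicator \<Omega> x" for x
  proof (cases "x \<in> \<Omega>")
    case True
    then obtain k where k: "x \<in> box (a k) (c k)"
      using \<open>\<Union>\<F> = \<Omega>\<close> \<G> B ac by (metis UnionE insertCI rangeE)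
    have "(\<lambda>n. 1 - (1 - box_bump n (a k) (c k) x)) \<longlonglongrightarrow> 1 - (1 - indicator (box (a k) (c k)) x)"
      by (intro tendsto_intros box_bump_tendsto_indicator)
    then have lim: "(\<lambda>n. 1 - (1 - box_bump n (a k) (c k) x)) \<longlonglongrightarrow> 1" using k by simp
    have "(\<lambda>n. cut n x) \<longlonglongrightarrow> 1"
    proof (rule tendsto_sandwich[OF _ _ lim tendsto_const])
      show "\<forall>\<^sub>F n in sequentially. cut n x \<le> 1"
        using bounds by (auto simp: cut_def)
      show "\<forall>\<^sub>F n in sequentially. 1 - (1 - box_bump n (a k) (c k) x) \<le> cut n x"
        using eventually_gt_at_top[of k]
      proof eventually_elim
        case (elim n)
        have "(\<Prod>k<n. 1 - box_bump n (a k) (c k) x)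
            = (1 - box_bump n (a k) (c k) x) * (\<Prod>j\<in>{..<n} - {k}. 1 - box_bump n (a j) (c j) x)"
          using elim by (intro prod.remove) auto
        also have "\<dots> \<le> (1 - box_bump n (a k) (c k) x) * 1"
          by (intro mult_left_mono prod_le_1) (auto simp: box_bump_bounds)
        finally show ?case by (simp add: cut_def)
      qed
    qed
    then show ?thesis using True by simp
  next
    case False
    have "cut n x = 0" for n
      using test_function_outside[OF partial False] by (simp add: cut_def)
    then show ?thesis using False by simp
  qed
  moreover have "cut n \<in> test_functions \<Omega>" for n
    using partial[of n n] unfolding cut_def[abs_def] .
  moreover have "0 \<le> cut n x \<and> cut n x \<le> 1" for n x
    using bounds by (auto simp: cut_def)
  ultimately show ?thesis by blast
qed

text \<open>
  A functional form of the monotone class argument. It is used to pass from statements tested with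
  smooth functions to statements tested with indicator functions.
\<close>

lemma test_functions_generate:
  fixes P :: "('a::euclidean_space \<Rightarrow> real) \<Rightarrow> bool"
  assumes "open \<Omega>"
    and test: "\<And>\<phi>. \<phi> \<in> test_functions \<Omega> \<Longrightarrow> P \<phi>"
    and lin: "\<And>f g a b. P f \<Longrightarrow> P g \<Longrightarrow> P (\<lambda>x. a * f x + b * g x)"
    and lim: "\<And>f g. (\<And>n. P (f n)) \<Longrightarrow> (\<And>n x. \<bar>f n x\<bar> \<le> 1) \<Longrightarrow> (\<And>x. (\<lambda>n. f n x) \<longlonglongrightarrow> g x) \<Longrightarrow> P g"
    and A: "A \<in> sets borel"
  shows "P (indicator (A \<inter> \<Omega>))"
proof -
  obtain cut where cut: "\<And>n. cut n \<in> test_functions \<Omega>" "\<And>n x. 0 \<le> cut n x" "\<And>n x. cut n x \<le> 1"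
      "\<And>x. (\<lambda>n. cut n x) \<longlonglongrightarrow> indicator \<Omega> x"
    using test_function_cutoffs[OF assms(1)] by metis
  let ?G = "range (\<lambda>(a, b). box a b :: 'a set)"
  \<comment> \<open>Boxes generate the Borel sets and are stable under intersection, so that the rest of the
    construction only needs complements and disjoint unions.\<close>
  have "Int_stable ?G"
    by (auto simp: Int_stable_def box_Int_box)
  moreover have "?G \<subseteq> Pow UNIV" by simp
  moreover have "A \<in> sigma_sets UNIV ?G"
    using A by (simp add: borel_eq_box)
  ultimately show ?thesis
  proof (induction rule: sigma_sets_induct_disjoint[where G = ?G and \<Omega> = UNIV])
    case (basic B)
    then obtain a c where B: "B = box a c" by auto
    show ?case
    proof (rule lim)
      show "P (\<lambda>x. cut n x * box_bump n a c x)" for n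
        by (intro test test_function_mult cut smooth_box_bump)
      show "\<bar>cut n x * box_bump n a c x\<bar> \<le> 1" for n x
        using cut(2,3)[where n = n and x = x] box_bump_bounds[of n a c x] by (auto simp: abs_mult intro: mult_le_one)
      show "(\<lambda>n. cut n x * box_bump n a c x) \<longlonglongrightarrow> indicator (B \<inter> \<Omega>) x" for x
        using tendsto_mult[OF cut(4)[of x] box_bump_tendsto_indicator[of a c x]]
        by (simp add: B indicator_inter_arith mult.commute)
    qed
  next
    case empty
    show ?case using test[OF test_function_zero] by (simp add: indicator_def)
  next
    case (compl B)
    have "P (indicator \<Omega>)"
      by (rule lim[of cut]) (use cut in \<open>auto intro: test\<close>)
    from lin[OF this compl.IH, of 1 "-1"]
    have "P (\<lambda>x. indicator \<Omega> x - indicator (B \<inter> \<Omega>) x)" by simp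
    also have "(\<lambda>x. indicator \<Omega> x - indicator (B \<inter> \<Omega>) x) = (indicator ((UNIV - B) \<inter> \<Omega>) :: 'a \<Rightarrow> real)"
      by (auto simp: indicator_def)
    finally show ?case .
  next
    case (union B)
    have part: "P (\<lambda>x. indicator (\<Union>i<n. B i \<inter> \<Omega>) x)" for n
    proof (induction n)
      case 0
      show ?case using test[OF test_function_zero] by simp
    next
      case (Suc n)
      have "B n \<inter> B i = {}" if "i < n" for i
        using union(1) that by (auto simp: disjoint_family_on_def)
      then have "(\<lambda>x. 1 * indicator (\<Union>i<n. B i \<inter> \<Omega>) x + 1 * indicator (B n \<inter> \<Omega>) x) =
          (\<lambda>x. indicator (\<Union>i<Suc n. B i \<inter> \<Omega>) x :: real)"
        by (auto simp: indicator_def lessThan_Suc fun_eq_iff)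
      then show ?case using lin[OF Suc.IH union(3)[of n], of 1 1] by simp
    qed
    show ?case
    proof (rule lim[OF part])
      show "(\<lambda>n. indicator (\<Union>i<n. B i \<inter> \<Omega>) x) \<longlonglongrightarrow> (indicator ((\<Union>i. B i) \<inter> \<Omega>) x :: real)" for x
        using LIMSEQ_indicator_UN[of "\<lambda>i. B i \<inter> \<Omega>" x] by (simp add: Int_UN_distrib2)
    qed (simp add: indicator_def)
  qed
qed

section \<open>Lebesgue spaces on the domain\<close>

lemma AE_lebesgue_on_iff:
  assumes "\<Omega> \<in> sets borel"
  shows "(AE x in lebesgue_on \<Omega>. P x) \<longleftrightarrow> (AE x in lborel. x \<in> \<Omega> \<longrightarrow> P x)"
  using assms by (simp add: AE_restrict_space_iff AE_completion_iff)

lemma borel_measurable_lebesgue_on: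
  assumes "f \<in> borel_measurable borel"
  shows "f \<in> borel_measurable (lebesgue_on \<Omega>)"
  using assms by (intro measurable_restrict_space1 measurable_completion) simp

lemma lebesgue_on_borel_version:
  fixes u :: "'a::euclidean_space \<Rightarrow> real"
  assumes "\<Omega> \<in> sets borel" "u \<in> borel_measurable (lebesgue_on \<Omega>)"
  shows "\<exists>u0\<in>borel_measurable borel. (\<forall>x. x \<notin> \<Omega> \<longrightarrow> u0 x = 0) \<and> (AE x in lebesgue_on \<Omega>. u x = u0 x)"
proof -
  have "(\<lambda>x. indicator \<Omega> x *\<^sub>R u x) \<in> borel_measurable (completion lborel)"
    using assms by (subst borel_measurable_restrict_space_iff[symmetric]) auto
  then obtain g where g: "g \<in> borel_measurable lborel" "AE x in lborel. indicator \<Omega> x *\<^sub>R u x = g x"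
    using completion_ex_borel_measurable_real by blast
  show ?thesis
  proof (intro bexI conjI allI impI)
    show "(\<lambda>x. indicator \<Omega> x * g x) \<in> borel_measurable borel"
      using g assms(1) by simp
    show "AE x in lebesgue_on \<Omega>. u x = indicator \<Omega> x * g x"
      unfolding AE_lebesgue_on_iff[OF assms(1)] using g(2) by eventually_elim (auto simp: indicator_def)
  qed auto
qed

lemma lebesgue_on_integral_lborel:
  fixes f :: "'a::euclidean_space \<Rightarrow> real"
  assumes "\<Omega> \<in> sets borel" "f \<in> borel_measurable borel" "\<And>x. x \<notin> \<Omega> \<Longrightarrow> f x = 0"
  shows "(LINT x|lebesgue_on \<Omega>. f x) = (LINT x|lborel. f x)"
    and "integrable (lebesgue_on \<Omega>) f \<longleftrightarrow> integrable lborel f"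
proof -
  have "(\<lambda>x. indicator \<Omega> x *\<^sub>R f x) = f"
    using assms(3) by (auto simp: indicator_def fun_eq_iff)
  then show "(LINT x|lebesgue_on \<Omega>. f x) = (LINT x|lborel. f x)"
      "integrable (lebesgue_on \<Omega>) f \<longleftrightarrow> integrable lborel f"
    using assms(1,2) integral_completion[of f lborel] integrable_completion[of f lborel]
    by (simp_all add: integral_restrict_space integrable_restrict_space)
qed

lemma integrable_mult_bounded:
  fixes v \<psi> :: "'a \<Rightarrow> real"
  assumes "integrable M v" "\<psi> \<in> borel_measurable M" "\<And>x. \<bar>\<psi> x\<bar> \<le> K"
  shows "integrable M (\<lambda>x. v x * \<psi> x)"
proof (rule Bochner_Integration.integrable_bound)
  show "integrable M (\<lambda>x. K * v x)" using assms by simp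
  show "AE x in M. norm (v x * \<psi> x) \<le> norm (K * v x)"
  proof (rule AE_I2)
    fix x
    have "\<bar>\<psi> x\<bar> \<le> \<bar>K\<bar>" using assms(3)[of x] by linarith
    then show "norm (v x * \<psi> x) \<le> norm (K * v x)"
      by (simp add: abs_mult mult.commute mult_right_mono)
  qed
qed (use assms in simp)

text \<open>
  The fundamental lemma of the calculus of variations: the integrals of \<open>v\<close> over all Borel sets
  vanish, in particular over the sets where \<open>v\<close> is positive or negative.
\<close>

lemma integral_mult_test_functions_eq_0:
  fixes v :: "'a::euclidean_space \<Rightarrow> real"
  assumes "open \<Omega>" "integrable (lebesgue_on \<Omega>) v"
    and zero: "\<And>\<phi>. \<phi> \<in> test_functions \<Omega> \<Longrightarrow> (LINT x|lebesgue_on \<Omega>. v x * \<phi> x) = 0"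
  shows "AE x in lebesgue_on \<Omega>. v x = 0"
proof -
  let ?M = "lebesgue_on \<Omega>"
  have b: "\<Omega> \<in> sets borel" using assms(1) by simp
  define P where "P \<psi> \<longleftrightarrow> \<psi> \<in> borel_measurable borel \<and> (\<exists>K. \<forall>x. \<bar>\<psi> x\<bar> \<le> K) \<and>
      (LINT x|?M. v x * \<psi> x) = 0" for \<psi> :: "'a \<Rightarrow> real"
  have int: "integrable ?M (\<lambda>x. v x * \<psi> x)" if P: "P \<psi>" for \<psi>
  proof -
    obtain K where "\<forall>x. \<bar>\<psi> x\<bar> \<le> K" using P unfolding P_def by blast
    then show ?thesis
      using P assms(2) by (intro integrable_mult_bounded[of _ _ _ K]) (auto simp: P_def borel_measurable_lebesgue_on)
  qed
  have Pind: "P (indicator (A \<inter> \<Omega>))" if "A \<in> sets borel" for A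
  proof (rule test_functions_generate[OF assms(1) _ _ _ that])
    show "P \<phi>" if "\<phi> \<in> test_functions \<Omega>" for \<phi>
      unfolding P_def
      by (intro conjI test_function_borel[OF that] test_function_bounded[OF that] zero[OF that])
  next
    fix f g :: "'a \<Rightarrow> real" and r s :: real
    assume fg: "P f" "P g"
    then obtain K L where KL: "\<forall>x. \<bar>f x\<bar> \<le> K" "\<forall>x. \<bar>g x\<bar> \<le> L" unfolding P_def by blast
    have "(LINT x|?M. v x * (r * f x + s * g x)) = (LINT x|?M. r * (v x * f x) + s * (v x * g x))"
      by (simp add: algebra_simps)
    also have "\<dots> = 0"
      using int[OF fg(1)] int[OF fg(2)] fg by (subst Bochner_Integration.integral_add) (auto simp: P_def)
    finally have "(LINT x|?M. v x * (r * f x + s * g x)) = 0" .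
    moreover have "\<bar>r * f x + s * g x\<bar> \<le> \<bar>r\<bar> * K + \<bar>s\<bar> * L" for x
    proof -
      have "\<bar>r * f x + s * g x\<bar> \<le> \<bar>r\<bar> * \<bar>f x\<bar> + \<bar>s\<bar> * \<bar>g x\<bar>"
        by (metis abs_mult abs_triangle_ineq)
      also have "\<dots> \<le> \<bar>r\<bar> * K + \<bar>s\<bar> * L"
        using KL by (intro add_mono mult_left_mono) auto
      finally show ?thesis .
    qed
    ultimately show "P (\<lambda>x. r * f x + s * g x)"
      using fg unfolding P_def by auto
  next
    fix f :: "nat \<Rightarrow> 'a \<Rightarrow> real" and g
    assume f: "\<And>n. P (f n)" "\<And>n x. \<bar>f n x\<bar> \<le> 1" "\<And>x. (\<lambda>n. f n x) \<longlonglongrightarrow> g x"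
    have fm: "f n \<in> borel_measurable borel" for n using f(1) P_def by blast
    have gm: "g \<in> borel_measurable borel"
      by (rule borel_measurable_LIMSEQ_real[of _ f]) (use f(3) fm in auto)
    have "(\<lambda>n. LINT x|?M. v x * f n x) \<longlonglongrightarrow> (LINT x|?M. v x * g x)"
    proof (rule integral_dominated_convergence[where w = "\<lambda>x. \<bar>v x\<bar>"])
      show "AE x in ?M. (\<lambda>n. v x * f n x) \<longlonglongrightarrow> v x * g x"
        by (intro AE_I2 tendsto_mult tendsto_const f(3))
      show "AE x in ?M. norm (v x * f n x) \<le> \<bar>v x\<bar>" for n
      proof (rule AE_I2)
        fix x show "norm (v x * f n x) \<le> \<bar>v x\<bar>"
          using mult_left_mono[OF f(2)[of n x], of "\<bar>v x\<bar>"] by (simp add: abs_mult)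
      qed
    qed (use assms(2) fm[THEN borel_measurable_lebesgue_on] gm[THEN borel_measurable_lebesgue_on] in auto)
    moreover have "(LINT x|?M. v x * f n x) = 0" for n
      using f(1) P_def by blast
    ultimately have "(LINT x|?M. v x * g x) = 0"
      by (simp add: LIMSEQ_const_iff)
    moreover have "\<bar>g x\<bar> \<le> 1" for x
      using f(2)[of _ x] by (intro LIMSEQ_le_const2[OF tendsto_rabs[OF f(3)[of x]]] exI[of _ 0]) simp
    ultimately show "P g"
      using gm unfolding P_def by (intro conjI exI[of _ 1] allI) auto
  qed
  obtain v0 where v0: "v0 \<in> borel_measurable borel" "AE x in ?M. v x = v0 x"
    using lebesgue_on_borel_version[OF b borel_measurable_integrable[OF assms(2)]] by blast
  have pos: "AE x in ?M. s * v x \<le> 0" if "s = 1 \<or> s = -1" for s :: real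
  proof -
    let ?A = "{x. s * v0 x > 0}"
    have A: "?A \<in> sets borel" using v0(1) by measurable
    have eq: "AE x in ?M. s * max 0 (s * v x) = v x * indicator (?A \<inter> \<Omega>) x"
      using v0(2) AE_space by eventually_elim (use that in \<open>auto simp: indicator_def max_def\<close>)
    have "(LINT x|?M. s * max 0 (s * v x)) = (LINT x|?M. v x * indicator (?A \<inter> \<Omega>) x)"
      using assms(2) eq borel_measurable_integrable[OF int[OF Pind[OF A]]]
      by (intro integral_cong_AE) auto
    also have "\<dots> = 0"
      using Pind[OF A] by (simp add: P_def)
    finally have "(LINT x|?M. max 0 (s * v x)) = 0" using that by auto
    then have "AE x in ?M. max 0 (s * v x) = 0"
      using assms(2) by (subst (asm) integral_nonneg_eq_0_iff_AE) auto
    then show ?thesis by eventually_elim auto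
  qed
  show ?thesis
    using pos[of 1, simplified] pos[of "-1", simplified] by eventually_elim auto
qed

lemma L2D: "f \<in> L2 \<Omega> \<Longrightarrow> f \<in> borel_measurable (lebesgue_on \<Omega>)"
  "f \<in> L2 \<Omega> \<Longrightarrow> integrable (lebesgue_on \<Omega>) (\<lambda>x. (f x)\<^sup>2)"
  by (auto simp: L2_def)

lemma L2_mult_integrable:
  assumes "f \<in> L2 \<Omega>" "g \<in> L2 \<Omega>"
  shows "integrable (lebesgue_on \<Omega>) (\<lambda>x. f x * g x)"
proof (rule Bochner_Integration.integrable_bound)
  show "integrable (lebesgue_on \<Omega>) (\<lambda>x. (f x)\<^sup>2 + (g x)\<^sup>2)"
    using assms by (simp add: L2D)
  show "AE x in lebesgue_on \<Omega>. norm (f x * g x) \<le> norm ((f x)\<^sup>2 + (g x)\<^sup>2)"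
  proof (rule AE_I2)
    fix x
    have "2 * \<bar>f x * g x\<bar> \<le> (f x)\<^sup>2 + (g x)\<^sup>2"
      using sum_squares_bound[of "\<bar>f x\<bar>" "\<bar>g x\<bar>"] by (simp add: abs_mult)
    then show "norm (f x * g x) \<le> norm ((f x)\<^sup>2 + (g x)\<^sup>2)" by simp
  qed
qed (use L2D(1)[OF assms(1)] L2D(1)[OF assms(2)] in simp)

lemma L2_lincomb:
  assumes "f \<in> L2 \<Omega>" "g \<in> L2 \<Omega>"
  shows "(\<lambda>x. a * f x + b * g x) \<in> L2 \<Omega>"
proof -
  have "(\<lambda>x. (a * f x + b * g x)\<^sup>2) = (\<lambda>x. a\<^sup>2 * (f x)\<^sup>2 + b\<^sup>2 * (g x)\<^sup>2 + (2 * a * b) * (f x * g x))"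
    by (auto simp: power2_eq_square algebra_simps)
  then have "integrable (lebesgue_on \<Omega>) (\<lambda>x. (a * f x + b * g x)\<^sup>2)"
    using L2_mult_integrable[OF assms] L2D(2)[OF assms(1)] L2D(2)[OF assms(2)] by simp
  then show ?thesis
    using assms by (auto simp: L2_def)
qed

lemma L2_bounded:
  assumes "bounded \<Omega>" "\<Omega> \<in> sets borel" "f \<in> borel_measurable (lebesgue_on \<Omega>)"
    "AE x in lebesgue_on \<Omega>. \<bar>f x\<bar> \<le> K"
  shows "f \<in> L2 \<Omega>"
proof -
  have fin: "finite_measure (lebesgue_on \<Omega>)"
    using assms(1,2) by (intro finite_measure_lebesgue_on bounded_set_imp_lmeasurable) auto
  have "integrable (lebesgue_on \<Omega>) (\<lambda>x. (f x)\<^sup>2)"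
  proof (rule finite_measure.integrable_const_bound[OF fin])
    show "AE x in lebesgue_on \<Omega>. norm ((f x)\<^sup>2) \<le> K\<^sup>2"
      using assms(4) by eventually_elim (simp add: abs_le_square_iff[symmetric])
  qed (use assms in simp)
  then show ?thesis using assms by (simp add: L2_def)
qed

lemma L2_integrable:
  assumes "bounded \<Omega>" "\<Omega> \<in> sets borel" "f \<in> L2 \<Omega>"
  shows "integrable (lebesgue_on \<Omega>) f"
  using L2_mult_integrable[OF assms(3), of "\<lambda>x. 1"] L2_bounded[OF assms(1,2), of "\<lambda>x. 1" 1] by simp

section \<open>Weak derivatives\<close>

lemma integral_lborel_shift:
  fixes f :: "'a::euclidean_space \<Rightarrow> real"
  assumes "f \<in> borel_measurable borel"
  shows "(LINT x|lborel. f (x + z)) = (LINT x|lborel. f x)"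
proof -
  have "(LINT x|lborel. f x) = (LINT x|distr lborel borel ((+) z). f x)"
    by (simp add: lborel_distr_plus)
  also have "\<dots> = (LINT x|lborel. f (z + x))"
    using assms by (intro integral_distr) auto
  finally show ?thesis by (simp add: add.commute)
qed

lemma integrable_lborel_shift:
  fixes f :: "'a::euclidean_space \<Rightarrow> real"
  assumes "integrable lborel f"
  shows "integrable lborel (\<lambda>x. f (x + z))"
proof -
  have "integrable (distr lborel borel ((+) z)) f"
    using assms by (simp add: lborel_distr_plus)
  then have "integrable lborel (\<lambda>x. f (z + x))"
    using assms by (subst (asm) integrable_distr_eq) auto
  then show ?thesis by (simp add: add.commute)
qed

lemma smooth_line_derivative:
  assumes "smooth \<phi>"
  shows "((\<lambda>s. \<phi> (x + s *\<^sub>R z)) has_real_derivative frechet_derivative \<phi> (at (x + s *\<^sub>R z)) z) (at s)"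
proof -
  have "((\<lambda>s. \<phi> (x + s *\<^sub>R z)) has_derivative
      (\<lambda>h. frechet_derivative \<phi> (at (x + s *\<^sub>R z)) (h *\<^sub>R z))) (at s)"
    by (rule has_derivative_compose[of "\<lambda>s. x + s *\<^sub>R z" _ s, OF _ smooth_has_derivative[OF assms]])
       (auto intro!: derivative_eq_intros)
  moreover have "linear (frechet_derivative \<phi> (at (x + s *\<^sub>R z)))"
    by (intro linear_frechet_derivative smooth_differentiable assms)
  then have "(\<lambda>h. frechet_derivative \<phi> (at (x + s *\<^sub>R z)) (h *\<^sub>R z)) = (*) (frechet_derivative \<phi> (at (x + s *\<^sub>R z)) z)"
    by (auto simp: linear_cmul mult.commute)
  ultimately show ?thesis by (simp add: has_field_derivative_def)
qed

lemma smooth_frechet_derivative_sum: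
  fixes z :: "'a::euclidean_space"
  assumes "smooth \<phi>"
  shows "frechet_derivative \<phi> (at x) z = (\<Sum>b\<in>Basis. (z \<bullet> b) * frechet_derivative \<phi> (at x) b)"
proof -
  have lin: "linear (frechet_derivative \<phi> (at x))"
    by (intro linear_frechet_derivative smooth_differentiable assms)
  have "frechet_derivative \<phi> (at x) (\<Sum>b\<in>Basis. (z \<bullet> b) *\<^sub>R b) = (\<Sum>b\<in>Basis. (z \<bullet> b) * frechet_derivative \<phi> (at x) b)"
    using lin by (simp add: linear_sum linear_cmul)
  then show ?thesis by (simp add: euclidean_representation)
qed

lemma integrable_test_function:
  assumes "\<phi> \<in> test_functions \<Omega>"
  shows "integrable lborel \<phi>"
proof -
  obtain K where K: "compact K" "K \<subseteq> \<Omega>" "\<forall>x. x \<notin> K \<longrightarrow> \<phi> x = 0"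
    using test_functionD(2)[OF assms] by blast
  have "integrable lborel (\<lambda>x. indicator K x *\<^sub>R \<phi> x)"
    using K(1) by (intro borel_integrable_compact smooth_continuous test_functionD(1)[OF assms]) auto
  moreover have "(\<lambda>x. indicator K x *\<^sub>R \<phi> x) = \<phi>"
    using K(3) by (auto simp: indicator_def fun_eq_iff)
  ultimately show ?thesis by simp
qed

text \<open>The difference quotients have integral zero by translation invariance.\<close>

lemma integral_derivative_test_function:
  assumes "\<phi> \<in> test_functions \<Omega>" "b \<in> Basis"
  shows "(LINT x|lborel. frechet_derivative \<phi> (at x) b) = 0"
proof -
  let ?D = "\<lambda>x. frechet_derivative \<phi> (at x) b"
  have D: "?D \<in> test_functions \<Omega>"
    by (rule test_function_frechet_derivative[OF assms])
  obtain M where M: "\<forall>x. \<bar>?D x\<bar> \<le> M"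
    using test_function_bounded[OF D] by blast
  obtain K where K: "compact K" "K \<subseteq> \<Omega>" "\<forall>x. x \<notin> K \<longrightarrow> \<phi> x = 0"
    using test_functionD(2)[OF assms(1)] by blast
  \<comment> \<open>All difference quotients with step at most one are supported in \<open>L\<close>.\<close>
  define L where "L = {x + y | x y. x \<in> K \<and> y \<in> cball 0 1}"
  have L: "compact L"
    unfolding L_def using K(1) by (intro compact_sums) auto
  define q where "q n x = real (Suc n) * (\<phi> (x + inverse (real (Suc n)) *\<^sub>R b) - \<phi> x)" for n x
  have \<phi>b: "\<phi> \<in> borel_measurable borel" by (rule test_function_borel[OF assms(1)])
  have "(\<lambda>n. LINT x|lborel. q n x) \<longlonglongrightarrow> (LINT x|lborel. ?D x)"
  proof (rule integral_dominated_convergence[where w = "\<lambda>x. M * indicator L x"])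
    show "integrable lborel (\<lambda>x. M * indicator L x)"
      using L by (intro integrable_mult_right integrable_real_indicator)
        (use emeasure_bounded_finite[OF compact_imp_bounded[OF L]] in \<open>auto simp: compact_imp_closed intro: borel_closed\<close>)
    show "AE x in lborel. (\<lambda>n. q n x) \<longlonglongrightarrow> ?D x"
    proof (rule AE_I2)
      fix x
      have "((\<lambda>h. (\<phi> (x + h *\<^sub>R b) - \<phi> x) / h) \<longlongrightarrow> ?D x) (at 0)"
        using smooth_line_derivative[OF test_functionD(1)[OF assms(1)], of x b 0] by (simp add: DERIV_def)
      then have "(\<lambda>n. (\<phi> (x + inverse (real (Suc n)) *\<^sub>R b) - \<phi> x) / inverse (real (Suc n))) \<longlonglongrightarrow> ?D x"
        by (rule filterlim_compose)
           (auto simp: filterlim_at simp del: of_nat_Suc intro: LIMSEQ_inverse_real_of_nat)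
      then show "(\<lambda>n. q n x) \<longlonglongrightarrow> ?D x"
        by (simp add: q_def divide_inverse mult.commute del: of_nat_Suc)
    qed
    show "AE x in lborel. norm (q n x) \<le> M * indicator L x" for n
    proof (rule AE_I2)
      fix x
      let ?h = "inverse (real (Suc n))"
      have h: "0 < ?h" "?h \<le> 1" by (auto simp: field_simps)
      have b: "norm b = 1" using assms(2) by simp
      show "norm (q n x) \<le> M * indicator L x"
      proof (cases "x \<in> L")
        case True
        obtain s where "\<phi> (x + ?h *\<^sub>R b) - \<phi> (x + 0 *\<^sub>R b) = (?h - 0) * ?D (x + s *\<^sub>R b)"
          using MVT2[of 0 ?h "\<lambda>s. \<phi> (x + s *\<^sub>R b)" "\<lambda>s. ?D (x + s *\<^sub>R b)"] h
            smooth_line_derivative[OF test_functionD(1)[OF assms(1)]] by blast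
        then have "q n x = ?D (x + s *\<^sub>R b)" by (simp add: q_def del: of_nat_Suc)
        then show ?thesis using M True by simp
      next
        case False
        have "x \<notin> K" using False by (force simp: L_def)
        moreover have "x + ?h *\<^sub>R b \<notin> K"
        proof
          assume "x + ?h *\<^sub>R b \<in> K"
          moreover have "- ?h *\<^sub>R b \<in> cball 0 1" using h(2) b by simp
          moreover have "x = (x + ?h *\<^sub>R b) + (- ?h *\<^sub>R b)" by simp
          ultimately have "x \<in> L"
            unfolding L_def by blast
          then show False using False by simp
        qed
        ultimately show ?thesis using K(3) False by (simp add: q_def)
      qed
    qed
  qed (use test_function_borel[OF D] \<phi>b in \<open>auto simp: q_def\<close>)
  moreover have "(LINT x|lborel. q n x) = 0" for n
    unfolding q_def using integrable_test_function[OF assms(1)]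
    by (simp add: integrable_lborel_shift integral_lborel_shift[OF \<phi>b])
  ultimately show ?thesis by (simp add: LIMSEQ_const_iff)
qed

lemma test_function_lebesgue_integral:
  assumes "open \<Omega>" "\<phi> \<in> test_functions \<Omega>"
  shows "(LINT x|lebesgue_on \<Omega>. \<phi> x) = (LINT x|lborel. \<phi> x)" "integrable (lebesgue_on \<Omega>) \<phi>"
  using lebesgue_on_integral_lborel[of \<Omega> \<phi>] assms test_function_borel[OF assms(2)]
    test_function_outside[OF assms(2)] integrable_test_function[OF assms(2)] by auto

lemma test_function_L2:
  assumes "open \<Omega>" "\<phi> \<in> test_functions \<Omega>"
  shows "\<phi> \<in> L2 \<Omega>"
proof -
  have "(\<lambda>x. \<phi> x * \<phi> x) \<in> test_functions \<Omega>"
    by (intro test_function_mult assms test_functionD(1)[OF assms(2)])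
  then show ?thesis
    using test_function_lebesgue_integral(2)[OF assms(1)] borel_measurable_lebesgue_on[OF test_function_borel[OF assms(2)]]
    by (simp add: L2_def power2_eq_square)
qed

lemma has_weak_deriv_unique:
  assumes "open \<Omega>" "bounded \<Omega>" "has_weak_deriv \<Omega> b u g" "has_weak_deriv \<Omega> b u g'"
  shows "AE x in lebesgue_on \<Omega>. g x = g' x"
proof -
  have L2: "g \<in> L2 \<Omega>" "g' \<in> L2 \<Omega>" using assms(3,4) by (auto simp: has_weak_deriv_def)
  have "AE x in lebesgue_on \<Omega>. g x - g' x = 0"
  proof (rule integral_mult_test_functions_eq_0[OF assms(1)])
    show "integrable (lebesgue_on \<Omega>) (\<lambda>x. g x - g' x)"
      using L2_integrable[OF assms(2) _ L2(1)] L2_integrable[OF assms(2) _ L2(2)] assms(1) by simp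
    fix \<phi> assume \<phi>: "\<phi> \<in> test_functions \<Omega>"
    have "(LINT x|lebesgue_on \<Omega>. (g x - g' x) * \<phi> x) = (LINT x|lebesgue_on \<Omega>. g x * \<phi> x) - (LINT x|lebesgue_on \<Omega>. g' x * \<phi> x)"
      using L2 test_function_L2[OF assms(1) \<phi>]
      by (subst Bochner_Integration.integral_diff[symmetric]) (auto intro!: L2_mult_integrable simp: algebra_simps)
    also have "\<dots> = 0"
      using assms(3,4) \<phi> by (auto simp: has_weak_deriv_def)
    finally show "(LINT x|lebesgue_on \<Omega>. (g x - g' x) * \<phi> x) = 0" .
  qed
  then show ?thesis by eventually_elim simp
qed

lemma weak_deriv_works:
  assumes "has_weak_deriv \<Omega> b u g"
  shows "has_weak_deriv \<Omega> b u (weak_deriv \<Omega> b u)"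
  unfolding weak_deriv_def by (rule someI[of _ g]) (rule assms)

lemma H1_weak_deriv: "u \<in> H1 \<Omega> \<Longrightarrow> b \<in> Basis \<Longrightarrow> has_weak_deriv \<Omega> b u (weak_deriv \<Omega> b u)"
  unfolding H1_def using weak_deriv_works by blast

lemma H1_weak_deriv_L2: "u \<in> H1 \<Omega> \<Longrightarrow> b \<in> Basis \<Longrightarrow> weak_deriv \<Omega> b u \<in> L2 \<Omega>"
  using H1_weak_deriv[of u \<Omega> b] by (simp add: has_weak_deriv_def)

lemma L2_cong_AE:
  assumes "f \<in> L2 \<Omega>" "g \<in> borel_measurable (lebesgue_on \<Omega>)" "AE x in lebesgue_on \<Omega>. f x = g x"
  shows "g \<in> L2 \<Omega>"
proof -
  have "integrable (lebesgue_on \<Omega>) (\<lambda>x. (g x)\<^sup>2)"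
    by (rule integrable_cong_AE_imp[OF L2D(2)[OF assms(1)]])
       (use assms in \<open>auto elim!: eventually_mono\<close>)
  then show ?thesis using assms by (simp add: L2_def)
qed

text \<open>
  The equality holds between the sets of weak derivatives, so that even the choice made in
  \<open>weak_deriv\<close> is the same for functions that agree almost everywhere.
\<close>

lemma has_weak_deriv_cong_AE:
  assumes "open \<Omega>" "u \<in> L2 \<Omega>" "u' \<in> L2 \<Omega>" "AE x in lebesgue_on \<Omega>. u x = u' x" "b \<in> Basis"
  shows "has_weak_deriv \<Omega> b u = has_weak_deriv \<Omega> b u'"
proof -
  have "(LINT x|lebesgue_on \<Omega>. u x * frechet_derivative \<phi> (at x) b) =
      (LINT x|lebesgue_on \<Omega>. u' x * frechet_derivative \<phi> (at x) b)" if "\<phi> \<in> test_functions \<Omega>" for \<phi>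
  proof -
    note L2_mult_integrable[OF _ test_function_L2[OF assms(1) test_function_frechet_derivative[OF that assms(5)]]]
    then show ?thesis
      using assms(2,3,4) by (intro integral_cong_AE) (auto elim!: eventually_mono)
  qed
  then show ?thesis using assms(2,3) by (auto simp: has_weak_deriv_def fun_eq_iff)
qed

lemma weak_deriv_cong_AE:
  assumes "open \<Omega>" "u \<in> L2 \<Omega>" "u' \<in> L2 \<Omega>" "AE x in lebesgue_on \<Omega>. u x = u' x" "b \<in> Basis"
  shows "weak_deriv \<Omega> b u = weak_deriv \<Omega> b u'"
  unfolding weak_deriv_def has_weak_deriv_cong_AE[OF assms] ..

lemma const_L2: "open \<Omega> \<Longrightarrow> bounded \<Omega> \<Longrightarrow> (\<lambda>x. c) \<in> L2 \<Omega>"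
  by (rule L2_bounded[where K = "\<bar>c\<bar>"]) auto

text \<open>
  Adding a constant does not change the set of weak derivatives. Therefore gradients, Laplacians
  and traces of the test functions \<open>w k i + const\<close> below are literally those of \<open>w k i\<close>.
\<close>

lemma has_weak_deriv_add_const:
  assumes "open \<Omega>" "bounded \<Omega>" "u \<in> L2 \<Omega>" "b \<in> Basis"
  shows "has_weak_deriv \<Omega> b (\<lambda>x. u x + c) = has_weak_deriv \<Omega> b u"
proof -
  have uc: "(\<lambda>x. u x + c) \<in> L2 \<Omega>"
    using L2_lincomb[OF assms(3) const_L2[OF assms(1,2)], of 1 1 c] by simp
  have "(LINT x|lebesgue_on \<Omega>. (u x + c) * frechet_derivative \<phi> (at x) b) =
      (LINT x|lebesgue_on \<Omega>. u x * frechet_derivative \<phi> (at x) b)" if "\<phi> \<in> test_functions \<Omega>" for \<phi>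
  proof -
    note D = test_function_frechet_derivative[OF that assms(4)]
    have "(LINT x|lebesgue_on \<Omega>. (u x + c) * frechet_derivative \<phi> (at x) b) =
      (LINT x|lebesgue_on \<Omega>. u x * frechet_derivative \<phi> (at x) b + c * frechet_derivative \<phi> (at x) b)"
      by (simp add: algebra_simps)
    also have "\<dots> = (LINT x|lebesgue_on \<Omega>. u x * frechet_derivative \<phi> (at x) b) +
        c * (LINT x|lebesgue_on \<Omega>. frechet_derivative \<phi> (at x) b)"
      using L2_mult_integrable[OF assms(3) test_function_L2[OF assms(1) D]]
        test_function_lebesgue_integral(2)[OF assms(1) D]
      by (subst Bochner_Integration.integral_add) auto
    finally show ?thesis
      using test_function_lebesgue_integral(1)[OF assms(1) D] integral_derivative_test_function[OF that assms(4)] by simp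
  qed
  then show ?thesis using assms(3) uc by (auto simp: has_weak_deriv_def fun_eq_iff)
qed

lemma weak_deriv_add_const:
  assumes "open \<Omega>" "bounded \<Omega>" "u \<in> L2 \<Omega>" "b \<in> Basis"
  shows "weak_deriv \<Omega> b (\<lambda>x. u x + c) = weak_deriv \<Omega> b u"
  unfolding weak_deriv_def has_weak_deriv_add_const[OF assms] ..

lemma Neumann_H2_L2: "u \<in> Neumann_H2 \<Omega> \<Longrightarrow> u \<in> L2 \<Omega>"
  and Neumann_H2_H1: "u \<in> Neumann_H2 \<Omega> \<Longrightarrow> u \<in> H1 \<Omega>"
  and Neumann_H2_weak_deriv_H1: "u \<in> Neumann_H2 \<Omega> \<Longrightarrow> b \<in> Basis \<Longrightarrow> weak_deriv \<Omega> b u \<in> H1 \<Omega>"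
  by (auto simp: Neumann_H2_def H2_def H1_def)

lemma Neumann_H2_add_const:
  assumes "open \<Omega>" "bounded \<Omega>" "u \<in> Neumann_H2 \<Omega>"
  shows "(\<lambda>x. u x + c) \<in> Neumann_H2 \<Omega>"
proof -
  have u: "u \<in> L2 \<Omega>" by (rule Neumann_H2_L2[OF assms(3)])
  have uc: "(\<lambda>x. u x + c) \<in> L2 \<Omega>"
    using L2_lincomb[OF u const_L2[OF assms(1,2)], of 1 1 c] by simp
  show ?thesis
    using assms(3) uc
    by (simp add: Neumann_H2_def H2_def H1_def zero_normal_derivative_def
        weak_deriv_add_const[OF assms(1,2) u] has_weak_deriv_add_const[OF assms(1,2) u])
qed

lemma has_weak_deriv_test_function:
  assumes "open \<Omega>" "\<psi> \<in> test_functions \<Omega>" "b \<in> Basis"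
  shows "has_weak_deriv \<Omega> b \<psi> (\<lambda>x. frechet_derivative \<psi> (at x) b)"
  unfolding has_weak_deriv_def
proof (intro conjI ballI)
  note D = test_function_frechet_derivative[OF assms(2,3)]
  show "\<psi> \<in> L2 \<Omega>" "(\<lambda>x. frechet_derivative \<psi> (at x) b) \<in> L2 \<Omega>"
    using test_function_L2[OF assms(1)] D assms(2) by auto
  fix \<phi> assume \<phi>: "\<phi> \<in> test_functions \<Omega>"
  note D' = test_function_frechet_derivative[OF \<phi> assms(3)]
  note s = test_functionD(1)[OF assms(2)] test_functionD(1)[OF \<phi>]
  have "(\<lambda>x. \<psi> x * \<phi> x) \<in> test_functions \<Omega>"
    by (intro test_function_mult assms s)
  from integral_derivative_test_function[OF this assms(3)] test_function_lebesgue_integral(1)[OF assms(1) test_function_frechet_derivative[OF this assms(3)]]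
  have "0 = (LINT x|lebesgue_on \<Omega>. frechet_derivative (\<lambda>x. \<psi> x * \<phi> x) (at x) b)" by simp
  also have "\<dots> = (LINT x|lebesgue_on \<Omega>. \<psi> x * frechet_derivative \<phi> (at x) b + frechet_derivative \<psi> (at x) b * \<phi> x)"
    by (simp add: frechet_derivative_real_mult smooth_differentiable s)
  also have "\<dots> = (LINT x|lebesgue_on \<Omega>. \<psi> x * frechet_derivative \<phi> (at x) b) + (LINT x|lebesgue_on \<Omega>. frechet_derivative \<psi> (at x) b * \<phi> x)"
    using assms(1,2) \<phi> D D' by (intro Bochner_Integration.integral_add L2_mult_integrable test_function_L2)
  finally show "(LINT x|lebesgue_on \<Omega>. \<psi> x * frechet_derivative \<phi> (at x) b) =
      - (LINT x|lebesgue_on \<Omega>. frechet_derivative \<psi> (at x) b * \<phi> x)" by simp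
qed

lemma has_weak_deriv_zero: "open \<Omega> \<Longrightarrow> b \<in> Basis \<Longrightarrow> has_weak_deriv \<Omega> b (\<lambda>x. 0) (\<lambda>x. 0)"
  using has_weak_deriv_test_function[OF _ test_function_zero, of \<Omega> b] by (simp add: frechet_derivative_const)

lemma L2_norm_nonneg: "0 \<le> L2_norm \<Omega> f"
  by (simp add: L2_norm_def)

lemma L2_norm_cong_AE:
  assumes "f \<in> borel_measurable (lebesgue_on \<Omega>)" "g \<in> borel_measurable (lebesgue_on \<Omega>)"
    "AE x in lebesgue_on \<Omega>. f x = g x"
  shows "L2_norm \<Omega> f = L2_norm \<Omega> g"
  unfolding L2_norm_def
  by (rule arg_cong[where f = sqrt], rule integral_cong_AE) (use assms in \<open>auto elim!: eventually_mono\<close>)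

lemma L2_norm_scale: "L2_norm \<Omega> (\<lambda>x. c * f x) = \<bar>c\<bar> * L2_norm \<Omega> f"
  by (simp add: L2_norm_def power_mult_distrib real_sqrt_mult)

lemma weak_deriv_AE_eq:
  assumes "open \<Omega>" "bounded \<Omega>" "has_weak_deriv \<Omega> b u g"
  shows "AE x in lebesgue_on \<Omega>. weak_deriv \<Omega> b u x = g x"
  by (rule has_weak_deriv_unique[OF assms(1,2) weak_deriv_works[OF assms(3)] assms(3)])

lemma H1_norm_zero:
  assumes "open \<Omega>" "bounded \<Omega>" "u \<in> L2 \<Omega>" "AE x in lebesgue_on \<Omega>. u x = 0"
  shows "H1_norm \<Omega> u = 0"
proof -
  have z: "(\<lambda>x. 0) \<in> L2 \<Omega>" using const_L2[OF assms(1,2)] .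
  have "L2_norm \<Omega> (weak_deriv \<Omega> b u) = 0" if "b \<in> Basis" for b
  proof -
    have h: "has_weak_deriv \<Omega> b u (\<lambda>x. 0)"
      using has_weak_deriv_cong_AE[OF assms(1,3) z assms(4) that] has_weak_deriv_zero[OF assms(1) that] by simp
    have "L2_norm \<Omega> (weak_deriv \<Omega> b u) = L2_norm \<Omega> (\<lambda>x. 0)"
      using weak_deriv_works[OF h] weak_deriv_AE_eq[OF assms(1,2) h]
      by (intro L2_norm_cong_AE L2D(1)) (auto simp: has_weak_deriv_def z)
    then show ?thesis by (simp add: L2_norm_def)
  qed
  moreover have "L2_norm \<Omega> u = L2_norm \<Omega> (\<lambda>x. 0)"
    using assms by (intro L2_norm_cong_AE L2D(1)) (auto simp: z)
  then have "L2_norm \<Omega> u = 0" by (simp add: L2_norm_def)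
  ultimately show ?thesis by (simp add: H1_norm_def)
qed

text \<open>
  A gradient with compact support in \<open>\<Omega>\<close> has zero boundary trace: the constant sequence of its
  smooth representatives vanishes on the boundary. Covers constants and test functions.
\<close>

lemma Neumann_H2_compact_gradient:
  assumes "open \<Omega>" "bounded \<Omega>" "u \<in> L2 \<Omega>"
    and \<psi>: "\<And>b. b \<in> Basis \<Longrightarrow> \<psi> b \<in> test_functions \<Omega>" "\<And>b. b \<in> Basis \<Longrightarrow> has_weak_deriv \<Omega> b u (\<psi> b)"
  shows "u \<in> Neumann_H2 \<Omega>"
proof -
  have \<psi>L2: "\<psi> b \<in> L2 \<Omega>" if "b \<in> Basis" for b
    by (intro test_function_L2 assms \<psi> that)
  have wd: "weak_deriv \<Omega> b u \<in> L2 \<Omega>" if "b \<in> Basis" for b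
    using weak_deriv_works[OF \<psi>(2)[OF that]] by (simp add: has_weak_deriv_def)
  have ae: "AE x in lebesgue_on \<Omega>. weak_deriv \<Omega> b u x = \<psi> b x" if "b \<in> Basis" for b
    by (rule weak_deriv_AE_eq[OF assms(1,2) \<psi>(2)[OF that]])
  have H1: "weak_deriv \<Omega> b u \<in> H1 \<Omega>" if "b \<in> Basis" for b
  proof -
    have "\<exists>g. has_weak_deriv \<Omega> a (weak_deriv \<Omega> b u) g" if "a \<in> Basis" for a
      using has_weak_deriv_cong_AE[OF assms(1) wd \<psi>L2 ae \<open>a \<in> Basis\<close>] \<open>b \<in> Basis\<close>
        has_weak_deriv_test_function[OF assms(1) \<psi>(1) \<open>a \<in> Basis\<close>] by metis
    then show ?thesis using wd[OF that] by (simp add: H1_def)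
  qed
  have "has_trace \<Omega> (weak_deriv \<Omega> b u) (\<lambda>x. 0)" if b: "b \<in> Basis" for b
    unfolding has_trace_def
  proof (intro conjI exI[of _ "\<lambda>n. \<psi> b"] allI)
    let ?v = "\<lambda>x. \<psi> b x - weak_deriv \<Omega> b u x"
    have "?v \<in> L2 \<Omega>"
      using L2_lincomb[OF \<psi>L2[OF b] wd[OF b], of 1 "-1"] by simp
    then have "H1_norm \<Omega> ?v = 0"
      using ae[OF b] by (intro H1_norm_zero assms) (auto elim!: eventually_mono)
    then show "(\<lambda>n. H1_norm \<Omega> ?v) \<longlonglongrightarrow> 0" by simp
    have "x \<notin> \<Omega>" if "x \<in> space (surface_measure \<Omega>)" for x
      using that assms(1) by (auto simp: surface_measure_def space_restrict_space frontier_def interior_open)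
    then have "(\<integral>\<^sup>+x. ennreal ((\<psi> b x - 0)\<^sup>2) \<partial>surface_measure \<Omega>) = (\<integral>\<^sup>+x. 0 \<partial>surface_measure \<Omega>)"
      using test_function_outside[OF \<psi>(1)[OF b]] by (intro nn_integral_cong) simp
    then show "(\<lambda>n. \<integral>\<^sup>+x. ennreal ((\<psi> b x - 0)\<^sup>2) \<partial>surface_measure \<Omega>) \<longlonglongrightarrow> 0" by simp
  qed (use H1[OF b] test_functionD(1)[OF \<psi>(1)[OF b]] in auto)
  then have "zero_normal_derivative \<Omega> u"
    unfolding zero_normal_derivative_def by (intro exI[of _ "\<lambda>b x. 0"]) auto
  then show ?thesis
    using assms(3) \<psi>(2) H1 by (auto simp: Neumann_H2_def H2_def H1_def)
qed

lemma const_Neumann_H2: "open \<Omega> \<Longrightarrow> bounded \<Omega> \<Longrightarrow> (\<lambda>x. c) \<in> Neumann_H2 \<Omega>"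
  using Neumann_H2_add_const[OF _ _ Neumann_H2_compact_gradient[OF _ _ const_L2 test_function_zero has_weak_deriv_zero], of \<Omega> c]
  by simp

lemma weak_deriv_const:
  assumes "open \<Omega>" "bounded \<Omega>" "b \<in> Basis"
  shows "AE x in lebesgue_on \<Omega>. weak_deriv \<Omega> b (\<lambda>x. c) x = 0"
proof -
  have "has_weak_deriv \<Omega> b (\<lambda>x. 0 + c) (\<lambda>x. 0)"
    unfolding has_weak_deriv_add_const[OF assms(1,2) const_L2[OF assms(1,2)] assms(3)]
    using has_weak_deriv_zero[OF assms(1,3)] .
  then have "has_weak_deriv \<Omega> b (\<lambda>x. c) (\<lambda>x. 0)" by simp
  from weak_deriv_AE_eq[OF assms(1,2) this] show ?thesis .
qed

lemma laplacian_const: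
  assumes "open \<Omega>" "bounded \<Omega>"
  shows "AE x in lebesgue_on \<Omega>. laplacian \<Omega> (\<lambda>x. c) x = 0"
proof -
  have "AE x in lebesgue_on \<Omega>. weak_deriv \<Omega> b (weak_deriv \<Omega> b (\<lambda>x. c)) x = 0" if b: "b \<in> Basis" for b
  proof -
    have "weak_deriv \<Omega> b (weak_deriv \<Omega> b (\<lambda>x. c)) = weak_deriv \<Omega> b (\<lambda>x. 0)"
      using weak_deriv_const[OF assms b] H1_weak_deriv_L2[OF Neumann_H2_H1[OF const_Neumann_H2[OF assms]] b]
      by (intro weak_deriv_cong_AE assms const_L2 b)
    then show ?thesis using weak_deriv_const[OF assms b, of 0] by simp
  qed
  then have "AE x in lebesgue_on \<Omega>. \<forall>b\<in>Basis. weak_deriv \<Omega> b (weak_deriv \<Omega> b (\<lambda>x. c)) x = 0"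
    by (intro AE_finite_allI) auto
  then show ?thesis by eventually_elim (simp add: laplacian_def)
qed

lemma test_function_Neumann_H2:
  assumes "open \<Omega>" "bounded \<Omega>" "\<phi> \<in> test_functions \<Omega>"
  shows "\<phi> \<in> Neumann_H2 \<Omega>"
  by (rule Neumann_H2_compact_gradient[OF assms(1,2) test_function_L2[OF assms(1,3)]
        test_function_frechet_derivative[OF assms(3)] has_weak_deriv_test_function[OF assms(1,3)]])

lemma has_weak_deriv_scale:
  assumes "has_weak_deriv \<Omega> b u g"
  shows "has_weak_deriv \<Omega> b (\<lambda>x. c * u x) (\<lambda>x. c * g x)"
  using assms L2_lincomb[of u \<Omega> u c 0] L2_lincomb[of g \<Omega> g c 0]
  by (auto simp: has_weak_deriv_def mult.assoc)

text \<open>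
  Weak derivatives are chosen up to null sets, so the \<open>H2\<close> norm is homogeneous on test functions
  only after comparing with the classical derivatives. This makes test functions available as
  multiples of elements of the unit ball that defines the dual norm.
\<close>

lemma H2_norm_test_function_scale:
  assumes "open \<Omega>" "bounded \<Omega>" "\<phi> \<in> test_functions \<Omega>"
  shows "\<exists>\<delta>>0. H2_norm \<Omega> (\<lambda>x. \<delta> * \<phi> x) \<le> 1"
proof -
  define D where "D b \<phi> = (\<lambda>x. frechet_derivative \<phi> (at x) b)" for b :: 'a and \<phi> :: "'a \<Rightarrow> real"
  have test: "D b \<phi> \<in> test_functions \<Omega>" if "\<phi> \<in> test_functions \<Omega>" "b \<in> Basis" for b \<phi>
    unfolding D_def by (rule test_function_frechet_derivative[OF that])
  have wd: "AE x in lebesgue_on \<Omega>. weak_deriv \<Omega> b (\<lambda>x. c * \<phi> x) x = c * D b \<phi> x"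
    "weak_deriv \<Omega> b (\<lambda>x. c * \<phi> x) \<in> L2 \<Omega>" "(\<lambda>x. c * D b \<phi> x) \<in> L2 \<Omega>"
    if "\<phi> \<in> test_functions \<Omega>" "b \<in> Basis" for b c \<phi>
  proof -
    have h: "has_weak_deriv \<Omega> b (\<lambda>x. c * \<phi> x) (\<lambda>x. c * D b \<phi> x)"
      unfolding D_def by (rule has_weak_deriv_scale[OF has_weak_deriv_test_function[OF assms(1) that]])
    show "AE x in lebesgue_on \<Omega>. weak_deriv \<Omega> b (\<lambda>x. c * \<phi> x) x = c * D b \<phi> x"
      by (rule weak_deriv_AE_eq[OF assms(1,2) h])
    show "weak_deriv \<Omega> b (\<lambda>x. c * \<phi> x) \<in> L2 \<Omega>" "(\<lambda>x. c * D b \<phi> x) \<in> L2 \<Omega>"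
      using h weak_deriv_works[OF h] by (auto simp: has_weak_deriv_def)
  qed
  have 1: "L2_norm \<Omega> (weak_deriv \<Omega> b (\<lambda>x. c * \<phi> x)) = \<bar>c\<bar> * L2_norm \<Omega> (D b \<phi>)" if b: "b \<in> Basis" for b c
    unfolding L2_norm_scale[symmetric]
    by (intro L2_norm_cong_AE L2D(1) wd assms b)
  have 2: "L2_norm \<Omega> (weak_deriv \<Omega> a (weak_deriv \<Omega> b (\<lambda>x. c * \<phi> x))) = \<bar>c\<bar> * L2_norm \<Omega> (D a (D b \<phi>))"
    if b: "b \<in> Basis" and a: "a \<in> Basis" for a b c
  proof -
    have "weak_deriv \<Omega> a (weak_deriv \<Omega> b (\<lambda>x. c * \<phi> x)) = weak_deriv \<Omega> a (\<lambda>x. c * D b \<phi> x)"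
      by (rule weak_deriv_cong_AE[OF assms(1) wd(2,3,1)[OF assms(3) b] a])
    moreover have "L2_norm \<Omega> (weak_deriv \<Omega> a (\<lambda>x. c * D b \<phi> x)) = \<bar>c\<bar> * L2_norm \<Omega> (D a (D b \<phi>))"
      unfolding L2_norm_scale[symmetric]
      by (intro L2_norm_cong_AE L2D(1) wd test assms a b)
    ultimately show ?thesis by simp
  qed
  define Q where "Q = sqrt ((L2_norm \<Omega> \<phi>)\<^sup>2 + (\<Sum>b\<in>Basis. (L2_norm \<Omega> (D b \<phi>))\<^sup>2)
       + (\<Sum>a\<in>Basis. \<Sum>b\<in>Basis. (L2_norm \<Omega> (D a (D b \<phi>)))\<^sup>2))"
  have "H2_norm \<Omega> (\<lambda>x. c * \<phi> x) = \<bar>c\<bar> * Q" for c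
  proof -
    have "H2_norm \<Omega> (\<lambda>x. c * \<phi> x) = sqrt (c\<^sup>2 * ((L2_norm \<Omega> \<phi>)\<^sup>2 + (\<Sum>b\<in>Basis. (L2_norm \<Omega> (D b \<phi>))\<^sup>2)
       + (\<Sum>a\<in>Basis. \<Sum>b\<in>Basis. (L2_norm \<Omega> (D a (D b \<phi>)))\<^sup>2)))"
      unfolding H2_norm_def
      by (simp add: 1 2 L2_norm_scale power_mult_distrib sum_distrib_left algebra_simps)
    then show ?thesis by (simp add: Q_def real_sqrt_mult)
  qed
  note norm = this
  have "Q \<ge> 0" unfolding Q_def by (intro real_sqrt_ge_zero add_nonneg_nonneg sum_nonneg) auto
  then have "0 < 1 / (1 + Q)" "\<bar>1 / (1 + Q)\<bar> * Q \<le> 1" by auto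
  then show ?thesis unfolding norm[symmetric] by blast
qed

lemma frechet_derivative_shift_minus:
  fixes f :: "'a::euclidean_space \<Rightarrow> real"
  assumes "smooth f"
  shows "frechet_derivative (\<lambda>x. f (x - z)) (at x) = frechet_derivative f (at (x - z))"
  using frechet_derivative_shift[of f "- z" x] smooth_differentiable[OF assms] by simp

section \<open>Sobolev functions along lines\<close>

text \<open>
  Borel representatives on the whole space, extended by zero: translations and Fubini's theorem
  can then be used for \<open>lborel\<close>. The weak derivative is required in all directions \<open>z\<close>, not only
  along the basis.
\<close>

definition weak_grad :: "'a::euclidean_space set \<Rightarrow> ('a \<Rightarrow> real) \<Rightarrow> ('a \<Rightarrow> 'a) \<Rightarrow> bool" where
  "weak_grad \<Omega> u G \<longleftrightarrow> u \<in> borel_measurable borel \<and> G \<in> borel_measurable borel \<and>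
     integrable lborel u \<and> integrable lborel G \<and> (\<forall>x. x \<notin> \<Omega> \<longrightarrow> u x = 0 \<and> G x = 0) \<and>
     (\<forall>\<phi>\<in>test_functions \<Omega>. \<forall>z. (LINT x|lborel. u x * frechet_derivative \<phi> (at x) z) =
        - (LINT x|lborel. (G x \<bullet> z) * \<phi> x))"

lemma integrable_pair_shift:
  fixes g :: "'a::euclidean_space \<Rightarrow> real"
  assumes "integrable lborel g" "g \<in> borel_measurable borel"
  shows "integrable (lborel \<Otimes>\<^sub>M lborel) (\<lambda>(s, x). indicator {0..t::real} s * g (x + s *\<^sub>R z))"
proof (rule lborel_pair.Fubini_integrable)
  have [measurable]: "g \<in> borel_measurable borel" by fact
  show "(\<lambda>(s, x). indicator {0..t::real} s * g (x + s *\<^sub>R z)) \<in> borel_measurable (lborel \<Otimes>\<^sub>M lborel)"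
    by measurable
  have "(LINT x|lborel. norm (indicator {0..t} s * g (x + s *\<^sub>R z))) = indicator {0..t} s * (LINT x|lborel. \<bar>g x\<bar>)" for s
    using integral_lborel_shift[of "\<lambda>x. \<bar>g x\<bar>" "s *\<^sub>R z"] by (simp add: abs_mult)
  moreover have "integrable lborel (indicat_real {0..t})"
    by (intro integrable_real_indicator) (auto simp: emeasure_lborel_Icc_eq)
  ultimately show "integrable lborel (\<lambda>s. LINT x|lborel. norm (case (s, x) of (s, x) \<Rightarrow> indicator {0..t} s * g (x + s *\<^sub>R z)))"
    by simp
  show "AE s in lborel. integrable lborel (\<lambda>x. case (s, x) of (s, x) \<Rightarrow> indicator {0..t} s * g (x + s *\<^sub>R z))"
    using integrable_lborel_shift[OF assms(1)] by simp
qed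

text \<open>
  Sobolev functions are absolutely continuous along almost all lines. For a test function \<open>\<phi>\<close> on
  \<open>U\<close> the translates \<open>\<phi> (x - s z)\<close> are test functions on \<open>\<Omega>\<close>, since the segments stay in \<open>\<Omega>\<close>.
  Integrating the definition of the weak derivative over \<open>s \<in> [0,t]\<close> and changing the order of
  integration shows that both sides have the same integral against \<open>\<phi>\<close>.
\<close>

lemma weak_grad_along_lines:
  assumes u: "weak_grad \<Omega> u G" and "open \<Omega>" "open U"
    and seg: "\<And>x s. x \<in> U \<Longrightarrow> 0 \<le> s \<Longrightarrow> s \<le> t \<Longrightarrow> x + s *\<^sub>R z \<in> \<Omega>" and "0 \<le> t"
  shows "AE x in lborel. x \<in> U \<longrightarrow>
    u (x + t *\<^sub>R z) - u x = (LINT s|lborel. indicator {0..t} s * (G (x + s *\<^sub>R z) \<bullet> z))"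
proof -
  define g where "g x = G x \<bullet> z" for x
  have [measurable]: "u \<in> borel_measurable borel" "G \<in> borel_measurable borel" and int: "integrable lborel u" "integrable lborel g"
    using u by (auto simp: weak_grad_def g_def[abs_def])
  have [measurable]: "g \<in> borel_measurable borel" unfolding g_def[abs_def] by measurable
  define I where "I x = (LINT s|lborel. indicator {0..t} s * g (x + s *\<^sub>R z))" for x
  have pair: "integrable (lborel \<Otimes>\<^sub>M lborel) (\<lambda>(s, x). indicator {0..t::real} s * g (x + s *\<^sub>R z))"
    by (rule integrable_pair_shift[OF int(2)]) auto
  have I: "integrable lborel I"
    unfolding I_def by (rule lborel_pair.integrable_snd[OF pair])
  have [measurable]: "I \<in> borel_measurable borel" using I by auto
  define v where "v x = u (x + t *\<^sub>R z) - u x - I x" for x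
  have v: "integrable lborel v"
    unfolding v_def using int I by (intro Bochner_Integration.integrable_diff integrable_lborel_shift)
  have "AE x in lebesgue_on U. v x = 0"
  proof (rule integral_mult_test_functions_eq_0[OF \<open>open U\<close>])
    show "integrable (lebesgue_on U) v"
      using integrable_mult_indicator[of U lebesgue v] v \<open>open U\<close>
      by (simp add: integrable_restrict_space integrable_completion)
    fix \<phi> assume \<phi>: "\<phi> \<in> test_functions U"
    have [measurable]: "\<phi> \<in> borel_measurable borel" by (rule test_function_borel[OF \<phi>])
    show "(LINT x|lebesgue_on U. v x * \<phi> x) = 0"
    proof -
      have sm: "smooth \<phi>" by (rule test_functionD(1)[OF \<phi>])
      define p where "p y = frechet_derivative \<phi> (at y) z" for y
      have p_eq: "p = (\<lambda>y. \<Sum>b\<in>Basis. (z \<bullet> b) * frechet_derivative \<phi> (at y) b)"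
        unfolding p_def[abs_def] by (rule ext) (rule smooth_frechet_derivative_sum[OF sm])
      have cont_p: "continuous_on UNIV p"
        unfolding p_eq by (intro continuous_intros smooth_continuous smooth_frechet_derivative sm) auto
      then have [measurable]: "p \<in> borel_measurable borel"
        by (rule borel_measurable_continuous_onI)
      obtain M where M: "\<forall>x. \<bar>\<phi> x\<bar> \<le> M"
        using test_function_bounded[OF \<phi>] by blast
      have "\<exists>P. \<forall>x. \<bar>p x\<bar> \<le> P"
      proof -
        have "\<forall>b\<in>Basis. \<exists>B. \<forall>x. \<bar>frechet_derivative \<phi> (at x) b\<bar> \<le> B"
          using test_function_bounded[OF test_function_frechet_derivative[OF \<phi>]] by blast
        then obtain B where B: "\<forall>b\<in>Basis. \<forall>x. \<bar>frechet_derivative \<phi> (at x) b\<bar> \<le> B b"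
          unfolding bchoice_iff by blast
        have "\<bar>p x\<bar> \<le> (\<Sum>b\<in>Basis. \<bar>z \<bullet> b\<bar> * B b)" for x
          unfolding p_eq using B by (intro sum_abs[THEN order_trans] sum_mono) (auto simp: abs_mult intro!: mult_left_mono)
        then show ?thesis by blast
      qed
      then obtain P where P: "\<forall>x. \<bar>p x\<bar> \<le> P" by blast
      have shift_int: "integrable lborel (\<lambda>x. u (x + t *\<^sub>R z) * \<phi> x)" "integrable lborel (\<lambda>x. u x * \<phi> x)"
        "integrable lborel (\<lambda>x. I x * \<phi> x)" "integrable lborel (\<lambda>x. u x * \<phi> (x - t *\<^sub>R z))"
        using M int I by (auto intro!: integrable_mult_bounded[where K = M] integrable_lborel_shift)
      have ftc: "\<phi> (y - t *\<^sub>R z) - \<phi> y = - (LINT s|lborel. indicator {0..t} s * p (y - s *\<^sub>R z))" for y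
      proof -
        have "(LINT s|lborel. indicator {0..t} s *\<^sub>R (- p (y + s *\<^sub>R (- z)))) = \<phi> (y + t *\<^sub>R (- z)) - \<phi> (y + 0 *\<^sub>R (- z))"
        proof (rule integral_FTC_atLeastAtMost[OF \<open>0 \<le> t\<close>])
          fix s :: real
          have "linear (frechet_derivative \<phi> (at (y + s *\<^sub>R (- z))))"
            by (intro linear_frechet_derivative smooth_differentiable sm)
          then have "((\<lambda>s. \<phi> (y + s *\<^sub>R (- z))) has_real_derivative - p (y + s *\<^sub>R (- z))) (at s)"
            using smooth_line_derivative[OF sm, of y "- z" s] by (simp add: p_def linear_neg)
          then show "((\<lambda>s. \<phi> (y + s *\<^sub>R (- z))) has_vector_derivative - p (y + s *\<^sub>R (- z))) (at s within {0..t})"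
            by (simp add: has_real_derivative_iff_has_vector_derivative has_vector_derivative_at_within)
        next
          show "continuous_on {0..t} (\<lambda>s. - p (y + s *\<^sub>R (- z)))"
            by (intro continuous_intros continuous_on_compose2[OF cont_p]) auto
        qed
        then show ?thesis by (simp add: mult.commute)
      qed
      have pair1: "integrable (lborel \<Otimes>\<^sub>M lborel) (\<lambda>(s, y). indicator {0..t} s * (u y * p (y - s *\<^sub>R z)))"
      proof -
        have "integrable (lborel \<Otimes>\<^sub>M lborel) (\<lambda>q. (case q of (s, y) \<Rightarrow> indicator {0..t} s * u (y + s *\<^sub>R 0)) *
            (case q of (s, y) \<Rightarrow> p (y - s *\<^sub>R z)))"
          using P by (intro integrable_mult_bounded[where K = P] integrable_pair_shift int) (measurable, auto)
        then show ?thesis by (simp add: case_prod_beta' mult.assoc)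
      qed
      have pair2: "integrable (lborel \<Otimes>\<^sub>M lborel) (\<lambda>(s, x). indicator {0..t} s * (g (x + s *\<^sub>R z) * \<phi> x))"
      proof -
        have "integrable (lborel \<Otimes>\<^sub>M lborel) (\<lambda>q. (case q of (s, x) \<Rightarrow> indicator {0..t} s * g (x + s *\<^sub>R z)) *
            (case q of (s, x) \<Rightarrow> \<phi> x))"
          using M by (intro integrable_mult_bounded[where K = M] pair) (measurable, auto)
        then show ?thesis by (simp add: case_prod_beta' mult.assoc)
      qed
      \<comment> \<open>The weak derivative, tested with the translate of \<open>\<phi>\<close> by \<open>s z\<close>.\<close>
      have slice: "indicator {0..t} s * (LINT y|lborel. u y * p (y - s *\<^sub>R z)) =
          - (indicator {0..t} s * (LINT x|lborel. g (x + s *\<^sub>R z) * \<phi> x))" for s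
      proof (cases "s \<in> {0..t}")
        case True
        have test: "(\<lambda>x. \<phi> (x - s *\<^sub>R z)) \<in> test_functions \<Omega>"
          using seg True by (intro test_function_shift[OF \<phi>]) auto
        have "(LINT y|lborel. u y * p (y - s *\<^sub>R z)) =
            (LINT y|lborel. u y * frechet_derivative (\<lambda>x. \<phi> (x - s *\<^sub>R z)) (at y) z)"
          by (simp add: p_def frechet_derivative_shift_minus[OF sm])
        also have "\<dots> = - (LINT y|lborel. g y * \<phi> (y - s *\<^sub>R z))"
          using u test unfolding weak_grad_def g_def by blast
        also have "(LINT y|lborel. g y * \<phi> (y - s *\<^sub>R z)) = (LINT x|lborel. g (x + s *\<^sub>R z) * \<phi> x)"
          using integral_lborel_shift[of "\<lambda>y. g y * \<phi> (y - s *\<^sub>R z)" "s *\<^sub>R z"] by simp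
        finally show ?thesis by simp
      qed simp
      have "(LINT x|lborel. u (x + t *\<^sub>R z) * \<phi> x) = (LINT y|lborel. u y * \<phi> (y - t *\<^sub>R z))"
        using integral_lborel_shift[of "\<lambda>y. u y * \<phi> (y - t *\<^sub>R z)" "t *\<^sub>R z"] by simp
      then have "(LINT x|lborel. u (x + t *\<^sub>R z) * \<phi> x) - (LINT x|lborel. u x * \<phi> x) =
          (LINT y|lborel. u y * (\<phi> (y - t *\<^sub>R z) - \<phi> y))"
        using shift_int by (simp add: right_diff_distrib)
      also have "\<dots> = - (LINT y|lborel. (LINT s|lborel. indicator {0..t} s * (u y * p (y - s *\<^sub>R z))))"
      proof -
        have "u y * (\<phi> (y - t *\<^sub>R z) - \<phi> y) = - (LINT s|lborel. indicator {0..t} s * (u y * p (y - s *\<^sub>R z)))" for y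
          unfolding ftc by (simp add: mult.left_commute)
        then show ?thesis by simp
      qed
      also have "\<dots> = - (LINT s|lborel. (LINT y|lborel. indicator {0..t} s * (u y * p (y - s *\<^sub>R z))))"
        using lborel_pair.Fubini_integral[OF pair1] by simp
      also have "\<dots> = (LINT s|lborel. (LINT x|lborel. indicator {0..t} s * (g (x + s *\<^sub>R z) * \<phi> x)))"
        by (simp add: slice)
      also have "\<dots> = (LINT x|lborel. (LINT s|lborel. indicator {0..t} s * (g (x + s *\<^sub>R z) * \<phi> x)))"
        using lborel_pair.Fubini_integral[OF pair2] by simp
      also have "\<dots> = (LINT x|lborel. I x * \<phi> x)"
      proof -
        have "(LINT s|lborel. indicator {0..t} s * (g (x + s *\<^sub>R z) * \<phi> x)) = I x * \<phi> x" for x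
          unfolding I_def by (simp add: mult.assoc[symmetric])
        then show ?thesis by simp
      qed
      finally have eq: "(LINT x|lborel. u (x + t *\<^sub>R z) * \<phi> x) - (LINT x|lborel. u x * \<phi> x) = (LINT x|lborel. I x * \<phi> x)" .
      have "(LINT x|lebesgue_on U. v x * \<phi> x) = (LINT x|lborel. v x * \<phi> x)"
        using \<open>open U\<close> test_function_outside[OF \<phi>]
        by (intro lebesgue_on_integral_lborel) (auto simp: v_def)
      also have "\<dots> = (LINT x|lborel. u (x + t *\<^sub>R z) * \<phi> x - u x * \<phi> x - I x * \<phi> x)"
        by (simp add: v_def left_diff_distrib)
      also have "\<dots> = 0"
        using shift_int eq by simp
      finally show ?thesis .
    qed
  qed
  then show ?thesis
    unfolding v_def I_def g_def using \<open>open U\<close>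
    by (subst (asm) AE_lebesgue_on_iff) (auto elim!: eventually_mono)
qed

text \<open>
  Over a fine partition the increments of \<open>\<Phi>\<close> are at most \<open>K\<close> times the oscillation of \<open>G\<close> times
  the increments of \<open>G\<close>, which sum up to something arbitrarily small.
\<close>

lemma quadratic_increment_constant:
  fixes \<Phi> G :: "real \<Rightarrow> real"
  assumes G: "continuous_on {0..1} G" "\<And>s t. 0 \<le> s \<Longrightarrow> s \<le> t \<Longrightarrow> t \<le> 1 \<Longrightarrow> G s \<le> G t"
    and \<Phi>: "\<And>s t. 0 \<le> s \<Longrightarrow> s \<le> t \<Longrightarrow> t \<le> 1 \<Longrightarrow> \<bar>\<Phi> t - \<Phi> s\<bar> \<le> K * (G t - G s)\<^sup>2"
    and K: "0 \<le> K"
  shows "\<Phi> 1 = \<Phi> 0"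
proof -
  have "\<bar>\<Phi> 1 - \<Phi> 0\<bar> \<le> K * (\<epsilon> * (G 1 - G 0))" if \<epsilon>: "\<epsilon> > 0" for \<epsilon>
  proof -
    have "uniformly_continuous_on {0..1} G"
      using G(1) by (intro compact_uniformly_continuous) auto
    then obtain \<delta> where \<delta>: "\<delta> > 0" "\<And>s t. s \<in> {0..1} \<Longrightarrow> t \<in> {0..1} \<Longrightarrow> dist t s < \<delta> \<Longrightarrow> dist (G t) (G s) < \<epsilon>"
      unfolding uniformly_continuous_on_def using \<epsilon> by metis
    obtain n :: nat where n: "0 < n" "1 / real n < \<delta>"
      using ex_inverse_of_nat_less[OF \<delta>(1)] by (auto simp: inverse_eq_divide)
    define p where "p m = real m / real n" for m
    have p: "0 \<le> p m" "p m \<le> p (Suc m)" "p (Suc m) \<le> 1" if "m < n" for m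
      using that n by (auto simp: p_def divide_simps)
    have "\<Phi> 1 - \<Phi> 0 = (\<Sum>m<n. \<Phi> (p (Suc m)) - \<Phi> (p m))"
      using n by (subst sum_lessThan_telescope) (simp add: p_def)
    also have "\<bar>\<dots>\<bar> \<le> (\<Sum>m<n. K * (\<epsilon> * (G (p (Suc m)) - G (p m))))"
    proof (intro sum_abs[THEN order_trans] sum_mono)
      fix m assume "m \<in> {..<n}"
      then have m: "m < n" by simp
      have "dist (p (Suc m)) (p m) < \<delta>"
        using n by (simp add: p_def dist_real_def diff_divide_distrib[symmetric])
      then have "\<bar>G (p (Suc m)) - G (p m)\<bar> < \<epsilon>"
        using \<delta>(2)[of "p m" "p (Suc m)"] p[OF m] by (auto simp: dist_real_def)
      then have "(G (p (Suc m)) - G (p m))\<^sup>2 \<le> \<epsilon> * (G (p (Suc m)) - G (p m))"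
        unfolding power2_eq_square using G(2)[OF p[OF m]] by (intro mult_right_mono) auto
      then show "\<bar>\<Phi> (p (Suc m)) - \<Phi> (p m)\<bar> \<le> K * (\<epsilon> * (G (p (Suc m)) - G (p m)))"
        using \<Phi>[OF p[OF m]] mult_left_mono[OF _ K] order_trans by blast
    qed
    also have "\<dots> = K * (\<epsilon> * (\<Sum>m<n. G (p (Suc m)) - G (p m)))"
      by (simp add: sum_distrib_left)
    also have "(\<Sum>m<n. G (p (Suc m)) - G (p m)) = G 1 - G 0"
      using n by (subst sum_lessThan_telescope) (simp add: p_def)
    finally show ?thesis .
  qed
  note bound = this
  have "((\<lambda>\<epsilon>. K * (\<epsilon> * (G 1 - G 0))) \<longlongrightarrow> K * (0 * (G 1 - G 0))) (at_right 0)"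
    by (intro tendsto_intros)
  then have "\<bar>\<Phi> 1 - \<Phi> 0\<bar> \<le> K * (0 * (G 1 - G 0))"
    by (rule tendsto_lowerbound) (auto intro!: eventually_at_rightI[of 0 1] bound)
  then show ?thesis by simp
qed

lemma HK_abs_bound_integral:
  fixes f g :: "real \<Rightarrow> real"
  assumes "f integrable_on S" "g integrable_on S" "\<And>x. x \<in> S \<Longrightarrow> \<bar>f x\<bar> \<le> g x"
  shows "\<bar>integral S f\<bar> \<le> integral S g"
  using Henstock_Kurzweil_Integration.integral_norm_bound_integral[OF assms(1,2)] assms(3) by simp

text \<open>
  Functions of the first \<open>N\<close> coordinates of a sequence. The derivative is formulated along lines
  since sequences do not form a normed space; \<open>F' j\<close> is the partial derivative with respect to
  coordinate \<open>j\<close>, and \<open>L\<close> bounds it together with its Lipschitz constant.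
\<close>

definition C11_fun :: "nat \<Rightarrow> real \<Rightarrow> ((nat \<Rightarrow> real) \<Rightarrow> real) \<Rightarrow> (nat \<Rightarrow> (nat \<Rightarrow> real) \<Rightarrow> real) \<Rightarrow> bool" where
  "C11_fun N L F F' \<longleftrightarrow> 0 \<le> L \<and>
     (\<forall>a d t. ((\<lambda>t. F (\<lambda>i. a i + t * d i)) has_real_derivative (\<Sum>j<N. F' j (\<lambda>i. a i + t * d i) * d j)) (at t)) \<and>
     (\<forall>j<N. \<forall>a b. \<bar>F' j a - F' j b\<bar> \<le> L * (\<Sum>i<N. \<bar>a i - b i\<bar>)) \<and> (\<forall>j<N. \<forall>a. \<bar>F' j a\<bar> \<le> L)"

text \<open>
  The curve \<open>\<gamma>\<close> is absolutely continuous with derivative \<open>h\<close>. On \<open>[s,t]\<close> the mean value theorem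
  and the Lipschitz continuity of \<open>F'\<close> show that \<open>F (\<gamma> t) - \<integral> F' (\<gamma>) h\<close> changes at most
  quadratically in the increment of \<open>G t = \<integral>\<^sub>0\<^sup>t \<Sum>i<N. |h i|\<close>, hence it is constant. This avoids
  the differentiability of integrals almost everywhere.
\<close>

lemma absolutely_continuous_chain_rule:
  fixes F :: "(nat \<Rightarrow> real) \<Rightarrow> real" and h :: "nat \<Rightarrow> real \<Rightarrow> real" and \<gamma> :: "real \<Rightarrow> nat \<Rightarrow> real"
  assumes F: "C11_fun N L F F'"
    and h: "\<And>i. h i absolutely_integrable_on {0..1}"
    and \<gamma>: "\<And>i t. 0 \<le> t \<Longrightarrow> t \<le> 1 \<Longrightarrow> \<gamma> t i = \<gamma> 0 i + integral {0..t} (h i)"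
  shows "(\<lambda>s. \<Sum>j<N. F' j (\<gamma> s) * h j s) absolutely_integrable_on {0..1}"
    and "F (\<gamma> 1) - F (\<gamma> 0) = integral {0..1} (\<lambda>s. \<Sum>j<N. F' j (\<gamma> s) * h j s)"
proof -
  have L: "0 \<le> L" and der: "\<And>a d t. ((\<lambda>t. F (\<lambda>i. a i + t * d i)) has_real_derivative (\<Sum>j<N. F' j (\<lambda>i. a i + t * d i) * d j)) (at t)"
    and Lip: "\<And>j a b. j < N \<Longrightarrow> \<bar>F' j a - F' j b\<bar> \<le> L * (\<Sum>i<N. \<bar>a i - b i\<bar>)"
    and bd: "\<And>j a. j < N \<Longrightarrow> \<bar>F' j a\<bar> \<le> L"
    using F by (auto simp: C11_fun_def)
  define q where "q s = (\<Sum>j<N. F' j (\<gamma> s) * h j s)" for s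
  define k where "k s = (\<Sum>i<N. \<bar>h i s\<bar>)" for s
  define G where "G t = integral {0..t} k" for t
  have h': "h i absolutely_integrable_on {s..t}" if "0 \<le> s" "t \<le> 1" for i and s t :: real
    by (rule set_integrable_subset[OF h]) (use that in auto)
  have hI: "h i integrable_on {s..t}" if "0 \<le> s" "t \<le> 1" for i s t
    using h'[OF that] set_lebesgue_integral_eq_integral(1) by blast
  have habs: "(\<lambda>s. \<bar>h i s\<bar>) integrable_on {s..t}" if "0 \<le> s" "t \<le> 1" for i s t
    using set_lebesgue_integral_eq_integral(1)[OF set_integrable_abs[OF h'[OF that]]] .
  have kI: "k integrable_on {s..t}" if "0 \<le> s" "t \<le> 1" for s t
    unfolding k_def[abs_def] by (intro integrable_sum finite_lessThan habs that)
  have inc: "\<gamma> t i - \<gamma> s i = integral {s..t} (h i)" if "0 \<le> s" "s \<le> t" "t \<le> 1" for s t i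
    using \<gamma>[of s i] \<gamma>[of t i] that Henstock_Kurzweil_Integration.integral_combine[OF that(1,2) hI[of 0 t i]] by simp
  have Ginc: "G t - G s = integral {s..t} k" if "0 \<le> s" "s \<le> t" "t \<le> 1" for s t
    using that Henstock_Kurzweil_Integration.integral_combine[OF that(1,2) kI[of 0 t]] by (simp add: G_def)
  have inc_le: "(\<Sum>i<N. \<bar>\<gamma> t i - \<gamma> s i\<bar>) \<le> G t - G s" if "0 \<le> s" "s \<le> t" "t \<le> 1" for s t
  proof -
    have "(\<Sum>i<N. \<bar>\<gamma> t i - \<gamma> s i\<bar>) \<le> (\<Sum>i<N. integral {s..t} (\<lambda>r. \<bar>h i r\<bar>))"
      unfolding inc[OF that] using that
      by (intro sum_mono HK_abs_bound_integral hI habs) auto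
    also have "\<dots> = integral {s..t} k"
      unfolding k_def[abs_def] using habs that by (subst integral_sum) auto
    finally show ?thesis using Ginc[OF that] by simp
  qed
  have Gmono: "G s \<le> G t" if "0 \<le> s" "s \<le> t" "t \<le> 1" for s t
  proof -
    have "0 \<le> (\<Sum>i<N. \<bar>\<gamma> t i - \<gamma> s i\<bar>)" by (intro sum_nonneg) simp
    then show ?thesis using inc_le[OF that] by linarith
  qed
  have Gcont: "continuous_on {0..1} G"
    unfolding G_def[abs_def] by (rule indefinite_integral_continuous_1) (rule kI, auto)
  have \<gamma>cont: "continuous_on {0..1} (\<lambda>t. \<gamma> t i)" for i
  proof -
    have "continuous_on {0..1} (\<lambda>t. \<gamma> 0 i + integral {0..t} (h i))"
      by (intro continuous_intros indefinite_integral_continuous_1 hI) auto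
    then show ?thesis
      by (rule continuous_on_eq) (use \<gamma>[symmetric] in auto)
  qed
  have F'cont: "continuous_on {0..1} (\<lambda>t. F' j (\<gamma> t))" if j: "j < N" for j
    unfolding continuous_on_def
  proof
    fix s :: real assume s: "s \<in> {0..1}"
    have "((\<lambda>t. L * (\<Sum>i<N. \<bar>\<gamma> t i - \<gamma> s i\<bar>)) \<longlongrightarrow> L * (\<Sum>i<N. \<bar>\<gamma> s i - \<gamma> s i\<bar>)) (at s within {0..1})"
      using \<gamma>cont s by (intro tendsto_intros) (auto simp: continuous_on_def)
    then have lim: "((\<lambda>t. L * (\<Sum>i<N. \<bar>\<gamma> t i - \<gamma> s i\<bar>)) \<longlongrightarrow> 0) (at s within {0..1})" by simp
    have "((\<lambda>t. F' j (\<gamma> t) - F' j (\<gamma> s)) \<longlongrightarrow> 0) (at s within {0..1})"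
      by (rule Lim_null_comparison[OF _ lim]) (use Lip[OF j] in auto)
    then show "((\<lambda>t. F' j (\<gamma> t)) \<longlongrightarrow> F' j (\<gamma> s)) (at s within {0..1})"
      by (simp add: LIM_zero_iff)
  qed
  have prod_ai: "(\<lambda>s. F' j (\<gamma> s) * h j s) absolutely_integrable_on {0..1}" if "j < N" for j
  proof (rule absolutely_integrable_bounded_measurable_product_real)
    show "(\<lambda>s. F' j (\<gamma> s)) \<in> borel_measurable (lebesgue_on {0..1})"
      by (intro continuous_imp_measurable_on_sets_lebesgue F'cont that) auto
    show "bounded ((\<lambda>s. F' j (\<gamma> s)) ` {0..1})"
      using bd[OF that] by (auto simp: bounded_iff)
  qed (auto intro: h)
  show q_ai: "(\<lambda>s. \<Sum>j<N. F' j (\<gamma> s) * h j s) absolutely_integrable_on {0..1}"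
    by (intro absolutely_integrable_sum prod_ai) auto
  have qI: "q integrable_on {s..t}" if "0 \<le> s" "t \<le> 1" for s t
  proof -
    have "(\<lambda>s. \<Sum>j<N. F' j (\<gamma> s) * h j s) absolutely_integrable_on {s..t}"
      by (rule set_integrable_subset[OF q_ai]) (use that in auto)
    from set_lebesgue_integral_eq_integral(1)[OF this] show ?thesis by (simp add: q_def[abs_def])
  qed
  define \<Phi> where "\<Phi> t = F (\<gamma> t) - integral {0..t} q" for t
  have "\<Phi> 1 = \<Phi> 0"
  proof (rule quadratic_increment_constant[OF Gcont Gmono, where K = "2 * L"])
    fix s t :: real assume st: "0 \<le> s" "s \<le> t" "t \<le> 1"
    define \<Delta> where "\<Delta> = G t - G s"
    have \<Delta>: "0 \<le> \<Delta>" using Gmono[OF st] by (simp add: \<Delta>_def)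
    define d where "d i = \<gamma> t i - \<gamma> s i" for i
    obtain \<theta> where \<theta>: "0 < \<theta>" "\<theta> < 1"
      "F (\<lambda>i. \<gamma> s i + 1 * d i) - F (\<lambda>i. \<gamma> s i + 0 * d i) = (1 - 0) * (\<Sum>j<N. F' j (\<lambda>i. \<gamma> s i + \<theta> * d i) * d j)"
      using MVT2[of 0 1 "\<lambda>t. F (\<lambda>i. \<gamma> s i + t * d i)" "\<lambda>t. \<Sum>j<N. F' j (\<lambda>i. \<gamma> s i + t * d i) * d j"] der by auto
    define \<xi> where "\<xi> i = \<gamma> s i + \<theta> * d i" for i
    have cI: "(\<lambda>r. c * h j r) integrable_on {s..t}" for c j
      using st by (intro integrable_on_mult_right hI) auto
    have "F (\<gamma> t) - F (\<gamma> s) = (\<Sum>j<N. F' j \<xi> * d j)"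
      using \<theta>(3) by (simp add: d_def \<xi>_def[abs_def])
    also have "\<dots> = (\<Sum>j<N. integral {s..t} (\<lambda>r. F' j \<xi> * h j r))"
      using st by (simp add: d_def inc)
    also have "\<dots> = integral {s..t} (\<lambda>r. \<Sum>j<N. F' j \<xi> * h j r)"
      using cI by (subst integral_sum) auto
    finally have eq: "F (\<gamma> t) - F (\<gamma> s) = integral {s..t} (\<lambda>r. \<Sum>j<N. F' j \<xi> * h j r)" .
    have I1: "(\<lambda>r. \<Sum>j<N. F' j \<xi> * h j r) integrable_on {s..t}"
      by (intro integrable_sum cI) auto
    have "\<Phi> t - \<Phi> s = integral {s..t} (\<lambda>r. \<Sum>j<N. F' j \<xi> * h j r) - integral {s..t} q"
      using eq Henstock_Kurzweil_Integration.integral_combine[OF st(1,2) qI[of 0 t]] st by (simp add: \<Phi>_def)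
    also have "\<dots> = integral {s..t} (\<lambda>r. (\<Sum>j<N. F' j \<xi> * h j r) - q r)"
      using I1 qI st by (subst Henstock_Kurzweil_Integration.integral_diff) auto
    also have "\<bar>\<dots>\<bar> \<le> integral {s..t} (\<lambda>r. L * (2 * \<Delta>) * k r)"
    proof (rule HK_abs_bound_integral)
      show "(\<lambda>r. (\<Sum>j<N. F' j \<xi> * h j r) - q r) integrable_on {s..t}"
        using I1 qI st by (intro integrable_diff) auto
      show "(\<lambda>r. L * (2 * \<Delta>) * k r) integrable_on {s..t}"
        using kI st by (intro integrable_on_mult_right) auto
      fix r assume "r \<in> {s..t}"
      then have r: "s \<le> r \<and> r \<le> t" by simp
      have "\<bar>\<xi> i - \<gamma> r i\<bar> \<le> \<bar>\<gamma> t i - \<gamma> s i\<bar> + \<bar>\<gamma> r i - \<gamma> s i\<bar>" for i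
      proof -
        have "\<bar>\<theta> * d i\<bar> \<le> \<bar>d i\<bar>" using \<theta>(1,2) by (simp add: abs_mult mult_left_le_one_le)
        then show ?thesis unfolding \<xi>_def d_def by linarith
      qed
      then have "(\<Sum>i<N. \<bar>\<xi> i - \<gamma> r i\<bar>) \<le> (\<Sum>i<N. \<bar>\<gamma> t i - \<gamma> s i\<bar>) + (\<Sum>i<N. \<bar>\<gamma> r i - \<gamma> s i\<bar>)"
        unfolding sum.distrib[symmetric] by (intro sum_mono)
      also have "\<dots> \<le> 2 * \<Delta>"
        using inc_le[OF st] inc_le[of s r] Gmono[of r t] r st by (simp add: \<Delta>_def)
      finally have close: "(\<Sum>i<N. \<bar>\<xi> i - \<gamma> r i\<bar>) \<le> 2 * \<Delta>" .
      have "\<bar>(\<Sum>j<N. F' j \<xi> * h j r) - q r\<bar> = \<bar>\<Sum>j<N. (F' j \<xi> - F' j (\<gamma> r)) * h j r\<bar>"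
        by (simp add: q_def sum_subtractf left_diff_distrib)
      also have "\<dots> \<le> (\<Sum>j<N. L * (2 * \<Delta>) * \<bar>h j r\<bar>)"
      proof (intro sum_abs[THEN order_trans] sum_mono)
        fix j assume "j \<in> {..<N}"
        then have "\<bar>F' j \<xi> - F' j (\<gamma> r)\<bar> \<le> L * (2 * \<Delta>)"
          using Lip[of j \<xi> "\<gamma> r"] mult_left_mono[OF close L] by simp
        then show "\<bar>(F' j \<xi> - F' j (\<gamma> r)) * h j r\<bar> \<le> L * (2 * \<Delta>) * \<bar>h j r\<bar>"
          unfolding abs_mult by (rule mult_right_mono) simp
      qed
      finally show "\<bar>(\<Sum>j<N. F' j \<xi> * h j r) - q r\<bar> \<le> L * (2 * \<Delta>) * k r"
        by (simp add: k_def sum_distrib_left)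
    qed
    also have "\<dots> = 2 * L * \<Delta>\<^sup>2"
      using Ginc[OF st] by (simp add: \<Delta>_def power2_eq_square)
    finally show "\<bar>\<Phi> t - \<Phi> s\<bar> \<le> 2 * L * (G t - G s)\<^sup>2" by (simp add: \<Delta>_def)
  qed (use L in auto)
  then show "F (\<gamma> 1) - F (\<gamma> 0) = integral {0..1} (\<lambda>s. \<Sum>j<N. F' j (\<gamma> s) * h j s)"
    by (simp add: \<Phi>_def q_def[abs_def])
qed

lemma nn_integral_lborel_shift:
  fixes f :: "'a::euclidean_space \<Rightarrow> ennreal"
  assumes "f \<in> borel_measurable borel"
  shows "(\<integral>\<^sup>+x. f (x + z) \<partial>lborel) = (\<integral>\<^sup>+x. f x \<partial>lborel)"
proof -
  have "(\<integral>\<^sup>+x. f x \<partial>lborel) = (\<integral>\<^sup>+x. f x \<partial>distr lborel borel ((+) z))"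
    by (simp add: lborel_distr_plus)
  also have "\<dots> = (\<integral>\<^sup>+x. f (z + x) \<partial>lborel)"
    using assms by (intro nn_integral_distr) auto
  finally show ?thesis by (simp add: add.commute)
qed

text \<open>
  The chosen weak derivatives are assembled to a Borel vector field; by linearity of the
  derivative of test functions the directions \<open>z\<close> reduce to the basis.
\<close>

lemma H1_weak_grad:
  fixes u :: "'a::euclidean_space \<Rightarrow> real"
  assumes "open \<Omega>" "bounded \<Omega>" "u \<in> H1 \<Omega>"
  shows "\<exists>u0 G. weak_grad \<Omega> u0 G \<and> (AE x in lebesgue_on \<Omega>. u x = u0 x) \<and>
    (\<forall>b\<in>Basis. AE x in lebesgue_on \<Omega>. weak_deriv \<Omega> b u x = G x \<bullet> b)"
proof -
  have b: "\<Omega> \<in> sets borel" using assms(1) by simp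
  have L2: "u \<in> L2 \<Omega>" using assms(3) by (simp add: H1_def)
  obtain u0 where u0: "u0 \<in> borel_measurable borel" "\<forall>x. x \<notin> \<Omega> \<longrightarrow> u0 x = 0" "AE x in lebesgue_on \<Omega>. u x = u0 x"
    using lebesgue_on_borel_version[OF b L2D(1)[OF L2]] by blast
  have "\<forall>b\<in>Basis. \<exists>g. g \<in> borel_measurable borel \<and> (\<forall>x. x \<notin> \<Omega> \<longrightarrow> g x = 0) \<and>
      (AE x in lebesgue_on \<Omega>. weak_deriv \<Omega> b u x = g x)"
    using lebesgue_on_borel_version[OF b L2D(1)[OF H1_weak_deriv_L2[OF assms(3)]]] by blast
  then obtain g where g: "\<And>b. b \<in> Basis \<Longrightarrow> g b \<in> borel_measurable borel"
      "\<And>b x. b \<in> Basis \<Longrightarrow> x \<notin> \<Omega> \<Longrightarrow> g b x = 0"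
      "\<And>b. b \<in> Basis \<Longrightarrow> AE x in lebesgue_on \<Omega>. weak_deriv \<Omega> b u x = g b x"
    unfolding bchoice_iff by auto
  define G where "G x = (\<Sum>b\<in>Basis. g b x *\<^sub>R b)" for x
  have Gb: "G x \<bullet> b = g b x" if "b \<in> Basis" for x b
    using that by (simp add: G_def inner_sum_left inner_Basis if_distrib cong: if_cong)
  have u0L2: "u0 \<in> L2 \<Omega>"
    by (rule L2_cong_AE[OF L2 borel_measurable_lebesgue_on[OF u0(1)] u0(3)])
  have gL2: "g b \<in> L2 \<Omega>" if "b \<in> Basis" for b
    by (rule L2_cong_AE[OF H1_weak_deriv_L2[OF assms(3) that] borel_measurable_lebesgue_on[OF g(1)[OF that]] g(3)[OF that]])
  have int_u0: "integrable lborel u0"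
    using L2_integrable[OF assms(2) b u0L2] lebesgue_on_integral_lborel(2)[OF b u0(1)] u0(2) by simp
  have int_g: "integrable lborel (g b)" if "b \<in> Basis" for b
    using L2_integrable[OF assms(2) b gL2[OF that]] lebesgue_on_integral_lborel(2)[OF b g(1)[OF that]] g(2)[OF that] by simp
  have "weak_grad \<Omega> u0 G"
    unfolding weak_grad_def
  proof (intro conjI allI ballI impI)
    show "G \<in> borel_measurable borel"
      unfolding G_def[abs_def] by (intro borel_measurable_sum borel_measurable_scaleR g) auto
    show "integrable lborel G"
      unfolding G_def[abs_def] by (intro Bochner_Integration.integrable_sum integrable_scaleR_left int_g) auto
    show "G x = 0" if "x \<notin> \<Omega>" for x
      using g(2) that by (simp add: G_def)
    fix \<phi> and z :: 'a assume \<phi>: "\<phi> \<in> test_functions \<Omega>"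
    note D = test_function_frechet_derivative[OF \<phi>]
    have int1: "integrable lborel (\<lambda>x. u0 x * frechet_derivative \<phi> (at x) b)" if bB: "b \<in> Basis" for b
    proof -
      obtain K where "\<forall>x. \<bar>frechet_derivative \<phi> (at x) b\<bar> \<le> K"
        using test_function_bounded[OF D[OF bB]] by blast
      then show ?thesis
        using test_function_borel[OF D[OF bB]] by (intro integrable_mult_bounded[where K = K] int_u0) auto
    qed
    have int2: "integrable lborel (\<lambda>x. g b x * \<phi> x)" if bB: "b \<in> Basis" for b
    proof -
      obtain K where "\<forall>x. \<bar>\<phi> x\<bar> \<le> K"
        using test_function_bounded[OF \<phi>] by blast
      then show ?thesis
        using test_function_borel[OF \<phi>] by (intro integrable_mult_bounded[where K = K] int_g bB) auto
    qed
    have comp: "(LINT x|lborel. u0 x * frechet_derivative \<phi> (at x) b) = - (LINT x|lborel. g b x * \<phi> x)" if "b \<in> Basis" for b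
    proof -
      have "(LINT x|lborel. u0 x * frechet_derivative \<phi> (at x) b) = (LINT x|lebesgue_on \<Omega>. u0 x * frechet_derivative \<phi> (at x) b)"
        using u0 test_function_borel[OF D[OF that]]
        by (intro lebesgue_on_integral_lborel(1)[OF b, symmetric]) auto
      also have "\<dots> = (LINT x|lebesgue_on \<Omega>. u x * frechet_derivative \<phi> (at x) b)"
        using L2_mult_integrable[OF u0L2 test_function_L2[OF assms(1) D[OF that]]]
          L2_mult_integrable[OF L2 test_function_L2[OF assms(1) D[OF that]]] u0(3)
        by (intro integral_cong_AE) (auto elim!: eventually_mono)
      also have "\<dots> = - (LINT x|lebesgue_on \<Omega>. weak_deriv \<Omega> b u x * \<phi> x)"
        using H1_weak_deriv[OF assms(3) that] \<phi> by (simp add: has_weak_deriv_def)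
      also have "(LINT x|lebesgue_on \<Omega>. weak_deriv \<Omega> b u x * \<phi> x) = (LINT x|lebesgue_on \<Omega>. g b x * \<phi> x)"
        using L2_mult_integrable[OF gL2[OF that] test_function_L2[OF assms(1) \<phi>]]
          L2_mult_integrable[OF H1_weak_deriv_L2[OF assms(3) that] test_function_L2[OF assms(1) \<phi>]] g(3)[OF that]
        by (intro integral_cong_AE) (auto elim!: eventually_mono)
      also have "\<dots> = (LINT x|lborel. g b x * \<phi> x)"
        using g[OF that] test_function_borel[OF \<phi>]
        by (intro lebesgue_on_integral_lborel(1)[OF b]) auto
      finally show ?thesis .
    qed
    have "(LINT x|lborel. u0 x * frechet_derivative \<phi> (at x) z) =
        (LINT x|lborel. (\<Sum>b\<in>Basis. (z \<bullet> b) * (u0 x * frechet_derivative \<phi> (at x) b)))"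
      by (subst smooth_frechet_derivative_sum[OF test_functionD(1)[OF \<phi>]])
        (simp add: sum_distrib_left mult.left_commute)
    also have "\<dots> = (\<Sum>b\<in>Basis. (z \<bullet> b) * (LINT x|lborel. u0 x * frechet_derivative \<phi> (at x) b))"
      using int1 by (subst Bochner_Integration.integral_sum) auto
    also have "\<dots> = - (\<Sum>b\<in>Basis. (z \<bullet> b) * (LINT x|lborel. g b x * \<phi> x))"
      by (simp add: comp sum_negf)
    also have "(\<Sum>b\<in>Basis. (z \<bullet> b) * (LINT x|lborel. g b x * \<phi> x)) = (LINT x|lborel. (\<Sum>b\<in>Basis. (z \<bullet> b) * (g b x * \<phi> x)))"
      using int2 by (subst Bochner_Integration.integral_sum) auto
    also have "(\<lambda>x. \<Sum>b\<in>Basis. (z \<bullet> b) * (g b x * \<phi> x)) = (\<lambda>x. (G x \<bullet> z) * \<phi> x)"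
      by (auto simp: G_def inner_sum_left sum_distrib_left sum_distrib_right inner_commute[of z] ac_simps)
    finally show "(LINT x|lborel. u0 x * frechet_derivative \<phi> (at x) z) = - (LINT x|lborel. (G x \<bullet> z) * \<phi> x)" .
  qed (use u0 int_u0 in auto)
  then show ?thesis
    using u0(3) g(3) Gb by (intro exI[of _ u0] exI[of _ G]) simp
qed

text \<open>
  The form in which \<open>\<integral> |\<nabla> f|\<^sup>2 \<le> S\<close> on \<open>\<Omega>\<close> enters all estimates. It avoids weak derivatives of
  \<open>f\<close>, makes sense for every Borel function, and allows the set \<open>U\<close> of starting points to be any
  open set for which the segments stay in \<open>\<Omega>\<close>.
\<close>

definition diff_bound :: "'a::euclidean_space set \<Rightarrow> ('a \<Rightarrow> real) \<Rightarrow> real \<Rightarrow> bool" where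
  "diff_bound \<Omega> f S \<longleftrightarrow> (\<forall>U z. open U \<longrightarrow> (\<forall>x\<in>U. \<forall>s\<in>{0..1}. x + s *\<^sub>R z \<in> \<Omega>) \<longrightarrow>
     (\<integral>\<^sup>+x. indicator U x * ennreal ((f (x + z) - f x)\<^sup>2) \<partial>lborel) \<le> ennreal ((norm z)\<^sup>2 * S))"

lemma ennreal_integral_Icc_square_le:
  assumes q: "q absolutely_integrable_on {0..1}" and [measurable]: "D \<in> borel_measurable borel"
    and eq: "AE s in lborel. s \<in> {0..1} \<longrightarrow> q s = D s"
  shows "ennreal ((integral {0..1} q)\<^sup>2) \<le> (\<integral>\<^sup>+s. indicator {0..1::real} s * ennreal ((D s)\<^sup>2) \<partial>lborel)"
proof -
  have "integral {0..1} q = (LINT s|lebesgue. indicator {0..1} s *\<^sub>R q s)"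
    using set_lebesgue_integral_eq_integral(2)[OF q] by (simp add: set_lebesgue_integral_def)
  then have "ennreal \<bar>integral {0..1} q\<bar> \<le> (\<integral>\<^sup>+s. ennreal (norm (indicator {0..1} s *\<^sub>R q s)) \<partial>lebesgue)"
    using integral_norm_bound_ennreal[of lebesgue "\<lambda>s. indicator {0..1} s *\<^sub>R q s"] q
    by (simp add: set_integrable_def)
  also have "\<dots> = (\<integral>\<^sup>+s. indicator {0..1} s * ennreal \<bar>D s\<bar> \<partial>lebesgue)"
    by (rule nn_integral_cong_AE) (use AE_completion[OF eq] in \<open>auto elim!: eventually_mono simp: indicator_def\<close>)
  also have "\<dots> = (\<integral>\<^sup>+s. indicator {0..1} s * (indicator {0..1} s * ennreal \<bar>D s\<bar>) \<partial>lborel)"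
    by (subst nn_integral_completion) (auto intro!: nn_integral_cong simp: indicator_def)
  finally have "(ennreal \<bar>integral {0..1} q\<bar>)\<^sup>2 \<le> (\<integral>\<^sup>+s. indicator {0..1} s * (indicator {0..1} s * ennreal \<bar>D s\<bar>) \<partial>lborel)\<^sup>2"
    by (intro power_mono) auto
  also have "\<dots> \<le> (\<integral>\<^sup>+s. (indicator {0..1::real} s)\<^sup>2 \<partial>lborel) * (\<integral>\<^sup>+s. (indicator {0..1} s * ennreal \<bar>D s\<bar>)\<^sup>2 \<partial>lborel)"
    by (rule Cauchy_Schwarz_nn_integral[of "indicator {0..1}" lborel "\<lambda>s. indicator {0..1} s * ennreal \<bar>D s\<bar>"]) measurable
  also have "(\<lambda>s::real. (indicator {0..1} s)\<^sup>2 :: ennreal) = indicator {0..1}"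
    by (auto simp: indicator_def)
  also have "(\<lambda>s. (indicator {0..1} s * ennreal \<bar>D s\<bar>)\<^sup>2) = (\<lambda>s. indicator {0..1} s * ennreal ((D s)\<^sup>2))"
    by (auto simp: indicator_def ennreal_power)
  finally show ?thesis by (simp add: ennreal_power)
qed

text \<open>
  For almost every \<open>x\<close> the functions \<open>w i\<close> are absolutely continuous on the segment from \<open>x\<close> to
  \<open>x + z\<close>, so the chain rule represents the difference as the integral of \<open>\<nabla> (F \<circ> w) \<bullet> z\<close> over the
  segment. Integrating the Cauchy-Schwarz inequality over \<open>x\<close> and shifting the variable gives the
  bound.
\<close>

theorem C11_composition_diff_bound:
  fixes w :: "nat \<Rightarrow> 'a::euclidean_space \<Rightarrow> real"
  assumes F: "C11_fun N L F F'" and "open \<Omega>" and w: "\<And>i. weak_grad \<Omega> (w i) (G i)"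
    and f[measurable]: "(\<lambda>x. F (\<lambda>i. w i x)) \<in> borel_measurable borel"
    and F'm: "\<And>j. j < N \<Longrightarrow> (\<lambda>x. F' j (\<lambda>i. w i x)) \<in> borel_measurable borel"
    and S: "(\<integral>\<^sup>+x. indicator \<Omega> x * ennreal ((norm (\<Sum>j<N. F' j (\<lambda>i. w i x) *\<^sub>R G j x))\<^sup>2) \<partial>lborel) \<le> ennreal S"
  shows "diff_bound \<Omega> (\<lambda>x. F (\<lambda>i. w i x)) S"
  unfolding diff_bound_def
proof (intro allI impI)
  fix U :: "'a set" and z :: 'a
  assume "open U" and seg: "\<forall>x\<in>U. \<forall>s\<in>{0..1}. x + s *\<^sub>R z \<in> \<Omega>"
  have [measurable]: "w i \<in> borel_measurable borel" "G i \<in> borel_measurable borel" for i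
    using w by (auto simp: weak_grad_def)
  have [measurable]: "U \<in> sets borel" "\<Omega> \<in> sets borel" using \<open>open U\<close> \<open>open \<Omega>\<close> by auto
  define E where "E x = (\<Sum>j<N. F' j (\<lambda>i. w i x) *\<^sub>R G j x)" for x
  have [measurable]: "E \<in> borel_measurable borel"
    unfolding E_def[abs_def] by (intro borel_measurable_sum borel_measurable_scaleR F'm) auto
  \<comment> \<open>For almost every \<open>x\<close>, the representation along lines is needed for almost every \<open>s\<close> in \<open>[0,1]\<close>,
    to identify \<open>F' (\<gamma> s)\<close>, and at \<open>s = 1\<close>, to identify the difference itself.\<close>
  define P where "P i s x \<longleftrightarrow> w i (x + s *\<^sub>R z) - w i x = (LINT r|lborel. indicator {0..s} r * (G i (x + r *\<^sub>R z) \<bullet> z))" for i s x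
  have A1: "AE x in lborel. x \<in> U \<longrightarrow> P i s x" if "s \<in> {0..1}" for i s
    unfolding P_def using that seg by (intro weak_grad_along_lines[OF w \<open>open \<Omega>\<close> \<open>open U\<close>]) auto
  have "AE x in lborel. AE s in lborel. s \<in> {0..1} \<longrightarrow> x \<in> U \<longrightarrow> P i s x" for i
  proof -
    have "AE s in lborel. AE x in lborel. s \<in> {0..1} \<longrightarrow> x \<in> U \<longrightarrow> P i s x"
    proof (rule AE_I2)
      fix s :: real
      show "AE x in lborel. s \<in> {0..1} \<longrightarrow> x \<in> U \<longrightarrow> P i s x"
        using A1[of s i] by (cases "s \<in> {0..1}") auto
    qed
    moreover have "{q \<in> space (lborel \<Otimes>\<^sub>M lborel). fst q \<in> {0..1} \<longrightarrow> snd q \<in> U \<longrightarrow> P i (fst q) (snd q)} \<in> sets (lborel \<Otimes>\<^sub>M lborel)"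
      unfolding P_def indicator_def atLeastAtMost_iff by measurable
    ultimately show ?thesis
      using lborel_pair.AE_commute[of "\<lambda>s x. s \<in> {0..1} \<longrightarrow> x \<in> U \<longrightarrow> P i s x"] by simp
  qed
  then have A2: "AE x in lborel. \<forall>i. AE s in lborel. s \<in> {0..1} \<longrightarrow> x \<in> U \<longrightarrow> P i s x"
    by (simp add: AE_all_countable)
  have A3: "AE x in lborel. \<forall>i. integrable lborel (\<lambda>s. indicator {0..1::real} s * (G i (x + s *\<^sub>R z) \<bullet> z))"
  proof (subst AE_all_countable, intro allI)
    fix i
    have "integrable lborel (\<lambda>x. G i x \<bullet> z)" using w[of i] by (auto simp: weak_grad_def)
    from lborel_pair.AE_integrable_snd[OF integrable_pair_shift[OF this, of 1 z]]
    show "AE x in lborel. integrable lborel (\<lambda>s. indicator {0..1::real} s * (G i (x + s *\<^sub>R z) \<bullet> z))" by simp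
  qed
  have A4: "AE x in lborel. \<forall>i. x \<in> U \<longrightarrow> P i 1 x"
    unfolding AE_all_countable using A1[of 1] by simp
  have key: "AE x in lborel. indicator U x * ennreal ((F (\<lambda>i. w i (x + z)) - F (\<lambda>i. w i x))\<^sup>2) \<le>
      (\<integral>\<^sup>+s. indicator {0..1::real} s * (indicator U x * ennreal ((E (x + s *\<^sub>R z) \<bullet> z)\<^sup>2)) \<partial>lborel)"
    using A2 A3 A4
  proof eventually_elim
    case (elim x)
    show ?case
    proof (cases "x \<in> U")
      case True
      define h where "h i s = G i (x + s *\<^sub>R z) \<bullet> z" for i s
      have [measurable]: "h i \<in> borel_measurable borel" for i unfolding h_def[abs_def] by measurable
      define \<gamma> where "\<gamma> t i = w i x + (LINT r|lborel. indicator {0..t} r * h i r)" for t i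
      have hi: "set_integrable lborel {0..1} (h i)" for i
        using elim(2) by (simp add: set_integrable_def h_def)
      have ha: "h i absolutely_integrable_on {0..1}" for i
        using hi[of i] by (simp add: set_integrable_def integrable_completion)
      have \<gamma>_eq: "\<gamma> t i = w i x + integral {0..t} (h i)" if "0 \<le> t" "t \<le> 1" for t i
      proof -
        have "set_integrable lborel {0..t} (h i)"
          by (rule set_integrable_subset[OF hi]) (use that in auto)
        from set_borel_integral_eq_integral(2)[OF this] show ?thesis
          by (simp add: \<gamma>_def set_lebesgue_integral_def)
      qed
      have \<gamma>0: "\<gamma> 0 = (\<lambda>i. w i x)" using \<gamma>_eq[of 0] by auto
      have \<gamma>1: "\<gamma> 1 = (\<lambda>i. w i (x + z))"
      proof
        fix i show "\<gamma> 1 i = w i (x + z)"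
          using elim(3)[rule_format, of i] True by (simp add: \<gamma>_def P_def h_def)
      qed
      have chain: "(\<lambda>s. \<Sum>j<N. F' j (\<gamma> s) * h j s) absolutely_integrable_on {0..1}"
         "F (\<gamma> 1) - F (\<gamma> 0) = integral {0..1} (\<lambda>s. \<Sum>j<N. F' j (\<gamma> s) * h j s)"
        using absolutely_continuous_chain_rule[OF F ha, of \<gamma>] \<gamma>_eq by auto
      have "AE s in lborel. \<forall>i. s \<in> {0..1} \<longrightarrow> P i s x"
        unfolding AE_all_countable using elim(1) True by simp
      then have "AE s in lborel. s \<in> {0..1} \<longrightarrow> (\<Sum>j<N. F' j (\<gamma> s) * h j s) = E (x + s *\<^sub>R z) \<bullet> z"
      proof eventually_elim
        case (elim s)
        show ?case
        proof
          assume "s \<in> {0..1}"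
          then have "\<gamma> s = (\<lambda>i. w i (x + s *\<^sub>R z))"
            using elim by (auto simp: \<gamma>_def P_def h_def fun_eq_iff diff_eq_eq add.commute)
          then show "(\<Sum>j<N. F' j (\<gamma> s) * h j s) = E (x + s *\<^sub>R z) \<bullet> z"
            by (simp add: E_def h_def inner_sum_left)
        qed
      qed
      from ennreal_integral_Icc_square_le[OF chain(1) _ this] show ?thesis
        using True chain(2) by (simp add: \<gamma>0 \<gamma>1)
    qed simp
  qed
  have "(\<integral>\<^sup>+x. indicator U x * ennreal ((F (\<lambda>i. w i (x + z)) - F (\<lambda>i. w i x))\<^sup>2) \<partial>lborel) \<le>
      (\<integral>\<^sup>+x. (\<integral>\<^sup>+s. indicator {0..1::real} s * (indicator U x * ennreal ((E (x + s *\<^sub>R z) \<bullet> z)\<^sup>2)) \<partial>lborel) \<partial>lborel)"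
    by (rule nn_integral_mono_AE[OF key])
  also have "\<dots> = (\<integral>\<^sup>+s. (\<integral>\<^sup>+x. indicator {0..1::real} s * (indicator U x * ennreal ((E (x + s *\<^sub>R z) \<bullet> z)\<^sup>2)) \<partial>lborel) \<partial>lborel)"
    by (rule lborel_pair.Fubini') measurable
  also have "\<dots> \<le> (\<integral>\<^sup>+s. indicator {0..1::real} s * ennreal ((norm z)\<^sup>2 * S) \<partial>lborel)"
  proof (rule nn_integral_mono)
    fix s :: real
    show "(\<integral>\<^sup>+x. indicator {0..1::real} s * (indicator U x * ennreal ((E (x + s *\<^sub>R z) \<bullet> z)\<^sup>2)) \<partial>lborel)
        \<le> indicator {0..1::real} s * ennreal ((norm z)\<^sup>2 * S)"
    proof (cases "s \<in> {0..1}")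
      case True
      have "(\<integral>\<^sup>+x. indicator U x * ennreal ((E (x + s *\<^sub>R z) \<bullet> z)\<^sup>2) \<partial>lborel)
          \<le> (\<integral>\<^sup>+x. indicator \<Omega> (x + s *\<^sub>R z) * ennreal ((E (x + s *\<^sub>R z) \<bullet> z)\<^sup>2) \<partial>lborel)"
        using seg True by (intro nn_integral_mono) (auto simp: indicator_def)
      also have "\<dots> = (\<integral>\<^sup>+y. indicator \<Omega> y * ennreal ((E y \<bullet> z)\<^sup>2) \<partial>lborel)"
        by (rule nn_integral_lborel_shift) measurable
      also have "\<dots> \<le> (\<integral>\<^sup>+y. ennreal ((norm z)\<^sup>2) * (indicator \<Omega> y * ennreal ((norm (E y))\<^sup>2)) \<partial>lborel)"
      proof (rule nn_integral_mono)
        fix y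
        have "(E y \<bullet> z)\<^sup>2 \<le> (norm z)\<^sup>2 * (norm (E y))\<^sup>2"
          using Cauchy_Schwarz_ineq2[of "E y" z] by (metis abs_ge_zero mult.commute power2_abs power_mono power_mult_distrib)
        then show "indicator \<Omega> y * ennreal ((E y \<bullet> z)\<^sup>2) \<le> ennreal ((norm z)\<^sup>2) * (indicator \<Omega> y * ennreal ((norm (E y))\<^sup>2))"
          by (auto simp: indicator_def ennreal_mult'[symmetric] intro!: ennreal_leI)
      qed
      also have "\<dots> = ennreal ((norm z)\<^sup>2) * (\<integral>\<^sup>+y. indicator \<Omega> y * ennreal ((norm (E y))\<^sup>2) \<partial>lborel)"
        by (rule nn_integral_cmult) measurable
      also have "\<dots> \<le> ennreal ((norm z)\<^sup>2) * ennreal S"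
        using S by (intro mult_left_mono) (auto simp: E_def)
      finally show ?thesis using True by (simp add: ennreal_mult')
    qed simp
  qed
  also have "\<dots> = ennreal ((norm z)\<^sup>2 * S)"
    by (simp add: nn_integral_multc)
  finally show "(\<integral>\<^sup>+x. indicator U x * ennreal ((F (\<lambda>i. w i (x + z)) - F (\<lambda>i. w i x))\<^sup>2) \<partial>lborel) \<le> ennreal ((norm z)\<^sup>2 * S)" .
qed

section \<open>The cone property and the Poincare inequality\<close>

text \<open>
  The cone consists of the segments from the vertex to the points of \<open>ball p \<rho>\<close>, relative to the
  vertex; for \<open>p = 0\<close> it is a ball.
\<close>

definition cone_at :: "'a::euclidean_space set \<Rightarrow> 'a set \<Rightarrow> 'a \<Rightarrow> real \<Rightarrow> bool" where
  "cone_at \<Omega> V p \<rho> \<longleftrightarrow> open V \<and> \<rho> > 0 \<and> (\<forall>x\<in>V \<inter> \<Omega>. \<forall>\<zeta>\<in>ball p \<rho>. \<forall>s\<in>{0..1}. x + s *\<^sub>R \<zeta> \<in> \<Omega>)"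

lemma cone_atD:
  "cone_at \<Omega> V p \<rho> \<Longrightarrow> x \<in> V \<Longrightarrow> x \<in> \<Omega> \<Longrightarrow> \<zeta> \<in> ball p \<rho> \<Longrightarrow> 0 \<le> s \<Longrightarrow> s \<le> 1 \<Longrightarrow> x + s *\<^sub>R \<zeta> \<in> \<Omega>"
  unfolding cone_at_def by (meson IntI atLeastAtMost_iff)

text \<open>
  The graph has some Lipschitz constant \<open>M\<close> in the ball. A cone with axis \<open>e\<close> that is steeper than
  \<open>M\<close> stays above the graph when its vertex is above the graph.
\<close>

lemma C11_graph_cone:
  assumes "C11_graph_at \<Omega> x0 r e \<gamma> g"
  shows "\<exists>p \<rho>. cone_at \<Omega> (ball x0 (r / 2)) p \<rho>"
proof -
  obtain L where r: "r > 0" and e: "norm e = 1" and const: "\<And>y s. \<gamma> (y + s *\<^sub>R e) = \<gamma> y"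
    and der: "\<And>y. GDERIV \<gamma> y :> g y" and L: "L-lipschitz_on UNIV g"
    and "\<Omega> \<inter> ball x0 r = {y \<in> ball x0 r. \<gamma> y < y \<bullet> e}"
    using assms unfolding C11_graph_at_def by blast
  then have graph: "y \<in> \<Omega> \<longleftrightarrow> \<gamma> y < y \<bullet> e" if "y \<in> ball x0 r" for y
    using that by blast
  define M where "M = norm (g x0) + L * r"
  have L0: "0 \<le> L" using L by (rule lipschitz_on_nonneg)
  have M0: "0 \<le> M" unfolding M_def using L0 r by simp
  have gM: "norm (g y) \<le> M" if "y \<in> ball x0 r" for y
  proof -
    have "norm (g y - g x0) \<le> L * dist y x0"
      using lipschitz_onD[OF L, of y x0] by (simp add: dist_norm)
    also have "\<dots> \<le> L * r" using that L0 by (intro mult_left_mono) (auto simp: dist_commute)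
    finally show ?thesis unfolding M_def using norm_triangle_sub[of "g y" "g x0"] by linarith
  qed
  have \<gamma>lip: "\<bar>\<gamma> y - \<gamma> x\<bar> \<le> M * norm (y - x)" if "x \<in> ball x0 r" "y \<in> ball x0 r" for x y
  proof -
    have "norm (\<gamma> y - \<gamma> x) \<le> M * norm (y - x)"
    proof (rule differentiable_bound[of "ball x0 r" \<gamma> "\<lambda>x h. h \<bullet> g x"])
      show "(\<gamma> has_derivative (\<lambda>h. h \<bullet> g x)) (at x within ball x0 r)" for x
        using der[of x] by (simp add: gderiv_def has_derivative_at_withinI)
      show "onorm (\<lambda>h. h \<bullet> g x) \<le> M" if "x \<in> ball x0 r" for x
      proof (rule onorm_bound[OF M0])
        fix h show "norm (h \<bullet> g x) \<le> M * norm h"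
          using Cauchy_Schwarz_ineq2[of h "g x"] mult_left_mono[OF gM[OF that], of "norm h"]
          by (simp add: mult.commute)
      qed
    qed (use that in auto)
    then show ?thesis by simp
  qed
  \<comment> \<open>With this height, and width \<open>\<rho> \<le> h\<close>, cones with vertex in the half ball stay in \<open>ball x0 r\<close>; the
    width is chosen such that \<open>(M + 1) \<rho> = h\<close>.\<close>
  define h where "h = r / 4"
  define \<rho> where "\<rho> = h / (M + 1)"
  have h0: "h > 0" using r by (simp add: h_def)
  have \<rho>0: "\<rho> > 0" and \<rho>h: "\<rho> \<le> h" and M\<rho>: "(M + 1) * \<rho> = h"
    using M0 h0 by (auto simp: \<rho>_def field_simps)
  have "x + s *\<^sub>R \<zeta> \<in> \<Omega>" if x: "x \<in> ball x0 (r / 2) \<inter> \<Omega>" and \<zeta>: "\<zeta> \<in> ball (h *\<^sub>R e) \<rho>" and s: "s \<in> {0..1}" for x \<zeta> s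
  proof -
    define \<xi> where "\<xi> = \<zeta> - h *\<^sub>R e"
    have \<xi>: "norm \<xi> < \<rho>" using \<zeta> by (simp add: \<xi>_def dist_norm norm_minus_commute)
    have \<zeta>_eq: "\<zeta> = h *\<^sub>R e + \<xi>" by (simp add: \<xi>_def)
    have xr: "norm (x - x0) < r / 2" using x by (simp add: dist_norm norm_minus_commute)
    have s\<xi>: "norm (s *\<^sub>R \<xi>) \<le> norm \<xi>" using s by (simp add: mult_left_le_one_le)
    have "norm \<zeta> \<le> h + norm \<xi>" unfolding \<zeta>_eq using norm_triangle_ineq[of "h *\<^sub>R e" \<xi>] e h0 by simp
    moreover have "norm (s *\<^sub>R \<zeta>) \<le> norm \<zeta>" using s by (simp add: mult_left_le_one_le)
    ultimately have n\<zeta>: "norm (s *\<^sub>R \<zeta>) < r / 2" using \<xi> \<rho>h by (simp add: h_def)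
    have near: "x + v \<in> ball x0 r" if "norm v < r / 2" for v
    proof -
      have "norm (x + v - x0) \<le> norm (x - x0) + norm v"
        using norm_triangle_ineq[of "x - x0" v] by (simp add: algebra_simps)
      then have "norm (x + v - x0) < r" using xr that by linarith
      then show ?thesis by (simp add: mem_ball dist_norm norm_minus_commute)
    qed
    have in1: "x + s *\<^sub>R \<zeta> \<in> ball x0 r" by (rule near[OF n\<zeta>])
    have "norm (s *\<^sub>R \<xi>) < r / 2" using s\<xi> \<xi> \<rho>h r unfolding h_def by linarith
    then have in2: "x + s *\<^sub>R \<xi> \<in> ball x0 r" by (rule near)
    have in3: "x \<in> ball x0 r" using x r by auto
    have "\<gamma> (x + s *\<^sub>R \<zeta>) = \<gamma> ((x + s *\<^sub>R \<xi>) + (s * h) *\<^sub>R e)"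
      by (simp add: \<zeta>_eq algebra_simps)
    also have "\<dots> = \<gamma> (x + s *\<^sub>R \<xi>)" by (rule const)
    also have "\<dots> \<le> \<gamma> x + M * norm (s *\<^sub>R \<xi>)" using \<gamma>lip[OF in3 in2] by simp
    also have "\<dots> < x \<bullet> e + M * norm (s *\<^sub>R \<xi>)" using graph[OF in3] x by simp
    also have "\<dots> \<le> x \<bullet> e + s * h - norm (s *\<^sub>R \<xi>)"
    proof -
      have "(M + 1) * norm \<xi> \<le> h" using mult_left_mono[of "norm \<xi>" \<rho> "M + 1"] \<xi> M0 M\<rho> by simp
      then have "s * ((M + 1) * norm \<xi>) \<le> s * h" using s by (intro mult_left_mono) auto
      then show ?thesis using s by (simp add: algebra_simps)
    qed
    also have "\<dots> \<le> (x + s *\<^sub>R \<zeta>) \<bullet> e"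
    proof -
      have "e \<bullet> e = 1" using e by (simp add: dot_square_norm)
      moreover have "- norm (s *\<^sub>R \<xi>) \<le> (s *\<^sub>R \<xi>) \<bullet> e"
        using Cauchy_Schwarz_ineq2[of "s *\<^sub>R \<xi>" e] e by simp
      ultimately show ?thesis by (simp add: \<zeta>_eq inner_add_left algebra_simps)
    qed
    finally show ?thesis using graph[OF in1] by simp
  qed
  then show ?thesis
    unfolding cone_at_def using \<rho>0 by (intro exI[of _ "h *\<^sub>R e"] exI[of _ \<rho>]) auto
qed

lemma cone_at_closure:
  assumes "bounded_C11_domain \<Omega>" "x \<in> closure \<Omega>"
  shows "\<exists>V p \<rho>. x \<in> V \<and> cone_at \<Omega> V p \<rho>"
proof (cases "x \<in> \<Omega>")
  case True
  then obtain r' where "r' > 0" "ball x r' \<subseteq> \<Omega>"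
    using assms(1) openE[of \<Omega> x] unfolding bounded_C11_domain_def by blast
  then obtain r where r: "r > 0" "ball x (2 * r) \<subseteq> \<Omega>"
    using that[of "r' / 2"] by simp
  have "y + s *\<^sub>R \<zeta> \<in> \<Omega>" if "y \<in> ball x r" "\<zeta> \<in> ball 0 r" "s \<in> {0..1}" for y \<zeta> s
  proof -
    have "norm (s *\<^sub>R \<zeta>) \<le> norm \<zeta>" using that by (simp add: mult_left_le_one_le)
    then have "dist y (y + s *\<^sub>R \<zeta>) < r" "dist x y < r" using that by (auto simp: dist_norm)
    then have "y + s *\<^sub>R \<zeta> \<in> ball x (2 * r)"
      using dist_triangle[of x "y + s *\<^sub>R \<zeta>" y] by simp
    then show ?thesis using r by blast
  qed
  then show ?thesis
    using r by (intro exI[of _ "ball x r"] exI[of _ 0] exI[of _ r]) (auto simp: cone_at_def)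
next
  case False
  then have "x \<in> frontier \<Omega>"
    using assms by (simp add: frontier_def bounded_C11_domain_def interior_open)
  then obtain r e \<gamma> g where g: "C11_graph_at \<Omega> x r e \<gamma> g"
    using assms(1) unfolding bounded_C11_domain_def C11_boundary_def by blast
  moreover have "r > 0" using g by (simp add: C11_graph_at_def)
  ultimately show ?thesis using C11_graph_cone[OF g] by (intro exI[of _ "ball x (r / 2)"]) auto
qed

text \<open>The inclusion extends to vertices on the boundary, because the ball is open.\<close>

lemma cone_at_ball:
  assumes "cone_at \<Omega> V p \<rho>" "x \<in> V" "x \<in> closure \<Omega>"
  shows "ball (x + p) \<rho> \<subseteq> \<Omega>"
proof
  fix y assume y: "y \<in> ball (x + p) \<rho>"
  define \<delta> where "\<delta> = \<rho> - dist (x + p) y"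
  have \<delta>: "\<delta> > 0" using y by (simp add: \<delta>_def)
  have "open (V \<inter> ball x \<delta>)" "x \<in> V \<inter> ball x \<delta>"
    using assms \<delta> by (auto simp: cone_at_def)
  then have "(V \<inter> ball x \<delta>) \<inter> \<Omega> \<noteq> {}"
    using assms(3) open_Int_closure_eq_empty[of "V \<inter> ball x \<delta>" \<Omega>] by blast
  then obtain x' where x': "x' \<in> V" "x' \<in> \<Omega>" "dist x x' < \<delta>" by auto
  have "norm (y - x' - p) \<le> norm (x + p - y) + norm (x - x')"
    using norm_triangle_ineq[of "y - x - p" "x - x'"] by (simp add: norm_minus_commute algebra_simps)
  then have "y - x' \<in> ball p \<rho>"
    using x'(3) by (simp add: \<delta>_def dist_norm norm_minus_commute[of p] diff_diff_eq)
  then have "x' + 1 *\<^sub>R (y - x') \<in> \<Omega>"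
    using x' by (intro cone_atD[OF assms(1)]) auto
  then show "y \<in> \<Omega>" by simp
qed

text \<open>
  The gradient is controlled on \<open>\<Omega>\<close>, the oscillation is bounded on the part \<open>U\<close>. The restriction
  to \<open>S > 0\<close> avoids a discussion of \<open>S = 0\<close>.
\<close>

definition poincare_on :: "'a::euclidean_space set \<Rightarrow> 'a set \<Rightarrow> bool" where
  "poincare_on \<Omega> U \<longleftrightarrow> (\<exists>C\<ge>0. \<forall>f S. f \<in> borel_measurable borel \<longrightarrow> S > 0 \<longrightarrow> diff_bound \<Omega> f S \<longrightarrow>
     (\<exists>m. (\<integral>\<^sup>+x. indicator U x * ennreal ((f x - m)\<^sup>2) \<partial>lborel) \<le> ennreal (C * S)))"

lemma ennreal_sq_sum_le:
  fixes a b :: real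
  shows "ennreal ((a + b)\<^sup>2) \<le> 2 * ennreal (a\<^sup>2) + 2 * ennreal (b\<^sup>2)"
proof -
  have "(a + b)\<^sup>2 \<le> 2 * a\<^sup>2 + 2 * b\<^sup>2"
    using sum_squares_bound[of a b] by (simp add: power2_sum)
  then have "ennreal ((a + b)\<^sup>2) \<le> ennreal (2 * a\<^sup>2 + 2 * b\<^sup>2)" by (rule ennreal_leI)
  then show ?thesis by (simp add: ennreal_plus ennreal_mult')
qed

text \<open>
  One of the values \<open>m = f y\<close> works: otherwise integration over \<open>y\<close> in the ball contradicts the
  bound of \<open>\<integral>\<integral> (f (y + z) - f y)\<^sup>2\<close> that follows from \<open>diff_bound\<close> for each \<open>z\<close>, by convexity of
  the ball.
\<close>

lemma poincare_on_ball:
  fixes \<Omega> :: "'a::euclidean_space set"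
  assumes "ball c r \<subseteq> \<Omega>" "r > 0"
  shows "poincare_on \<Omega> (ball c r)"
proof -
  let ?B = "ball c r"
  have [measurable]: "?B \<in> sets borel" by simp
  have emeas: "emeasure lborel (ball y s) = ennreal (measure lborel (ball y s))" for y :: 'a and s
    using emeasure_bounded_finite[of "ball y s"] by (intro emeasure_eq_ennreal_measure) auto
  define C0 where "C0 = (2 * r)\<^sup>2 * measure lborel (ball (0::'a) (2 * r))"
  define b where "b = measure lborel ?B"
  have b: "b > 0" unfolding b_def using content_ball_pos[OF assms(2), of c] by simp
  have C0: "C0 > 0" unfolding C0_def using content_ball_pos[of "2 * r" "0::'a"] assms(2) by simp
  have "\<exists>m. (\<integral>\<^sup>+x. indicator ?B x * ennreal ((f x - m)\<^sup>2) \<partial>lborel) \<le> ennreal (2 * C0 / b * S)"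
    if f[measurable]: "f \<in> borel_measurable borel" and S: "S > 0" and D: "diff_bound \<Omega> f S" for f S
  proof (rule ccontr)
    assume "\<not> ?thesis"
    then have big: "ennreal (2 * C0 / b * S) \<le> (\<integral>\<^sup>+x. indicator ?B x * ennreal ((f x - f y)\<^sup>2) \<partial>lborel)" for y
      by (meson linear)
    have slice: "(\<integral>\<^sup>+x. indicator ?B x * indicator ?B (x + z) * ennreal ((f (x + z) - f x)\<^sup>2) \<partial>lborel)
        \<le> indicator (ball 0 (2 * r)) z * ennreal ((2 * r)\<^sup>2 * S)" for z
    proof (cases "z \<in> ball 0 (2 * r)")
      case True
      define U where "U = ?B \<inter> ((\<lambda>x. x + z) -` ?B)"
      have U: "open U" unfolding U_def
        by (intro open_Int open_ball open_vimage continuous_intros)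
      have seg: "\<forall>x\<in>U. \<forall>s\<in>{0..1}. x + s *\<^sub>R z \<in> \<Omega>"
      proof (intro ballI)
        fix x and s :: real assume x: "x \<in> U" and s: "s \<in> {0..1}"
        have "(1 - s) *\<^sub>R x + s *\<^sub>R (x + z) \<in> ?B"
          using x s by (intro convexD[OF convex_ball]) (auto simp: U_def)
        then show "x + s *\<^sub>R z \<in> \<Omega>" using assms(1) by (auto simp: algebra_simps)
      qed
      have "(\<integral>\<^sup>+x. indicator ?B x * indicator ?B (x + z) * ennreal ((f (x + z) - f x)\<^sup>2) \<partial>lborel)
          = (\<integral>\<^sup>+x. indicator U x * ennreal ((f (x + z) - f x)\<^sup>2) \<partial>lborel)"
        by (intro nn_integral_cong) (auto simp: U_def indicator_def)
      also have "\<dots> \<le> ennreal ((norm z)\<^sup>2 * S)"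
        using D U seg unfolding diff_bound_def by blast
      also have "\<dots> \<le> ennreal ((2 * r)\<^sup>2 * S)"
        using True S by (intro ennreal_leI mult_right_mono power_mono) auto
      finally show ?thesis using True by simp
    next
      case False
      have "x \<notin> ?B \<or> x + z \<notin> ?B" for x
      proof (rule ccontr)
        assume "\<not> ?thesis"
        then have "dist c x < r" "dist c (x + z) < r" by auto
        then have "dist x (x + z) < 2 * r" using dist_triangle3[of x "x + z" c] by simp
        then show False using False by (simp add: dist_norm)
      qed
      then have "(\<integral>\<^sup>+x. indicator ?B x * indicator ?B (x + z) * ennreal ((f (x + z) - f x)\<^sup>2) \<partial>lborel) = (\<integral>\<^sup>+(x::'a). 0 \<partial>lborel)"
        by (intro nn_integral_cong) (auto simp: indicator_def)
      then show ?thesis by simp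
    qed
    have "ennreal (2 * C0 / b * S) * emeasure lborel ?B = (\<integral>\<^sup>+y. ennreal (2 * C0 / b * S) * indicator ?B y \<partial>lborel)"
      by (simp add: nn_integral_cmult_indicator)
    also have "\<dots> \<le> (\<integral>\<^sup>+y. (\<integral>\<^sup>+x. indicator ?B x * ennreal ((f x - f y)\<^sup>2) \<partial>lborel) * indicator ?B y \<partial>lborel)"
      by (intro nn_integral_mono mult_right_mono big) auto
    also have "\<dots> = (\<integral>\<^sup>+y. (\<integral>\<^sup>+x. indicator ?B y * indicator ?B x * ennreal ((f x - f y)\<^sup>2) \<partial>lborel) \<partial>lborel)"
      by (intro nn_integral_cong) (auto simp: indicator_def)
    also have "\<dots> = (\<integral>\<^sup>+y. (\<integral>\<^sup>+z. indicator ?B y * indicator ?B (y + z) * ennreal ((f (y + z) - f y)\<^sup>2) \<partial>lborel) \<partial>lborel)"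
    proof (rule nn_integral_cong)
      fix y
      show "(\<integral>\<^sup>+x. indicator ?B y * indicator ?B x * ennreal ((f x - f y)\<^sup>2) \<partial>lborel) =
          (\<integral>\<^sup>+z. indicator ?B y * indicator ?B (y + z) * ennreal ((f (y + z) - f y)\<^sup>2) \<partial>lborel)"
        using nn_integral_lborel_shift[of "\<lambda>x. indicator ?B y * indicator ?B x * ennreal ((f x - f y)\<^sup>2)" y]
        by (simp add: add.commute[of _ y])
    qed
    also have "\<dots> = (\<integral>\<^sup>+z. (\<integral>\<^sup>+y. indicator ?B y * indicator ?B (y + z) * ennreal ((f (y + z) - f y)\<^sup>2) \<partial>lborel) \<partial>lborel)"
      by (rule lborel_pair.Fubini') measurable
    also have "\<dots> \<le> (\<integral>\<^sup>+z. indicator (ball (0::'a) (2 * r)) z * ennreal ((2 * r)\<^sup>2 * S) \<partial>lborel)"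
      by (rule nn_integral_mono) (rule slice)
    also have "\<dots> = emeasure lborel (ball (0::'a) (2 * r)) * ennreal ((2 * r)\<^sup>2 * S)"
      by (subst nn_integral_multc) (auto intro!: borel_measurable_indicator)
    also have "\<dots> = ennreal (C0 * S)"
      unfolding emeas[of 0 "2 * r"] C0_def using S by (simp add: ennreal_mult'[symmetric] mult_ac)
    finally have "ennreal (2 * C0 / b * S) * ennreal b \<le> ennreal (C0 * S)"
      by (simp add: b_def emeas)
    then have "ennreal (2 * (C0 * S)) \<le> ennreal (C0 * S)"
      using b C0 S by (simp add: ennreal_mult'[symmetric])
    then have "2 * (C0 * S) \<le> C0 * S" using C0 S by (subst (asm) ennreal_le_iff) auto
    then show False using mult_pos_pos[OF C0 S] by simp
  qed
  then show ?thesis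
    unfolding poincare_on_def using b C0 by (intro exI[of _ "2 * C0 / b"]) auto
qed

text \<open>
  Moves boundary parts \<open>U\<close> of the domain to an interior set \<open>W\<close>, at the price of one difference.
\<close>

lemma poincare_on_shift:
  fixes \<Omega> :: "'a::euclidean_space set"
  assumes "open U" "\<And>x s. x \<in> U \<Longrightarrow> 0 \<le> s \<Longrightarrow> s \<le> 1 \<Longrightarrow> x + s *\<^sub>R p \<in> \<Omega>"
    and "\<And>x. x \<in> U \<Longrightarrow> x + p \<in> W" "W \<in> sets borel" "poincare_on \<Omega> W"
  shows "poincare_on \<Omega> U"
proof -
  obtain C where C: "C \<ge> 0" "\<And>f S. f \<in> borel_measurable borel \<Longrightarrow> S > 0 \<Longrightarrow> diff_bound \<Omega> f S \<Longrightarrow>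
     (\<exists>m. (\<integral>\<^sup>+x. indicator W x * ennreal ((f x - m)\<^sup>2) \<partial>lborel) \<le> ennreal (C * S))"
    using assms(5) unfolding poincare_on_def by blast
  have [measurable]: "U \<in> sets borel" "W \<in> sets borel" using assms by auto
  have "\<exists>m. (\<integral>\<^sup>+x. indicator U x * ennreal ((f x - m)\<^sup>2) \<partial>lborel) \<le> ennreal ((2 * (norm p)\<^sup>2 + 2 * C) * S)"
    if f[measurable]: "f \<in> borel_measurable borel" and S: "S > 0" and D: "diff_bound \<Omega> f S" for f S
  proof -
    obtain m where m: "(\<integral>\<^sup>+x. indicator W x * ennreal ((f x - m)\<^sup>2) \<partial>lborel) \<le> ennreal (C * S)"
      using C(2)[OF f S D] by blast
    have "(\<integral>\<^sup>+x. indicator U x * ennreal ((f x - m)\<^sup>2) \<partial>lborel) \<le>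
        (\<integral>\<^sup>+x. 2 * (indicator U x * ennreal ((f (x + p) - f x)\<^sup>2)) + 2 * (indicator W (x + p) * ennreal ((f (x + p) - m)\<^sup>2)) \<partial>lborel)"
    proof (rule nn_integral_mono)
      fix x
      have "- (f (x + p) - f x) + (f (x + p) - m) = f x - m" by simp
      with ennreal_sq_sum_le[of "- (f (x + p) - f x)" "f (x + p) - m"]
      have "ennreal ((f x - m)\<^sup>2) \<le> 2 * ennreal ((- (f (x + p) - f x))\<^sup>2) + 2 * ennreal ((f (x + p) - m)\<^sup>2)"
        by (simp only:)
      then show "indicator U x * ennreal ((f x - m)\<^sup>2) \<le>
          2 * (indicator U x * ennreal ((f (x + p) - f x)\<^sup>2)) + 2 * (indicator W (x + p) * ennreal ((f (x + p) - m)\<^sup>2))"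
        using assms(3)[of x] by (auto simp: indicator_def power2_commute)
    qed
    also have "\<dots> = 2 * (\<integral>\<^sup>+x. indicator U x * ennreal ((f (x + p) - f x)\<^sup>2) \<partial>lborel)
        + 2 * (\<integral>\<^sup>+x. indicator W (x + p) * ennreal ((f (x + p) - m)\<^sup>2) \<partial>lborel)"
      by (subst nn_integral_add) (auto simp: nn_integral_cmult)
    also have "(\<integral>\<^sup>+x. indicator W (x + p) * ennreal ((f (x + p) - m)\<^sup>2) \<partial>lborel) =
        (\<integral>\<^sup>+x. indicator W x * ennreal ((f x - m)\<^sup>2) \<partial>lborel)"
      by (rule nn_integral_lborel_shift) measurable
    also have "2 * (\<integral>\<^sup>+x. indicator U x * ennreal ((f (x + p) - f x)\<^sup>2) \<partial>lborel) + 2 * \<dots> \<le>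
        2 * ennreal ((norm p)\<^sup>2 * S) + 2 * ennreal (C * S)"
      using D assms(1,2) m unfolding diff_bound_def by (intro add_mono mult_left_mono) auto
    also have "\<dots> = ennreal ((2 * (norm p)\<^sup>2 + 2 * C) * S)"
      using S C(1) by (simp add: ennreal_plus ennreal_mult' distrib_right mult.assoc)
    finally show ?thesis by blast
  qed
  then show ?thesis
    unfolding poincare_on_def using C(1) by (intro exI[of _ "2 * (norm p)\<^sup>2 + 2 * C"]) auto
qed

text \<open>
  The two constants for \<open>U\<close> and \<open>V\<close> are close to each other, since both are close to \<open>f\<close> on the
  overlap, which has positive measure.
\<close>

lemma poincare_on_Un:
  fixes \<Omega> :: "'a::euclidean_space set"
  assumes "open U" "open V" "bounded V" "U \<inter> V \<noteq> {}" "poincare_on \<Omega> U" "poincare_on \<Omega> V"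
  shows "poincare_on \<Omega> (U \<union> V)"
proof -
  obtain C1 where C1: "C1 \<ge> 0" "\<And>f S. f \<in> borel_measurable borel \<Longrightarrow> S > 0 \<Longrightarrow> diff_bound \<Omega> f S \<Longrightarrow>
     (\<exists>m. (\<integral>\<^sup>+x. indicator U x * ennreal ((f x - m)\<^sup>2) \<partial>lborel) \<le> ennreal (C1 * S))"
    using assms(5) unfolding poincare_on_def by blast
  obtain C2 where C2: "C2 \<ge> 0" "\<And>f S. f \<in> borel_measurable borel \<Longrightarrow> S > 0 \<Longrightarrow> diff_bound \<Omega> f S \<Longrightarrow>
     (\<exists>m. (\<integral>\<^sup>+x. indicator V x * ennreal ((f x - m)\<^sup>2) \<partial>lborel) \<le> ennreal (C2 * S))"
    using assms(6) unfolding poincare_on_def by blast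
  have [measurable]: "U \<in> sets borel" "V \<in> sets borel" using assms by auto
  define a where "a = measure lborel (U \<inter> V)"
  define v where "v = measure lborel V"
  have fin: "emeasure lborel V < \<infinity>" "emeasure lborel (U \<inter> V) < \<infinity>"
    using emeasure_bounded_finite[OF assms(3)] emeasure_bounded_finite[of "U \<inter> V"] bounded_subset[OF assms(3), of "U \<inter> V"] by auto
  have ea: "emeasure lborel (U \<inter> V) = ennreal a" and ev: "emeasure lborel V = ennreal v"
    using fin by (simp_all add: a_def v_def emeasure_eq_ennreal_measure)
  have "emeasure lborel (U \<inter> V) \<noteq> 0"
    using open_not_negligible[of "U \<inter> V"] assms(1,2,4) by (auto simp: negligible_iff_emeasure0 open_Int)
  then have a: "a > 0" using ea by (metis a_def ennreal_0 less_eq_real_def measure_nonneg)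
  define C where "C = C1 + 2 * C2 + 2 * (2 * (C1 + C2) / a) * v"
  have v: "v \<ge> 0" by (simp add: v_def)
  have "\<exists>m. (\<integral>\<^sup>+x. indicator (U \<union> V) x * ennreal ((f x - m)\<^sup>2) \<partial>lborel) \<le> ennreal (C * S)"
    if f[measurable]: "f \<in> borel_measurable borel" and S: "S > 0" and D: "diff_bound \<Omega> f S" for f S
  proof -
    obtain m where m: "(\<integral>\<^sup>+x. indicator U x * ennreal ((f x - m)\<^sup>2) \<partial>lborel) \<le> ennreal (C1 * S)"
      using C1(2)[OF f S D] by blast
    obtain n where n: "(\<integral>\<^sup>+x. indicator V x * ennreal ((f x - n)\<^sup>2) \<partial>lborel) \<le> ennreal (C2 * S)"
      using C2(2)[OF f S D] by blast
    have "ennreal ((n - m)\<^sup>2) * ennreal a = (\<integral>\<^sup>+x. ennreal ((n - m)\<^sup>2) * indicator (U \<inter> V) x \<partial>lborel)"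
      by (simp add: nn_integral_cmult_indicator ea)
    also have "\<dots> \<le> (\<integral>\<^sup>+x. 2 * (indicator U x * ennreal ((f x - m)\<^sup>2)) + 2 * (indicator V x * ennreal ((f x - n)\<^sup>2)) \<partial>lborel)"
    proof (rule nn_integral_mono)
      fix x
      have "ennreal ((n - m)\<^sup>2) \<le> 2 * ennreal ((f x - m)\<^sup>2) + 2 * ennreal ((f x - n)\<^sup>2)"
        using ennreal_sq_sum_le[of "f x - m" "n - f x"] by (simp add: power2_commute)
      then show "ennreal ((n - m)\<^sup>2) * indicator (U \<inter> V) x \<le> 2 * (indicator U x * ennreal ((f x - m)\<^sup>2)) + 2 * (indicator V x * ennreal ((f x - n)\<^sup>2))"
        by (auto simp: indicator_def)
    qed
    also have "\<dots> = 2 * (\<integral>\<^sup>+x. indicator U x * ennreal ((f x - m)\<^sup>2) \<partial>lborel)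
        + 2 * (\<integral>\<^sup>+x. indicator V x * ennreal ((f x - n)\<^sup>2) \<partial>lborel)"
      by (subst nn_integral_add) (auto simp: nn_integral_cmult)
    also have "\<dots> \<le> 2 * ennreal (C1 * S) + 2 * ennreal (C2 * S)"
      using m n by (intro add_mono mult_left_mono) auto
    also have "\<dots> = ennreal (2 * (C1 + C2) * S)"
      using S C1(1) C2(1) by (simp add: ennreal_plus ennreal_mult' distrib_right distrib_left mult.assoc)
    finally have "(n - m)\<^sup>2 * a \<le> 2 * (C1 + C2) * S"
      using a S C1(1) C2(1) by (simp add: ennreal_mult'[symmetric])
    then have nm: "(n - m)\<^sup>2 \<le> 2 * (C1 + C2) / a * S"
      using a by (simp add: pos_le_divide_eq)
    have "(\<integral>\<^sup>+x. indicator (U \<union> V) x * ennreal ((f x - m)\<^sup>2) \<partial>lborel) \<le>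
        (\<integral>\<^sup>+x. indicator U x * ennreal ((f x - m)\<^sup>2) + (2 * (indicator V x * ennreal ((f x - n)\<^sup>2)) + 2 * ennreal ((n - m)\<^sup>2) * indicator V x) \<partial>lborel)"
    proof (rule nn_integral_mono)
      fix x
      have "ennreal ((f x - m)\<^sup>2) \<le> 2 * ennreal ((f x - n)\<^sup>2) + 2 * ennreal ((n - m)\<^sup>2)"
        using ennreal_sq_sum_le[of "f x - n" "n - m"] by simp
      then show "indicator (U \<union> V) x * ennreal ((f x - m)\<^sup>2) \<le> indicator U x * ennreal ((f x - m)\<^sup>2) + (2 * (indicator V x * ennreal ((f x - n)\<^sup>2)) + 2 * ennreal ((n - m)\<^sup>2) * indicator V x)"
        by (auto simp: indicator_def intro: order_trans)
    qed
    also have "\<dots> = (\<integral>\<^sup>+x. indicator U x * ennreal ((f x - m)\<^sup>2) \<partial>lborel)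
        + (2 * (\<integral>\<^sup>+x. indicator V x * ennreal ((f x - n)\<^sup>2) \<partial>lborel) + 2 * ennreal ((n - m)\<^sup>2) * ennreal v)"
      by (subst nn_integral_add; (measurable)?) (subst nn_integral_add; auto simp: nn_integral_cmult nn_integral_cmult_indicator ev)
    also have "\<dots> \<le> ennreal (C1 * S) + (2 * ennreal (C2 * S) + 2 * ennreal (2 * (C1 + C2) / a * S) * ennreal v)"
      using m n nm by (intro add_mono mult_left_mono mult_right_mono ennreal_leI) auto
    also have "\<dots> = ennreal (C * S)"
    proof -
      have "ennreal (C1 * S) + (2 * ennreal (C2 * S) + 2 * ennreal (2 * (C1 + C2) / a * S) * ennreal v) =
          ennreal (C1 * S + (2 * (C2 * S) + 2 * (2 * (C1 + C2) / a * S) * v))"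
      proof -
        have "ennreal x + (2 * ennreal y + 2 * ennreal k * ennreal v) = ennreal (x + (2 * y + 2 * k * v))"
          if "0 \<le> x" "0 \<le> y" "0 \<le> k" for x y k
          using that v by (simp add: ennreal_plus ennreal_mult)
        from this[of "C1 * S" "C2 * S" "2 * (C1 + C2) / a * S"] show ?thesis
          using S C1(1) C2(1) a by simp
      qed
      also have "C1 * S + (2 * (C2 * S) + 2 * (2 * (C1 + C2) / a * S) * v) = C * S"
        by (simp add: C_def algebra_simps)
      finally show ?thesis .
    qed
    finally show ?thesis by blast
  qed
  moreover have "C \<ge> 0" unfolding C_def using C1(1) C2(1) a v by simp
  ultimately show ?thesis unfolding poincare_on_def by blast
qed

text \<open>
  The axis of the cone shifts the boundary part into the ball \<open>ball (x + p) \<rho>\<close>, which lies in \<open>\<Omega>\<close>.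
\<close>

lemma cone_at_poincare:
  assumes "open \<Omega>" "cone_at \<Omega> V p \<rho>" "x \<in> V" "x \<in> closure \<Omega>"
  shows "poincare_on \<Omega> (\<Omega> \<inter> V \<inter> ball x \<rho>)"
proof (rule poincare_on_shift)
  have \<rho>: "\<rho> > 0" and V: "open V" using assms(2) by (auto simp: cone_at_def)
  show "open (\<Omega> \<inter> V \<inter> ball x \<rho>)" using assms(1) V by auto
  show "poincare_on \<Omega> (ball (x + p) \<rho>)"
    by (rule poincare_on_ball[OF cone_at_ball[OF assms(2-4)] \<rho>])
  show "y + s *\<^sub>R p \<in> \<Omega>" if "y \<in> \<Omega> \<inter> V \<inter> ball x \<rho>" "0 \<le> s" "s \<le> 1" for y s
    by (rule cone_atD[OF assms(2)]) (use that \<rho> in auto)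
  show "y + p \<in> ball (x + p) \<rho>" if "y \<in> \<Omega> \<inter> V \<inter> ball x \<rho>" for y
    using that by (simp add: dist_norm)
qed auto

text \<open>
  A maximal subfamily with the Poincare inequality is the whole family: by connectedness, a proper
  subfamily meets one of the remaining sets.
\<close>

lemma poincare_on_Union:
  assumes fin: "finite \<U>" and op: "\<And>U. U \<in> \<U> \<Longrightarrow> open U \<and> U \<noteq> {} \<and> bounded U \<and> poincare_on \<Omega> U"
    and conn: "connected (\<Union>\<U>)" and ne: "\<U> \<noteq> {}"
  shows "poincare_on \<Omega> (\<Union>\<U>)"
proof -
  define \<J> where "\<J> = {J. J \<subseteq> \<U> \<and> J \<noteq> {} \<and> poincare_on \<Omega> (\<Union>J)}"
  obtain U0 where U0: "U0 \<in> \<U>" using ne by blast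
  then have "{U0} \<in> \<J>" using op by (auto simp: \<J>_def)
  moreover have "finite \<J>"
    using fin by (auto simp: \<J>_def intro: finite_subset[of _ "Pow \<U>"])
  ultimately have fJ: "finite (card ` \<J>)" "card ` \<J> \<noteq> {}" by auto
  from Max_in[OF this] obtain J where J: "J \<in> \<J>" "card J = Max (card ` \<J>)" by auto
  then have max: "card J' \<le> card J" if "J' \<in> \<J>" for J'
    using Max_ge[OF fJ(1)] that by simp
  have Jsub: "J \<subseteq> \<U>" "J \<noteq> {}" "poincare_on \<Omega> (\<Union>J)" using J(1) by (auto simp: \<J>_def)
  have finJ: "finite J" using Jsub(1) fin by (rule finite_subset)
  have "J = \<U>"
  proof (rule ccontr)
    assume "J \<noteq> \<U>"
    then obtain W where W: "W \<in> \<U> - J" using Jsub by blast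
    have o1: "open (\<Union>J)" and o2: "open (\<Union>(\<U> - J))"
      using op Jsub(1) by (intro open_Union ballI; blast)+
    have "\<Union>J \<inter> \<Union>(\<U> - J) \<noteq> {}"
    proof
      assume dis: "\<Union>J \<inter> \<Union>(\<U> - J) = {}"
      have "\<Union>J \<inter> \<Union>(\<U> - J) \<inter> \<Union>\<U> = {}" using dis by blast
      moreover have "\<Union>\<U> \<subseteq> \<Union>J \<union> \<Union>(\<U> - J)" by blast
      ultimately have "\<Union>J \<inter> \<Union>\<U> = {} \<or> \<Union>(\<U> - J) \<inter> \<Union>\<U> = {}"
        by (rule connectedD[OF conn o1 o2])
      moreover have "\<Union>J \<inter> \<Union>\<U> \<noteq> {}" using Jsub op by blast
      moreover have "\<Union>(\<U> - J) \<inter> \<Union>\<U> \<noteq> {}" using W op by blast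
      ultimately show False by blast
    qed
    then obtain A where A: "A \<in> \<U>" "A \<notin> J" "\<Union>J \<inter> A \<noteq> {}" by blast
    have "poincare_on \<Omega> (\<Union>J \<union> A)"
      using A op[OF A(1)] Jsub o1 by (intro poincare_on_Un) auto
    moreover have "\<Union>J \<union> A = \<Union>(insert A J)" by blast
    ultimately have "insert A J \<in> \<J>" using A Jsub by (auto simp: \<J>_def)
    then have "card (insert A J) \<le> card J" by (rule max)
    then show False using A finJ by simp
  qed
  then show ?thesis using Jsub by simp
qed

lemma C11_domain_cone_cover:
  assumes "bounded_C11_domain \<Omega>"
  shows "\<exists>I V p \<rho>. finite (I :: 'a::euclidean_space set) \<and> (\<forall>x\<in>I. x \<in> closure \<Omega> \<and> x \<in> V x \<and> cone_at \<Omega> (V x) (p x) (\<rho> x)) \<and>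
    \<Omega> \<subseteq> (\<Union>x\<in>I. V x \<inter> ball x (\<rho> x))"
proof -
  have "\<forall>x\<in>closure \<Omega>. \<exists>V p \<rho>. x \<in> V \<and> cone_at \<Omega> V p \<rho>"
    using cone_at_closure[OF assms] by blast
  then obtain V where "\<forall>x\<in>closure \<Omega>. \<exists>p \<rho>. x \<in> V x \<and> cone_at \<Omega> (V x) p \<rho>"
    unfolding bchoice_iff by blast
  then obtain p where "\<forall>x\<in>closure \<Omega>. \<exists>\<rho>. x \<in> V x \<and> cone_at \<Omega> (V x) (p x) \<rho>"
    unfolding bchoice_iff by blast
  then obtain \<rho> where \<rho>: "\<forall>x\<in>closure \<Omega>. x \<in> V x \<and> cone_at \<Omega> (V x) (p x) (\<rho> x)"
    unfolding bchoice_iff by blast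
  have "compact (closure \<Omega>)" using assms by (simp add: bounded_C11_domain_def compact_closure)
  moreover have "open (V x \<inter> ball x (\<rho> x))" if "x \<in> closure \<Omega>" for x
    using \<rho> that by (auto simp: cone_at_def)
  moreover have "closure \<Omega> \<subseteq> (\<Union>x\<in>closure \<Omega>. V x \<inter> ball x (\<rho> x))"
    using \<rho> by (auto simp: cone_at_def)
  ultimately obtain I where I: "I \<subseteq> closure \<Omega>" "finite I" "closure \<Omega> \<subseteq> (\<Union>x\<in>I. V x \<inter> ball x (\<rho> x))"
    using compactE_image[of "closure \<Omega>" "closure \<Omega>" "\<lambda>x. V x \<inter> ball x (\<rho> x)"] by blast
  have "\<Omega> \<subseteq> (\<Union>x\<in>I. V x \<inter> ball x (\<rho> x))" using I(3) closure_subset by blast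
  moreover have "\<forall>x\<in>I. x \<in> closure \<Omega> \<and> x \<in> V x \<and> cone_at \<Omega> (V x) (p x) (\<rho> x)"
    using I(1) \<rho> by blast
  ultimately show ?thesis using I(2) by blast
qed

theorem poincare_C11_domain:
  assumes "bounded_C11_domain \<Omega>"
  shows "poincare_on \<Omega> \<Omega>"
proof -
  have \<Omega>: "open \<Omega>" "connected \<Omega>" "\<Omega> \<noteq> {}" "bounded \<Omega>"
    using assms by (auto simp: bounded_C11_domain_def)
  obtain I V p \<rho> where I: "finite I" "\<And>x. x \<in> I \<Longrightarrow> x \<in> closure \<Omega> \<and> x \<in> V x \<and> cone_at \<Omega> (V x) (p x) (\<rho> x)"
      "\<Omega> \<subseteq> (\<Union>x\<in>I. V x \<inter> ball x (\<rho> x))"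
    using C11_domain_cone_cover[OF assms] by blast
  define \<U> where "\<U> = (\<lambda>x. \<Omega> \<inter> V x \<inter> ball x (\<rho> x)) ` I - {{}}"
  have un: "\<Union>\<U> = \<Omega>" using I(3) unfolding \<U>_def by blast
  have "poincare_on \<Omega> (\<Union>\<U>)"
  proof (rule poincare_on_Union)
    show "finite \<U>" using I(1) by (simp add: \<U>_def)
    show "connected (\<Union>\<U>)" using un \<Omega> by simp
    show "\<U> \<noteq> {}" using un \<Omega> by auto
    fix U assume "U \<in> \<U>"
    then obtain x where x: "x \<in> I" "U = \<Omega> \<inter> V x \<inter> ball x (\<rho> x)" "U \<noteq> {}"
      by (auto simp: \<U>_def)
    have "open U" unfolding x(2) using I(2)[OF x(1)] \<Omega>(1) by (auto simp: cone_at_def)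
    moreover have "bounded U" unfolding x(2) using \<Omega>(4) by (meson bounded_Int)
    moreover have "poincare_on \<Omega> U" unfolding x(2) using I(2)[OF x(1)] cone_at_poincare[OF \<Omega>(1)] by blast
    ultimately show "open U \<and> U \<noteq> {} \<and> bounded U \<and> poincare_on \<Omega> U" using x(3) by blast
  qed
  then show ?thesis unfolding un .
qed

section \<open>The logarithmic Sobolev inequality\<close>

lemma nn_integral_lborel_affine:
  fixes f :: "'a::euclidean_space \<Rightarrow> ennreal"
  assumes [measurable]: "f \<in> borel_measurable borel" and r: "r > 0"
  shows "(\<integral>\<^sup>+\<zeta>. f (x + r *\<^sub>R \<zeta>) \<partial>lborel) = ennreal (1 / r ^ DIM('a)) * (\<integral>\<^sup>+y. f y \<partial>lborel)"
proof -
  have "(\<integral>\<^sup>+y. f y \<partial>lborel) = (\<integral>\<^sup>+y. f y \<partial>density (distr lborel borel (\<lambda>\<zeta>. x + r *\<^sub>R \<zeta>)) (\<lambda>_. ennreal (\<bar>r\<bar> ^ DIM('a))))"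
    using r by (subst lborel_affine[of r x]) auto
  also have "\<dots> = ennreal (r ^ DIM('a)) * (\<integral>\<^sup>+\<zeta>. f (x + r *\<^sub>R \<zeta>) \<partial>lborel)"
    using r by (simp add: nn_integral_density nn_integral_distr nn_integral_cmult)
  finally have "ennreal (1 / r ^ DIM('a)) * (\<integral>\<^sup>+y. f y \<partial>lborel) =
      (ennreal (1 / r ^ DIM('a)) * ennreal (r ^ DIM('a))) * (\<integral>\<^sup>+\<zeta>. f (x + r *\<^sub>R \<zeta>) \<partial>lborel)"
    by (simp add: mult.assoc)
  also have "ennreal (1 / r ^ DIM('a)) * ennreal (r ^ DIM('a)) = 1"
    using r by (simp add: ennreal_mult'[symmetric])
  finally show ?thesis by simp
qed

text \<open>
  Compare \<open>f x\<close> with its values at \<open>x + r \<zeta>\<close>, where \<open>\<zeta>\<close> ranges over the ball \<open>B\<close> of the cone. On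
  average over \<open>\<zeta>\<close> the squares \<open>(f (x + r \<zeta>))\<^sup>2\<close> are at most \<open>\<Sigma> / (|B| r\<^sup>d)\<close>, where \<open>d\<close> is the
  dimension. Where \<open>(f x)\<^sup>2\<close> exceeds a large multiple of this, it is bounded by the average of the
  squared differences, whose integral over \<open>x\<close> is of order \<open>r\<^sup>2 S\<close>.
\<close>

lemma cone_level_set_estimate:
  fixes \<Omega> :: "'a::euclidean_space set"
  assumes "open \<Omega>" and cone: "cone_at \<Omega> V p \<rho>" and [measurable]: "f \<in> borel_measurable borel" and D: "diff_bound \<Omega> f S"
    and S: "S > 0" and \<Sigma>: "(\<integral>\<^sup>+x. indicator \<Omega> x * ennreal ((f x)\<^sup>2) \<partial>lborel) \<le> ennreal \<Sigma>" "\<Sigma> > 0"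
    and r: "0 < r" "r \<le> 1" and K: "4 / measure lborel (ball p \<rho>) \<le> K"
  shows "(\<integral>\<^sup>+x. indicator (\<Omega> \<inter> V) x * (if K * \<Sigma> / r ^ DIM('a) \<le> (f x)\<^sup>2 then ennreal ((f x)\<^sup>2) else 0) \<partial>lborel)
    \<le> ennreal (4 * (norm p + \<rho>)\<^sup>2 * S * r\<^sup>2)"
proof -
  let ?B = "ball p \<rho>"
  have \<rho>: "\<rho> > 0" and V: "open V" using cone by (auto simp: cone_at_def)
  have [measurable]: "?B \<in> sets borel" "\<Omega> \<in> sets borel" "V \<in> sets borel" using assms(1) V by auto
  define \<beta> where "\<beta> = measure lborel ?B"
  have \<beta>: "\<beta> > 0" unfolding \<beta>_def using content_ball_pos[OF \<rho>, of p] by simp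
  have e\<beta>: "emeasure lborel ?B = ennreal \<beta>"
    unfolding \<beta>_def using emeasure_bounded_finite[of ?B] by (intro emeasure_eq_ennreal_measure) auto
  define A where "A x = (\<integral>\<^sup>+\<zeta>. indicator ?B \<zeta> * ennreal ((f (x + r *\<^sub>R \<zeta>) - f x)\<^sup>2) \<partial>lborel)" for x
  have pw: "(if K * \<Sigma> / r ^ DIM('a) \<le> (f x)\<^sup>2 then ennreal ((f x)\<^sup>2) else 0) \<le> ennreal (4 / \<beta>) * A x" if x: "x \<in> \<Omega> \<inter> V" for x
  proof (cases "K * \<Sigma> / r ^ DIM('a) \<le> (f x)\<^sup>2 \<and> A x < \<infinity>")
    case True
    then obtain a where a: "A x = ennreal a" "a \<ge> 0" by (cases "A x") auto
    have sum: "(f x)\<^sup>2 * \<beta> \<le> 2 * a + 2 * (\<Sigma> / r ^ DIM('a))"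
    proof -
      have "ennreal ((f x)\<^sup>2) * ennreal \<beta> = (\<integral>\<^sup>+\<zeta>. ennreal ((f x)\<^sup>2) * indicator ?B \<zeta> \<partial>lborel)"
        by (simp add: nn_integral_cmult_indicator e\<beta>)
      also have "\<dots> \<le> (\<integral>\<^sup>+\<zeta>. 2 * (indicator ?B \<zeta> * ennreal ((f (x + r *\<^sub>R \<zeta>) - f x)\<^sup>2)) + 2 * (indicator \<Omega> (x + r *\<^sub>R \<zeta>) * ennreal ((f (x + r *\<^sub>R \<zeta>))\<^sup>2)) \<partial>lborel)"
      proof (rule nn_integral_mono)
        fix \<zeta>
        have "ennreal ((f x)\<^sup>2) \<le> 2 * ennreal ((f (x + r *\<^sub>R \<zeta>) - f x)\<^sup>2) + 2 * ennreal ((f (x + r *\<^sub>R \<zeta>))\<^sup>2)"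
          using ennreal_sq_sum_le[of "f x - f (x + r *\<^sub>R \<zeta>)" "f (x + r *\<^sub>R \<zeta>)"] by (simp add: power2_commute)
        moreover have "x + r *\<^sub>R \<zeta> \<in> \<Omega>" if "\<zeta> \<in> ?B"
          using that x r by (intro cone_atD[OF cone]) auto
        ultimately show "ennreal ((f x)\<^sup>2) * indicator ?B \<zeta> \<le> 2 * (indicator ?B \<zeta> * ennreal ((f (x + r *\<^sub>R \<zeta>) - f x)\<^sup>2)) + 2 * (indicator \<Omega> (x + r *\<^sub>R \<zeta>) * ennreal ((f (x + r *\<^sub>R \<zeta>))\<^sup>2))"
          by (auto simp: indicator_def)
      qed
      also have "\<dots> = 2 * A x + 2 * (\<integral>\<^sup>+\<zeta>. indicator \<Omega> (x + r *\<^sub>R \<zeta>) * ennreal ((f (x + r *\<^sub>R \<zeta>))\<^sup>2) \<partial>lborel)"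
        unfolding A_def by (subst nn_integral_add) (auto simp: nn_integral_cmult)
      also have "(\<integral>\<^sup>+\<zeta>. indicator \<Omega> (x + r *\<^sub>R \<zeta>) * ennreal ((f (x + r *\<^sub>R \<zeta>))\<^sup>2) \<partial>lborel) =
          ennreal (1 / r ^ DIM('a)) * (\<integral>\<^sup>+y. indicator \<Omega> y * ennreal ((f y)\<^sup>2) \<partial>lborel)"
        by (rule nn_integral_lborel_affine[OF _ r(1)]) measurable
      also have "2 * A x + 2 * \<dots> \<le> 2 * ennreal a + 2 * (ennreal (1 / r ^ DIM('a)) * ennreal \<Sigma>)"
        using a \<Sigma>(1) by (intro add_mono mult_left_mono) auto
      also have "\<dots> = ennreal (2 * a + 2 * (\<Sigma> / r ^ DIM('a)))"
      proof -
        have "2 * ennreal u + 2 * ennreal v = ennreal (2 * u + 2 * v)" if "0 \<le> u" "0 \<le> v" for u v :: real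
          using that by (simp add: ennreal_plus ennreal_mult)
        moreover have "ennreal (1 / r ^ DIM('a)) * ennreal \<Sigma> = ennreal (\<Sigma> / r ^ DIM('a))"
          using \<Sigma>(2) r by (simp add: ennreal_mult'[symmetric])
        ultimately show ?thesis using a \<Sigma>(2) r by simp
      qed
      finally have "ennreal ((f x)\<^sup>2 * \<beta>) \<le> ennreal (2 * a + 2 * (\<Sigma> / r ^ DIM('a)))"
        by (simp add: ennreal_mult')
      then show ?thesis
        by (rule ennreal_le_iff[THEN iffD1, rotated]) (use a \<Sigma>(2) r in simp)
    qed
    have "4 / \<beta> * (\<Sigma> / r ^ DIM('a)) \<le> K * (\<Sigma> / r ^ DIM('a))"
      using K \<Sigma>(2) r by (intro mult_right_mono) (auto simp: \<beta>_def)
    then have "4 / \<beta> * (\<Sigma> / r ^ DIM('a)) \<le> (f x)\<^sup>2" using True by simp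
    from mult_right_mono[OF this, of \<beta>] have "4 * (\<Sigma> / r ^ DIM('a)) \<le> (f x)\<^sup>2 * \<beta>" using \<beta> by simp
    with sum have "(f x)\<^sup>2 * \<beta> \<le> 4 * a" by linarith
    then have "(f x)\<^sup>2 \<le> 4 / \<beta> * a" using \<beta> by (simp add: field_simps)
    then have "ennreal ((f x)\<^sup>2) \<le> ennreal (4 / \<beta> * a)" by (rule ennreal_leI)
    also have "\<dots> = ennreal (4 / \<beta>) * A x" unfolding a(1) using a(2) \<beta> by (intro ennreal_mult) auto
    finally show ?thesis by simp
  next
    case False
    then consider "\<not> K * \<Sigma> / r ^ DIM('a) \<le> (f x)\<^sup>2" | "A x = \<infinity>" by (auto simp: less_top[symmetric])
    then show ?thesis using \<beta> by cases (auto simp: ennreal_mult_eq_top_iff ennreal_mult_top)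
  qed
  have "(\<integral>\<^sup>+x. indicator (\<Omega> \<inter> V) x * (if K * \<Sigma> / r ^ DIM('a) \<le> (f x)\<^sup>2 then ennreal ((f x)\<^sup>2) else 0) \<partial>lborel)
      \<le> (\<integral>\<^sup>+x. ennreal (4 / \<beta>) * (\<integral>\<^sup>+\<zeta>. indicator (\<Omega> \<inter> V) x * (indicator ?B \<zeta> * ennreal ((f (x + r *\<^sub>R \<zeta>) - f x)\<^sup>2)) \<partial>lborel) \<partial>lborel)"
  proof (rule nn_integral_mono)
    fix x
    show "indicator (\<Omega> \<inter> V) x * (if K * \<Sigma> / r ^ DIM('a) \<le> (f x)\<^sup>2 then ennreal ((f x)\<^sup>2) else 0)
      \<le> ennreal (4 / \<beta>) * (\<integral>\<^sup>+\<zeta>. indicator (\<Omega> \<inter> V) x * (indicator ?B \<zeta> * ennreal ((f (x + r *\<^sub>R \<zeta>) - f x)\<^sup>2)) \<partial>lborel)"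
    proof (cases "x \<in> \<Omega> \<inter> V")
      case True
      then show ?thesis using pw[OF True] unfolding A_def by simp
    qed simp
  qed
  also have "\<dots> = ennreal (4 / \<beta>) * (\<integral>\<^sup>+x. (\<integral>\<^sup>+\<zeta>. indicator (\<Omega> \<inter> V) x * (indicator ?B \<zeta> * ennreal ((f (x + r *\<^sub>R \<zeta>) - f x)\<^sup>2)) \<partial>lborel) \<partial>lborel)"
    by (rule nn_integral_cmult) measurable
  also have "(\<integral>\<^sup>+x. (\<integral>\<^sup>+\<zeta>. indicator (\<Omega> \<inter> V) x * (indicator ?B \<zeta> * ennreal ((f (x + r *\<^sub>R \<zeta>) - f x)\<^sup>2)) \<partial>lborel) \<partial>lborel)
      = (\<integral>\<^sup>+\<zeta>. (\<integral>\<^sup>+x. indicator (\<Omega> \<inter> V) x * (indicator ?B \<zeta> * ennreal ((f (x + r *\<^sub>R \<zeta>) - f x)\<^sup>2)) \<partial>lborel) \<partial>lborel)"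
    by (rule lborel_pair.Fubini') measurable
  also have "ennreal (4 / \<beta>) * \<dots> \<le> ennreal (4 / \<beta>) * (\<integral>\<^sup>+\<zeta>. ennreal (r\<^sup>2 * (norm p + \<rho>)\<^sup>2 * S) * indicator ?B \<zeta> \<partial>lborel)"
  proof (intro mult_left_mono nn_integral_mono)
    fix \<zeta>
    show "(\<integral>\<^sup>+x. indicator (\<Omega> \<inter> V) x * (indicator ?B \<zeta> * ennreal ((f (x + r *\<^sub>R \<zeta>) - f x)\<^sup>2)) \<partial>lborel)
        \<le> ennreal (r\<^sup>2 * (norm p + \<rho>)\<^sup>2 * S) * indicator ?B \<zeta>"
    proof (cases "\<zeta> \<in> ?B")
      case True
      have seg: "\<forall>x\<in>\<Omega> \<inter> V. \<forall>s\<in>{0..1}. x + s *\<^sub>R (r *\<^sub>R \<zeta>) \<in> \<Omega>"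
      proof (intro ballI)
        fix x and s :: real assume "x \<in> \<Omega> \<inter> V" "s \<in> {0..1}"
        then have "x + (s * r) *\<^sub>R \<zeta> \<in> \<Omega>"
          using True r by (intro cone_atD[OF cone]) (auto simp: mult_le_one)
        then show "x + s *\<^sub>R (r *\<^sub>R \<zeta>) \<in> \<Omega>" by simp
      qed
      have "(\<integral>\<^sup>+x. indicator (\<Omega> \<inter> V) x * (indicator ?B \<zeta> * ennreal ((f (x + r *\<^sub>R \<zeta>) - f x)\<^sup>2)) \<partial>lborel)
          = (\<integral>\<^sup>+x. indicator (\<Omega> \<inter> V) x * ennreal ((f (x + r *\<^sub>R \<zeta>) - f x)\<^sup>2) \<partial>lborel)"
        using True by simp
      also have "\<dots> \<le> ennreal ((norm (r *\<^sub>R \<zeta>))\<^sup>2 * S)"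
        using D seg open_Int[OF assms(1) V] unfolding diff_bound_def by blast
      also have "\<dots> \<le> ennreal (r\<^sup>2 * (norm p + \<rho>)\<^sup>2 * S)"
      proof (intro ennreal_leI mult_right_mono)
        have "norm \<zeta> \<le> norm p + \<rho>"
          using True norm_triangle_sub[of \<zeta> p] by (simp add: dist_norm norm_minus_commute)
        then have "(norm \<zeta>)\<^sup>2 \<le> (norm p + \<rho>)\<^sup>2" by (intro power_mono) auto
        then show "(norm (r *\<^sub>R \<zeta>))\<^sup>2 \<le> r\<^sup>2 * (norm p + \<rho>)\<^sup>2"
          by (simp add: power_mult_distrib mult_left_mono)
      qed (use S in simp)
      finally show ?thesis using True by simp
    qed simp
  qed auto
  also have "\<dots> = ennreal (4 / \<beta>) * (ennreal (r\<^sup>2 * (norm p + \<rho>)\<^sup>2 * S) * ennreal \<beta>)"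
    by (simp add: nn_integral_cmult_indicator e\<beta>)
  also have "\<dots> = ennreal (4 / \<beta> * (r\<^sup>2 * (norm p + \<rho>)\<^sup>2 * S * \<beta>))"
  proof -
    have "ennreal u * (ennreal v * ennreal w) = ennreal (u * (v * w))" if "0 \<le> u" "0 \<le> v" "0 \<le> w" for u v w
      using that by (simp add: ennreal_mult)
    then show ?thesis using \<beta> S by simp
  qed
  also have "4 / \<beta> * (r\<^sup>2 * (norm p + \<rho>)\<^sup>2 * S * \<beta>) = 4 * (norm p + \<rho>)\<^sup>2 * S * r\<^sup>2"
    using \<beta> by (simp add: field_simps)
  finally show ?thesis .
qed

lemma C11_domain_level_sets:
  fixes \<Omega> :: "'a::euclidean_space set"
  assumes "bounded_C11_domain \<Omega>"
  shows "\<exists>K>0. \<exists>C>0. \<forall>f S \<Sigma> r. f \<in> borel_measurable borel \<longrightarrow> diff_bound \<Omega> f S \<longrightarrow> S > 0 \<longrightarrow>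
    (\<integral>\<^sup>+x. indicator \<Omega> x * ennreal ((f x)\<^sup>2) \<partial>lborel) \<le> ennreal \<Sigma> \<longrightarrow> \<Sigma> > 0 \<longrightarrow> 0 < r \<longrightarrow> r \<le> 1 \<longrightarrow>
    (\<integral>\<^sup>+x. indicator \<Omega> x * (if K * \<Sigma> / r ^ DIM('a) \<le> (f x)\<^sup>2 then ennreal ((f x)\<^sup>2) else 0) \<partial>lborel)
    \<le> ennreal (C * S * r\<^sup>2)"
proof -
  have \<Omega>: "open \<Omega>" "\<Omega> \<noteq> {}" using assms by (auto simp: bounded_C11_domain_def)
  have [measurable]: "\<Omega> \<in> sets borel" using \<Omega>(1) by simp
  obtain I V p \<rho> where I: "finite I" "\<And>x. x \<in> I \<Longrightarrow> x \<in> closure \<Omega> \<and> x \<in> V x \<and> cone_at \<Omega> (V x) (p x) (\<rho> x)"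
      "\<Omega> \<subseteq> (\<Union>x\<in>I. V x \<inter> ball x (\<rho> x))"
    using C11_domain_cone_cover[OF assms] by blast
  define K where "K = 1 + (\<Sum>i\<in>I. 4 / measure lborel (ball (p i) (\<rho> i)))"
  define C where "C = 1 + (\<Sum>i\<in>I. 4 * (norm (p i) + \<rho> i)\<^sup>2)"
  have K: "4 / measure lborel (ball (p i) (\<rho> i)) \<le> K" if "i \<in> I" for i
  proof -
    have "4 / measure lborel (ball (p i) (\<rho> i)) \<le> (\<Sum>i\<in>I. 4 / measure lborel (ball (p i) (\<rho> i)))"
      using I(1) that by (intro member_le_sum) auto
    then show ?thesis by (simp add: K_def)
  qed
  have K0: "K > 0" unfolding K_def by (intro add_pos_nonneg sum_nonneg) auto
  have C0: "C > 0" unfolding C_def by (intro add_pos_nonneg sum_nonneg) auto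
  have "(\<integral>\<^sup>+x. indicator \<Omega> x * (if K * \<Sigma> / r ^ DIM('a) \<le> (f x)\<^sup>2 then ennreal ((f x)\<^sup>2) else 0) \<partial>lborel)
    \<le> ennreal (C * S * r\<^sup>2)"
    if f[measurable]: "f \<in> borel_measurable borel" and D: "diff_bound \<Omega> f S" and S: "S > 0"
      and \<Sigma>: "(\<integral>\<^sup>+x. indicator \<Omega> x * ennreal ((f x)\<^sup>2) \<partial>lborel) \<le> ennreal \<Sigma>" "\<Sigma> > 0" and r: "0 < r" "r \<le> 1" for f S \<Sigma> r
  proof -
    let ?h = "\<lambda>x. if K * \<Sigma> / r ^ DIM('a) \<le> (f x)\<^sup>2 then ennreal ((f x)\<^sup>2) else 0"
    have Vm: "V i \<in> sets borel" if "i \<in> I" for i using I(2)[OF that] by (auto simp: cone_at_def)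
    have "(\<integral>\<^sup>+x. indicator \<Omega> x * ?h x \<partial>lborel) \<le> (\<integral>\<^sup>+x. (\<Sum>i\<in>I. indicator (\<Omega> \<inter> V i) x * ?h x) \<partial>lborel)"
    proof (rule nn_integral_mono)
      fix x
      show "indicator \<Omega> x * ?h x \<le> (\<Sum>i\<in>I. indicator (\<Omega> \<inter> V i) x * ?h x)"
      proof (cases "x \<in> \<Omega>")
        case True
        then obtain i where i: "i \<in> I" "x \<in> V i" using I(3) by blast
        have "indicator (\<Omega> \<inter> V i) x * ?h x \<le> (\<Sum>i\<in>I. indicator (\<Omega> \<inter> V i) x * ?h x)"
          using I(1) i by (intro member_le_sum) auto
        then show ?thesis using True i by simp
      qed simp
    qed
    also have "\<dots> = (\<Sum>i\<in>I. \<integral>\<^sup>+x. indicator (\<Omega> \<inter> V i) x * ?h x \<partial>lborel)"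
    proof (rule nn_integral_sum)
      fix i assume "i \<in> I"
      from Vm[OF this] have [measurable]: "V i \<in> sets borel" .
      show "(\<lambda>x. indicator (\<Omega> \<inter> V i) x * ?h x) \<in> borel_measurable lborel" by measurable
    qed
    also have "\<dots> \<le> (\<Sum>i\<in>I. ennreal (4 * (norm (p i) + \<rho> i)\<^sup>2 * S * r\<^sup>2))"
      using I(2) K by (intro sum_mono cone_level_set_estimate[OF \<Omega>(1) _ f D S \<Sigma> r]) auto
    also have "\<dots> = ennreal (\<Sum>i\<in>I. 4 * (norm (p i) + \<rho> i)\<^sup>2 * S * r\<^sup>2)"
      using S by (intro sum_ennreal) auto
    also have "\<dots> \<le> ennreal (C * S * r\<^sup>2)"
      using S by (intro ennreal_leI) (simp add: C_def sum_distrib_right[symmetric] distrib_right)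
    finally show ?thesis .
  qed
  then show ?thesis using K0 C0 by blast
qed

definition lnplus :: "real \<Rightarrow> real" where "lnplus x = (if x \<ge> 1 then ln x else 0)"

text \<open>
  Counts the dyadic levels below \<open>x\<close>; the exponent \<open>d\<close> matches the levels \<open>r\<^sup>-\<^sup>d\<close> for \<open>r = 2\<^sup>-\<^sup>k\<close>.
\<close>

lemma lnplus_le_levels:
  assumes "d > 0"
  shows "ennreal (lnplus x) \<le> ennreal (real d * ln 2) * (\<Sum>k. if 2 ^ (d * k) \<le> x then 1 else (0::ennreal))"
proof (cases "x \<ge> 1")
  case True
  define n where "n = nat \<lfloor>ln x / (real d * ln 2)\<rfloor>"
  have pos: "real d * ln 2 > 0" using assms by simp
  have q: "ln x / (real d * ln 2) \<ge> 0" using True pos by simp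
  have n1: "real n \<le> ln x / (real d * ln 2)" and n2: "ln x / (real d * ln 2) < real n + 1"
    using q by (simp_all add: n_def)
  have lev: "2 ^ (d * k) \<le> x" if "k \<le> n" for k
  proof -
    have "real (d * k) * ln 2 \<le> real d * ln 2 * real n" using that assms by (simp add: mult_left_mono)
    also have "\<dots> \<le> ln x" using n1 pos by (simp add: pos_le_divide_eq mult.commute)
    finally have "ln (2 ^ (d * k)) \<le> ln x" by (simp add: ln_realpow)
    then show ?thesis using True by (subst (asm) ln_le_cancel_iff) auto
  qed
  have "ln x \<le> real d * ln 2 * real (Suc n)" using n2 pos by (simp add: pos_divide_less_eq mult.commute add.commute)
  then have "ennreal (lnplus x) \<le> ennreal (real d * ln 2 * real (Suc n))" using True by (simp add: lnplus_def ennreal_leI del: of_nat_Suc)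
  also have "\<dots> = ennreal (real d * ln 2) * of_nat (Suc n)"
    using pos by (subst ennreal_mult) (auto simp: ennreal_of_nat_eq_real_of_nat)
  also have "(of_nat (Suc n) :: ennreal) = (\<Sum>k<Suc n. if 2 ^ (d * k) \<le> x then 1 else 0)"
    using lev by simp
  also have "\<dots> \<le> (\<Sum>k. if 2 ^ (d * k) \<le> x then 1 else (0::ennreal))"
    by (rule sum_le_suminf) auto
  finally show ?thesis by (simp add: mult_left_mono)
qed (simp add: lnplus_def)

text \<open>
  Sum of the level set estimates over \<open>r = 2\<^sup>-\<^sup>k\<close>; the series of \<open>r\<^sup>2\<close> converges.
\<close>

lemma C11_domain_square_log_estimate:
  fixes \<Omega> :: "'a::euclidean_space set"
  assumes "bounded_C11_domain \<Omega>"
  shows "\<exists>K>0. \<exists>C>0. \<forall>f S \<Sigma>. f \<in> borel_measurable borel \<longrightarrow> diff_bound \<Omega> f S \<longrightarrow> S > 0 \<longrightarrow>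
    (\<integral>\<^sup>+x. indicator \<Omega> x * ennreal ((f x)\<^sup>2) \<partial>lborel) \<le> ennreal \<Sigma> \<longrightarrow> \<Sigma> > 0 \<longrightarrow>
    (\<integral>\<^sup>+x. indicator \<Omega> x * ennreal ((f x)\<^sup>2 * lnplus ((f x)\<^sup>2 / (K * \<Sigma>))) \<partial>lborel) \<le> ennreal (C * S)"
proof -
  obtain K C where K: "K > 0" and C: "C > 0" and lev: "\<And>f S \<Sigma> r. f \<in> borel_measurable borel \<Longrightarrow> diff_bound \<Omega> f S \<Longrightarrow> S > 0 \<Longrightarrow>
    (\<integral>\<^sup>+x. indicator \<Omega> x * ennreal ((f x)\<^sup>2) \<partial>lborel) \<le> ennreal \<Sigma> \<Longrightarrow> \<Sigma> > 0 \<Longrightarrow> 0 < r \<Longrightarrow> r \<le> 1 \<Longrightarrow>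
    (\<integral>\<^sup>+x. indicator \<Omega> x * (if K * \<Sigma> / r ^ DIM('a) \<le> (f x)\<^sup>2 then ennreal ((f x)\<^sup>2) else 0) \<partial>lborel)
    \<le> ennreal (C * S * r\<^sup>2)"
    using C11_domain_level_sets[OF assms] by blast
  let ?d = "DIM('a)"
  define D where "D = real ?d * ln 2"
  have D: "D > 0" by (simp add: D_def)
  have [measurable]: "\<Omega> \<in> sets borel" using assms by (simp add: bounded_C11_domain_def)
  have "(\<integral>\<^sup>+x. indicator \<Omega> x * ennreal ((f x)\<^sup>2 * lnplus ((f x)\<^sup>2 / (K * \<Sigma>))) \<partial>lborel) \<le> ennreal (D * (C * (4 / 3)) * S)"
    if f[measurable]: "f \<in> borel_measurable borel" and Df: "diff_bound \<Omega> f S" and S: "S > 0"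
      and \<Sigma>: "(\<integral>\<^sup>+x. indicator \<Omega> x * ennreal ((f x)\<^sup>2) \<partial>lborel) \<le> ennreal \<Sigma>" "\<Sigma> > 0" for f S \<Sigma>
  proof -
    let ?h = "\<lambda>k x. if K * \<Sigma> / ((1 / 2) ^ k) ^ ?d \<le> (f x)\<^sup>2 then ennreal ((f x)\<^sup>2) else 0"
    have eq: "2 ^ (?d * k) \<le> y / (K * \<Sigma>) \<longleftrightarrow> K * \<Sigma> / ((1 / 2) ^ k) ^ ?d \<le> y" for k and y :: real
    proof -
      have "K * \<Sigma> / ((1 / 2) ^ k) ^ ?d = 2 ^ (?d * k) * (K * \<Sigma>)"
        by (simp add: power_mult[symmetric] power_one_over mult.commute)
      then show ?thesis using K \<Sigma>(2) by (simp add: pos_le_divide_eq)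
    qed
    have "(\<integral>\<^sup>+x. indicator \<Omega> x * ennreal ((f x)\<^sup>2 * lnplus ((f x)\<^sup>2 / (K * \<Sigma>))) \<partial>lborel)
        \<le> (\<integral>\<^sup>+x. ennreal D * (\<Sum>k. indicator \<Omega> x * ?h k x) \<partial>lborel)"
    proof (rule nn_integral_mono)
      fix x
      have "ennreal ((f x)\<^sup>2 * lnplus ((f x)\<^sup>2 / (K * \<Sigma>))) = ennreal ((f x)\<^sup>2) * ennreal (lnplus ((f x)\<^sup>2 / (K * \<Sigma>)))"
        by (intro ennreal_mult) (auto simp: lnplus_def)
      also have "\<dots> \<le> ennreal ((f x)\<^sup>2) * (ennreal D * (\<Sum>k. if 2 ^ (?d * k) \<le> (f x)\<^sup>2 / (K * \<Sigma>) then 1 else 0))"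
        unfolding D_def by (intro mult_left_mono lnplus_le_levels) auto
      also have "\<dots> = ennreal D * (\<Sum>k. ennreal ((f x)\<^sup>2) * (if 2 ^ (?d * k) \<le> (f x)\<^sup>2 / (K * \<Sigma>) then 1 else 0))"
        by (simp add: mult.left_commute)
      also have "(\<lambda>k. ennreal ((f x)\<^sup>2) * (if 2 ^ (?d * k) \<le> (f x)\<^sup>2 / (K * \<Sigma>) then 1 else 0)) = (\<lambda>k. ?h k x)"
        unfolding eq by auto
      finally show "indicator \<Omega> x * ennreal ((f x)\<^sup>2 * lnplus ((f x)\<^sup>2 / (K * \<Sigma>))) \<le> ennreal D * (\<Sum>k. indicator \<Omega> x * ?h k x)"
        by (cases "x \<in> \<Omega>") auto
    qed
    also have "\<dots> = ennreal D * (\<integral>\<^sup>+x. (\<Sum>k. indicator \<Omega> x * ?h k x) \<partial>lborel)"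
      by (rule nn_integral_cmult) measurable
    also have "(\<integral>\<^sup>+x. (\<Sum>k. indicator \<Omega> x * ?h k x) \<partial>lborel) = (\<Sum>k. \<integral>\<^sup>+x. indicator \<Omega> x * ?h k x \<partial>lborel)"
      by (rule nn_integral_suminf) measurable
    also have "ennreal D * \<dots> \<le> ennreal D * (\<Sum>k. ennreal (C * S * ((1 / 2) ^ k)\<^sup>2))"
      by (intro mult_left_mono suminf_le lev[OF f Df S \<Sigma>]) (auto simp: power_le_one)
    also have "(\<Sum>k. ennreal (C * S * ((1 / 2) ^ k)\<^sup>2)) = ennreal (C * S * (4 / 3))"
    proof (rule suminf_ennreal_eq)
      have "(\<lambda>k. C * S * (1 / 4) ^ k) sums (C * S * (1 / (1 - 1 / 4)))"
        by (intro sums_mult geometric_sums) simp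
      moreover have "((1 / 2) ^ k)\<^sup>2 = (1 / 4 :: real) ^ k" for k
        by (simp add: power_mult[symmetric] mult.commute[of k 2]) (simp add: power_mult power2_eq_square)
      ultimately show "(\<lambda>k. C * S * ((1 / 2) ^ k)\<^sup>2) sums (C * S * (4 / 3))" by simp
    qed (use C S in simp)
    finally show ?thesis using C S D by (simp add: ennreal_mult'[symmetric] mult_ac)
  qed
  then show ?thesis using K C D by (intro exI[of _ K] conjI exI[of _ "D * (C * (4 / 3))"]) auto
qed

lemma abs_x_ln_x_le_1:
  fixes y :: real
  assumes "0 \<le> y" "y \<le> 1"
  shows "\<bar>y * ln y\<bar> \<le> 1"
proof (cases "y = 0")
  case False
  then have y: "y > 0" using assms by simp
  have "ln (1 / y) \<le> 1 / y - 1" using y by (intro ln_le_minus_one) simp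
  then have "y * (- ln y) \<le> y * (1 / y - 1)" using y by (intro mult_left_mono) (auto simp: ln_div)
  also have "\<dots> \<le> 1" using y by (simp add: right_diff_distrib)
  finally have "- (y * ln y) \<le> 1" by simp
  moreover have "y * ln y \<le> 0" using y assms by (simp add: mult_nonneg_nonpos)
  ultimately show ?thesis by linarith
qed simp

lemma entropy_integrable:
  fixes c :: "'a \<Rightarrow> real"
  assumes "finite_measure M" "c \<in> borel_measurable M" "AE x in M. 0 \<le> c x \<and> c x \<le> 1" "t > 0"
  shows "integrable M (\<lambda>x. c x * ln (c x / t))"
proof (rule finite_measure.integrable_const_bound[OF assms(1)])
  show "AE x in M. norm (c x * ln (c x / t)) \<le> 1 + \<bar>ln t\<bar>"
    using assms(3)
  proof eventually_elim
    case (elim x)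
    show ?case
    proof (cases "c x = 0")
      case False
      then have "c x * ln (c x / t) = c x * ln (c x) - c x * ln t"
        using elim assms(4) by (simp add: ln_div right_diff_distrib)
      moreover have "\<bar>c x * ln t\<bar> \<le> \<bar>ln t\<bar>" using elim by (simp add: abs_mult mult_left_le_one_le)
      ultimately show ?thesis using abs_x_ln_x_le_1[of "c x"] elim by simp
    qed simp
  qed
qed (use assms in measurable)

text \<open>
  The left-hand side is the relative entropy density of \<open>(m + g)\<^sup>2\<close> with respect to \<open>t\<close>. For
  \<open>g\<^sup>2 \<le> t\<close> it is bounded by \<open>((m + g)\<^sup>2 - t)\<^sup>2 / t\<close>, a quadratic expression in \<open>g\<close> and \<open>sqrt \<sigma>2\<close>;
  for \<open>g\<^sup>2 > t\<close> the part \<open>g\<close> dominates and the logarithm is bounded by \<open>ln (4 g\<^sup>2 / \<sigma>2)\<close>.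
\<close>

lemma entropy_density_bound:
  fixes m g \<sigma>2 :: real
  assumes "\<sigma>2 > 0"
  defines "t \<equiv> m\<^sup>2 + \<sigma>2"
  shows "(m + g)\<^sup>2 * ln ((m + g)\<^sup>2 / t) - (m + g)\<^sup>2 + t \<le> 15 * g\<^sup>2 + 3 * \<sigma>2 + 4 * (g\<^sup>2 * lnplus (g\<^sup>2 / \<sigma>2))"
proof -
  have t: "t > 0" "m\<^sup>2 \<le> t" "\<sigma>2 \<le> t" unfolding t_def using assms(1) by (auto simp: add_nonneg_pos)
  have lp: "0 \<le> g\<^sup>2 * lnplus (g\<^sup>2 / \<sigma>2)" by (simp add: lnplus_def)
  define y where "y = (m + g)\<^sup>2"
  have y: "y \<ge> 0" by (simp add: y_def)
  show ?thesis
  proof (cases "g\<^sup>2 \<le> t")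
    case True
    have "y * ln (y / t) \<le> y * (y / t - 1)"
    proof (cases "y = 0")
      case False
      then show ?thesis using y t by (intro mult_left_mono ln_le_minus_one) auto
    qed simp
    then have "y * ln (y / t) - y + t \<le> y * (y / t - 1) - y + t" by simp
    also have "\<dots> = (y - t)\<^sup>2 / t" using t by (simp add: field_simps power2_eq_square)
    also have "y - t = 2 * m * g + g\<^sup>2 - \<sigma>2" by (simp add: y_def t_def power2_eq_square algebra_simps)
    also have "(2 * m * g + g\<^sup>2 - \<sigma>2)\<^sup>2 \<le> 3 * (4 * m\<^sup>2 * g\<^sup>2 + g\<^sup>2 * g\<^sup>2 + \<sigma>2 * \<sigma>2)"
    proof -
      have "(a + b - c)\<^sup>2 \<le> 3 * (a\<^sup>2 + b\<^sup>2 + c\<^sup>2)" for a b c :: real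
      proof -
        have "0 \<le> (a - b)\<^sup>2 + (a + c)\<^sup>2 + (b + c)\<^sup>2" by simp
        then show ?thesis by (simp add: power2_eq_square algebra_simps)
      qed
      from this[of "2 * m * g" "g\<^sup>2" \<sigma>2] show ?thesis by (simp add: power2_eq_square mult_ac)
    qed
    also have "\<dots> \<le> 3 * (4 * t * g\<^sup>2 + t * g\<^sup>2 + \<sigma>2 * t)"
      using t True assms(1) by (intro mult_left_mono add_mono mult_right_mono) auto
    also have "3 * (4 * t * g\<^sup>2 + t * g\<^sup>2 + \<sigma>2 * t) / t = 15 * g\<^sup>2 + 3 * \<sigma>2"
      using t by (simp add: field_simps)
    finally show ?thesis using t lp unfolding y_def by (simp add: divide_right_mono)
  next
    case False
    then have g: "t < g\<^sup>2" by simp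
    have "y \<le> 2 * m\<^sup>2 + 2 * g\<^sup>2"
      unfolding y_def using sum_squares_bound[of m g] by (simp add: power2_sum)
    then have y4: "y \<le> 4 * g\<^sup>2" using t(2) g by linarith
    have gt1: "g\<^sup>2 / t > 1" using g t by simp
    have "y * ln (y / t) \<le> 4 * g\<^sup>2 * (3 + lnplus (g\<^sup>2 / \<sigma>2))"
    proof (cases "y = 0")
      case False
      have "y / t \<le> 4 * (g\<^sup>2 / t)" using y4 t(1) by (simp add: divide_right_mono)
      then have "ln (y / t) \<le> ln (4 * (g\<^sup>2 / t))" using False y t gt1 by (intro ln_mono) auto
      also have "\<dots> = ln 4 + ln (g\<^sup>2 / t)" using gt1 by (subst ln_mult) auto
      also have "ln 4 \<le> (3::real)" using ln_le_minus_one[of "4::real"] by simp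
      also have "ln (g\<^sup>2 / t) \<le> lnplus (g\<^sup>2 / \<sigma>2)"
      proof -
        have le: "g\<^sup>2 / t \<le> g\<^sup>2 / \<sigma>2" using t assms(1) by (intro divide_left_mono) auto
        then have "1 \<le> g\<^sup>2 / \<sigma>2" using gt1 by linarith
        moreover have "ln (g\<^sup>2 / t) \<le> ln (g\<^sup>2 / \<sigma>2)" using le gt1 by (subst ln_le_cancel_iff) auto
        ultimately show ?thesis by (simp add: lnplus_def)
      qed
      finally have l: "ln (y / t) \<le> 3 + lnplus (g\<^sup>2 / \<sigma>2)" by simp
      have "y * ln (y / t) \<le> y * (3 + lnplus (g\<^sup>2 / \<sigma>2))" using y l by (rule mult_left_mono[rotated])
      also have "\<dots> \<le> 4 * g\<^sup>2 * (3 + lnplus (g\<^sup>2 / \<sigma>2))" using y4 by (intro mult_right_mono) (auto simp: lnplus_def)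
      finally show ?thesis .
    qed (simp add: lnplus_def)
    moreover have "- y + t \<le> g\<^sup>2" using y g by linarith
    moreover have "0 \<le> g\<^sup>2" by simp
    ultimately have "y * ln (y / t) - y + t \<le> 15 * g\<^sup>2 + 3 * \<sigma>2 + 4 * (g\<^sup>2 * lnplus (g\<^sup>2 / \<sigma>2))"
    proof -
      have "4 * g\<^sup>2 * (3 + lnplus (g\<^sup>2 / \<sigma>2)) = 12 * g\<^sup>2 + 4 * (g\<^sup>2 * lnplus (g\<^sup>2 / \<sigma>2))"
        by (simp add: algebra_simps)
      with \<open>y * ln (y / t) \<le> _\<close> \<open>- y + t \<le> _\<close> \<open>0 \<le> g\<^sup>2\<close> assms(1) show ?thesis by linarith
    qed
    then show ?thesis unfolding y_def .
  qed
qed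

lemma diff_bound_minus_const: "diff_bound \<Omega> f S \<Longrightarrow> diff_bound \<Omega> (\<lambda>x. f x - m) S"
  by (simp add: diff_bound_def)

lemma diff_bound_mono: "diff_bound \<Omega> f S \<Longrightarrow> S \<le> S' \<Longrightarrow> diff_bound \<Omega> f S'"
  unfolding diff_bound_def by (meson order_trans ennreal_leI mult_left_mono zero_le_power2)

lemma nn_integral_lebesgue_on:
  assumes "\<Omega> \<in> sets borel" "f \<in> borel_measurable borel"
  shows "(\<integral>\<^sup>+x. f x \<partial>lebesgue_on \<Omega>) = (\<integral>\<^sup>+x. indicator \<Omega> x * f x \<partial>lborel)"
proof -
  have "(\<integral>\<^sup>+x. f x \<partial>lebesgue_on \<Omega>) = (\<integral>\<^sup>+x. f x * indicator \<Omega> x \<partial>lebesgue)"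
    using assms by (simp add: nn_integral_restrict_space)
  also have "\<dots> = (\<integral>\<^sup>+x. f x * indicator \<Omega> x \<partial>lborel)"
    using assms by (subst nn_integral_completion) auto
  finally show ?thesis by (simp add: mult.commute)
qed

lemma finite_measure_lebesgue_on_bounded:
  "\<Omega> \<in> sets borel \<Longrightarrow> bounded \<Omega> \<Longrightarrow> finite_measure (lebesgue_on \<Omega>)"
  by (intro finite_measure_lebesgue_on bounded_set_imp_lmeasurable) auto

lemma measure_open_pos:
  fixes \<Omega> :: "'a::euclidean_space set"
  assumes "open \<Omega>" "\<Omega> \<noteq> {}" "bounded \<Omega>"
  shows "measure lebesgue \<Omega> > 0"
proof -
  have "\<Omega> \<in> lmeasurable" using assms by (simp add: bounded_set_imp_lmeasurable)
  moreover have "\<not> negligible \<Omega>" using open_not_negligible[of \<Omega>] assms by auto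
  ultimately show ?thesis
    using negligible_iff_measure[of \<Omega>] measure_nonneg[of lebesgue \<Omega>] by (simp add: less_le)
qed

lemma integral_const_lebesgue_on:
  "\<Omega> \<in> sets borel \<Longrightarrow> (LINT x|lebesgue_on \<Omega>. c) = c * measure lebesgue \<Omega>"
  by (simp add: measure_restrict_space)

text \<open>
  The logarithmic Sobolev inequality, with \<open>S\<close> in place of \<open>\<integral> |\<nabla> f|\<^sup>2\<close>; the functions \<open>f\<close> are the
  square roots of concentrations, hence bounded by one.
\<close>

definition log_sobolev :: "'a::euclidean_space set \<Rightarrow> real \<Rightarrow> bool" where
  "log_sobolev \<Omega> C \<longleftrightarrow> (\<forall>f S. f \<in> borel_measurable borel \<longrightarrow> (\<forall>x. \<bar>f x\<bar> \<le> 1) \<longrightarrow> S \<ge> 0 \<longrightarrow> diff_bound \<Omega> f S \<longrightarrow>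
    (LINT x|lebesgue_on \<Omega>. (f x)\<^sup>2 * ln ((f x)\<^sup>2 / average \<Omega> (\<lambda>x. (f x)\<^sup>2))) \<le> C * S)"

text \<open>
  Write \<open>f = m + g\<close> with the constant \<open>m\<close> from the Poincare inequality, so that \<open>\<integral> g\<^sup>2\<close> is bounded
  by a multiple of \<open>S\<close>, and use \<open>entropy_density_bound\<close> with \<open>\<sigma>2\<close> proportional to \<open>S\<close>. The average
  of \<open>f\<^sup>2\<close> minimizes the integrated relative entropy density over all reference values \<open>t\<close>, so
  \<open>t = m\<^sup>2 + \<sigma>2\<close> may be used instead.
\<close>

theorem log_sobolev_C11_domain:
  fixes \<Omega> :: "'a::euclidean_space set"
  assumes "bounded_C11_domain \<Omega>"
  shows "\<exists>C>0. log_sobolev \<Omega> C"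
proof -
  have \<Omega>: "open \<Omega>" "\<Omega> \<noteq> {}" "bounded \<Omega>" using assms by (auto simp: bounded_C11_domain_def)
  have [measurable]: "\<Omega> \<in> sets borel" using \<Omega>(1) by simp
  let ?M = "lebesgue_on \<Omega>"
  define V where "V = measure lebesgue \<Omega>"
  have V: "V > 0" unfolding V_def by (rule measure_open_pos[OF \<Omega>])
  have fin: "finite_measure ?M" using \<Omega> by (intro finite_measure_lebesgue_on_bounded) auto
  have emV: "emeasure lborel \<Omega> = ennreal V"
    using emeasure_bounded_finite[OF \<Omega>(3)] by (simp add: V_def emeasure_eq_ennreal_measure measure_completion)
  obtain Cp where Cp: "Cp \<ge> 0" "\<And>f S. f \<in> borel_measurable borel \<Longrightarrow> S > 0 \<Longrightarrow> diff_bound \<Omega> f S \<Longrightarrow>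
     (\<exists>m. (\<integral>\<^sup>+x. indicator \<Omega> x * ennreal ((f x - m)\<^sup>2) \<partial>lborel) \<le> ennreal (Cp * S))"
    using poincare_C11_domain[OF assms] unfolding poincare_on_def by blast
  obtain K C2 where K: "K > 0" and C2: "C2 > 0" and sq: "\<And>f S \<Sigma>. f \<in> borel_measurable borel \<Longrightarrow> diff_bound \<Omega> f S \<Longrightarrow> S > 0 \<Longrightarrow>
    (\<integral>\<^sup>+x. indicator \<Omega> x * ennreal ((f x)\<^sup>2) \<partial>lborel) \<le> ennreal \<Sigma> \<Longrightarrow> \<Sigma> > 0 \<Longrightarrow>
    (\<integral>\<^sup>+x. indicator \<Omega> x * ennreal ((f x)\<^sup>2 * lnplus ((f x)\<^sup>2 / (K * \<Sigma>))) \<partial>lborel) \<le> ennreal (C2 * S)"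
    using C11_domain_square_log_estimate[OF assms] by blast
  define C where "C = 15 * (Cp + 1) + 3 * K * (Cp + 1) * V + 4 * C2"
  have C: "C > 0" unfolding C_def using Cp(1) K C2 V by (intro add_nonneg_pos add_nonneg_nonneg) auto
  have main: "(LINT x|?M. (f x)\<^sup>2 * ln ((f x)\<^sup>2 / average \<Omega> (\<lambda>x. (f x)\<^sup>2))) \<le> C * S"
    if f[measurable]: "f \<in> borel_measurable borel" and f1: "\<forall>x. \<bar>f x\<bar> \<le> 1" and S: "S > 0" and D: "diff_bound \<Omega> f S" for f S
  proof -
    have f01: "0 \<le> (f x)\<^sup>2 \<and> (f x)\<^sup>2 \<le> 1" for x using f1 by (simp add: abs_square_le_1)
    have f2m: "(\<lambda>x. (f x)\<^sup>2) \<in> borel_measurable ?M" by (intro borel_measurable_lebesgue_on) measurable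
    have f2i: "integrable ?M (\<lambda>x. (f x)\<^sup>2)"
      by (rule finite_measure.integrable_const_bound[OF fin _ f2m, of 1]) (use f01 in auto)
    obtain m where m: "(\<integral>\<^sup>+x. indicator \<Omega> x * ennreal ((f x - m)\<^sup>2) \<partial>lborel) \<le> ennreal (Cp * S)"
      using Cp(2)[OF f S D] by blast
    define \<Sigma> where "\<Sigma> = (Cp + 1) * S"
    have \<Sigma>: "\<Sigma> > 0" unfolding \<Sigma>_def using Cp(1) S by simp
    have m': "(\<integral>\<^sup>+x. indicator \<Omega> x * ennreal ((f x - m)\<^sup>2) \<partial>lborel) \<le> ennreal \<Sigma>"
      using m by (rule order_trans) (use S in \<open>auto simp: \<Sigma>_def intro!: ennreal_leI\<close>)
    have sq': "(\<integral>\<^sup>+x. indicator \<Omega> x * ennreal ((f x - m)\<^sup>2 * lnplus ((f x - m)\<^sup>2 / (K * \<Sigma>))) \<partial>lborel) \<le> ennreal (C2 * S)"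
      by (rule sq[OF _ diff_bound_minus_const[OF D] S m' \<Sigma>]) measurable
    define \<sigma>2 where "\<sigma>2 = K * \<Sigma>"
    have \<sigma>2: "\<sigma>2 > 0" using K \<Sigma> by (simp add: \<sigma>2_def)
    define t where "t = m\<^sup>2 + \<sigma>2"
    have t: "t > 0" unfolding t_def using \<sigma>2 by (simp add: add_nonneg_pos)
    have [measurable]: "lnplus \<in> borel_measurable borel" unfolding lnplus_def[abs_def] by measurable
    define h where "h x = (f x)\<^sup>2 * ln ((f x)\<^sup>2 / t) - (f x)\<^sup>2 + t" for x
    have [measurable]: "h \<in> borel_measurable borel" unfolding h_def[abs_def] by measurable
    have "(\<integral>\<^sup>+x. ennreal (h x) \<partial>?M) = (\<integral>\<^sup>+x. indicator \<Omega> x * ennreal (h x) \<partial>lborel)"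
      by (rule nn_integral_lebesgue_on) measurable
    also have "\<dots> \<le> (\<integral>\<^sup>+x. ennreal 15 * (indicator \<Omega> x * ennreal ((f x - m)\<^sup>2)) + (ennreal (3 * \<sigma>2) * indicator \<Omega> x
        + ennreal 4 * (indicator \<Omega> x * ennreal ((f x - m)\<^sup>2 * lnplus ((f x - m)\<^sup>2 / \<sigma>2)))) \<partial>lborel)"
    proof (rule nn_integral_mono)
      fix x
      let ?g = "f x - m"
      have "h x \<le> 15 * ?g\<^sup>2 + (3 * \<sigma>2 + 4 * (?g\<^sup>2 * lnplus (?g\<^sup>2 / \<sigma>2)))"
        using entropy_density_bound[OF \<sigma>2, of m ?g] by (simp add: h_def t_def)
      then have "ennreal (h x) \<le> ennreal (15 * ?g\<^sup>2 + (3 * \<sigma>2 + 4 * (?g\<^sup>2 * lnplus (?g\<^sup>2 / \<sigma>2))))" by (rule ennreal_leI)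
      also have "\<dots> = ennreal 15 * ennreal (?g\<^sup>2) + (ennreal (3 * \<sigma>2) + ennreal 4 * ennreal (?g\<^sup>2 * lnplus (?g\<^sup>2 / \<sigma>2)))"
      proof -
        have "ennreal (15 * a + (b + 4 * c)) = ennreal 15 * ennreal a + (ennreal b + ennreal 4 * ennreal c)" if "0 \<le> a" "0 \<le> b" "0 \<le> c" for a b c
          using that by (simp add: ennreal_plus ennreal_mult)
        note gen = this
        show ?thesis by (rule gen) (use \<sigma>2 in \<open>auto simp: lnplus_def\<close>)
      qed
      finally show "indicator \<Omega> x * ennreal (h x) \<le> ennreal 15 * (indicator \<Omega> x * ennreal (?g\<^sup>2)) + (ennreal (3 * \<sigma>2) * indicator \<Omega> x
        + ennreal 4 * (indicator \<Omega> x * ennreal (?g\<^sup>2 * lnplus (?g\<^sup>2 / \<sigma>2))))"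
        by (cases "x \<in> \<Omega>") auto
    qed
    also have "\<dots> = ennreal 15 * (\<integral>\<^sup>+x. indicator \<Omega> x * ennreal ((f x - m)\<^sup>2) \<partial>lborel) + (ennreal (3 * \<sigma>2) * ennreal V
        + ennreal 4 * (\<integral>\<^sup>+x. indicator \<Omega> x * ennreal ((f x - m)\<^sup>2 * lnplus ((f x - m)\<^sup>2 / \<sigma>2)) \<partial>lborel))"
      by (subst nn_integral_add; (measurable)?) (subst nn_integral_add; (measurable)?; subst nn_integral_cmult; (measurable)?;
        subst nn_integral_cmult; (measurable)?; simp add: nn_integral_cmult_indicator emV)
    also have "\<dots> \<le> ennreal 15 * ennreal \<Sigma> + (ennreal (3 * \<sigma>2) * ennreal V + ennreal 4 * ennreal (C2 * S))"
      using m' sq' unfolding \<sigma>2_def by (intro add_mono mult_left_mono) auto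
    also have "\<dots> = ennreal (15 * \<Sigma> + (3 * \<sigma>2 * V + 4 * (C2 * S)))"
    proof -
      have "ennreal 15 * ennreal a + (ennreal b * ennreal v + ennreal 4 * ennreal c) = ennreal (15 * a + (b * v + 4 * c))"
        if "0 \<le> a" "0 \<le> b" "0 \<le> c" "0 \<le> v" for a b c v
        using that by (simp add: ennreal_plus ennreal_mult)
      note gen = this
      show ?thesis by (rule gen) (use \<sigma>2 \<Sigma> C2 S V in auto)
    qed
    also have "15 * \<Sigma> + (3 * \<sigma>2 * V + 4 * (C2 * S)) = C * S"
      by (simp add: C_def \<Sigma>_def \<sigma>2_def algebra_simps)
    finally have hn: "(\<integral>\<^sup>+x. ennreal (h x) \<partial>?M) \<le> ennreal (C * S)" .
    have hint: "(LINT x|?M. h x) \<le> C * S"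
      by (rule integral_real_bounded[OF _ hn]) (use C S in simp)
    have ei: "integrable ?M (\<lambda>x. (f x)\<^sup>2 * ln ((f x)\<^sup>2 / t))"
      by (rule entropy_integrable[OF fin f2m _ t]) (use f01 in simp)
    define A where "A = (LINT x|?M. (f x)\<^sup>2)"
    \<comment> \<open>The density \<open>h\<close> differs from the entropy with respect to the average \<open>a = A / V\<close> by a
      nonnegative amount: \<open>ln (t / a) A \<le> (t / a - 1) A = t V - A\<close>.\<close>
    have hA: "(LINT x|?M. h x) = (LINT x|?M. (f x)\<^sup>2 * ln ((f x)\<^sup>2 / t)) - A + t * V"
    proof -
      have "(LINT x|?M. h x) = (LINT x|?M. (f x)\<^sup>2 * ln ((f x)\<^sup>2 / t)) - A + (LINT x|?M. t)"
        unfolding h_def A_def using ei f2i finite_measure.integrable_const[OF fin, of t]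
        by (subst Bochner_Integration.integral_add) auto
      then show ?thesis using integral_const_lebesgue_on[of \<Omega> t] by (simp add: V_def)
    qed
    define a where "a = average \<Omega> (\<lambda>x. (f x)\<^sup>2)"
    have aA: "a * V = A" using V by (simp add: a_def average_def A_def V_def)
    have A0: "A \<ge> 0" unfolding A_def by simp
    show ?thesis
    proof (cases "A = 0")
      case True
      have "AE x in ?M. (f x)\<^sup>2 = 0"
        using integral_nonneg_eq_0_iff_AE[OF f2i] True by (simp add: A_def)
      then have "(LINT x|?M. (f x)\<^sup>2 * ln ((f x)\<^sup>2 / average \<Omega> (\<lambda>x. (f x)\<^sup>2))) = 0"
        by (intro integral_eq_zero_AE) (auto elim!: eventually_mono)
      then show ?thesis using C S by simp
    next
      case False
      have "a = A / V" using aA V by (simp add: field_simps)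
      then have a: "a > 0" using A0 False V by simp
      have "(LINT x|?M. (f x)\<^sup>2 * ln ((f x)\<^sup>2 / a)) = (LINT x|?M. (f x)\<^sup>2 * ln ((f x)\<^sup>2 / t) + ln (t / a) * (f x)\<^sup>2)"
      proof (intro Bochner_Integration.integral_cong refl)
        fix x
        show "(f x)\<^sup>2 * ln ((f x)\<^sup>2 / a) = (f x)\<^sup>2 * ln ((f x)\<^sup>2 / t) + ln (t / a) * (f x)\<^sup>2"
          using a t by (cases "f x = 0") (auto simp: ln_div algebra_simps)
      qed
      also have "\<dots> = (LINT x|?M. (f x)\<^sup>2 * ln ((f x)\<^sup>2 / t)) + ln (t / a) * A"
        using ei f2i by (simp add: A_def)
      also have "ln (t / a) * A \<le> (t / a - 1) * A"
        using t a A0 by (intro mult_right_mono ln_le_minus_one) auto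
      also have "(t / a - 1) * A = t * V - A"
        using a aA by (simp add: aA[symmetric] field_simps)
      finally show ?thesis using hA hint unfolding a_def by simp
    qed
  qed
  have "(LINT x|?M. (f x)\<^sup>2 * ln ((f x)\<^sup>2 / average \<Omega> (\<lambda>x. (f x)\<^sup>2))) \<le> C * S"
    if "f \<in> borel_measurable borel" "\<forall>x. \<bar>f x\<bar> \<le> 1" "S \<ge> 0" "diff_bound \<Omega> f S" for f S
  proof (rule field_le_epsilon)
    fix e :: real assume e: "e > 0"
    have "(LINT x|?M. (f x)\<^sup>2 * ln ((f x)\<^sup>2 / average \<Omega> (\<lambda>x. (f x)\<^sup>2))) \<le> C * (S + e / C)"
      using that e C by (intro main diff_bound_mono[OF that(4)]) (auto intro: add_nonneg_pos)
    then show "(LINT x|?M. (f x)\<^sup>2 * ln ((f x)\<^sup>2 / average \<Omega> (\<lambda>x. (f x)\<^sup>2))) \<le> C * S + e"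
      using C by (simp add: distrib_left)
  qed
  then show ?thesis unfolding log_sobolev_def using C by blast
qed

section \<open>Algebra of the Maxwell-Stefan relations\<close>

lemma minv_nonsingular:
  assumes A: "A \<in> carrier_mat n n" and det: "Determinant.det A \<noteq> 0"
  shows "minv A \<in> carrier_mat n n" "A * minv A = 1\<^sub>m n" "minv A * A = 1\<^sub>m n"
    and "minv A = (1 / Determinant.det A) \<cdot>\<^sub>m adj_mat A"
proof -
  have "A \<in> Units (ring_mat TYPE(real) n ())"
    by (rule det_non_zero_imp_unit[OF A det])
  then obtain B where "mat_inverse A = Some B"
    using mat_inverse(1)[OF A, where b = "()"] by (cases "mat_inverse A") auto
  then show 1: "minv A \<in> carrier_mat n n" "A * minv A = 1\<^sub>m n" "minv A * A = 1\<^sub>m n"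
    using mat_inverse(2)[OF A] by (auto simp: minv_def)
  let ?X = "(1 / Determinant.det A) \<cdot>\<^sub>m adj_mat A"
  have X: "?X \<in> carrier_mat n n" using adj_mat(1)[OF A] by simp
  have "A * ?X = (1 / Determinant.det A) \<cdot>\<^sub>m (A * adj_mat A)"
    using A adj_mat(1)[OF A] by (simp add: mult_smult_distrib)
  also have "\<dots> = 1\<^sub>m n"
    unfolding adj_mat(2)[OF A] using det by (intro eq_matI) auto
  finally have AX: "A * ?X = 1\<^sub>m n" .
  have "minv A = minv A * (A * ?X)" unfolding AX using 1 by simp
  also have "\<dots> = (minv A * A) * ?X" using 1(1) A X by (simp add: assoc_mult_mat)
  also have "\<dots> = ?X" unfolding 1(3) by (rule left_mult_one_mat[OF X])
  finally show "minv A = ?X" .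
qed

text \<open>
  Injectivity is formulated for functions on the naturals, the form in which the dissipation
  estimate proves it.
\<close>

lemma nonsingular_of_injective:
  fixes A :: "real Matrix.mat"
  assumes A: "A \<in> carrier_mat n n"
    and inj: "\<And>p. (\<And>i. i < n \<Longrightarrow> (\<Sum>j<n. A $$ (i, j) * p j) = 0) \<Longrightarrow> (\<And>i. i < n \<Longrightarrow> p i = 0)"
  shows "Determinant.det A \<noteq> 0"
proof
  assume "Determinant.det A = 0"
  then obtain v where v: "v \<in> carrier_vec n" "v \<noteq> 0\<^sub>v n" "A *\<^sub>v v = 0\<^sub>v n"
    using det_0_iff_vec_prod_zero_field[OF A] by blast
  have "(\<Sum>j<n. A $$ (i, j) * Matrix.vec_index v j) = 0" if "i < n" for i
  proof -
    have "Matrix.vec_index (A *\<^sub>v v) i = (\<Sum>j = 0..<n. A $$ (i, j) * Matrix.vec_index v j)"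
      using A v(1) that by (simp add: Matrix.scalar_prod_def)
    then show ?thesis using v(3) that by (simp add: lessThan_atLeast0)
  qed
  from inj[OF this] have "Matrix.vec_index v i = 0" if "i < n" for i using that by blast
  then have "v = 0\<^sub>v n" using v(1) by (intro eq_vecI) auto
  then show False using v(2) by simp
qed

lemma sum_symmetric_square:
  fixes d :: "'b \<Rightarrow> 'b \<Rightarrow> real" and c u :: "'b \<Rightarrow> real"
  assumes "\<And>i j. i \<in> I \<Longrightarrow> j \<in> I \<Longrightarrow> d i j = d j i"
  shows "(\<Sum>i\<in>I. \<Sum>j\<in>I. d i j * c i * c j * (u i - u j)\<^sup>2) = 2 * (\<Sum>i\<in>I. \<Sum>j\<in>I. d i j * c i * c j * (u i - u j) * u i)"
proof -
  let ?X = "\<Sum>i\<in>I. \<Sum>j\<in>I. d i j * c i * c j * (u i - u j) * u i"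
  have "(\<Sum>i\<in>I. \<Sum>j\<in>I. d i j * c i * c j * (u i - u j) * u j) = (\<Sum>j\<in>I. \<Sum>i\<in>I. d i j * c i * c j * (u i - u j) * u j)"
    by (rule sum.swap)
  also have "\<dots> = (\<Sum>j\<in>I. \<Sum>i\<in>I. - (d j i * c j * c i * (u j - u i) * u j))"
    using assms by (intro sum.cong refl) (simp add: algebra_simps)
  also have "\<dots> = - ?X" by (simp add: sum_negf)
  finally have "(\<Sum>i\<in>I. \<Sum>j\<in>I. d i j * c i * c j * (u i - u j) * u j) = - ?X" .
  moreover have "(\<Sum>i\<in>I. \<Sum>j\<in>I. d i j * c i * c j * (u i - u j)\<^sup>2) =
      ?X - (\<Sum>i\<in>I. \<Sum>j\<in>I. d i j * c i * c j * (u i - u j) * u j)"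
    by (simp add: sum_subtractf[symmetric] power2_eq_square algebra_simps)
  ultimately show ?thesis by simp
qed

text \<open>
  Here \<open>u i\<close> is the velocity of species \<open>i\<close>, \<open>z\<close> the right-hand side of the Maxwell-Stefan
  relations and \<open>d i j\<close> the friction coefficients. Symmetrization gives
  \<open>2 Q = \<Sum>i j. d i j c i c j (u i - u j)\<^sup>2\<close>. The three inequalities follow from \<open>d i j \<ge> \<delta>\<close>, from
  the Cauchy-Schwarz inequality in \<open>j\<close> with \<open>d i j \<le> \<Delta>\<close>, and from Young's inequality with the
  first one.
\<close>

lemma maxwell_stefan_dissipation:
  fixes d :: "'b \<Rightarrow> 'b \<Rightarrow> real" and c u z :: "'b \<Rightarrow> real"
  assumes sym: "\<And>i j. i \<in> I \<Longrightarrow> j \<in> I \<Longrightarrow> d i j = d j i"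
    and d: "\<And>i j. i \<in> I \<Longrightarrow> j \<in> I \<Longrightarrow> \<delta> \<le> d i j \<and> d i j \<le> \<Delta>" and \<delta>: "\<delta> > 0"
    and c: "\<And>i. i \<in> I \<Longrightarrow> c i > 0" "(\<Sum>i\<in>I. c i) = 1" and u: "(\<Sum>i\<in>I. c i * u i) = 0" and I: "finite I"
    and z: "\<And>i. i \<in> I \<Longrightarrow> z i = c i * (\<Sum>j\<in>I. d i j * c j * (u i - u j))"
  defines "Q \<equiv> (\<Sum>i\<in>I. z i * u i)"
  shows "\<delta> * (\<Sum>i\<in>I. c i * (u i)\<^sup>2) \<le> Q" "(\<Sum>i\<in>I. (z i)\<^sup>2 / c i) \<le> 2 * \<Delta> * Q" "Q \<le> (\<Sum>i\<in>I. (z i)\<^sup>2 / c i) / \<delta>"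
proof -
  have Q: "2 * Q = (\<Sum>i\<in>I. \<Sum>j\<in>I. d i j * c i * c j * (u i - u j)\<^sup>2)"
  proof -
    have "Q = (\<Sum>i\<in>I. \<Sum>j\<in>I. d i j * c i * c j * (u i - u j) * u i)"
      unfolding Q_def by (simp add: z sum_distrib_left sum_distrib_right mult_ac)
    then show ?thesis using sum_symmetric_square[of I d c u] sym by simp
  qed
  have one: "(\<Sum>i\<in>I. \<Sum>j\<in>I. 1 * c i * c j * (u i - u j)\<^sup>2) = 2 * (\<Sum>i\<in>I. c i * (u i)\<^sup>2)"
  proof -
    have "(\<Sum>i\<in>I. \<Sum>j\<in>I. 1 * c i * c j * (u i - u j) * u i) =
        (\<Sum>i\<in>I. c i * (u i)\<^sup>2 * (\<Sum>j\<in>I. c j) - c i * u i * (\<Sum>j\<in>I. c j * u j))"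
      by (simp add: sum_distrib_left sum_subtractf[symmetric] power2_eq_square algebra_simps)
    then show ?thesis
      by (subst sum_symmetric_square) (simp_all add: c(2) u)
  qed
  have "\<delta> * (2 * (\<Sum>i\<in>I. c i * (u i)\<^sup>2)) = (\<Sum>i\<in>I. \<Sum>j\<in>I. \<delta> * (c i * c j * (u i - u j)\<^sup>2))"
    unfolding one[symmetric] by (simp add: sum_distrib_left)
  also have "\<dots> \<le> (\<Sum>i\<in>I. \<Sum>j\<in>I. d i j * (c i * c j * (u i - u j)\<^sup>2))"
    using d c(1) by (intro sum_mono mult_right_mono mult_nonneg_nonneg) (auto simp: less_imp_le)
  finally show 1: "\<delta> * (\<Sum>i\<in>I. c i * (u i)\<^sup>2) \<le> Q" using Q by (simp add: mult.assoc)
  have "(z i)\<^sup>2 / c i \<le> \<Delta> * (\<Sum>j\<in>I. d i j * c i * c j * (u i - u j)\<^sup>2)" if i: "i \<in> I" for i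
  proof -
    have nn: "0 \<le> d i j * c j" if "j \<in> I" for j using d[OF i that] \<delta> c(1)[OF that] by simp
    have "(\<Sum>j\<in>I. d i j * c j * (u i - u j))\<^sup>2 = (\<Sum>j\<in>I. sqrt (d i j * c j) * (sqrt (d i j * c j) * (u i - u j)))\<^sup>2"
      using nn by (simp add: mult.assoc[symmetric])
    also have "\<dots> \<le> (\<Sum>j\<in>I. (sqrt (d i j * c j))\<^sup>2) * (\<Sum>j\<in>I. (sqrt (d i j * c j) * (u i - u j))\<^sup>2)"
      by (rule Cauchy_Schwarz_ineq_sum)
    also have "\<dots> = (\<Sum>j\<in>I. d i j * c j) * (\<Sum>j\<in>I. d i j * c j * (u i - u j)\<^sup>2)"
      using nn by (simp add: power_mult_distrib)
    also have "\<dots> \<le> \<Delta> * (\<Sum>j\<in>I. d i j * c j * (u i - u j)\<^sup>2)"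
    proof (rule mult_right_mono)
      have "(\<Sum>j\<in>I. d i j * c j) \<le> (\<Sum>j\<in>I. \<Delta> * c j)"
        using d[OF i] c(1) by (intro sum_mono mult_right_mono) (auto intro: less_imp_le)
      then show "(\<Sum>j\<in>I. d i j * c j) \<le> \<Delta>" using c(2) by (simp add: sum_distrib_left[symmetric])
      show "0 \<le> (\<Sum>j\<in>I. d i j * c j * (u i - u j)\<^sup>2)" using nn by (intro sum_nonneg) simp
    qed
    finally have "c i * (\<Sum>j\<in>I. d i j * c j * (u i - u j))\<^sup>2 \<le> c i * (\<Delta> * (\<Sum>j\<in>I. d i j * c j * (u i - u j)\<^sup>2))"
      using c(1)[OF i] by (intro mult_left_mono) auto
    moreover have "(z i)\<^sup>2 / c i = c i * (\<Sum>j\<in>I. d i j * c j * (u i - u j))\<^sup>2"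
      using c(1)[OF i] by (simp add: z[OF i] power2_eq_square)
    ultimately show ?thesis by (simp add: sum_distrib_left mult_ac)
  qed
  then have "(\<Sum>i\<in>I. (z i)\<^sup>2 / c i) \<le> (\<Sum>i\<in>I. \<Delta> * (\<Sum>j\<in>I. d i j * c i * c j * (u i - u j)\<^sup>2))"
    by (rule sum_mono)
  also have "\<dots> = \<Delta> * (2 * Q)" unfolding Q by (simp add: sum_distrib_left)
  finally show "(\<Sum>i\<in>I. (z i)\<^sup>2 / c i) \<le> 2 * \<Delta> * Q" by simp
  have "Q \<le> (\<Sum>i\<in>I. (z i)\<^sup>2 / c i / (2 * \<delta>) + \<delta> / 2 * (c i * (u i)\<^sup>2))"
    unfolding Q_def
  proof (rule sum_mono)
    fix i assume i: "i \<in> I"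
    have ci: "c i > 0" by (rule c(1)[OF i])
    have "0 \<le> (z i - \<delta> * c i * u i)\<^sup>2 / (2 * \<delta> * c i)" using \<delta> ci by simp
    also have "\<dots> = (z i)\<^sup>2 / c i / (2 * \<delta>) + \<delta> / 2 * (c i * (u i)\<^sup>2) - z i * u i"
      using \<delta> ci by (simp add: field_simps power2_eq_square)
    finally show "z i * u i \<le> (z i)\<^sup>2 / c i / (2 * \<delta>) + \<delta> / 2 * (c i * (u i)\<^sup>2)" by simp
  qed
  also have "\<dots> = (\<Sum>i\<in>I. (z i)\<^sup>2 / c i) / (2 * \<delta>) + \<delta> / 2 * (\<Sum>i\<in>I. c i * (u i)\<^sup>2)"
    by (simp add: sum.distrib sum_divide_distrib sum_distrib_left)
  also have "\<dots> \<le> (\<Sum>i\<in>I. (z i)\<^sup>2 / c i) / (2 * \<delta>) + Q / 2" using 1 by simp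
  finally have "Q / 2 \<le> (\<Sum>i\<in>I. (z i)\<^sup>2 / c i) / (2 * \<delta>)" by linarith
  then show "Q \<le> (\<Sum>i\<in>I. (z i)\<^sup>2 / c i) / \<delta>" by simp
qed

lemma A0_carrier: "A0 N D c \<in> carrier_mat N N"
  by (simp add: A0_def Let_def)

text \<open>
  The matrix \<open>A0\<close> arises by eliminating the last flux and the last concentration; the value of
  \<open>d i i\<close> is arbitrary, as its coefficient vanishes.
\<close>

lemma A0_flux_relation:
  assumes i: "i < N" and c: "c N = 1 - (\<Sum>k<N. c k)" and p: "p N = - (\<Sum>k<N. p k)"
    and d: "\<And>j. j \<le> N \<Longrightarrow> j \<noteq> i \<Longrightarrow> d i j = 1 / D $$ (i, j)"
  shows "(\<Sum>j<N. A0 N D c $$ (i, j) * p j) = (\<Sum>j\<le>N. d i j * (c j * p i - c i * p j))"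
proof -
  let ?J = "{..<N} - {i}"
  define e where "e j = 1 / D $$ (i, j)" for j
  have J: "finite ?J" "i \<in> {..<N}" using i by auto
  define X where "X j = c j * p i - c i * p j" for j
  have "(\<Sum>j<N. A0 N D c $$ (i, j) * p j) = A0 N D c $$ (i, i) * p i + (\<Sum>j\<in>?J. A0 N D c $$ (i, j) * p j)"
    using J by (subst sum.remove[of _ i]) auto
  also have "\<dots> = ((\<Sum>k\<in>?J. (e k - e N) * c k) + e N) * p i + (\<Sum>j\<in>?J. - (e j - e N) * c i * p j)"
    using i by (simp add: A0_def Let_def e_def)
  also have "\<dots> = (\<Sum>j\<in>?J. (e j - e N) * X j) + e N * p i"
  proof -
    have "(\<Sum>j\<in>?J. (e j - e N) * X j) = (\<Sum>k\<in>?J. (e k - e N) * c k) * p i + (\<Sum>j\<in>?J. - (e j - e N) * c i * p j)"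
      unfolding sum_distrib_right sum.distrib[symmetric] X_def by (intro sum.cong refl) (simp add: algebra_simps)
    then show ?thesis by (simp add: distrib_right)
  qed
  also have "\<dots> = (\<Sum>j\<in>?J. e j * X j) + e N * (p i - (\<Sum>j\<in>?J. X j))"
    by (simp add: left_diff_distrib sum_subtractf sum_distrib_left right_diff_distrib)
  also have "p i - (\<Sum>j\<in>?J. X j) = X N"
  proof -
    have "(\<Sum>k<N. c k) = c i + (\<Sum>k\<in>?J. c k)" "(\<Sum>k<N. p k) = p i + (\<Sum>k\<in>?J. p k)"
      using J by (simp_all add: sum.remove)
    then show ?thesis
      unfolding X_def c p by (simp add: sum_subtractf sum_distrib_left[symmetric] sum_distrib_right[symmetric] algebra_simps)
  qed
  also have "(\<Sum>j\<in>?J. e j * X j) + e N * X N = (\<Sum>j\<in>insert N ?J. d i j * X j)"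
    using i J by (subst sum.insert) (auto simp: d e_def intro!: sum.cong)
  also have "\<dots> = (\<Sum>j\<le>N. d i j * X j)"
    using i by (intro sum.mono_neutral_left) (auto simp: X_def)
  finally show ?thesis by (simp add: X_def)
qed

lemma conc_less: "i < N \<Longrightarrow> conc N w i = exp (w i) / (1 + (\<Sum>j<N. exp (w j)))"
  by (simp add: conc_def)

lemma exp_sum_pos: "0 < 1 + (\<Sum>j<N. exp (w j :: real))"
  by (intro add_pos_nonneg sum_nonneg) auto

lemma conc_last: "conc N w N = 1 / (1 + (\<Sum>j<N. exp (w j)))"
  using exp_sum_pos[of w N] by (simp add: conc_def sum_divide_distrib[symmetric] field_simps)

lemma conc_last_sum: "conc N w N = 1 - (\<Sum>i<N. conc N w i)"
  by (simp add: conc_def)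

lemma sum_conc: "(\<Sum>i\<le>N. conc N w i) = 1"
  by (simp add: lessThan_Suc_atMost[symmetric] conc_last_sum)

lemma conc_pos: "i \<le> N \<Longrightarrow> 0 < conc N w i"
  using exp_sum_pos[of w N] by (cases "i = N") (simp_all add: conc_last conc_less)

lemma conc_le_1: "i \<le> N \<Longrightarrow> conc N w i \<le> 1"
  using sum_conc[of N w] member_le_sum[of i "{..N}" "conc N w"] conc_pos[of _ N w]
  by (simp add: less_imp_le)

lemma mat_mult_entry:
  fixes A B :: "real Matrix.mat"
  assumes "A \<in> carrier_mat n n" "B \<in> carrier_mat n n" "i < n" "j < n"
  shows "(A * B) $$ (i, j) = (\<Sum>k<n. A $$ (i, k) * B $$ (k, j))"
  using assms by (simp add: Matrix.scalar_prod_def lessThan_atLeast0)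

lemma minv_eqI:
  assumes A: "A \<in> carrier_mat n n" and X: "X \<in> carrier_mat n n" and AX: "A * X = 1\<^sub>m n"
  shows "minv A = X"
proof -
  have "Determinant.det A * Determinant.det X = 1"
    using det_mult[OF A X] AX by simp
  then have "Determinant.det A \<noteq> 0" by auto
  note inv = minv_nonsingular(1-3)[OF A this]
  have "minv A = minv A * (A * X)" unfolding AX using inv by simp
  also have "\<dots> = (minv A * A) * X" using inv(1) A X by (simp add: assoc_mult_mat)
  also have "\<dots> = X" unfolding inv(3) by (rule left_mult_one_mat[OF X])
  finally show ?thesis .
qed

text \<open>The Jacobian of the concentrations with respect to the entropy variables.\<close>

definition hessian_inverse :: "nat \<Rightarrow> (nat \<Rightarrow> real) \<Rightarrow> real Matrix.mat" where
  "hessian_inverse N c = Matrix.mat N N (\<lambda>(i, j). (if i = j then c i else 0) - c i * c j)"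

lemma minv_entropy_hessian:
  assumes c: "\<And>i. i \<le> N \<Longrightarrow> c i > 0" "c N = 1 - (\<Sum>k<N. c k)"
  shows "minv (entropy_hessian N c) = hessian_inverse N c"
proof (rule minv_eqI)
  show H: "entropy_hessian N c \<in> carrier_mat N N" and X: "hessian_inverse N c \<in> carrier_mat N N"
    by (simp_all add: entropy_hessian_def hessian_inverse_def)
  show "entropy_hessian N c * hessian_inverse N c = 1\<^sub>m N"
  proof (rule eq_matI)
    fix i j assume "i < dim_row (1\<^sub>m N)" "j < dim_col (1\<^sub>m N)"
    then have ij: "i < N" "j < N" by auto
    have "(entropy_hessian N c * hessian_inverse N c) $$ (i, j) =
        (\<Sum>k<N. (1 / c N + (if i = k then 1 / c i else 0)) * ((if k = j then c k else 0) - c k * c j))"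
      unfolding mat_mult_entry[OF H X ij] using ij by (simp add: entropy_hessian_def hessian_inverse_def)
    also have "\<dots> = (\<Sum>k<N. (if k = j then 1 / c N * c j else 0)) - (\<Sum>k<N. 1 / c N * c j * c k)
        + (\<Sum>k<N. if i = k then (if k = j then 1 / c i * c k else 0) - 1 / c i * c k * c j else 0)"
      unfolding sum_subtractf[symmetric] sum.distrib[symmetric] by (intro sum.cong refl) (simp add: algebra_simps)
    also have "\<dots> = 1 / c N * c j - 1 / c N * c j * (1 - c N) + ((if i = j then 1 else 0) - c j)"
    proof -
      have "(\<Sum>k<N. (if k = j then 1 / c N * c j else 0)) = 1 / c N * c j"
        using ij by simp
      moreover have "(\<Sum>k<N. 1 / c N * c j * c k) = 1 / c N * c j * (1 - c N)"
        unfolding sum_distrib_left[symmetric] using c(2) by simp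
      moreover have "(\<Sum>k<N. if i = k then (if k = j then 1 / c i * c k else 0) - 1 / c i * c k * c j else 0) = (if i = j then 1 else 0) - c j"
        using ij c(1)[of i] by (cases "i = j") auto
      ultimately show ?thesis by simp
    qed
    also have "\<dots> = (if i = j then 1 else 0)"
      using c(1)[of N] by (simp add: field_simps)
    finally show "(entropy_hessian N c * hessian_inverse N c) $$ (i, j) = 1\<^sub>m N $$ (i, j)"
      using ij by simp
  qed (simp_all add: entropy_hessian_def hessian_inverse_def)
qed

text \<open>
  If \<open>y\<close> is a partial derivative of the entropy variables \<open>w\<close> and \<open>c = conc N w\<close>, then the
  summands are \<open>(\<partial> c i)\<^sup>2 / c i = 4 (\<partial> (sqrt (c i)))\<^sup>2\<close>.
\<close>

definition conc_grad_sq :: "nat \<Rightarrow> (nat \<Rightarrow> real) \<Rightarrow> (nat \<Rightarrow> real) \<Rightarrow> real" where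
  "conc_grad_sq N c y = (\<Sum>i\<le>N. c i * ((if i < N then y i else 0) - (\<Sum>k<N. c k * y k))\<^sup>2)"

locale diffusion_coefficients =
  fixes N :: nat and D :: "real Matrix.mat"
  assumes N: "N \<ge> 1"
    and sym: "\<And>i j. i \<le> N \<Longrightarrow> j \<le> N \<Longrightarrow> D $$ (i, j) = D $$ (j, i)"
    and pos: "\<And>i j. i \<le> N \<Longrightarrow> j \<le> N \<Longrightarrow> i \<noteq> j \<Longrightarrow> D $$ (i, j) > 0"
begin

definition "inverse_coeffs = (\<lambda>(i, j). 1 / D $$ (i, j)) ` {(i, j). i \<le> N \<and> j \<le> N \<and> i \<noteq> j}"
definition "dmin = Min inverse_coeffs"
definition "dmax = Max inverse_coeffs"
definition "d i j = (if i = j then dmin else 1 / D $$ (i, j))"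

lemma finite_inverse_coeffs: "finite inverse_coeffs" and inverse_coeffs_nonempty: "inverse_coeffs \<noteq> {}"
proof -
  have "finite {(i, j). i \<le> N \<and> j \<le> N \<and> i \<noteq> j}"
    by (rule finite_subset[of _ "{..N} \<times> {..N}"]) auto
  then show "finite inverse_coeffs" by (simp add: inverse_coeffs_def)
  have "(0, 1) \<in> {(i, j). i \<le> N \<and> j \<le> N \<and> i \<noteq> j}" using N by auto
  then show "inverse_coeffs \<noteq> {}" unfolding inverse_coeffs_def by blast
qed

lemma dmin_pos: "dmin > 0"
  using finite_inverse_coeffs inverse_coeffs_nonempty pos
  by (auto simp: dmin_def inverse_coeffs_def Min_gr_iff)

text \<open>
  The diagonal of \<open>d\<close> is set to \<open>dmin\<close> so that the bounds hold for all pairs of indices.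
\<close>

lemma d_bounds: "i \<le> N \<Longrightarrow> j \<le> N \<Longrightarrow> dmin \<le> d i j \<and> d i j \<le> dmax"
proof -
  assume ij: "i \<le> N" "j \<le> N"
  have le: "dmin \<le> dmax"
    unfolding dmin_def dmax_def using finite_inverse_coeffs inverse_coeffs_nonempty
    by (meson Max_ge Min_in)
  show ?thesis
  proof (cases "i = j")
    case False
    then have "1 / D $$ (i, j) \<in> inverse_coeffs" unfolding inverse_coeffs_def using ij by force
    then show ?thesis
      using False finite_inverse_coeffs by (simp add: d_def dmin_def dmax_def)
  qed (use le in \<open>simp add: d_def\<close>)
qed

lemma dmax_pos: "dmax > 0"
  using dmin_pos d_bounds[of 0 0] by simp

lemma d_sym: "i \<le> N \<Longrightarrow> j \<le> N \<Longrightarrow> d i j = d j i"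
  by (simp add: d_def sym)

text \<open>
  The flux \<open>p\<close> solves the reduced relations \<open>A0 p = z\<close>, and \<open>z\<close> and \<open>p\<close> are extended to the last
  component by zero total sum. In terms of \<open>u = p / c\<close> the reduced relations become the symmetric
  ones for all \<open>N + 1\<close> species.
\<close>

lemma flux_dissipation:
  assumes c: "\<And>i. i \<le> N \<Longrightarrow> c i > 0" "c N = 1 - (\<Sum>k<N. c k)"
    and p: "p N = - (\<Sum>k<N. p k)" and z: "\<And>i. i < N \<Longrightarrow> (\<Sum>j<N. A0 N D c $$ (i, j) * p j) = z i" "z N = - (\<Sum>k<N. z k)"
  defines "Q \<equiv> (\<Sum>i\<le>N. z i * p i / c i)"
  shows "dmin * (\<Sum>i\<le>N. (p i)\<^sup>2 / c i) \<le> Q" "(\<Sum>i\<le>N. (z i)\<^sup>2 / c i) \<le> 2 * dmax * Q" "Q \<le> (\<Sum>i\<le>N. (z i)\<^sup>2 / c i) / dmin"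
proof -
  define u where "u i = p i / c i" for i
  have pu: "p i = c i * u i" if "i \<le> N" for i using c(1)[OF that] by (simp add: u_def)
  have zlt: "z i = (\<Sum>j\<le>N. d i j * (c j * p i - c i * p j))" if "i < N" for i
    using A0_flux_relation[OF that c(2) p, of d D] z(1)[OF that] by (simp add: d_def)
  \<comment> \<open>The relation for the last species follows, since the right-hand sides of all relations sum to
    zero.\<close>
  have zN: "z N = (\<Sum>j\<le>N. d N j * (c j * p N - c N * p j))"
  proof -
    let ?r = "\<lambda>i. \<Sum>j\<le>N. d i j * (c j * p i - c i * p j)"
    have "(\<Sum>i\<le>N. ?r i) = (\<Sum>j\<le>N. \<Sum>i\<le>N. d i j * (c j * p i - c i * p j))" by (rule sum.swap)
    also have "\<dots> = (\<Sum>j\<le>N. \<Sum>i\<le>N. - (d j i * (c i * p j - c j * p i)))"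
      using d_sym by (intro sum.cong refl) (auto simp: algebra_simps)
    also have "\<dots> = - (\<Sum>i\<le>N. ?r i)" by (simp add: sum_negf)
    finally have "(\<Sum>i\<le>N. ?r i) = 0" by simp
    then have "?r N = - (\<Sum>i<N. ?r i)" by (simp add: lessThan_Suc_atMost[symmetric])
    then show ?thesis using zlt z(2) by simp
  qed
  have zi: "z i = c i * (\<Sum>j\<le>N. d i j * c j * (u i - u j))" if "i \<in> {..N}" for i
  proof -
    have "z i = (\<Sum>j\<le>N. d i j * (c j * p i - c i * p j))"
      using zlt[of i] zN that by (cases "i = N") auto
    also have "\<dots> = (\<Sum>j\<le>N. c i * (d i j * c j * (u i - u j)))"
      using that by (intro sum.cong refl) (auto simp: pu algebra_simps)
    finally show ?thesis by (simp add: sum_distrib_left)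
  qed
  have c1: "(\<Sum>i\<in>{..N}. c i) = 1" using c(2) by (simp add: lessThan_Suc_atMost[symmetric])
  have "(\<Sum>i\<le>N. p i) = 0" using p by (simp add: lessThan_Suc_atMost[symmetric])
  then have u0: "(\<Sum>i\<in>{..N}. c i * u i) = 0" using pu by simp
  have Q: "Q = (\<Sum>i\<in>{..N}. z i * u i)" by (simp add: Q_def u_def)
  note diss = maxwell_stefan_dissipation[of "{..N}" d dmin dmax c u z, OF _ _ dmin_pos _ c1 u0 _ zi, folded Q]
  have "(\<Sum>i\<le>N. (p i)\<^sup>2 / c i) = (\<Sum>i\<le>N. c i * (u i)\<^sup>2)"
    using c(1) by (intro sum.cong refl) (simp add: u_def power2_eq_square)
  then show "dmin * (\<Sum>i\<le>N. (p i)\<^sup>2 / c i) \<le> Q"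
    using diss(1) d_sym d_bounds c(1) by simp
  show "(\<Sum>i\<le>N. (z i)\<^sup>2 / c i) \<le> 2 * dmax * Q" "Q \<le> (\<Sum>i\<le>N. (z i)\<^sup>2 / c i) / dmin"
    using diss(2,3) d_sym d_bounds c(1) by simp_all
qed

text \<open>A solution of the homogeneous relations has zero dissipation.\<close>

lemma A0_nonsingular:
  assumes c: "\<And>i. i \<le> N \<Longrightarrow> c i > 0" "c N = 1 - (\<Sum>k<N. c k)"
  shows "Determinant.det (A0 N D c) \<noteq> 0"
proof (rule nonsingular_of_injective[OF A0_carrier])
  fix p :: "nat \<Rightarrow> real" and i
  assume p: "\<And>i. i < N \<Longrightarrow> (\<Sum>j<N. A0 N D c $$ (i, j) * p j) = 0" and i: "i < N"
  define p' where "p' j = (if j < N then p j else - (\<Sum>k<N. p k))" for j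
  have "dmin * (\<Sum>i\<le>N. (p' i)\<^sup>2 / c i) \<le> (\<Sum>i\<le>N. 0 * p' i / c i)"
    using p by (intro flux_dissipation(1)[OF c]) (auto simp: p'_def)
  then have "(\<Sum>i\<le>N. (p' i)\<^sup>2 / c i) \<le> 0" using dmin_pos by (simp add: mult_le_0_iff)
  moreover have "(p' i)\<^sup>2 / c i \<le> (\<Sum>i\<le>N. (p' i)\<^sup>2 / c i)"
    using c(1) i by (intro member_le_sum) (auto simp: less_imp_le)
  ultimately have "(p' i)\<^sup>2 / c i \<le> 0" by linarith
  then show "p i = 0" using c(1)[of i] i by (simp add: p'_def divide_le_0_iff)
qed

text \<open>
  With \<open>z\<close> the derivative of the concentrations in direction \<open>y\<close> and \<open>p\<close> the corresponding flux,
  the quadratic form of the diffusion matrix is \<open>\<Sum>i\<le>N. z i p i / c i\<close>. The upper bound provides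
  the integrability of the form, the lower bound the coercivity.
\<close>

theorem diffusion_matrix_bounds:
  fixes w y :: "nat \<Rightarrow> real"
  defines "Q \<equiv> (\<Sum>i<N. \<Sum>j<N. diffusion_matrix N D w $$ (i, j) * (y i * y j))"
  shows "conc_grad_sq N (conc N w) y \<le> 2 * dmax * Q" "Q \<le> conc_grad_sq N (conc N w) y / dmin"
proof -
  let ?c = "conc N w"
  have c: "\<And>i. i \<le> N \<Longrightarrow> ?c i > 0" "?c N = 1 - (\<Sum>k<N. ?c k)"
    by (simp_all add: conc_pos conc_last_sum)
  let ?A = "A0 N D ?c" and ?H = "hessian_inverse N ?c"
  note inv = minv_nonsingular(1-3)[OF A0_carrier A0_nonsingular[OF c]]
  have H: "?H \<in> carrier_mat N N" by (simp add: hessian_inverse_def)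
  have B: "diffusion_matrix N D w = minv ?A * ?H"
    unfolding diffusion_matrix_def using minv_entropy_hessian[OF c] by simp
  define s where "s = (\<Sum>k<N. ?c k * y k)"
  define z where "z i = ?c i * ((if i < N then y i else 0) - s)" for i
  define p where "p i = (if i < N then (\<Sum>k<N. minv ?A $$ (i, k) * z k) else - (\<Sum>i<N. \<Sum>k<N. minv ?A $$ (i, k) * z k))" for i
  have Hy: "(\<Sum>j<N. ?H $$ (k, j) * y j) = z k" if "k < N" for k
  proof -
    have "(\<Sum>j<N. ?H $$ (k, j) * y j) = (\<Sum>j<N. (if k = j then ?c k * y k else 0) - ?c k * (?c j * y j))"
      using that by (intro sum.cong refl) (simp add: hessian_inverse_def algebra_simps)
    also have "\<dots> = z k"
      using that by (simp add: sum_subtractf sum_distrib_left[symmetric] z_def s_def right_diff_distrib)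
    finally show ?thesis .
  qed
  have By: "(\<Sum>j<N. diffusion_matrix N D w $$ (i, j) * y j) = p i" if i: "i < N" for i
  proof -
    have "(\<Sum>j<N. diffusion_matrix N D w $$ (i, j) * y j) = (\<Sum>j<N. \<Sum>k<N. minv ?A $$ (i, k) * ?H $$ (k, j) * y j)"
      unfolding B using i by (simp add: mat_mult_entry[OF inv(1) H] sum_distrib_right)
    also have "\<dots> = (\<Sum>k<N. \<Sum>j<N. minv ?A $$ (i, k) * ?H $$ (k, j) * y j)" by (rule sum.swap)
    also have "\<dots> = (\<Sum>k<N. minv ?A $$ (i, k) * (\<Sum>j<N. ?H $$ (k, j) * y j))"
      by (simp add: sum_distrib_left mult.assoc)
    also have "\<dots> = p i" using Hy i by (simp add: p_def)
    finally show ?thesis .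
  qed
  have Ap: "(\<Sum>j<N. ?A $$ (i, j) * p j) = z i" if i: "i < N" for i
  proof -
    have "(\<Sum>j<N. ?A $$ (i, j) * p j) = (\<Sum>j<N. \<Sum>k<N. ?A $$ (i, j) * minv ?A $$ (j, k) * z k)"
      by (simp add: p_def sum_distrib_left mult.assoc)
    also have "\<dots> = (\<Sum>k<N. \<Sum>j<N. ?A $$ (i, j) * minv ?A $$ (j, k) * z k)" by (rule sum.swap)
    also have "\<dots> = (\<Sum>k<N. (?A * minv ?A) $$ (i, k) * z k)"
      using i by (simp add: mat_mult_entry[OF A0_carrier inv(1)] sum_distrib_right)
    also have "\<dots> = (\<Sum>k<N. if i = k then z k else 0)"
      using i by (intro sum.cong refl) (simp add: inv(2) del: index_mult_mat)
    also have "\<dots> = z i" using i by (simp del: index_mult_mat)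
    finally show ?thesis .
  qed
  have pN: "p N = - (\<Sum>k<N. p k)" by (simp add: p_def)
  have zN: "z N = - (\<Sum>k<N. z k)"
  proof -
    have "(\<Sum>k<N. z k) = (\<Sum>k<N. ?c k * y k - s * ?c k)"
      by (intro sum.cong refl) (simp add: z_def algebra_simps)
    also have "\<dots> = s - s * (\<Sum>k<N. ?c k)"
      unfolding sum_subtractf sum_distrib_left[symmetric] s_def ..
    finally have "(\<Sum>k<N. z k) = s - s * (\<Sum>k<N. ?c k)" .
    moreover have "z N = - (1 - (\<Sum>k<N. ?c k)) * s" unfolding z_def c(2) by (simp only: less_irrefl if_False diff_0 mult_minus_left mult_minus_right)
    moreover have "- (1 - S) * s = - (s - s * S)" for S :: real by (simp add: algebra_simps)
    ultimately show ?thesis by metis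
  qed
  have "(\<Sum>i\<le>N. z i * p i / ?c i) = (\<Sum>i<N. z i * p i / ?c i) + z N * p N / ?c N"
    by (simp add: lessThan_Suc_atMost[symmetric])
  also have "\<dots> = (\<Sum>i<N. (y i - s) * p i) + s * (\<Sum>k<N. p k)"
  proof -
    have "z i * p i / ?c i = (y i - s) * p i" if "i < N" for i
      using c(1)[of i] that by (simp add: z_def)
    moreover have "z N * p N / ?c N = s * (\<Sum>k<N. p k)"
      using c(1)[of N] unfolding pN by (simp add: z_def)
    ultimately show ?thesis by simp
  qed
  also have "\<dots> = (\<Sum>i<N. y i * p i)"
    by (simp add: left_diff_distrib sum_subtractf sum_distrib_left)
  also have "\<dots> = Q"
  proof -
    have "(\<Sum>j<N. diffusion_matrix N D w $$ (i, j) * (y i * y j)) = y i * (\<Sum>j<N. diffusion_matrix N D w $$ (i, j) * y j)" for i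
      by (simp add: sum_distrib_left ac_simps)
    then show ?thesis unfolding Q_def using By by simp
  qed
  finally have Q: "(\<Sum>i\<le>N. z i * p i / ?c i) = Q" .
  have R: "(\<Sum>i\<le>N. (z i)\<^sup>2 / ?c i) = conc_grad_sq N ?c y"
    unfolding conc_grad_sq_def
  proof (intro sum.cong refl)
    fix i assume "i \<in> {..N}"
    then show "(z i)\<^sup>2 / ?c i = ?c i * ((if i < N then y i else 0) - (\<Sum>k<N. ?c k * y k))\<^sup>2"
      using c(1)[of i] by (simp add: z_def s_def power_mult_distrib power2_eq_square)
  qed
  show "conc_grad_sq N ?c y \<le> 2 * dmax * Q" "Q \<le> conc_grad_sq N ?c y / dmin"
    using flux_dissipation(2,3)[OF c pN Ap zN] unfolding Q R by auto
qed

end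

section \<open>Entropy dissipation of the concentrations\<close>

lemma borel_measurable_det:
  fixes A :: "'x \<Rightarrow> real Matrix.mat"
  assumes "\<And>x. A x \<in> carrier_mat n n" and m: "\<And>i j. i < n \<Longrightarrow> j < n \<Longrightarrow> (\<lambda>x. A x $$ (i, j)) \<in> borel_measurable M"
  shows "(\<lambda>x. Determinant.det (A x)) \<in> borel_measurable M"
proof -
  have "(\<lambda>x. \<Sum>p\<in>{p. p permutes {0..<n}}. signof p * (\<Prod>i = 0..<n. A x $$ (i, p i))) \<in> borel_measurable M"
  proof (intro borel_measurable_sum borel_measurable_times borel_measurable_const borel_measurable_prod)
    fix p i assume "p \<in> {p. p permutes {0..<n}}" "i \<in> {0..<n}"
    then have "i < n" "p i < n" using permutes_in_image[of p "{0..<n}" i] by auto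
    then show "(\<lambda>x. A x $$ (i, p i)) \<in> borel_measurable M" by (rule m)
  qed
  then show ?thesis using det_def'[OF assms(1)] by simp
qed

text \<open>
  By Cramer's rule the entries of the inverse are rational functions of the entries.
\<close>

lemma borel_measurable_minv:
  fixes A :: "'x \<Rightarrow> real Matrix.mat"
  assumes A: "\<And>x. A x \<in> carrier_mat n n" and m: "\<And>i j. i < n \<Longrightarrow> j < n \<Longrightarrow> (\<lambda>x. A x $$ (i, j)) \<in> borel_measurable M"
    and det: "\<And>x. Determinant.det (A x) \<noteq> 0" and ij: "i < n" "j < n"
  shows "(\<lambda>x. minv (A x) $$ (i, j)) \<in> borel_measurable M"
proof -
  have "minv (A x) $$ (i, j) = 1 / Determinant.det (A x) * ((-1) ^ (j + i) * Determinant.det (mat_delete (A x) j i))" for x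
    unfolding minv_nonsingular(4)[OF A det] using A[of x] ij by (simp add: adj_mat_def Determinant.cofactor_def)
  moreover have "(\<lambda>x. Determinant.det (mat_delete (A x) j i)) \<in> borel_measurable M"
  proof (rule borel_measurable_det)
    show "mat_delete (A x) j i \<in> carrier_mat (n - 1) (n - 1)" for x
      using mat_delete_carrier[OF A] by simp
    fix a b assume ab: "a < n - 1" "b < n - 1"
    have "mat_delete (A x) j i $$ (a, b) = A x $$ (if a < j then a else Suc a, if b < i then b else Suc b)" for x
      using A[of x] ab by (simp add: mat_delete_def)
    then show "(\<lambda>x. mat_delete (A x) j i $$ (a, b)) \<in> borel_measurable M"
      using ab m by simp
  qed
  moreover have "(\<lambda>x. Determinant.det (A x)) \<in> borel_measurable M"
    by (rule borel_measurable_det[OF A m])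
  ultimately show ?thesis by simp
qed

lemma hessian_inverse_carrier: "hessian_inverse N c \<in> carrier_mat N N"
  unfolding hessian_inverse_def by (rule mat_carrier)

lemma conc_cong: "(\<And>l. l < N \<Longrightarrow> v l = w l) \<Longrightarrow> conc N v i = conc N w i"
  by (simp add: conc_def)

lemma borel_measurable_conc:
  assumes "\<And>l. l < N \<Longrightarrow> w l \<in> borel_measurable M"
  shows "(\<lambda>x. conc N (\<lambda>l. w l x) i) \<in> borel_measurable M"
proof -
  have [measurable]: "l < N \<Longrightarrow> w l \<in> borel_measurable M" for l by (rule assms)
  have "(\<lambda>x. exp (w k x) / (1 + (\<Sum>j<N. exp (w j x)))) \<in> borel_measurable M" if "k < N" for k
    using that by measurable
  then show ?thesis by (cases "i < N") (simp_all add: conc_def)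
qed

lemma (in diffusion_coefficients) borel_measurable_diffusion_matrix:
  assumes w: "\<And>l. l < N \<Longrightarrow> w l \<in> borel_measurable M" and ij: "i < N" "j < N"
  shows "(\<lambda>x. diffusion_matrix N D (\<lambda>l. w l x) $$ (i, j)) \<in> borel_measurable M"
proof -
  let ?c = "\<lambda>x. conc N (\<lambda>l. w l x)"
  have [measurable]: "(\<lambda>x. ?c x k) \<in> borel_measurable M" for k
    by (rule borel_measurable_conc[OF w])
  have c: "\<And>i. i \<le> N \<Longrightarrow> ?c x i > 0" "?c x N = 1 - (\<Sum>k<N. ?c x k)" for x
    by (simp_all add: conc_pos conc_last_sum)
  note det = A0_nonsingular[OF c]
  have H: "minv (entropy_hessian N (?c x)) = hessian_inverse N (?c x)" for x
    by (rule minv_entropy_hessian[OF c])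
  have "(\<lambda>x. minv (A0 N D (?c x)) $$ (i, k)) \<in> borel_measurable M" if "k < N" for k
  proof (rule borel_measurable_minv[OF A0_carrier _ det ij(1) that])
    fix a b assume "a < N" "b < N"
    then show "(\<lambda>x. A0 N D (?c x) $$ (a, b)) \<in> borel_measurable M"
      by (cases "a = b") (simp_all add: A0_def Let_def)
  qed
  moreover have "(\<lambda>x. hessian_inverse N (?c x) $$ (k, j)) \<in> borel_measurable M" if "k < N" for k
    using that ij by (cases "k = j") (simp_all add: hessian_inverse_def)
  moreover have "diffusion_matrix N D (\<lambda>l. w l x) $$ (i, j) =
      (\<Sum>k<N. minv (A0 N D (?c x)) $$ (i, k) * hessian_inverse N (?c x) $$ (k, j))" for x
    unfolding diffusion_matrix_def H
    by (rule mat_mult_entry[OF minv_nonsingular(1)[OF A0_carrier det] hessian_inverse_carrier ij])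
  ultimately show ?thesis by simp
qed

text \<open>Also valid for \<open>i = N\<close>, where the entropy variable is zero.\<close>

lemma conc_deriv_line:
  assumes "i \<le> N"
  shows "((\<lambda>t. conc N (\<lambda>l. a l + t * d l) i) has_real_derivative
    (conc N (\<lambda>l. a l + t * d l) i * ((if i < N then d i else 0) - (\<Sum>k<N. conc N (\<lambda>l. a l + t * d l) k * d k)))) (at t)"
proof -
  define S where "S t = 1 + (\<Sum>j<N. exp (a j + t * d j))" for t
  have S0: "S t > 0" for t unfolding S_def by (rule exp_sum_pos)
  have S': "(S has_real_derivative (\<Sum>j<N. exp (a j + t * d j) * d j)) (at t)"
    unfolding S_def by (auto intro!: derivative_eq_intros sum.cong)
  have E: "(\<Sum>k<N. conc N (\<lambda>l. a l + t * d l) k * d k) = (\<Sum>j<N. exp (a j + t * d j) * d j) / S t"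
    by (simp add: conc_less S_def sum_divide_distrib)
  define R where "R = (\<Sum>j<N. exp (a j + t * d j) * d j)"
  show ?thesis
  proof (cases "i < N")
    case True
    have "((\<lambda>t. exp (a i + t * d i) / S t) has_real_derivative
        (exp (a i + t * d i) * d i * S t - exp (a i + t * d i) * R) / (S t * S t)) (at t)"
      unfolding R_def using S0[of t] by (auto intro!: derivative_eq_intros S')
    moreover have "(exp (a i + t * d i) * d i * S t - exp (a i + t * d i) * R) / (S t * S t) = exp (a i + t * d i) / S t * (d i - R / S t)"
      using S0[of t] by (simp add: field_simps)
    ultimately show ?thesis unfolding E using True by (simp add: conc_less S_def[symmetric] R_def[symmetric])
  next
    case False
    then have i: "i = N" using assms by simp
    have "((\<lambda>t. 1 / S t) has_real_derivative (0 * S t - 1 * R) / (S t * S t)) (at t)"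
      unfolding R_def using S0[of t] by (intro DERIV_divide DERIV_const S') auto
    then show ?thesis unfolding E i by (simp add: conc_last S_def[symmetric] R_def[symmetric])
  qed
qed

lemma line_derivative_lipschitz:
  fixes F :: "(nat \<Rightarrow> real) \<Rightarrow> real"
  assumes "\<And>a d t. ((\<lambda>t. F (\<lambda>i. a i + t * d i)) has_real_derivative (\<Sum>j<N. F' j (\<lambda>i. a i + t * d i) * d j)) (at t)"
    and K: "\<And>j a. j < N \<Longrightarrow> \<bar>F' j a\<bar> \<le> K"
  shows "\<bar>F a - F b\<bar> \<le> K * (\<Sum>i<N. \<bar>a i - b i\<bar>)"
proof -
  let ?d = "\<lambda>i. a i - b i"
  let ?p = "\<lambda>t i. b i + t * ?d i"
  have "\<exists>z. 0 < z \<and> z < 1 \<and> F (?p 1) - F (?p 0) = (1 - 0) * (\<Sum>j<N. F' j (?p z) * ?d j)"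
    using assms(1)[of b ?d] by (intro MVT2[of 0 1 "\<lambda>t. F (?p t)" "\<lambda>t. \<Sum>j<N. F' j (?p t) * ?d j"]) auto
  then obtain z where "F a - F b = (\<Sum>j<N. F' j (?p z) * ?d j)" by auto
  also have "\<bar>\<dots>\<bar> \<le> (\<Sum>j<N. \<bar>F' j (?p z) * ?d j\<bar>)" by (rule sum_abs)
  also have "\<dots> \<le> (\<Sum>j<N. K * \<bar>?d j\<bar>)"
    using K by (intro sum_mono) (auto simp: abs_mult intro!: mult_right_mono)
  finally show ?thesis by (simp add: sum_distrib_left)
qed

definition sqrt_conc_deriv :: "nat \<Rightarrow> nat \<Rightarrow> nat \<Rightarrow> (nat \<Rightarrow> real) \<Rightarrow> real" where
  "sqrt_conc_deriv N i j a = sqrt (conc N a i) * ((if i = j then 1 else 0) - conc N a j) / 2"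

lemma inverse_sqrt_mult:
  fixes c X :: real
  assumes "0 < c"
  shows "(inverse (sqrt c) / 2) * (c * X) = sqrt c / 2 * X"
proof -
  have "c / sqrt c = sqrt c" using assms by (simp add: real_div_sqrt)
  moreover have "(inverse s / 2) * (c * X) = (c / s) / 2 * X" for s :: real
    by (simp only: divide_inverse mult.assoc mult.commute mult.left_commute)
  ultimately show ?thesis by (simp only:)
qed

lemma sqrt_conc_deriv_sum:
  assumes "i \<le> N"
  shows "(\<Sum>j<N. sqrt_conc_deriv N i j a * y j) = sqrt (conc N a i) / 2 * ((if i < N then y i else 0) - (\<Sum>k<N. conc N a k * y k))"
proof -
  have "(\<Sum>j<N. sqrt_conc_deriv N i j a * y j) = (\<Sum>j<N. sqrt (conc N a i) / 2 * ((if i = j then y j else 0) - conc N a j * y j))"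
    by (intro sum.cong refl, rename_tac j, case_tac "i = j") (simp_all add: sqrt_conc_deriv_def left_diff_distrib right_diff_distrib diff_divide_distrib)
  then show ?thesis unfolding sum_distrib_left[symmetric] sum_subtractf by simp
qed

text \<open>
  The square root is harmless although concentrations can be arbitrarily small: the derivative of
  \<open>sqrt (c i)\<close> with respect to \<open>w j\<close> is \<open>sqrt (c i) (\<delta> i j - c j) / 2\<close>, which is bounded and
  Lipschitz.
\<close>

lemma C11_fun_sqrt_conc:
  assumes i: "i \<le> N"
  shows "C11_fun N 1 (\<lambda>a. sqrt (conc N a i)) (sqrt_conc_deriv N i)"
proof -
  have c: "0 < conc N a j" "conc N a j \<le> 1" if "j \<le> N" for a j
    using that by (auto simp: conc_pos conc_le_1)
  have s: "0 < sqrt (conc N a i)" "sqrt (conc N a i) \<le> 1" for a using c[OF i, of a] by auto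
  have ln: "((\<lambda>t. sqrt (conc N (\<lambda>l. a l + t * d l) i)) has_real_derivative
      (\<Sum>j<N. sqrt_conc_deriv N i j (\<lambda>l. a l + t * d l) * d j)) (at t)" for a d t
  proof -
    let ?c = "conc N (\<lambda>l. a l + t * d l)"
    let ?X = "(if i < N then d i else 0) - (\<Sum>k<N. ?c k * d k)"
    have "((\<lambda>t. sqrt (conc N (\<lambda>l. a l + t * d l) i)) has_real_derivative (inverse (sqrt (?c i)) / 2) * (?c i * ?X)) (at t)"
      by (rule DERIV_chain2[OF DERIV_real_sqrt conc_deriv_line[OF i]]) (use c i in auto)
    moreover have "(inverse (sqrt (?c i)) / 2) * (?c i * ?X) = sqrt (?c i) / 2 * ?X"
      using c(1)[OF i, of "\<lambda>l. a l + t * d l"] by (intro inverse_sqrt_mult) auto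
    ultimately show ?thesis unfolding sqrt_conc_deriv_sum[OF i] by (simp only:)
  qed
  have b1: "\<bar>(if i = j then 1 else 0) - conc N a j\<bar> \<le> 1" if "j < N" for a j
    using c[of j a] that by auto
  have b: "\<bar>sqrt_conc_deriv N i j a\<bar> \<le> 1 / 2" if "j < N" for a j
    using mult_mono[OF _ b1[OF that], of "sqrt (conc N a i)" 1 a] s[of a]
    by (simp add: sqrt_conc_deriv_def abs_mult)
  have Ls: "\<bar>sqrt (conc N a i) - sqrt (conc N b i)\<bar> \<le> 1 / 2 * (\<Sum>i<N. \<bar>a i - b i\<bar>)" for a b
    by (rule line_derivative_lipschitz[OF ln b])
  have Lc: "\<bar>conc N a j - conc N b j\<bar> \<le> 1 * (\<Sum>i<N. \<bar>a i - b i\<bar>)" if j: "j < N" for a b j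
  proof (rule line_derivative_lipschitz)
    let ?F' = "\<lambda>k a. conc N a j * ((if j = k then 1 else 0) - conc N a k)"
    fix a d :: "nat \<Rightarrow> real" and t
    let ?c = "conc N (\<lambda>l. a l + t * d l)"
    have "(\<Sum>k<N. ?F' k (\<lambda>l. a l + t * d l) * d k) = (\<Sum>k<N. ?c j * ((if j = k then d k else 0) - ?c k * d k))"
      by (intro sum.cong refl) (simp add: algebra_simps)
    also have "\<dots> = ?c j * ((if j < N then d j else 0) - (\<Sum>k<N. ?c k * d k))"
      by (simp add: sum_distrib_left[symmetric] sum_subtractf)
    finally show "((\<lambda>t. conc N (\<lambda>l. a l + t * d l) j) has_real_derivative (\<Sum>k<N. ?F' k (\<lambda>l. a l + t * d l) * d k)) (at t)"
      using conc_deriv_line[of j N a d t] j by simp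
  next
    fix k a assume "k < N"
    then have "\<bar>(if j = k then 1 else 0) - conc N a k\<bar> \<le> 1" using c[of k a] by auto
    then show "\<bar>conc N a j * ((if j = k then 1 else 0) - conc N a k)\<bar> \<le> 1"
      using mult_mono[of "conc N a j" 1 "\<bar>(if j = k then 1 else 0) - conc N a k\<bar>" 1] c[of j a] j
      by (simp add: abs_mult)
  qed
  have "\<bar>sqrt_conc_deriv N i j a - sqrt_conc_deriv N i j b\<bar> \<le> 1 * (\<Sum>i<N. \<bar>a i - b i\<bar>)" if j: "j < N" for j a b
  proof -
    let ?s = "\<lambda>a. sqrt (conc N a i)" and ?e = "\<lambda>a. (if i = j then 1 else 0) - conc N a j"
    let ?S = "\<Sum>i<N. \<bar>a i - b i\<bar>"
    have S: "0 \<le> ?S" by (rule sum_nonneg) simp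
    have "sqrt_conc_deriv N i j a - sqrt_conc_deriv N i j b = ((?s a - ?s b) * ?e a + ?s b * (?e a - ?e b)) / 2"
      by (simp add: sqrt_conc_deriv_def algebra_simps diff_divide_distrib)
    also have "\<bar>\<dots>\<bar> \<le> (\<bar>?s a - ?s b\<bar> * \<bar>?e a\<bar> + \<bar>?s b\<bar> * \<bar>?e a - ?e b\<bar>) / 2"
      unfolding abs_mult[symmetric] by simp
    also have "\<dots> \<le> (1 / 2 * ?S * 1 + 1 * ?S) / 2"
    proof -
      have "\<bar>?s a - ?s b\<bar> * \<bar>?e a\<bar> \<le> 1 / 2 * ?S * 1"
        by (rule mult_mono[OF Ls b1[OF j]]) (use S in auto)
      moreover have "\<bar>?s b\<bar> * \<bar>?e a - ?e b\<bar> \<le> 1 * ?S"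
        by (rule mult_mono) (use s[of b] Lc[OF j, of a b] S in auto)
      ultimately show ?thesis by (intro divide_right_mono add_mono) auto
    qed
    also have "\<dots> \<le> 1 * ?S" using S by simp
    finally show ?thesis .
  qed
  moreover have "\<bar>sqrt_conc_deriv N i j a\<bar> \<le> 1" if "j < N" for j a using b[OF that, of a] by simp
  ultimately show ?thesis unfolding C11_fun_def using ln by auto
qed

text \<open>
  The left-hand side is the variance of \<open>y\<close> (extended by zero to the last index) under the
  probability weights \<open>c\<close>.
\<close>

lemma conc_grad_sq_le:
  assumes c: "\<And>i. i \<le> N \<Longrightarrow> c i > 0" "c N = 1 - (\<Sum>k<N. c k)"
  shows "conc_grad_sq N c y \<le> (\<Sum>k<N. (y k)\<^sup>2)"
proof -
  let ?s = "\<Sum>k<N. c k * y k"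
  have c1: "c i \<le> 1" if "i < N" for i
    using c(1)[of N] c(2) member_le_sum[of i "{..<N}" c] c(1) that by (auto simp: less_imp_le)
  have "conc_grad_sq N c y = (\<Sum>i<N. c i * (y i - ?s)\<^sup>2) + c N * ?s\<^sup>2"
    by (simp add: conc_grad_sq_def lessThan_Suc_atMost[symmetric])
  also have "(\<Sum>i<N. c i * (y i - ?s)\<^sup>2) = (\<Sum>i<N. c i * (y i)\<^sup>2 - 2 * ?s * (c i * y i) + ?s\<^sup>2 * c i)"
    by (intro sum.cong refl) (simp add: power2_eq_square algebra_simps)
  also have "\<dots> = (\<Sum>i<N. c i * (y i)\<^sup>2) - 2 * ?s * ?s + ?s\<^sup>2 * (\<Sum>i<N. c i)"
    by (simp only: sum.distrib sum_subtractf sum_distrib_left)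
  also have "\<dots> + c N * ?s\<^sup>2 = (\<Sum>i<N. c i * (y i)\<^sup>2) - ?s\<^sup>2"
    unfolding c(2) by (simp only: power2_eq_square) (simp add: algebra_simps)
  also have "\<dots> \<le> (\<Sum>i<N. c i * (y i)\<^sup>2)" by simp
  also have "\<dots> \<le> (\<Sum>k<N. (y k)\<^sup>2)"
    using c1 by (intro sum_mono mult_left_le_one_le) (auto simp: c(1) less_imp_le)
  finally show ?thesis .
qed

text \<open>
  The entropy variables are replaced by Borel representatives; those with index \<open>\<ge> N\<close> are set to
  zero, as the composition theorem asks for weak gradients of the whole sequence.
\<close>

lemma log_sobolev_conc:
  fixes \<Omega> :: "'a::euclidean_space set"
  assumes \<Omega>: "open \<Omega>" "bounded \<Omega>" and LS: "log_sobolev \<Omega> C" and w: "\<And>l. l < N \<Longrightarrow> w l \<in> H1 \<Omega>"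
    and i: "i \<le> N"
  defines "c \<equiv> \<lambda>x. conc N (\<lambda>l. w l x)"
  defines "g \<equiv> \<lambda>x. \<Sum>b\<in>Basis. c x i * ((if i < N then weak_deriv \<Omega> b (w i) x else 0) - (\<Sum>k<N. c x k * weak_deriv \<Omega> b (w k) x))\<^sup>2"
  assumes g: "integrable (lebesgue_on \<Omega>) g"
  shows "(LINT x|lebesgue_on \<Omega>. c x i * ln (c x i / average \<Omega> (\<lambda>x. c x i))) \<le> C / 4 * (LINT x|lebesgue_on \<Omega>. g x)"
proof -
  let ?M = "lebesgue_on \<Omega>"
  have b[measurable]: "\<Omega> \<in> sets borel" using \<Omega> by simp
  have "\<exists>p. \<forall>l<N. weak_grad \<Omega> (fst (p l)) (snd (p l)) \<and> (AE x in ?M. w l x = fst (p l) x) \<and>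
     (\<forall>b\<in>Basis. AE x in ?M. weak_deriv \<Omega> b (w l) x = snd (p l) x \<bullet> b)"
    by (rule choice_iff'[THEN iffD1]) (use H1_weak_grad[OF \<Omega> w] in \<open>simp add: split_paired_Ex\<close>)
  then obtain p where p: "\<And>l. l < N \<Longrightarrow> weak_grad \<Omega> (fst (p l)) (snd (p l))"
     "\<And>l. l < N \<Longrightarrow> AE x in ?M. w l x = fst (p l) x"
     "\<And>l b. l < N \<Longrightarrow> b \<in> Basis \<Longrightarrow> AE x in ?M. weak_deriv \<Omega> b (w l) x = snd (p l) x \<bullet> b"
    by blast
  define u where "u l = (if l < N then fst (p l) else (\<lambda>x. 0))" for l
  define G where "G l = (if l < N then snd (p l) else (\<lambda>x. 0))" for l
  have wg: "weak_grad \<Omega> (u l) (G l)" for l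
    using p(1)[of l] by (cases "l < N") (simp_all add: u_def G_def weak_grad_def)
  have [measurable]: "u l \<in> borel_measurable borel" "G l \<in> borel_measurable borel" for l
    using wg[of l] by (simp_all add: weak_grad_def)
  have uG: "AE x in ?M. (\<forall>l\<in>{..<N}. w l x = u l x) \<and> (\<forall>l\<in>{..<N}. \<forall>b\<in>Basis. weak_deriv \<Omega> b (w l) x = G l x \<bullet> b)"
    using p(2,3) by (intro AE_conjI AE_finite_allI) (auto simp: u_def G_def)
  let ?a = "\<lambda>x l. u l x"
  have cm[measurable]: "(\<lambda>x. conc N (?a x) k) \<in> borel_measurable borel" for k
    by (rule borel_measurable_conc) simp
  define f where "f x = sqrt (conc N (?a x) i)" for x
  have c01: "0 < conc N a i" "conc N a i \<le> 1" for a using conc_pos[OF i] conc_le_1[OF i] by auto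
  have f2: "(f x)\<^sup>2 = conc N (?a x) i" for x using c01[of "?a x"] by (simp add: f_def less_imp_le)
  have cu: "AE x in ?M. c x i = (f x)\<^sup>2"
    using uG by eventually_elim (auto simp: f2 c_def intro!: conc_cong)
  define E where "E x = (\<Sum>j<N. sqrt_conc_deriv N i j (?a x) *\<^sub>R G j x)" for x
  have [measurable]: "(\<lambda>x. sqrt_conc_deriv N i j (?a x)) \<in> borel_measurable borel" for j
    unfolding sqrt_conc_deriv_def by measurable
  have [measurable]: "E \<in> borel_measurable borel" unfolding E_def by measurable
  have E: "AE x in ?M. (norm (E x))\<^sup>2 = 1 / 4 * g x"
    using uG
  proof eventually_elim
    case (elim x)
    have cc: "conc N (?a x) k = c x k" for k
      using elim by (auto simp: c_def intro!: conc_cong)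
    have "E x \<bullet> b = sqrt (c x i) / 2 * ((if i < N then weak_deriv \<Omega> b (w i) x else 0) - (\<Sum>k<N. c x k * weak_deriv \<Omega> b (w k) x))"
      if "b \<in> Basis" for b
    proof -
      have "E x \<bullet> b = (\<Sum>j<N. sqrt_conc_deriv N i j (?a x) * (G j x \<bullet> b))"
        by (simp add: E_def inner_sum_left)
      also have "\<dots> = sqrt (c x i) / 2 * ((if i < N then G i x \<bullet> b else 0) - (\<Sum>k<N. c x k * (G k x \<bullet> b)))"
        unfolding sqrt_conc_deriv_sum[OF i] cc ..
      finally show ?thesis using elim that by simp
    qed
    note Eb = this
    have ge: "(sqrt C / 2 * Y)\<^sup>2 = 1 / 4 * (C * Y\<^sup>2)" if "0 \<le> C" for C Y :: real
      using that by (simp add: power_mult_distrib power_divide)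
    have "(E x \<bullet> b)\<^sup>2 = 1 / 4 * (c x i * ((if i < N then weak_deriv \<Omega> b (w i) x else 0) - (\<Sum>k<N. c x k * weak_deriv \<Omega> b (w k) x))\<^sup>2)"
      if "b \<in> Basis" for b
      unfolding Eb[OF that] by (rule ge) (simp add: c_def conc_pos i less_imp_le)
    moreover have "(norm (E x))\<^sup>2 = (\<Sum>b\<in>Basis. (E x \<bullet> b)\<^sup>2)"
      unfolding power2_norm_eq_inner by (subst euclidean_inner) (simp add: power2_eq_square)
    ultimately show ?case unfolding g_def sum_distrib_left by (metis (no_types, lifting) sum.cong)
  qed
  have g0: "0 \<le> g x" for x
    unfolding g_def c_def using c01 by (intro sum_nonneg mult_nonneg_nonneg) (auto simp: less_imp_le)
  have "(\<integral>\<^sup>+x. indicator \<Omega> x * ennreal ((norm (E x))\<^sup>2) \<partial>lborel) = (\<integral>\<^sup>+x. ennreal ((norm (E x))\<^sup>2) \<partial>?M)"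
    by (subst nn_integral_lebesgue_on) auto
  also have "\<dots> = (\<integral>\<^sup>+x. ennreal (1 / 4 * g x) \<partial>?M)"
    by (rule nn_integral_cong_AE) (use E in \<open>eventually_elim, simp only:\<close>)
  also have "\<dots> = ennreal (LINT x|?M. 1 / 4 * g x)"
    using g g0 by (intro nn_integral_eq_integral) auto
  finally have "diff_bound \<Omega> f (LINT x|?M. 1 / 4 * g x)"
    unfolding f_def E_def
    by (intro C11_composition_diff_bound[OF C11_fun_sqrt_conc[OF i] \<Omega>(1) wg]) auto
  moreover have "f \<in> borel_measurable borel" unfolding f_def by measurable
  moreover have "\<bar>f x\<bar> \<le> 1" for x using c01[of "?a x"] by (simp add: f_def)
  moreover have "0 \<le> (LINT x|?M. 1 / 4 * g x)" using g0 by (intro Bochner_Integration.integral_nonneg) auto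
  ultimately have "(LINT x|?M. (f x)\<^sup>2 * ln ((f x)\<^sup>2 / average \<Omega> (\<lambda>x. (f x)\<^sup>2))) \<le> C * (LINT x|?M. 1 / 4 * g x)"
    using LS unfolding log_sobolev_def by blast
  moreover have fm: "f \<in> borel_measurable ?M" by (rule borel_measurable_lebesgue_on) fact
  have cm': "(\<lambda>x. c x i) \<in> borel_measurable ?M"
    unfolding c_def using w by (intro borel_measurable_conc) (auto simp: H1_def dest: L2D)
  have "average \<Omega> (\<lambda>x. c x i) = average \<Omega> (\<lambda>x. (f x)\<^sup>2)"
    unfolding average_def using cu fm cm' by (intro arg_cong2[where f="(/)"] refl integral_cong_AE) auto
  then have "(LINT x|?M. c x i * ln (c x i / average \<Omega> (\<lambda>x. c x i))) = (LINT x|?M. (f x)\<^sup>2 * ln ((f x)\<^sup>2 / average \<Omega> (\<lambda>x. (f x)\<^sup>2)))"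
    using cu fm cm' by (intro integral_cong_AE) auto
  ultimately show ?thesis by simp
qed

text \<open>
  Coercivity of the diffusion matrix for each partial derivative, combined with the logarithmic
  Sobolev inequality for each component.
\<close>

lemma (in diffusion_coefficients) entropy_dissipation:
  fixes \<Omega> :: "'a::euclidean_space set"
  assumes \<Omega>: "open \<Omega>" "bounded \<Omega>" and LS: "log_sobolev \<Omega> C" "C \<ge> 0" and w: "\<And>l. l < N \<Longrightarrow> w l \<in> H1 \<Omega>"
  defines "c \<equiv> \<lambda>x. conc N (\<lambda>l. w l x)"
  defines "q \<equiv> \<lambda>x. \<Sum>i<N. \<Sum>j<N. diffusion_matrix N D (\<lambda>l. w l x) $$ (i, j) * grad_inner \<Omega> (w i) (w j) x"
  shows "(\<Sum>i\<le>N. LINT x|lebesgue_on \<Omega>. c x i * ln (c x i / average \<Omega> (\<lambda>x. c x i))) \<le> C * dmax / 2 * (LINT x|lebesgue_on \<Omega>. q x)"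
proof -
  let ?M = "lebesgue_on \<Omega>"
  define y where "y b l x = weak_deriv \<Omega> b (w l) x" for b l x
  have yL2: "y b l \<in> L2 \<Omega>" if "b \<in> Basis" "l < N" for b l
    using H1_weak_deriv_L2[OF w] that unfolding y_def by auto
  have ym: "y b l \<in> borel_measurable ?M" and y2: "integrable ?M (\<lambda>x. (y b l x)\<^sup>2)" if "b \<in> Basis" "l < N" for b l
    using yL2[OF that] by (auto simp: L2_def)
  have wm: "w l \<in> borel_measurable ?M" if "l < N" for l using w[OF that] by (auto simp: H1_def dest: L2D)
  have cm[measurable]: "(\<lambda>x. c x k) \<in> borel_measurable ?M" for k
    unfolding c_def using wm by (rule borel_measurable_conc)
  have c: "\<And>i. i \<le> N \<Longrightarrow> c x i > 0" "c x N = 1 - (\<Sum>k<N. c x k)" for x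
    by (simp_all add: conc_pos conc_last_sum c_def)
  define g where "g i b x = c x i * ((if i < N then y b i x else 0) - (\<Sum>k<N. c x k * y b k x))\<^sup>2" for i b x
  have gP: "(\<Sum>i\<le>N. g i b x) = conc_grad_sq N (c x) (\<lambda>l. y b l x)" for b x
    by (simp add: g_def conc_grad_sq_def)
  have g0: "0 \<le> g i b x" if "i \<le> N" for i b x using c(1)[OF that, of x] by (simp add: g_def)
  have gi: "integrable ?M (g i b)" if b: "b \<in> Basis" and i: "i \<le> N" for i b
  proof (rule Bochner_Integration.integrable_bound)
    show "integrable ?M (\<lambda>x. \<Sum>k<N. (y b k x)\<^sup>2)" using y2 b by auto
    have [measurable]: "k < N \<Longrightarrow> y b k \<in> borel_measurable ?M" for k using ym b by auto
    have "(\<lambda>x. if i < N then y b i x else 0) \<in> borel_measurable ?M" by (cases "i < N") simp_all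
    then show "g i b \<in> borel_measurable ?M" unfolding g_def by measurable
    have "g i b x \<le> (\<Sum>k<N. (y b k x)\<^sup>2)" for x
    proof -
      have "g i b x \<le> (\<Sum>i\<le>N. g i b x)" using i g0 by (intro member_le_sum) auto
      also have "\<dots> \<le> (\<Sum>k<N. (y b k x)\<^sup>2)" unfolding gP by (rule conc_grad_sq_le[OF c])
      finally show ?thesis .
    qed
    then show "AE x in ?M. norm (g i b x) \<le> norm (\<Sum>k<N. (y b k x)\<^sup>2)"
      using g0[OF i] by (intro AE_I2) (auto simp: sum_nonneg)
  qed
  define Q where "Q b x = (\<Sum>i<N. \<Sum>j<N. diffusion_matrix N D (\<lambda>l. w l x) $$ (i, j) * (y b i x * y b j x))" for b x
  have Q: "(\<Sum>i\<le>N. g i b x) \<le> 2 * dmax * Q b x" "Q b x \<le> (\<Sum>i\<le>N. g i b x) / dmin" for b x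
    using diffusion_matrix_bounds[of "\<lambda>l. w l x" "\<lambda>l. y b l x"] unfolding gP Q_def c_def by auto
  have Q0: "0 \<le> Q b x" for b x
  proof -
    have "0 \<le> (\<Sum>i\<le>N. g i b x)" using g0 by (intro sum_nonneg) auto
    then have "0 \<le> dmax * Q b x" using Q(1)[of b x] by simp
    then show ?thesis using dmax_pos by (simp add: zero_le_mult_iff)
  qed
  have Qi: "integrable ?M (Q b)" if b: "b \<in> Basis" for b
  proof (rule Bochner_Integration.integrable_bound)
    show "integrable ?M (\<lambda>x. (\<Sum>i\<le>N. g i b x) / dmin)"
      by (rule integrable_divide, rule Bochner_Integration.integrable_sum) (use gi b in auto)
    show "Q b \<in> borel_measurable ?M" unfolding Q_def
      using ym b borel_measurable_diffusion_matrix[of w, OF wm] by (intro borel_measurable_sum borel_measurable_times) auto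
    have "norm (Q b x) \<le> norm ((\<Sum>i\<le>N. g i b x) / dmin)" for x
      using Q(2)[of b x] Q0[of b x] unfolding real_norm_def by linarith
    then show "AE x in ?M. norm (Q b x) \<le> norm ((\<Sum>i\<le>N. g i b x) / dmin)" by simp
  qed
  have qQ: "q x = (\<Sum>b\<in>Basis. Q b x)" for x
  proof -
    have "q x = (\<Sum>i<N. \<Sum>j<N. \<Sum>b\<in>Basis. diffusion_matrix N D (\<lambda>l. w l x) $$ (i, j) * (y b i x * y b j x))"
      by (simp add: q_def grad_inner_def y_def sum_distrib_left)
    also have "\<dots> = (\<Sum>i<N. \<Sum>b\<in>Basis. \<Sum>j<N. diffusion_matrix N D (\<lambda>l. w l x) $$ (i, j) * (y b i x * y b j x))"
      by (intro sum.cong refl sum.swap)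
    also have "\<dots> = (\<Sum>b\<in>Basis. Q b x)" unfolding Q_def by (rule sum.swap)
    finally show ?thesis .
  qed
  have "(\<Sum>i\<le>N. LINT x|?M. c x i * ln (c x i / average \<Omega> (\<lambda>x. c x i))) \<le> (\<Sum>i\<le>N. C / 4 * (LINT x|?M. (\<Sum>b\<in>Basis. g i b x)))"
  proof (rule sum_mono)
    fix i assume "i \<in> {..N}"
    then have i: "i \<le> N" by simp
    have "integrable ?M (\<lambda>x. \<Sum>b\<in>Basis. g i b x)" using gi i by auto
    then show "(LINT x|?M. c x i * ln (c x i / average \<Omega> (\<lambda>x. c x i))) \<le> C / 4 * (LINT x|?M. (\<Sum>b\<in>Basis. g i b x))"
      using log_sobolev_conc[OF \<Omega> LS(1) w i] unfolding c_def g_def y_def by simp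
  qed
  also have "\<dots> = C / 4 * (\<Sum>b\<in>Basis. LINT x|?M. (\<Sum>i\<le>N. g i b x))"
    using gi by (subst sum_distrib_left[symmetric]) (simp add: sum.swap[of _ Basis])
  also have "\<dots> \<le> C / 4 * (\<Sum>b\<in>Basis. LINT x|?M. 2 * dmax * Q b x)"
    using gi Qi LS(2) Q(1) by (intro mult_left_mono sum_mono integral_mono) auto
  also have "\<dots> = C * dmax / 2 * (\<Sum>b\<in>Basis. LINT x|?M. Q b x)"
    by (simp add: sum_distrib_left mult.assoc)
  also have "(\<Sum>b\<in>Basis. LINT x|?M. Q b x) = (LINT x|?M. q x)"
    unfolding qQ using Qi by simp
  finally show ?thesis .
qed

section \<open>Entropy decay of the time-discrete scheme\<close>

text \<open>
  Convexity of \<open>x ln (x / m)\<close>: the tangent at \<open>a\<close> lies below the graph at \<open>b\<close>.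
\<close>

lemma x_ln_ratio_convex:
  fixes a b m :: real
  assumes "a > 0" "b > 0" "m > 0"
  shows "a * ln (a / m) - b * ln (b / m) \<le> (a - b) * ln (a / m) + (a - b)"
proof -
  have "ln (a / b) \<le> a / b - 1" using assms by (intro ln_le_minus_one) auto
  then have "b * ln (a / b) \<le> b * (a / b - 1)" using assms by (intro mult_left_mono) auto
  also have "\<dots> = a - b" using assms by (simp add: field_simps)
  finally have "b * ln (a / b) \<le> a - b" .
  moreover have "ln (a / m) = ln (b / m) + ln (a / b)" using assms by (simp add: ln_div)
  then have "b * ln (a / m) = b * ln (b / m) + b * ln (a / b)" by (simp add: distrib_left)
  ultimately show ?thesis by (simp add: left_diff_distrib)
qed

text \<open>
  Taylor expansion at \<open>m\<close>: the second derivative \<open>1 / c\<close> of \<open>c ln (c / m)\<close> is at least one on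
  \<open>(0,1]\<close>.
\<close>

lemma relative_entropy_density_ge:
  fixes c m :: real
  assumes "0 < c" "c \<le> 1" "0 < m" "m \<le> 1"
  shows "c - m + (c - m)\<^sup>2 / 2 \<le> c * ln (c / m)"
proof -
  define f where "f x = x * ln x - x - x\<^sup>2 / 2 - (ln m - m) * x" for x :: real
  define f' where "f' x = ln x - x - (ln m - m)" for x :: real
  have der: "(f has_real_derivative f' x) (at x)" if "x > 0" for x
    unfolding f_def f'_def using that by (auto intro!: derivative_eq_intros simp: field_simps)
  have mono: "f' x \<le> f' y" if "0 < x" "x \<le> y" "y \<le> 1" for x y
  proof -
    have "ln (x / y) \<le> x / y - 1" using that by (intro ln_le_minus_one) auto
    moreover have "x / y - 1 = (x - y) / y" using that by (simp add: field_simps)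
    moreover have "(x - y) / y \<le> x - y" 
    proof -
      have "(y - x) * y \<le> y - x" using that by (intro mult_right_le_one_le) auto
      then have "y - x \<le> (y - x) / y" using that by (simp add: field_simps)
      then show ?thesis using that by (simp add: diff_divide_distrib)
    qed
    ultimately show ?thesis using that by (simp add: f'_def ln_div)
  qed
  have fm: "f' m = 0" by (simp add: f'_def)
  have "f m \<le> f c"
  proof (cases "m \<le> c")
    case True
    then show ?thesis
      by (rule DERIV_nonneg_imp_nondecreasing) (use der mono[of m] fm assms in \<open>metis less_le_trans order.trans\<close>)
  next
    case False
    then have "c \<le> m" by simp
    then show ?thesis
      by (rule DERIV_nonpos_imp_nonincreasing) (use der mono[of _ m] fm assms in \<open>metis less_le_trans order.trans\<close>)
  qed
  then have "c * ln c - c - c\<^sup>2 / 2 - (ln m - m) * c \<ge> - m + m\<^sup>2 / 2"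
    by (simp add: f_def power2_eq_square algebra_simps)
  moreover have "(c - m)\<^sup>2 / 2 = c\<^sup>2 / 2 - m * c + m\<^sup>2 / 2" by (simp add: power2_eq_square field_simps)
  moreover have "c * ln (c / m) = c * ln c - ln m * c" using assms by (simp add: ln_div algebra_simps)
  ultimately show ?thesis unfolding left_diff_distrib by linarith
qed

text \<open>
  One run of the time-discrete scheme, for positive initial data and on a domain with logarithmic
  Sobolev constant \<open>C\<close>.
\<close>

locale scheme = diffusion_coefficients N D for N D +
  fixes \<Omega> :: "'a::euclidean_space set" and c0 :: "nat \<Rightarrow> 'a \<Rightarrow> real" and C \<eta> \<epsilon> \<tau> :: real and w :: "nat \<Rightarrow> nat \<Rightarrow> 'a \<Rightarrow> real"
  assumes domain: "bounded_C11_domain \<Omega>" and LS: "log_sobolev \<Omega> C" "C > 0"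
    and init: "initial_data \<Omega> N c0" and \<eta>: "\<eta> > 0" "\<And>i. i \<le> N \<Longrightarrow> AE x in lebesgue_on \<Omega>. \<eta> \<le> c0 i x"
    and \<epsilon>: "\<epsilon> > 0" and \<tau>: "\<tau> > 0" and discrete: "discrete_solution \<Omega> N D c0 \<epsilon> \<tau> w"
begin

abbreviation "M \<equiv> lebesgue_on \<Omega>"
abbreviation "vol \<equiv> measure lebesgue \<Omega>"
definition "m i = average \<Omega> (c0 i)"
definition "c k i x = conc N (\<lambda>l. w k l x) i"
definition "entropy k = (\<Sum>i\<le>N. LINT x|M. c k i x * ln (c k i x / m i))"
definition "\<kappa> = 2 / (C * dmax)"

lemma \<Omega>: "open \<Omega>" "bounded \<Omega>" "\<Omega> \<in> sets borel" "\<Omega> \<noteq> {}"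
  using domain by (auto simp: bounded_C11_domain_def)

lemma vol_pos: "vol > 0"
  by (rule measure_open_pos[OF \<Omega>(1,4,2)])

lemma fin: "finite_measure M" by (rule finite_measure_lebesgue_on_bounded[OF \<Omega>(3,2)])

lemma \<kappa>_pos: "\<kappa> > 0" using LS(2) dmax_pos by (simp add: \<kappa>_def)

lemma w_Neumann: "k \<ge> 1 \<Longrightarrow> i < N \<Longrightarrow> w k i \<in> Neumann_H2 \<Omega>"
  using discrete by (simp add: discrete_solution_def)

lemma w_measurable: "i < N \<Longrightarrow> w k i \<in> borel_measurable M"
proof (cases "k \<ge> 1")
  case False
  assume i: "i < N"
  have "k = 0" using False by simp
  then have "w k i = (\<lambda>x. ln (c0 i x / c0 N x))" using discrete i by (simp add: discrete_solution_def)
  moreover have "c0 i \<in> borel_measurable M" "c0 N \<in> borel_measurable M"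
    using init i by (simp_all add: initial_data_def)
  ultimately show ?thesis by simp
qed (use w_Neumann Neumann_H2_L2 L2D(1) in blast)

lemma c_measurable[measurable]: "c k i \<in> borel_measurable M"
  unfolding c_def using w_measurable by (rule borel_measurable_conc)

lemma c_pos: "i \<le> N \<Longrightarrow> 0 < c k i x" and c_le_1: "i \<le> N \<Longrightarrow> c k i x \<le> 1" and sum_c: "(\<Sum>i\<le>N. c k i x) = 1"
  by (simp_all add: c_def conc_pos conc_le_1 sum_conc)

lemma c_L2: "i \<le> N \<Longrightarrow> c k i \<in> L2 \<Omega>"
  by (rule L2_bounded[OF \<Omega>(2,3), of _ 1]) (auto simp: abs_of_pos c_pos c_le_1)

lemma c_integrable: "i \<le> N \<Longrightarrow> integrable M (c k i)"
  by (rule L2_integrable[OF \<Omega>(2,3) c_L2])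

text \<open>
  The scheme starts from the entropy variables of the initial data, which are recovered by \<open>conc\<close>
  because they are positive with sum one.
\<close>

lemma c_initial: "i \<le> N \<Longrightarrow> AE x in M. c 0 i x = c0 i x"
proof -
  assume i: "i \<le> N"
  have "AE x in M. \<forall>i\<in>{..N}. \<eta> \<le> c0 i x" using \<eta>(2) by (intro AE_finite_allI) auto
  moreover have "AE x in M. c0 N x = 1 - (\<Sum>i<N. c0 i x)" using init by (auto simp: initial_data_def)
  ultimately show "AE x in M. c 0 i x = c0 i x"
  proof eventually_elim
    case (elim x)
    have p: "c0 j x > 0" if "j \<le> N" for j using elim(1) \<eta>(1) that by force
    have "w 0 l x = ln (c0 l x / c0 N x)" if "l < N" for l using discrete that by (simp add: discrete_solution_def)
    then have e: "exp (w 0 l x) = c0 l x / c0 N x" if "l < N" for l using that p[of l] p[of N] by simp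
    then have "1 + (\<Sum>j<N. exp (w 0 j x)) = 1 + (\<Sum>j<N. c0 j x) / c0 N x" by (simp add: sum_divide_distrib)
    also have "\<dots> = 1 / c0 N x" using elim(2) p[of N] by (simp add: field_simps)
    finally show "c 0 i x = c0 i x"
      using i p[of N] e by (cases "i = N") (simp_all add: c_def conc_last conc_less)
  qed
qed

lemma c0_measurable: "i \<le> N \<Longrightarrow> c0 i \<in> borel_measurable M" using init by (simp add: initial_data_def)

lemma m_initial: "i \<le> N \<Longrightarrow> m i = average \<Omega> (c 0 i)"
  unfolding m_def average_def using c_initial[of i] c0_measurable[of i]
  by (intro arg_cong2[where f="(/)"] refl integral_cong_AE) (auto elim: eventually_mono)

lemma average_sum: "(\<Sum>i\<le>N. average \<Omega> (c k i)) = 1"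
proof -
  have "(\<Sum>i\<le>N. average \<Omega> (c k i)) = (LINT x|M. (\<Sum>i\<le>N. c k i x)) / vol"
    unfolding average_def sum_divide_distrib[symmetric] using c_integrable by (subst Bochner_Integration.integral_sum) auto
  also have "\<dots> = 1" using vol_pos by (simp add: sum_c integral_const_lebesgue_on[OF \<Omega>(3)] del: lebesgue_integral_const)
  finally show ?thesis .
qed

lemma average_pos: "i \<le> N \<Longrightarrow> average \<Omega> (c k i) > 0"
proof -
  assume i: "i \<le> N"
  have "0 < (LINT x|M. c k i x)"
  proof (rule finite_measure.integral_less_AE_space[OF fin, of "\<lambda>x. 0" "c k i", simplified])
    show "integrable M (c k i)" by (rule c_integrable[OF i])
    show "AE x in M. 0 < c k i x" using c_pos[OF i] by simp
    show "emeasure M \<Omega> \<noteq> 0" using vol_pos \<Omega>(3) by (auto simp: emeasure_restrict_space measure_def)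
  qed
  then show ?thesis using vol_pos by (simp add: average_def)
qed

lemma average_le_1: "i \<le> N \<Longrightarrow> average \<Omega> (c k i) \<le> 1"
  using average_sum[of k] member_le_sum[of i "{..N}" "\<lambda>i. average \<Omega> (c k i)"] average_pos
  by (auto simp: less_imp_le)

lemma m_pos: "i \<le> N \<Longrightarrow> m i > 0" and m_le_1: "i \<le> N \<Longrightarrow> m i \<le> 1"
  using average_pos[of i 0] average_le_1[of i 0] by (simp_all add: m_initial)

lemma sum_m: "(\<Sum>i\<le>N. m i) = 1" using average_sum[of 0] by (simp add: m_initial)

lemma ent_integrable: "i \<le> N \<Longrightarrow> t > 0 \<Longrightarrow> integrable M (\<lambda>x. c k i x * ln (c k i x / t))"
  by (rule entropy_integrable[OF fin]) (auto simp: c_pos c_le_1 less_imp_le)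

text \<open>
  The linear terms \<open>c i - m i\<close> of the lower bound for the entropy density cancel after summation
  over \<open>i\<close>, since concentrations and averages both sum to one. Thus no mass has to be conserved.
\<close>

lemma entropy_lower_bound: "j \<le> N \<Longrightarrow> (LINT x|M. (c k j x - m j)\<^sup>2) / 2 \<le> entropy k"
proof -
  assume j: "j \<le> N"
  let ?h = "\<lambda>i x. c k i x - m i" and ?q = "\<lambda>i x. (c k i x - m i)\<^sup>2 / 2"
  have L2: "?h i \<in> L2 \<Omega>" if "i \<le> N" for i
    using L2_lincomb[OF c_L2[OF that, of k] const_L2[OF \<Omega>(1,2), of "m i"], of 1 "-1"] by simp
  have hi: "integrable M (?h i)" if "i \<le> N" for i by (rule L2_integrable[OF \<Omega>(2,3) L2[OF that]])
  have qi: "integrable M (?q i)" if "i \<le> N" for i using L2D(2)[OF L2[OF that]] by simp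
  have "(LINT x|M. ?q j x) \<le> (\<Sum>i\<le>N. LINT x|M. ?q i x)"
    using j by (intro member_le_sum Bochner_Integration.integral_nonneg) auto
  moreover have "(\<Sum>i\<le>N. LINT x|M. ?h i x) = 0"
  proof -
    have "(\<Sum>i\<le>N. LINT x|M. ?h i x) = (LINT x|M. (\<Sum>i\<le>N. ?h i x))" using hi by (subst Bochner_Integration.integral_sum) auto
    also have "\<dots> = 0" by (simp add: sum_subtractf sum_c sum_m)
    finally show ?thesis .
  qed
  moreover have "(LINT x|M. ?h i x) + (LINT x|M. ?q i x) \<le> (LINT x|M. c k i x * ln (c k i x / m i))" if i: "i \<le> N" for i
  proof -
    have "(LINT x|M. ?h i x) + (LINT x|M. ?q i x) = (LINT x|M. ?h i x + ?q i x)"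
      using hi[OF i] qi[OF i] by simp
    also have "\<dots> \<le> (LINT x|M. c k i x * ln (c k i x / m i))"
      by (rule integral_mono) (use hi[OF i] qi[OF i] ent_integrable[OF i m_pos[OF i]] i in
          \<open>auto intro!: relative_entropy_density_ge c_pos c_le_1 m_pos m_le_1\<close>)
    finally show ?thesis .
  qed
  then have "(\<Sum>i\<le>N. (LINT x|M. ?h i x) + (LINT x|M. ?q i x)) \<le> entropy k"
    unfolding entropy_def by (intro sum_mono) auto
  ultimately show ?thesis by (simp add: sum.distrib)
qed

lemma entropy_nonneg: "0 \<le> entropy k"
proof -
  have "0 \<le> (LINT x|M. (c k 0 x - m 0)\<^sup>2) / 2" by simp
  then show ?thesis using entropy_lower_bound[of 0 k] by linarith
qed

text \<open>
  The relative entropies with respect to the own average and to \<open>m i\<close> differ by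
  \<open>vol a ln (a / m i)\<close>, which is small when \<open>a\<close> is close to \<open>m i\<close>.
\<close>

lemma average_entropy:
  fixes k
  assumes i: "i \<le> N"
  defines "a \<equiv> average \<Omega> (c k i)"
  shows "0 \<le> (LINT x|M. c k i x * ln (c k i x / a))"
    and "(LINT x|M. c k i x * ln (c k i x / m i)) \<le> (LINT x|M. c k i x * ln (c k i x / a)) + vol * \<bar>a - m i\<bar> / m i"
proof -
  have a: "0 < a" "a \<le> 1" using average_pos[OF i] average_le_1[OF i] by (auto simp: a_def)
  have Ia: "(LINT x|M. c k i x) = vol * a" using vol_pos by (simp add: a_def average_def)
  have "(LINT x|M. c k i x - a) \<le> (LINT x|M. c k i x * ln (c k i x / a))"
  proof (rule integral_mono)
    show "integrable M (\<lambda>x. c k i x - a)"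
      using c_integrable[OF i] finite_measure.integrable_const[OF fin] by (intro Bochner_Integration.integrable_diff) auto
    show "integrable M (\<lambda>x. c k i x * ln (c k i x / a))" by (rule ent_integrable[OF i a(1)])
    fix x
    have "0 \<le> (c k i x - a)\<^sup>2 / 2" by simp
    then show "c k i x - a \<le> c k i x * ln (c k i x / a)"
      using relative_entropy_density_ge[of "c k i x" a] a c_pos[OF i, of k x] c_le_1[OF i, of k x] by linarith
  qed
  also have "(LINT x|M. c k i x - a) = 0"
    using c_integrable[OF i, of k] finite_measure.integrable_const[OF fin] 
    by (subst Bochner_Integration.integral_diff) (auto simp: Ia integral_const_lebesgue_on[OF \<Omega>(3)] simp del: lebesgue_integral_const)
  finally show "0 \<le> (LINT x|M. c k i x * ln (c k i x / a))" .
  have m: "m i > 0" by (rule m_pos[OF i])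
  have "(LINT x|M. c k i x * ln (c k i x / m i)) = (LINT x|M. c k i x * ln (c k i x / a) + ln (a / m i) * c k i x)"
    using m a c_pos[OF i] by (intro Bochner_Integration.integral_cong refl) (simp add: ln_div less_imp_neq[symmetric] algebra_simps)
  also have "\<dots> = (LINT x|M. c k i x * ln (c k i x / a)) + ln (a / m i) * (vol * a)"
    using c_integrable[OF i] ent_integrable[OF i a(1)] by (subst Bochner_Integration.integral_add) (auto simp: Ia)
  also have "ln (a / m i) * (vol * a) \<le> vol * \<bar>a - m i\<bar> / m i"
  proof -
    have "ln (a / m i) \<le> a / m i - 1" using a m by (intro ln_le_minus_one) auto
    also have "\<dots> = (a - m i) / m i" using m by (simp add: diff_divide_distrib)
    also have "\<dots> \<le> \<bar>a - m i\<bar> / m i" using m by (intro divide_right_mono) auto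
    finally have "ln (a / m i) * (vol * a) \<le> \<bar>a - m i\<bar> / m i * (vol * a)"
      using a vol_pos by (intro mult_right_mono) auto
    also have "\<dots> \<le> \<bar>a - m i\<bar> / m i * (vol * 1)"
      using a vol_pos m by (intro mult_left_mono) auto
    finally show ?thesis by (simp add: mult.commute)
  qed
  finally show "(LINT x|M. c k i x * ln (c k i x / m i)) \<le> (LINT x|M. c k i x * ln (c k i x / a)) + vol * \<bar>a - m i\<bar> / m i"
    by simp
qed

end

lemma L2_sum:
  assumes "open \<Omega>" "bounded \<Omega>" "finite I" "\<And>i. i \<in> I \<Longrightarrow> f i \<in> L2 \<Omega>"
  shows "(\<lambda>x. \<Sum>i\<in>I. f i x) \<in> L2 \<Omega>"
  using assms(3,4)
proof (induction I rule: finite_induct)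
  case empty
  then show ?case using const_L2[OF assms(1,2), of 0] by simp
next
  case (insert i I)
  then show ?case using L2_lincomb[of "f i" \<Omega> "\<lambda>x. \<Sum>i\<in>I. f i x" 1 1] by simp
qed

lemma laplacian_L2:
  assumes "open \<Omega>" "bounded \<Omega>" "u \<in> Neumann_H2 \<Omega>"
  shows "laplacian \<Omega> u \<in> L2 \<Omega>"
  unfolding laplacian_def[abs_def]
  by (rule L2_sum[OF assms(1,2)]) (auto intro!: H1_weak_deriv_L2 Neumann_H2_weak_deriv_H1 assms(3))

lemma laplacian_add_const:
  assumes "open \<Omega>" "bounded \<Omega>" "u \<in> L2 \<Omega>"
  shows "laplacian \<Omega> (\<lambda>x. u x + c) = laplacian \<Omega> u"
  unfolding laplacian_def[abs_def] using weak_deriv_add_const[OF assms] by simp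

lemma grad_inner_add_const:
  assumes "open \<Omega>" "bounded \<Omega>" "u \<in> L2 \<Omega>"
  shows "grad_inner \<Omega> (\<lambda>x. u x + c) v x = grad_inner \<Omega> u v x"
  unfolding grad_inner_def using weak_deriv_add_const[OF assms] by simp

context scheme
begin

definition "dissipation k = (LINT x|M. (\<Sum>i<N. \<Sum>j<N. diffusion_matrix N D (\<lambda>l. w k l x) $$ (i, j) * grad_inner \<Omega> (w k i) (w k j) x))"
definition "w_sq k = (\<Sum>i<N. LINT x|M. (w k i x)\<^sup>2)"
definition "reg_bound = vol / 2 * (\<Sum>i<N. (ln (m i / m N))\<^sup>2)"

lemma weak_equation:
  assumes "k \<ge> 1" "\<And>i. i < N \<Longrightarrow> v i \<in> Neumann_H2 \<Omega>"
  shows "1 / \<tau> * (LINT x|M. (\<Sum>i<N. (c k i x - c (k - 1) i x) * v i x)) +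
     (LINT x|M. (\<Sum>i<N. \<Sum>j<N. diffusion_matrix N D (\<lambda>l. w k l x) $$ (i, j) * grad_inner \<Omega> (v i) (w k j) x)) +
     \<epsilon> * (LINT x|M. (\<Sum>i<N. laplacian \<Omega> (w k i) x * laplacian \<Omega> (v i) x + w k i x * v i x)) = 0"
  using discrete assms unfolding discrete_solution_def c_def by blast

lemma w_L2: "k \<ge> 1 \<Longrightarrow> i < N \<Longrightarrow> w k i \<in> L2 \<Omega>"
  by (intro Neumann_H2_L2 w_Neumann)

text \<open>
  The scheme tested with the constant \<open>1\<close> in component \<open>i\<close>; only the regularization violates mass
  conservation.
\<close>

lemma mass_step:
  assumes k: "k \<ge> 1" and i: "i < N"
  shows "(LINT x|M. c k i x) - (LINT x|M. c (k - 1) i x) = - \<tau> * \<epsilon> * (LINT x|M. w k i x)"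
proof -
  define v :: "nat \<Rightarrow> 'a \<Rightarrow> real" where "v l = (\<lambda>x. if l = i then 1 else 0)" for l
  have v: "v l \<in> Neumann_H2 \<Omega>" for l unfolding v_def by (rule const_Neumann_H2[OF \<Omega>(1,2)])
  have lap: "AE x in M. \<forall>l\<in>{..<N}. laplacian \<Omega> (v l) x = 0"
    unfolding v_def using laplacian_const[OF \<Omega>(1,2)] by (intro AE_finite_allI) auto
  have "AE x in M. \<forall>b\<in>Basis. \<forall>l\<in>{..<N}. weak_deriv \<Omega> b (v l) x = 0"
    unfolding v_def using weak_deriv_const[OF \<Omega>(1,2)] by (intro AE_finite_allI) auto
  then have "AE x in M. (\<Sum>i<N. \<Sum>j<N. diffusion_matrix N D (\<lambda>l. w k l x) $$ (i, j) * grad_inner \<Omega> (v i) (w k j) x) = 0"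
    by eventually_elim (simp add: grad_inner_def)
  then have diff: "(LINT x|M. (\<Sum>i<N. \<Sum>j<N. diffusion_matrix N D (\<lambda>l. w k l x) $$ (i, j) * grad_inner \<Omega> (v i) (w k j) x)) = 0"
    by (rule integral_eq_zero_AE)
  have [measurable]: "laplacian \<Omega> (v l) \<in> borel_measurable M" for l
    by (rule L2D(1)[OF laplacian_L2[OF \<Omega>(1,2) v]])
  have [measurable]: "laplacian \<Omega> (w k l) \<in> borel_measurable M" "w k l \<in> borel_measurable M" if "l < N" for l
    using L2D(1)[OF laplacian_L2[OF \<Omega>(1,2) w_Neumann[OF k that]]] w_measurable[OF that] by auto
  have [measurable]: "v l \<in> borel_measurable M" for l unfolding v_def by simp
  have "(LINT x|M. (\<Sum>l<N. laplacian \<Omega> (w k l) x * laplacian \<Omega> (v l) x + w k l x * v l x)) = (LINT x|M. w k i x)"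
  proof (rule integral_cong_AE)
    show "(\<lambda>x. \<Sum>l<N. laplacian \<Omega> (w k l) x * laplacian \<Omega> (v l) x + w k l x * v l x) \<in> borel_measurable M"
      by measurable
    show "w k i \<in> borel_measurable M" by (rule w_measurable[OF i])
    show "AE x in M. (\<Sum>l<N. laplacian \<Omega> (w k l) x * laplacian \<Omega> (v l) x + w k l x * v l x) = w k i x"
      using lap
    proof eventually_elim
      case (elim x)
      then have "(\<Sum>l<N. laplacian \<Omega> (w k l) x * laplacian \<Omega> (v l) x + w k l x * v l x) = (\<Sum>l<N. if l = i then w k l x else 0)"
        by (intro sum.cong refl) (auto simp: v_def)
      then show ?case using i by simp
    qed
  qed
  moreover have "(\<Sum>l<N. (c k l x - c (k - 1) l x) * v l x) = c k i x - c (k - 1) i x" for x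
  proof -
    have "(\<Sum>l<N. (c k l x - c (k - 1) l x) * v l x) = (\<Sum>l<N. if l = i then c k l x - c (k - 1) l x else 0)"
      by (intro sum.cong refl) (auto simp: v_def)
    then show ?thesis using i by simp
  qed
  moreover have "(LINT x|M. c k i x - c (k - 1) i x) = (LINT x|M. c k i x) - (LINT x|M. c (k - 1) i x)"
    using c_integrable i by simp
  ultimately have "1 / \<tau> * ((LINT x|M. c k i x) - (LINT x|M. c (k - 1) i x)) + \<epsilon> * (LINT x|M. w k i x) = 0"
    using weak_equation[OF k, of v] v diff by simp
  then show ?thesis using \<tau> by (simp add: field_simps)
qed

lemma ln_c_ratio: "i < N \<Longrightarrow> ln (c k i x / c k N x) = w k i x"
proof -
  assume "i < N"
  moreover have "1 + (\<Sum>j<N. exp (w k j x)) \<noteq> 0" using exp_sum_pos[of "\<lambda>l. w k l x" N] by linarith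
  ultimately have "c k i x / c k N x = exp (w k i x)"
    by (simp add: c_def conc_less conc_last)
  then show ?thesis by simp
qed

text \<open>
  The scheme tested with \<open>v i = w k i - ln (m i / m N)\<close>. Since \<open>w k i = ln (c i / c N)\<close>, the
  product of the time difference with \<open>v\<close> equals \<open>\<Sum>i\<le>N. (c i - c' i) ln (c i / m i)\<close>, where the
  last component comes from the vanishing sum of the differences; convexity bounds it by the
  entropy difference.
\<close>

lemma entropy_step:
  assumes k: "k \<ge> 1"
  shows "entropy k + \<tau> * dissipation k + \<tau> * \<epsilon> / 2 * w_sq k \<le> entropy (k - 1) + \<tau> * \<epsilon> * reg_bound"
proof -
  define r where "r i = ln (m i / m N)" for i
  define v where "v i x = w k i x + (- r i)" for i x
  have wL2: "w k i \<in> L2 \<Omega>" if "i < N" for i by (rule w_L2[OF k that])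
  have v: "v i \<in> Neumann_H2 \<Omega>" if "i < N" for i
    unfolding v_def[abs_def] by (rule Neumann_H2_add_const[OF \<Omega>(1,2) w_Neumann[OF k that]])
  have vL2: "v i \<in> L2 \<Omega>" if "i < N" for i by (rule Neumann_H2_L2[OF v[OF that]])
  have lap: "laplacian \<Omega> (v i) = laplacian \<Omega> (w k i)" if "i < N" for i
    unfolding v_def[abs_def] by (rule laplacian_add_const[OF \<Omega>(1,2) wL2[OF that]])
  have grad: "grad_inner \<Omega> (v i) (w k j) x = grad_inner \<Omega> (w k i) (w k j) x" if "i < N" for i j x
    unfolding v_def[abs_def] by (rule grad_inner_add_const[OF \<Omega>(1,2) wL2[OF that]])
  let ?c = "c k" and ?c' = "c (k - 1)"
  have dL2: "(\<lambda>x. ?c i x - ?c' i x) \<in> L2 \<Omega>" if "i \<le> N" for i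
    using L2_lincomb[OF c_L2[OF that, of k] c_L2[OF that, of "k - 1"], of 1 "-1"] by simp
  have pt: "(\<Sum>i\<le>N. ?c i x * ln (?c i x / m i) - ?c' i x * ln (?c' i x / m i)) \<le> (\<Sum>i<N. (?c i x - ?c' i x) * v i x)" for x
  proof -
    have "(\<Sum>i\<le>N. ?c i x * ln (?c i x / m i) - ?c' i x * ln (?c' i x / m i)) \<le>
        (\<Sum>i\<le>N. (?c i x - ?c' i x) * ln (?c i x / m i) + (?c i x - ?c' i x))"
      by (intro sum_mono x_ln_ratio_convex c_pos m_pos) auto
    also have "\<dots> = (\<Sum>i\<le>N. (?c i x - ?c' i x) * ln (?c i x / m i))"
      by (simp add: sum.distrib sum_subtractf sum_c)
    also have "\<dots> = (\<Sum>i<N. (?c i x - ?c' i x) * ln (?c i x / m i)) + (?c N x - ?c' N x) * ln (?c N x / m N)"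
      by (simp add: lessThan_Suc_atMost[symmetric])
    also have "?c N x - ?c' N x = - (\<Sum>i<N. ?c i x - ?c' i x)"
      using sum_c[of k x] sum_c[of "k - 1" x] by (simp add: lessThan_Suc_atMost[symmetric] sum_subtractf)
    also have "(\<Sum>i<N. (?c i x - ?c' i x) * ln (?c i x / m i)) + - (\<Sum>i<N. ?c i x - ?c' i x) * ln (?c N x / m N) =
        (\<Sum>i<N. (?c i x - ?c' i x) * (ln (?c i x / m i) - ln (?c N x / m N)))"
      unfolding right_diff_distrib[of _ "ln _"] sum_subtractf[of _ _ "{..<N}"]
      by (simp only: sum_distrib_right[symmetric] sum_subtractf[of _ _ "{..<N}"] mult_minus_left diff_conv_add_uminus[symmetric] add_uminus_conv_diff)
    also have "\<dots> = (\<Sum>i<N. (?c i x - ?c' i x) * v i x)"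
    proof (intro sum.cong refl arg_cong2[where f="(*)"])
      fix i assume "i \<in> {..<N}"
      then have i: "i < N" "i \<le> N" by auto
      have p: "0 < ?c i x" "0 < ?c N x" "0 < m i" "0 < m N" using c_pos m_pos i by auto
      have "v i x = ln (?c i x / ?c N x) - ln (m i / m N)" using i by (simp add: v_def ln_c_ratio r_def)
      then show "ln (?c i x / m i) - ln (?c N x / m N) = v i x" using p by (simp add: ln_div)
    qed
    finally show ?thesis .
  qed
  have ei: "integrable M (\<lambda>x. c k' i x * ln (c k' i x / m i))" if "i \<le> N" for k' i
    using that by (intro ent_integrable m_pos)
  have "entropy k - entropy (k - 1) = (LINT x|M. (\<Sum>i\<le>N. ?c i x * ln (?c i x / m i) - ?c' i x * ln (?c' i x / m i)))"
    unfolding entropy_def using ei by (subst Bochner_Integration.integral_sum) (auto simp: sum_subtractf)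
  also have "\<dots> \<le> (LINT x|M. (\<Sum>i<N. (?c i x - ?c' i x) * v i x))"
    using ei dL2 vL2 pt by (intro integral_mono) (auto intro!: L2_mult_integrable)
  finally have 1: "entropy k - entropy (k - 1) \<le> (LINT x|M. (\<Sum>i<N. (?c i x - ?c' i x) * v i x))" .
  have lapL2: "laplacian \<Omega> (w k i) \<in> L2 \<Omega>" if "i < N" for i by (rule laplacian_L2[OF \<Omega>(1,2) w_Neumann[OF k that]])
  have ri: "integrable M (\<lambda>x. (w k i x)\<^sup>2 / 2 - (r i)\<^sup>2 / 2)" if "i < N" for i
    by (intro Bochner_Integration.integrable_diff integrable_divide L2D(2)[OF wL2[OF that]] finite_measure.integrable_const[OF fin])
  have "w_sq k / 2 - reg_bound = (LINT x|M. (\<Sum>i<N. (w k i x)\<^sup>2 / 2 - (r i)\<^sup>2 / 2))"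
  proof -
    have "(LINT x|M. (\<Sum>i<N. (w k i x)\<^sup>2 / 2 - (r i)\<^sup>2 / 2)) = (\<Sum>i<N. (LINT x|M. (w k i x)\<^sup>2 / 2 - (r i)\<^sup>2 / 2))"
      by (rule Bochner_Integration.integral_sum) (use ri in auto)
    also have "\<dots> = (\<Sum>i<N. (LINT x|M. (w k i x)\<^sup>2) / 2 - (r i)\<^sup>2 / 2 * vol)"
    proof (intro sum.cong refl)
      fix i assume "i \<in> {..<N}"
      then have "(LINT x|M. (w k i x)\<^sup>2 / 2 - (r i)\<^sup>2 / 2) = (LINT x|M. (w k i x)\<^sup>2 / 2) - (LINT x|M. (r i)\<^sup>2 / 2)"
        using L2D(2)[OF wL2] finite_measure.integrable_const[OF fin, of "(r i)\<^sup>2 / 2"] by (intro Bochner_Integration.integral_diff) auto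
      then show "(LINT x|M. (w k i x)\<^sup>2 / 2 - (r i)\<^sup>2 / 2) = (LINT x|M. (w k i x)\<^sup>2) / 2 - (r i)\<^sup>2 / 2 * vol"
        unfolding integral_const_lebesgue_on[OF \<Omega>(3)] by simp
    qed
    also have "\<dots> = w_sq k / 2 - reg_bound"
      by (simp add: w_sq_def reg_bound_def r_def sum_subtractf sum_divide_distrib sum_distrib_left mult.commute)
    finally show ?thesis by simp
  qed
  also have "\<dots> \<le> (LINT x|M. (\<Sum>i<N. laplacian \<Omega> (w k i) x * laplacian \<Omega> (v i) x + w k i x * v i x))"
  proof (rule integral_mono)
    show "integrable M (\<lambda>x. \<Sum>i<N. (w k i x)\<^sup>2 / 2 - (r i)\<^sup>2 / 2)"
      by (rule Bochner_Integration.integrable_sum) (use ri in auto)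
    show "integrable M (\<lambda>x. \<Sum>i<N. laplacian \<Omega> (w k i) x * laplacian \<Omega> (v i) x + w k i x * v i x)"
    proof (rule Bochner_Integration.integrable_sum, rule Bochner_Integration.integrable_add)
      fix i assume "i \<in> {..<N}"
      then have i: "i < N" by simp
      show "integrable M (\<lambda>x. laplacian \<Omega> (w k i) x * laplacian \<Omega> (v i) x)"
        unfolding lap[OF i] by (rule L2_mult_integrable[OF lapL2[OF i] lapL2[OF i]])
      show "integrable M (\<lambda>x. w k i x * v i x)" by (rule L2_mult_integrable[OF wL2[OF i] vL2[OF i]])
    qed
    fix x
    show "(\<Sum>i<N. (w k i x)\<^sup>2 / 2 - (r i)\<^sup>2 / 2) \<le> (\<Sum>i<N. laplacian \<Omega> (w k i) x * laplacian \<Omega> (v i) x + w k i x * v i x)"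
    proof (rule sum_mono)
      fix i assume "i \<in> {..<N}"
      then have "laplacian \<Omega> (w k i) x * laplacian \<Omega> (v i) x = (laplacian \<Omega> (w k i) x)\<^sup>2"
        using lap by (simp add: power2_eq_square)
      then have "0 \<le> laplacian \<Omega> (w k i) x * laplacian \<Omega> (v i) x" by simp
      moreover have "0 \<le> (w k i x - r i)\<^sup>2" by simp
      then have "(w k i x)\<^sup>2 / 2 - (r i)\<^sup>2 / 2 \<le> w k i x * v i x" by (simp add: v_def power2_eq_square algebra_simps)
      ultimately show "(w k i x)\<^sup>2 / 2 - (r i)\<^sup>2 / 2 \<le> laplacian \<Omega> (w k i) x * laplacian \<Omega> (v i) x + w k i x * v i x" by linarith
    qed
  qed
  finally have 2: "w_sq k / 2 - reg_bound \<le> (LINT x|M. (\<Sum>i<N. laplacian \<Omega> (w k i) x * laplacian \<Omega> (v i) x + w k i x * v i x))" .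
  have 3: "(LINT x|M. (\<Sum>i<N. \<Sum>j<N. diffusion_matrix N D (\<lambda>l. w k l x) $$ (i, j) * grad_inner \<Omega> (v i) (w k j) x)) = dissipation k"
    unfolding dissipation_def using grad by simp
  define X where "X = (LINT x|M. (\<Sum>i<N. (?c i x - ?c' i x) * v i x))"
  define Y where "Y = (LINT x|M. (\<Sum>i<N. laplacian \<Omega> (w k i) x * laplacian \<Omega> (v i) x + w k i x * v i x))"
  have "1 / \<tau> * X + dissipation k + \<epsilon> * Y = 0"
    unfolding 3[symmetric] X_def Y_def by (rule weak_equation[OF k v])
  then have "\<tau> * (1 / \<tau> * X + dissipation k + \<epsilon> * Y) = 0" by simp
  then have "X + \<tau> * dissipation k + \<tau> * \<epsilon> * Y = 0" using \<tau> by (simp add: algebra_simps)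
  moreover have "\<tau> * \<epsilon> * (w_sq k / 2 - reg_bound) \<le> \<tau> * \<epsilon> * Y"
    using 2 \<tau> \<epsilon> unfolding Y_def by (intro mult_left_mono) auto
  ultimately show ?thesis using 1 unfolding X_def by (simp add: algebra_simps)
qed

lemma dissipation_lower_bound:
  assumes k: "k \<ge> 1"
  shows "\<kappa> * (\<Sum>i\<le>N. LINT x|M. c k i x * ln (c k i x / average \<Omega> (c k i))) \<le> dissipation k"
proof -
  have "(\<Sum>i\<le>N. LINT x|M. c k i x * ln (c k i x / average \<Omega> (c k i))) \<le> C * dmax / 2 * dissipation k"
    using entropy_dissipation[OF \<Omega>(1,2) LS(1), of "w k"] LS(2) Neumann_H2_H1[OF w_Neumann[OF k]]
    unfolding c_def[abs_def] dissipation_def by simp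
  then have "\<kappa> * (\<Sum>i\<le>N. LINT x|M. c k i x * ln (c k i x / average \<Omega> (c k i))) \<le> \<kappa> * (C * dmax / 2 * dissipation k)"
    using \<kappa>_pos by (intro mult_left_mono) auto
  also have "\<dots> = dissipation k" using LS(2) dmax_pos by (simp add: \<kappa>_def)
  finally show ?thesis .
qed

lemma w_sq_nonneg: "0 \<le> w_sq k" unfolding w_sq_def by (intro sum_nonneg) auto

lemma dissipation_nonneg: "k \<ge> 1 \<Longrightarrow> 0 \<le> dissipation k"
proof -
  assume k: "k \<ge> 1"
  have "0 \<le> \<kappa> * (\<Sum>i\<le>N. LINT x|M. c k i x * ln (c k i x / average \<Omega> (c k i)))"
    using \<kappa>_pos average_entropy(1) by (intro mult_nonneg_nonneg sum_nonneg) auto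
  then show ?thesis using dissipation_lower_bound[OF k] by linarith
qed

text \<open>
  The entropy inequality also bounds the regularization terms, which is what controls the mass
  defect.
\<close>

lemma w_sq_sum: "entropy K + \<tau> * \<epsilon> / 2 * (\<Sum>k=1..K. w_sq k) \<le> entropy 0 + real K * (\<tau> * \<epsilon> * reg_bound)"
proof (induction K)
  case (Suc K)
  have "entropy (Suc K) + \<tau> * dissipation (Suc K) + \<tau> * \<epsilon> / 2 * w_sq (Suc K) \<le> entropy K + \<tau> * \<epsilon> * reg_bound"
    using entropy_step[of "Suc K"] by simp
  moreover have "0 \<le> \<tau> * dissipation (Suc K)" using dissipation_nonneg[of "Suc K"] \<tau> by simp
  moreover have "\<tau> * \<epsilon> / 2 * (\<Sum>k=1..Suc K. w_sq k) = \<tau> * \<epsilon> / 2 * (\<Sum>k=1..K. w_sq k) + \<tau> * \<epsilon> / 2 * w_sq (Suc K)"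
    by (simp add: distrib_left)
  moreover have "real (Suc K) * (\<tau> * \<epsilon> * reg_bound) = real K * (\<tau> * \<epsilon> * reg_bound) + \<tau> * \<epsilon> * reg_bound"
    by (simp add: distrib_right)
  ultimately show ?case using Suc by linarith
qed simp

definition "mass_defect T = sqrt \<epsilon> * (real N * (T * vol / 2 + entropy 0 + T * \<epsilon> * reg_bound)) / vol"

text \<open>
  The changes of the mass in single steps are summed up. Each is of order \<open>\<tau> \<epsilon> \<integral> |w|\<close>, and
  \<open>|w| \<le> (1 / s + s w\<^sup>2) / 2\<close> with \<open>s = sqrt \<epsilon>\<close> balances the measure of the domain against the
  bound for \<open>\<tau> \<epsilon> \<Sum>k. \<integral> w\<^sup>2\<close>.
\<close>

lemma mass_defect_bound:
  assumes K: "real K * \<tau> \<le> T" and i: "i \<le> N"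
  shows "\<bar>average \<Omega> (c K i) - m i\<bar> \<le> mass_defect T"
proof -
  define s where "s = sqrt \<epsilon>"
  have s: "s > 0" "s * s = \<epsilon>" using \<epsilon> by (simp_all add: s_def)
  have R: "0 \<le> reg_bound" unfolding reg_bound_def using vol_pos by (intro mult_nonneg_nonneg sum_nonneg) auto
  define B where "B = T * vol / 2 + entropy 0 + T * \<epsilon> * reg_bound"
  have step: "\<bar>(LINT x|M. c k i x) - (LINT x|M. c (k - 1) i x)\<bar> \<le> s * (\<tau> * vol / 2 + \<tau> * \<epsilon> / 2 * w_sq k)"
    if k: "k \<ge> 1" and i: "i < N" for k i
  proof -
    have "(LINT x|M. \<bar>w k i x\<bar>) \<le> (LINT x|M. (1 / s) / 2 + s / 2 * (w k i x)\<^sup>2)"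
    proof (rule integral_mono)
      show "integrable M (\<lambda>x. \<bar>w k i x\<bar>)" using L2_integrable[OF \<Omega>(2,3) w_L2[OF k i]] by simp
      show "integrable M (\<lambda>x. (1 / s) / 2 + s / 2 * (w k i x)\<^sup>2)"
        by (intro Bochner_Integration.integrable_add integrable_mult_right L2D(2)[OF w_L2[OF k i]] finite_measure.integrable_const[OF fin])
      fix x
      have "0 \<le> (1 / s) * (s * \<bar>w k i x\<bar> - 1)\<^sup>2" using s by simp
      also have "\<dots> = 1 / s + s * (w k i x)\<^sup>2 - 2 * \<bar>w k i x\<bar>"
        using s(1) by (simp add: power2_eq_square field_simps)
      finally show "\<bar>w k i x\<bar> \<le> (1 / s) / 2 + s / 2 * (w k i x)\<^sup>2" by simp
    qed
    also have "\<dots> = (1 / s) / 2 * vol + s / 2 * (LINT x|M. (w k i x)\<^sup>2)"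
      using L2D(2)[OF w_L2[OF k i]] finite_measure.integrable_const[OF fin]
      by (subst Bochner_Integration.integral_add)
        (simp_all only: integral_const_lebesgue_on[OF \<Omega>(3)] integral_mult_right_zero integrable_mult_right)
    also have "\<dots> \<le> (1 / s) / 2 * vol + s / 2 * w_sq k"
      unfolding w_sq_def using s i by (intro add_left_mono mult_left_mono member_le_sum) auto
    finally have w: "(LINT x|M. \<bar>w k i x\<bar>) \<le> (1 / s) / 2 * vol + s / 2 * w_sq k" .
    have "\<bar>(LINT x|M. c k i x) - (LINT x|M. c (k - 1) i x)\<bar> = \<tau> * \<epsilon> * \<bar>LINT x|M. w k i x\<bar>"
      unfolding mass_step[OF k i] using \<tau> \<epsilon> by (simp add: abs_mult)
    also have "\<dots> \<le> \<tau> * \<epsilon> * ((1 / s) / 2 * vol + s / 2 * w_sq k)"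
      using \<tau> \<epsilon> order_trans[OF integral_abs_bound w] by (intro mult_left_mono) auto
    also have "\<dots> = s * (\<tau> * vol / 2 + \<tau> * \<epsilon> / 2 * w_sq k)"
      using s(1) unfolding s(2)[symmetric] by (simp add: field_simps)
    finally show ?thesis .
  qed
  have "\<bar>(LINT x|M. c K i x) - (LINT x|M. c 0 i x)\<bar> \<le> s * (real K * \<tau> * vol / 2 + \<tau> * \<epsilon> / 2 * (\<Sum>k=1..K. w_sq k))" if i: "i < N" for i
  proof (induction K)
    case (Suc K)
    have "\<bar>(LINT x|M. c (Suc K) i x) - (LINT x|M. c K i x)\<bar> \<le> s * (\<tau> * vol / 2 + \<tau> * \<epsilon> / 2 * w_sq (Suc K))"
      using step[of "Suc K", OF _ i] by simp
    moreover have "s * (real (Suc K) * \<tau> * vol / 2 + \<tau> * \<epsilon> / 2 * (\<Sum>k=1..Suc K. w_sq k)) =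
        s * (real K * \<tau> * vol / 2 + \<tau> * \<epsilon> / 2 * (\<Sum>k=1..K. w_sq k)) + s * (\<tau> * vol / 2 + \<tau> * \<epsilon> / 2 * w_sq (Suc K))"
      by (simp add: algebra_simps)
    ultimately show ?case using Suc by linarith
  qed simp
  moreover have "s * (real K * \<tau> * vol / 2 + \<tau> * \<epsilon> / 2 * (\<Sum>k=1..K. w_sq k)) \<le> s * B"
  proof -
    have "real K * \<tau> * vol / 2 \<le> T * vol / 2" using K vol_pos by (intro divide_right_mono mult_right_mono) auto
    moreover have "real K * (\<tau> * \<epsilon> * reg_bound) \<le> T * (\<epsilon> * reg_bound)"
      using mult_right_mono[OF K, of "\<epsilon> * reg_bound"] \<epsilon> R by (simp add: mult.assoc)
    ultimately have "real K * \<tau> * vol / 2 + \<tau> * \<epsilon> / 2 * (\<Sum>k=1..K. w_sq k) \<le> B"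
      using w_sq_sum[of K] entropy_nonneg[of K] unfolding B_def mult.assoc by linarith
    then show ?thesis using s(1) by (intro mult_left_mono) auto
  qed
  ultimately have J: "\<bar>(LINT x|M. c K i x) - (LINT x|M. c 0 i x)\<bar> \<le> s * B" if "i < N" for i
    using that by (meson order_trans)
  have sB: "0 \<le> s * B" using J[of 0] N by linarith
  have F: "\<bar>(LINT x|M. c K i x) - (LINT x|M. c 0 i x)\<bar> \<le> real N * (s * B)"
  proof (cases "i < N")
    case True
    have "1 * (s * B) \<le> real N * (s * B)" using N sB by (intro mult_right_mono) auto
    then show ?thesis using J[OF True] by linarith
  next
    case False
    then have iN: "i = N" using i by simp
    have mass: "(LINT x|M. c k N x) = vol - (\<Sum>l<N. LINT x|M. c k l x)" for k
    proof -
      have "vol * (\<Sum>l\<le>N. average \<Omega> (c k l)) = (\<Sum>l\<le>N. LINT x|M. c k l x)"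
        using vol_pos by (simp add: average_def sum_distrib_left)
      then show ?thesis unfolding average_sum by (simp add: lessThan_Suc_atMost[symmetric])
    qed
    have "\<bar>(LINT x|M. c K i x) - (LINT x|M. c 0 i x)\<bar> = \<bar>\<Sum>l<N. (LINT x|M. c 0 l x) - (LINT x|M. c K l x)\<bar>"
      unfolding iN mass by (simp add: sum_subtractf)
    also have "\<dots> \<le> (\<Sum>l<N. \<bar>(LINT x|M. c 0 l x) - (LINT x|M. c K l x)\<bar>)" by (rule sum_abs)
    also have "\<dots> \<le> (\<Sum>l<N. s * B)" using J by (intro sum_mono) (simp add: abs_minus_commute)
    finally show ?thesis by simp
  qed
  have "\<bar>average \<Omega> (c K i) - m i\<bar> = \<bar>(LINT x|M. c K i x) - (LINT x|M. c 0 i x)\<bar> / vol"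
    unfolding m_initial[OF i] average_def using vol_pos by (simp add: diff_divide_distrib[symmetric])
  also have "\<dots> \<le> real N * (s * B) / vol" using F vol_pos by (intro divide_right_mono) auto
  also have "\<dots> = mass_defect T" by (simp add: mass_defect_def s_def B_def)
  finally show ?thesis .
qed

definition "defect T = \<epsilon> * reg_bound + \<kappa> * vol * mass_defect T * (\<Sum>i\<le>N. 1 / m i)"

lemma entropy_decay_step:
  assumes K: "real (Suc K) * \<tau> \<le> T"
  shows "entropy (Suc K) * (1 + \<kappa> * \<tau>) \<le> entropy K + \<tau> * defect T"
proof -
  let ?k = "Suc K"
  let ?E = "\<Sum>i\<le>N. LINT x|M. c ?k i x * ln (c ?k i x / average \<Omega> (c ?k i))"
  have "entropy ?k \<le> (\<Sum>i\<le>N. (LINT x|M. c ?k i x * ln (c ?k i x / average \<Omega> (c ?k i))) + vol * \<bar>average \<Omega> (c ?k i) - m i\<bar> / m i)"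
    unfolding entropy_def by (intro sum_mono average_entropy(2)) auto
  also have "\<dots> = ?E + (\<Sum>i\<le>N. vol * \<bar>average \<Omega> (c ?k i) - m i\<bar> / m i)" by (rule sum.distrib)
  also have "\<dots> \<le> ?E + (\<Sum>i\<le>N. vol * mass_defect T / m i)"
    using mass_defect_bound[OF K] vol_pos m_pos by (intro add_left_mono sum_mono divide_right_mono mult_left_mono) (auto simp: less_imp_le)
  finally have "\<kappa> * entropy ?k \<le> \<kappa> * (?E + (\<Sum>i\<le>N. vol * mass_defect T / m i))"
    using \<kappa>_pos by (intro mult_left_mono) auto
  also have "\<dots> \<le> dissipation ?k + \<kappa> * (\<Sum>i\<le>N. vol * mass_defect T / m i)"
    using dissipation_lower_bound[of ?k] by (simp add: distrib_left)
  finally have "\<tau> * (\<kappa> * entropy ?k) \<le> \<tau> * (dissipation ?k + \<kappa> * (\<Sum>i\<le>N. vol * mass_defect T / m i))"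
    using \<tau> by (intro mult_left_mono) auto
  also have "\<dots> = \<tau> * dissipation ?k + \<tau> * (\<kappa> * vol * mass_defect T * (\<Sum>i\<le>N. 1 / m i))"
    by (simp add: distrib_left sum_distrib_left mult.assoc)
  finally have "\<tau> * (\<kappa> * entropy ?k) \<le> \<tau> * dissipation ?k + \<tau> * (\<kappa> * vol * mass_defect T * (\<Sum>i\<le>N. 1 / m i))" .
  moreover have "0 \<le> \<tau> * \<epsilon> / 2 * w_sq ?k" using \<tau> \<epsilon> w_sq_nonneg by simp
  ultimately show ?thesis
    using entropy_step[of ?k] by (simp add: defect_def algebra_simps)
qed

text \<open>
  With \<open>q = 1 / (1 + \<kappa> \<tau>)\<close> the constant \<open>defect T / \<kappa>\<close> is a fixed point of the recursion
  \<open>E \<mapsto> q (E + \<tau> defect T)\<close>, so the recursion gives \<open>E K \<le> q\<^sup>K E 0 + defect T / \<kappa>\<close>. Moreover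
  \<open>q \<le> 1 - \<kappa> \<tau> / 2 \<le> exp (- \<kappa> \<tau> / 2)\<close>, as \<open>q \<ge> 1 / 2\<close>.
\<close>

lemma entropy_decay:
  assumes K: "real K * \<tau> \<le> T" and \<kappa>\<tau>: "\<kappa> * \<tau> \<le> 1" and T: "T \<ge> 0"
  shows "entropy K \<le> exp (- \<kappa> / 2 * (real K * \<tau>)) * entropy 0 + defect T / \<kappa>"
proof -
  have R: "0 \<le> reg_bound" unfolding reg_bound_def using vol_pos by (intro mult_nonneg_nonneg sum_nonneg) auto
  have md: "0 \<le> mass_defect T" unfolding mass_defect_def
    using R entropy_nonneg[of 0] \<epsilon> T vol_pos by (intro divide_nonneg_nonneg mult_nonneg_nonneg add_nonneg_nonneg) auto
  have d: "0 \<le> defect T" unfolding defect_def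
    using R md \<epsilon> \<kappa>_pos vol_pos m_pos by (intro add_nonneg_nonneg mult_nonneg_nonneg sum_nonneg) (auto simp: less_imp_le)
  define q where "q = 1 / (1 + \<kappa> * \<tau>)"
  have kt: "0 < \<kappa> * \<tau>" using \<kappa>_pos \<tau> by simp
  have q: "0 < q" "q \<le> 1" "q * (1 + \<kappa> * \<tau>) = 1" using kt by (auto simp: q_def)
  have qe: "q \<le> exp (- \<kappa> / 2 * \<tau>)"
  proof -
    have "1 - q = \<kappa> * \<tau> * q" using q(3) by (simp add: algebra_simps)
    moreover have "1 / 2 \<le> q" using kt \<kappa>\<tau> by (simp add: q_def field_simps)
    then have "\<kappa> * \<tau> * (1 / 2) \<le> \<kappa> * \<tau> * q" using kt by (intro mult_left_mono) auto
    ultimately have "q \<le> 1 + (- \<kappa> / 2 * \<tau>)" by simp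
    also have "\<dots> \<le> exp (- \<kappa> / 2 * \<tau>)" by (rule exp_ge_add_one_self)
    finally show ?thesis .
  qed
  have "entropy K \<le> q ^ K * entropy 0 + defect T / \<kappa>"
    using K
  proof (induction K)
    case 0
    then show ?case using d \<kappa>_pos by simp
  next
    case (Suc K)
    have "entropy (Suc K) = q * (entropy (Suc K) * (1 + \<kappa> * \<tau>))" using q(3) by (metis mult.assoc mult.commute mult_1)
    also have "\<dots> \<le> q * (entropy K + \<tau> * defect T)" using entropy_decay_step[OF Suc.prems] q(1) by (intro mult_left_mono) auto
    also have "\<dots> \<le> q * ((q ^ K * entropy 0 + defect T / \<kappa>) + \<tau> * defect T)"
    proof -
      have "real K * \<tau> \<le> T" using Suc.prems \<tau> by (simp add: distrib_right)
      then show ?thesis using Suc.IH q(1) by (intro mult_left_mono add_right_mono) auto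
    qed
    also have "\<dots> = q ^ Suc K * entropy 0 + (q * (1 + \<kappa> * \<tau>)) * (defect T / \<kappa>)"
      using \<kappa>_pos by (simp add: field_simps)
    finally show ?case unfolding q(3) by simp
  qed
  also have "q ^ K \<le> exp (- \<kappa> / 2 * \<tau>) ^ K" using q qe by (intro power_mono) auto
  also have "\<dots> = exp (- \<kappa> / 2 * (real K * \<tau>))" by (simp add: exp_of_nat_mult[symmetric] mult_ac)
  finally show ?thesis using entropy_nonneg[of 0] by (simp add: mult_right_mono)
qed

end

section \<open>Decay of the scheme in the L1 norm\<close>

lemma L2_norm_sq: "(L2_norm \<Omega> f)\<^sup>2 = (LINT x|lebesgue_on \<Omega>. (f x)\<^sup>2)"
  unfolding L2_norm_def by (rule real_sqrt_pow2) (simp add: Bochner_Integration.integral_nonneg)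

lemma L2_diff: "f \<in> L2 \<Omega> \<Longrightarrow> g \<in> L2 \<Omega> \<Longrightarrow> (\<lambda>x. f x - g x) \<in> L2 \<Omega>"
  using L2_lincomb[of f \<Omega> g 1 "-1"] by simp

lemma L2_cauchy_schwarz:
  assumes f: "f \<in> L2 \<Omega>" and g: "g \<in> L2 \<Omega>"
  shows "\<bar>LINT x|lebesgue_on \<Omega>. f x * g x\<bar> \<le> L2_norm \<Omega> f * L2_norm \<Omega> g"
proof -
  let ?M = "lebesgue_on \<Omega>"
  define F G P where "F = (LINT x|?M. (f x)\<^sup>2)" and "G = (LINT x|?M. (g x)\<^sup>2)" and "P = (LINT x|?M. f x * g x)"
  note i = L2D(2)[OF f] L2D(2)[OF g] L2_mult_integrable[OF f g]
  have G0: "0 \<le> G" "0 \<le> F" by (simp_all add: F_def G_def)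
  have "P\<^sup>2 \<le> F * G"
  proof (cases "G = 0")
    case True
    then have "AE x in ?M. (g x)\<^sup>2 = 0" using i(2) by (simp add: G_def integral_nonneg_eq_0_iff_AE)
    then have "AE x in ?M. f x * g x = 0" by eventually_elim simp
    then have "P = 0" unfolding P_def by (rule integral_eq_zero_AE)
    then show ?thesis using True by simp
  next
    case False
    have "0 \<le> (LINT x|?M. (G * f x - P * g x)\<^sup>2)" by simp
    also have "\<dots> = (LINT x|?M. G\<^sup>2 * (f x)\<^sup>2 - 2 * G * P * (f x * g x) + P\<^sup>2 * (g x)\<^sup>2)"
      by (intro Bochner_Integration.integral_cong refl) (simp add: power2_eq_square algebra_simps)
    also have "\<dots> = G\<^sup>2 * F - 2 * G * P * P + P\<^sup>2 * G"
      using i by (simp add: F_def G_def P_def)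
    also have "\<dots> = G * (F * G - P\<^sup>2)" by (simp add: power2_eq_square algebra_simps)
    finally show ?thesis using False G0(1) by (simp add: zero_le_mult_iff)
  qed
  then have "sqrt (P\<^sup>2) \<le> sqrt (F * G)" by (rule real_sqrt_le_mono)
  then show ?thesis by (simp add: real_sqrt_mult F_def G_def P_def L2_norm_def)
qed

lemma L2_norm_triangle:
  assumes f: "f \<in> L2 \<Omega>" and g: "g \<in> L2 \<Omega>"
  shows "L2_norm \<Omega> (\<lambda>x. f x + g x) \<le> L2_norm \<Omega> f + L2_norm \<Omega> g"
proof (rule power2_le_imp_le)
  let ?M = "lebesgue_on \<Omega>"
  note i = L2D(2)[OF f] L2D(2)[OF g] L2_mult_integrable[OF f g]
  have "(L2_norm \<Omega> (\<lambda>x. f x + g x))\<^sup>2 = (LINT x|?M. (f x)\<^sup>2 + 2 * (f x * g x) + (g x)\<^sup>2)"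
    unfolding L2_norm_sq by (intro Bochner_Integration.integral_cong refl) (simp add: power2_eq_square algebra_simps)
  also have "\<dots> = (L2_norm \<Omega> f)\<^sup>2 + 2 * (LINT x|?M. f x * g x) + (L2_norm \<Omega> g)\<^sup>2"
    unfolding L2_norm_sq using i by simp
  also have "\<dots> \<le> (L2_norm \<Omega> f + L2_norm \<Omega> g)\<^sup>2"
    using L2_cauchy_schwarz[OF f g] by (simp add: power2_sum)
  finally show "(L2_norm \<Omega> (\<lambda>x. f x + g x))\<^sup>2 \<le> (L2_norm \<Omega> f + L2_norm \<Omega> g)\<^sup>2" .
qed (simp add: L2_norm_nonneg)

lemma L2_norm_minus_commute: "L2_norm \<Omega> (\<lambda>x. f x - g x) = L2_norm \<Omega> (\<lambda>x. g x - f x)"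
  unfolding L2_norm_def by (simp add: power2_commute)

lemma L2_norm_triangle_diff:
  assumes "f \<in> L2 \<Omega>" "g \<in> L2 \<Omega>" "h \<in> L2 \<Omega>"
  shows "L2_norm \<Omega> (\<lambda>x. f x - h x) \<le> L2_norm \<Omega> (\<lambda>x. f x - g x) + L2_norm \<Omega> (\<lambda>x. g x - h x)"
  using L2_norm_triangle[OF L2_diff[OF assms(1,2)] L2_diff[OF assms(2,3)]] by simp

lemma L1_norm_le_L2_norm:
  assumes "open \<Omega>" "bounded \<Omega>" "f \<in> L2 \<Omega>"
  shows "L1_norm \<Omega> f \<le> sqrt (measure lebesgue \<Omega>) * L2_norm \<Omega> f"
proof -
  have [measurable]: "f \<in> borel_measurable (lebesgue_on \<Omega>)" by (rule L2D(1)[OF assms(3)])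
  have b: "\<Omega> \<in> sets borel" using assms(1) by simp
  have a: "(\<lambda>x. \<bar>f x\<bar>) \<in> L2 \<Omega>" using assms(3) by (simp add: L2_def)
  have "L1_norm \<Omega> f \<le> L2_norm \<Omega> (\<lambda>x. 1) * L2_norm \<Omega> (\<lambda>x. \<bar>f x\<bar>)"
    using L2_cauchy_schwarz[OF const_L2[OF assms(1,2), of 1] a] by (simp add: L1_norm_def)
  then show ?thesis
    using integral_const_lebesgue_on[OF b, of 1] by (simp add: L2_norm_def)
qed

lemma L1_norm_triangle:
  assumes "integrable (lebesgue_on \<Omega>) f" "integrable (lebesgue_on \<Omega>) g"
  shows "L1_norm \<Omega> (\<lambda>x. f x + g x) \<le> L1_norm \<Omega> f + L1_norm \<Omega> g"
proof -
  have "L1_norm \<Omega> (\<lambda>x. f x + g x) \<le> (LINT x|lebesgue_on \<Omega>. \<bar>f x\<bar> + \<bar>g x\<bar>)"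
    unfolding L1_norm_def using assms by (intro integral_mono) auto
  then show ?thesis using assms by (simp add: L1_norm_def)
qed

text \<open>
  The error of the decay estimate as an explicit function of \<open>\<epsilon>\<close> and the data, which shows that it
  tends to zero uniformly in \<open>\<tau>\<close>.
\<close>

definition scheme_defect :: "nat \<Rightarrow> 'a::euclidean_space set \<Rightarrow> (nat \<Rightarrow> 'a \<Rightarrow> real) \<Rightarrow> real \<Rightarrow> real \<Rightarrow> real \<Rightarrow> real" where
  "scheme_defect N \<Omega> c0 \<kappa> T \<epsilon> = (let v = measure lebesgue \<Omega>; m = (\<lambda>i. average \<Omega> (c0 i)); R = v / 2 * (\<Sum>i<N. (ln (m i / m N))\<^sup>2) in
     (\<epsilon> * R + \<kappa> * v * (sqrt \<epsilon> * (real N * (T * v / 2 + relative_entropy \<Omega> N c0 c0 + T * \<epsilon> * R)) / v) * (\<Sum>i\<le>N. 1 / m i)) / \<kappa>)"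

lemma scheme_defect_tendsto:
  assumes "\<epsilon> \<longlonglongrightarrow> 0"
  shows "(\<lambda>n. scheme_defect N \<Omega> c0 \<kappa> T (\<epsilon> n)) \<longlonglongrightarrow> 0"
proof -
  let ?v = "measure lebesgue \<Omega>"
  have "(\<lambda>n. (\<epsilon> n * R + \<kappa> * ?v * (sqrt (\<epsilon> n) * (p * (X + T * \<epsilon> n * R)) / ?v) * S) / \<kappa>) \<longlonglongrightarrow>
      (0 * R + \<kappa> * ?v * (sqrt 0 * (p * (X + T * 0 * R)) / ?v) * S) / \<kappa>" for R X S p
    unfolding divide_inverse by (intro tendsto_intros assms)
  then have *: "(\<lambda>n. (\<epsilon> n * R + \<kappa> * ?v * (sqrt (\<epsilon> n) * (p * (X + T * \<epsilon> n * R)) / ?v) * S) / \<kappa>) \<longlonglongrightarrow> 0" for R X S p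
    by simp
  show ?thesis
    unfolding scheme_defect_def Let_def by (rule *)
qed

context scheme
begin

definition "H = relative_entropy \<Omega> N c0 c0"

lemma entropy_initial: "entropy 0 = H"
  unfolding entropy_def H_def relative_entropy_def m_def
proof (intro sum.cong refl integral_cong_AE)
  fix i assume "i \<in> {..N}"
  then have i: "i \<le> N" by simp
  have [measurable]: "c0 i \<in> borel_measurable M" by (rule c0_measurable[OF i])
  show "(\<lambda>x. c 0 i x * ln (c 0 i x / average \<Omega> (c0 i))) \<in> borel_measurable M"
    "(\<lambda>x. c0 i x * ln (c0 i x / average \<Omega> (c0 i))) \<in> borel_measurable M" by measurable
  show "AE x in M. c 0 i x * ln (c 0 i x / average \<Omega> (c0 i)) = c0 i x * ln (c0 i x / average \<Omega> (c0 i))"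
    using c_initial[OF i] by eventually_elim simp
qed

lemma step_index_bounds: "0 < t \<Longrightarrow> t \<le> real (step_index \<tau> t) * \<tau> \<and> real (step_index \<tau> t) * \<tau> \<le> t + \<tau>"
proof -
  assume t: "0 < t"
  have "0 < t / \<tau>" using t \<tau> by simp
  then have "0 \<le> \<lceil>t / \<tau>\<rceil>" by linarith
  then have r: "real (step_index \<tau> t) = of_int \<lceil>t / \<tau>\<rceil>" by (simp add: step_index_def)
  have "t / \<tau> \<le> real (step_index \<tau> t)" "real (step_index \<tau> t) \<le> t / \<tau> + 1" unfolding r by linarith+
  then have "t / \<tau> * \<tau> \<le> real (step_index \<tau> t) * \<tau>" "real (step_index \<tau> t) * \<tau> \<le> (t / \<tau> + 1) * \<tau>"
    using \<tau> by (intro mult_right_mono; simp)+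
  then show ?thesis using \<tau> by (simp add: distrib_right)
qed

lemma step_bound:
  assumes t: "0 < t" "t \<le> T" and \<kappa>\<tau>: "\<kappa> * \<tau> \<le> 1" "\<tau> \<le> 1" and i: "i \<le> N"
  shows "L1_norm \<Omega> (\<lambda>x. step_conc N \<tau> w i t x - average \<Omega> (c0 i)) \<le>
    sqrt (2 * vol * (exp (- \<kappa> / 2 * t) * H + defect (T + 1) / \<kappa>))"
proof -
  define K where "K = step_index \<tau> t"
  have K: "t \<le> real K * \<tau>" "real K * \<tau> \<le> T + 1" using step_index_bounds[OF t(1)] t \<kappa>\<tau> by (auto simp: K_def)
  have f: "(\<lambda>x. step_conc N \<tau> w i t x - average \<Omega> (c0 i)) = (\<lambda>x. c K i x - m i)"
    by (simp add: step_conc_def K_def c_def m_def)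
  have L2: "(\<lambda>x. c K i x - m i) \<in> L2 \<Omega>"
    using L2_diff[OF c_L2[OF i] const_L2[OF \<Omega>(1,2)]] .
  have "entropy K \<le> exp (- \<kappa> / 2 * (real K * \<tau>)) * entropy 0 + defect (T + 1) / \<kappa>"
    using t by (intro entropy_decay K \<kappa>\<tau>(1)) auto
  also have "exp (- \<kappa> / 2 * (real K * \<tau>)) * entropy 0 \<le> exp (- \<kappa> / 2 * t) * H"
    unfolding entropy_initial[symmetric] using entropy_nonneg[of 0] K(1) \<kappa>_pos by (intro mult_right_mono) auto
  finally have E: "entropy K \<le> exp (- \<kappa> / 2 * t) * H + defect (T + 1) / \<kappa>" by simp
  have "L1_norm \<Omega> (\<lambda>x. c K i x - m i) \<le> sqrt vol * sqrt (LINT x|M. (c K i x - m i)\<^sup>2)"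
    using L1_norm_le_L2_norm[OF \<Omega>(1,2) L2] by (simp add: L2_norm_def)
  also have "\<dots> = sqrt (vol * (LINT x|M. (c K i x - m i)\<^sup>2))" by (simp add: real_sqrt_mult)
  also have "\<dots> \<le> sqrt (vol * (2 * (exp (- \<kappa> / 2 * t) * H + defect (T + 1) / \<kappa>)))"
    using vol_pos E entropy_lower_bound[OF i, of K] by (intro real_sqrt_le_mono mult_left_mono) auto
  also have "vol * (2 * (exp (- \<kappa> / 2 * t) * H + defect (T + 1) / \<kappa>)) = 2 * vol * (exp (- \<kappa> / 2 * t) * H + defect (T + 1) / \<kappa>)"
    by (simp only: mult_ac)
  finally show ?thesis unfolding f .
qed

lemma scheme_bound:
  assumes t: "0 < t" "t < T" and \<kappa>\<tau>: "2 / (C * dmax) * \<tau> \<le> 1" "\<tau> \<le> 1" and i: "i \<le> N"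
  shows "L1_norm \<Omega> (\<lambda>x. step_conc N \<tau> w i t x - average \<Omega> (c0 i)) \<le>
    sqrt (2 * vol * (exp (- (2 / (C * dmax)) / 2 * t) * relative_entropy \<Omega> N c0 c0 + scheme_defect N \<Omega> c0 (2 / (C * dmax)) (T + 1) \<epsilon>))"
proof -
  have "defect (T + 1) / \<kappa> = scheme_defect N \<Omega> c0 \<kappa> (T + 1) \<epsilon>"
    by (simp add: defect_def mass_defect_def entropy_initial H_def m_def reg_bound_def scheme_defect_def Let_def)
  then show ?thesis
    using step_bound[of t T i] t \<kappa>\<tau> i unfolding H_def \<kappa>_def[symmetric] by simp
qed

end

section \<open>Limits in space and time\<close>

text \<open>
  Measurability in the sense of Bochner with values in \<open>L2 \<Omega>\<close>, with functions as representatives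
  of their classes.
\<close>

definition strongly_measurable :: "'a::euclidean_space set \<Rightarrow> real \<Rightarrow> (real \<Rightarrow> 'a \<Rightarrow> real) \<Rightarrow> bool" where
  "strongly_measurable \<Omega> T f \<longleftrightarrow> (\<exists>s :: nat \<Rightarrow> real \<Rightarrow> 'a \<Rightarrow> real.
     (\<forall>n. simple_function (lebesgue_on {0<..<T}) (s n) \<and> s n ` {0<..<T} \<subseteq> L2 \<Omega>) \<and>
     (AE t in lebesgue_on {0<..<T}. f t \<in> L2 \<Omega> \<and> (\<lambda>n. L2_norm \<Omega> (\<lambda>x. s n t x - f t x)) \<longlonglongrightarrow> 0))"

lemma L2_norm_le_H1_norm: "L2_norm \<Omega> u \<le> H1_norm \<Omega> u"
proof -
  have "sqrt ((L2_norm \<Omega> u)\<^sup>2) \<le> H1_norm \<Omega> u"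
    unfolding H1_norm_def by (intro real_sqrt_le_mono) (simp add: sum_nonneg)
  then show ?thesis by (simp add: L2_norm_nonneg)
qed

lemma bochner_H1_strongly_measurable:
  assumes "c \<in> bochner_L2 T (H1 \<Omega>) (H1_norm \<Omega>)"
  shows "strongly_measurable \<Omega> T c"
proof -
  from assms obtain s :: "nat \<Rightarrow> real \<Rightarrow> 'a \<Rightarrow> real" where
    s: "\<And>n. simple_function (lebesgue_on {0<..<T}) (s n)" "\<And>n. s n ` {0<..<T} \<subseteq> H1 \<Omega>"
    and c: "AE t in lebesgue_on {0<..<T}. c t \<in> H1 \<Omega>"
    and l: "AE t in lebesgue_on {0<..<T}. (\<lambda>n. H1_norm \<Omega> (\<lambda>y. s n t y - c t y)) \<longlonglongrightarrow> 0"
    unfolding bochner_L2_def by blast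
  have "AE t in lebesgue_on {0<..<T}. c t \<in> L2 \<Omega> \<and> (\<lambda>n. L2_norm \<Omega> (\<lambda>x. s n t x - c t x)) \<longlonglongrightarrow> 0"
    using c l
  proof eventually_elim
    case (elim t)
    have "(\<lambda>n. L2_norm \<Omega> (\<lambda>x. s n t x - c t x)) \<longlonglongrightarrow> 0"
      by (rule tendsto_sandwich[OF _ _ tendsto_const elim(2)]) (simp_all add: L2_norm_nonneg L2_norm_le_H1_norm)
    then show ?case using elim by (simp add: H1_def)
  qed
  moreover have "H1 \<Omega> \<subseteq> L2 \<Omega>" by (auto simp: H1_def)
  ultimately show ?thesis unfolding strongly_measurable_def using s by (intro exI[of _ s]) blast
qed

lemma step_strongly_measurable:
  assumes g: "\<And>k. g k \<in> L2 \<Omega>" and \<tau>: "\<tau> > 0"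
  shows "strongly_measurable \<Omega> T (\<lambda>t. g (step_index \<tau> t))"
proof -
  let ?M = "lebesgue_on {0<..<T}"
  have "simple_function ?M (step_index \<tau>)"
    unfolding simple_function_def
  proof (intro conjI ballI)
    have "step_index \<tau> t \<le> nat \<lceil>T / \<tau>\<rceil>" if "t \<in> {0<..<T}" for t
      unfolding step_index_def using that \<tau> by (intro nat_mono ceiling_mono divide_right_mono) auto
    then have "step_index \<tau> ` {0<..<T} \<subseteq> {..nat \<lceil>T / \<tau>\<rceil>}" by auto
    then show "finite (step_index \<tau> ` space ?M)" by (simp add: finite_subset)
    fix k
    have "(\<lambda>t. \<lceil>t / \<tau>\<rceil>) \<in> measurable borel (count_space UNIV)"
      by (rule measurable_compose[OF _ measurable_real_ceiling]) simp
    then have "(\<lambda>t. nat \<lceil>t / \<tau>\<rceil>) \<in> measurable borel (count_space UNIV)"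
      by (rule measurable_compose) simp
    then have "step_index \<tau> \<in> measurable borel (count_space UNIV)"
      unfolding step_index_def[abs_def] .
    from measurable_sets[OF this, of "{k}"] have "step_index \<tau> -` {k} \<in> sets borel" by simp
    then have "step_index \<tau> -` {k} \<in> sets lebesgue" by (simp add: sets_completionI_sets)
    then show "step_index \<tau> -` {k} \<inter> space ?M \<in> sets ?M"
      unfolding sets_restrict_space by (intro image_eqI[where x = "step_index \<tau> -` {k}"]) auto
  qed
  then have "simple_function ?M (\<lambda>t. g (step_index \<tau> t))" by (rule simple_function_compose1)
  then show ?thesis unfolding strongly_measurable_def using g by (intro exI[of _ "\<lambda>n t. g (step_index \<tau> t)"]) (auto simp: L2_norm_def)
qed

lemma borel_measurable_lebesgue_on_AE:
  fixes f g :: "'a::euclidean_space \<Rightarrow> real"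
  assumes S: "S \<in> sets lebesgue" and f: "f \<in> borel_measurable (lebesgue_on S)" and ae: "AE x in lebesgue_on S. f x = g x"
  shows "g \<in> borel_measurable (lebesgue_on S)"
proof -
  have S': "S \<inter> space lebesgue \<in> sets lebesgue" using S by simp
  have "AE x in lebesgue. x \<in> S \<longrightarrow> f x = g x" using ae S by (simp add: AE_restrict_space_iff)
  then have "AE x in lebesgue. indicator S x *\<^sub>R f x = indicator S x *\<^sub>R g x"
    by eventually_elim (simp add: indicator_def)
  moreover have "(\<lambda>x. indicator S x *\<^sub>R f x) \<in> borel_measurable lebesgue"
    using f unfolding borel_measurable_restrict_space_iff[OF S'] .
  ultimately have "(\<lambda>x. indicator S x *\<^sub>R g x) \<in> borel_measurable lebesgue"
    by (rule borel_measurable_AE[rotated])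
  then show ?thesis unfolding borel_measurable_restrict_space_iff[OF S'] .
qed

text \<open>
  The distances between the approximating simple functions are simple functions and converge
  almost everywhere.
\<close>

lemma L2_dist_measurable:
  fixes f g :: "real \<Rightarrow> 'a::euclidean_space \<Rightarrow> real"
  assumes "strongly_measurable \<Omega> T f" "strongly_measurable \<Omega> T g"
  shows "(\<lambda>t. L2_norm \<Omega> (\<lambda>x. f t x - g t x)) \<in> borel_measurable (lebesgue_on {0<..<T})"
proof -
  let ?M = "lebesgue_on {0<..<T}"
  obtain s where s0: "(\<forall>n. simple_function ?M (s n) \<and> s n ` {0<..<T} \<subseteq> L2 \<Omega>) \<and>
     (AE t in ?M. f t \<in> L2 \<Omega> \<and> (\<lambda>n. L2_norm \<Omega> (\<lambda>x. s n t x - f t x)) \<longlonglongrightarrow> 0)"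
    using assms(1) unfolding strongly_measurable_def by (rule exE)
  have s: "\<And>n. simple_function ?M (s n)" "\<And>n. s n ` {0<..<T} \<subseteq> L2 \<Omega>"
    and f: "AE t in ?M. f t \<in> L2 \<Omega> \<and> (\<lambda>n. L2_norm \<Omega> (\<lambda>x. s n t x - f t x)) \<longlonglongrightarrow> 0"
    by (rule s0[THEN conjunct1, THEN spec, THEN conjunct1] s0[THEN conjunct1, THEN spec, THEN conjunct2] s0[THEN conjunct2])+
  obtain r where r0: "(\<forall>n. simple_function ?M (r n) \<and> r n ` {0<..<T} \<subseteq> L2 \<Omega>) \<and>
     (AE t in ?M. g t \<in> L2 \<Omega> \<and> (\<lambda>n. L2_norm \<Omega> (\<lambda>x. r n t x - g t x)) \<longlonglongrightarrow> 0)"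
    using assms(2) unfolding strongly_measurable_def by (rule exE)
  have r: "\<And>n. simple_function ?M (r n)" "\<And>n. r n ` {0<..<T} \<subseteq> L2 \<Omega>"
    and g: "AE t in ?M. g t \<in> L2 \<Omega> \<and> (\<lambda>n. L2_norm \<Omega> (\<lambda>x. r n t x - g t x)) \<longlonglongrightarrow> 0"
    by (rule r0[THEN conjunct1, THEN spec, THEN conjunct1] r0[THEN conjunct1, THEN spec, THEN conjunct2] r0[THEN conjunct2])+
  define h where "h n t = L2_norm \<Omega> (\<lambda>x. s n t x - r n t x)" for n t
  have hm[measurable]: "h n \<in> borel_measurable ?M" for n
    unfolding h_def
    by (rule borel_measurable_simple_function, rule simple_function_compose2[where h = "\<lambda>a b. L2_norm \<Omega> (\<lambda>x. a x - b x)", OF s(1) r(1)])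
  have lim: "AE t in ?M. (\<lambda>n. h n t) \<longlonglongrightarrow> L2_norm \<Omega> (\<lambda>x. f t x - g t x)"
    using f g AE_space
  proof eventually_elim
    case (elim t)
    then have t: "t \<in> {0<..<T}" by simp
    have L2: "s n t \<in> L2 \<Omega>" "r n t \<in> L2 \<Omega>" for n using s(2) r(2) t by blast+
    have b: "\<bar>h n t - L2_norm \<Omega> (\<lambda>x. f t x - g t x)\<bar> \<le> L2_norm \<Omega> (\<lambda>x. s n t x - f t x) + L2_norm \<Omega> (\<lambda>x. r n t x - g t x)" for n
    proof -
      have fg: "f t \<in> L2 \<Omega>" "g t \<in> L2 \<Omega>" using elim by auto
      have "h n t \<le> L2_norm \<Omega> (\<lambda>x. s n t x - f t x) + L2_norm \<Omega> (\<lambda>x. f t x - r n t x)"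
        unfolding h_def by (rule L2_norm_triangle_diff[OF L2(1) fg(1) L2(2)])
      moreover have "L2_norm \<Omega> (\<lambda>x. f t x - r n t x) \<le> L2_norm \<Omega> (\<lambda>x. f t x - g t x) + L2_norm \<Omega> (\<lambda>x. g t x - r n t x)"
        by (rule L2_norm_triangle_diff[OF fg L2(2)])
      moreover have "L2_norm \<Omega> (\<lambda>x. f t x - g t x) \<le> L2_norm \<Omega> (\<lambda>x. f t x - s n t x) + L2_norm \<Omega> (\<lambda>x. s n t x - g t x)"
        by (rule L2_norm_triangle_diff[OF fg(1) L2(1) fg(2)])
      moreover have "L2_norm \<Omega> (\<lambda>x. s n t x - g t x) \<le> h n t + L2_norm \<Omega> (\<lambda>x. r n t x - g t x)"
        unfolding h_def by (rule L2_norm_triangle_diff[OF L2(1) L2(2) fg(2)])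
      ultimately show ?thesis
        using L2_norm_minus_commute[of \<Omega> "f t" "s n t"] L2_norm_minus_commute[of \<Omega> "g t" "r n t"] by linarith
    qed
    have "(\<lambda>n. L2_norm \<Omega> (\<lambda>x. s n t x - f t x) + L2_norm \<Omega> (\<lambda>x. r n t x - g t x)) \<longlonglongrightarrow> 0 + 0"
      by (rule tendsto_add[OF conjunct2[OF elim(1)] conjunct2[OF elim(2)]])
    then have lim0: "(\<lambda>n. L2_norm \<Omega> (\<lambda>x. s n t x - f t x) + L2_norm \<Omega> (\<lambda>x. r n t x - g t x)) \<longlonglongrightarrow> 0"
      unfolding add_0_left .
    have "(\<lambda>n. h n t - L2_norm \<Omega> (\<lambda>x. f t x - g t x)) \<longlonglongrightarrow> 0"
      by (rule Lim_null_comparison[OF always_eventually lim0]) (use b in \<open>simp only: real_norm_def simp_thms\<close>)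
    then show ?case by (simp add: LIM_zero_iff)
  qed
  define L where "L t = lim (\<lambda>n. h n t)" for t
  have "L \<in> borel_measurable ?M" unfolding L_def by (rule borel_measurable_lim_metric) (rule hm)
  moreover have "AE t in ?M. L t = L2_norm \<Omega> (\<lambda>x. f t x - g t x)"
    using lim by eventually_elim (simp add: L_def limI)
  ultimately show ?thesis by (rule borel_measurable_lebesgue_on_AE[rotated]) auto
qed

text \<open>
  The squared distances converge to zero in \<open>L1\<close> of the time interval, hence almost everywhere
  along a subsequence. Without measurability their integrals would carry no information. The
  uniform bound \<open>K\<close> provides the integrability.
\<close>

lemma L2_AE_subsequence:
  fixes u :: "nat \<Rightarrow> 'i \<Rightarrow> real \<Rightarrow> 'a::euclidean_space \<Rightarrow> real"
  assumes I: "finite I" and u: "\<And>n i. i \<in> I \<Longrightarrow> strongly_measurable \<Omega> T (u n i)" and c: "\<And>i. i \<in> I \<Longrightarrow> strongly_measurable \<Omega> T (c i)"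
    and K: "\<And>n i. i \<in> I \<Longrightarrow> AE t in lebesgue_on {0<..<T}. L2_norm \<Omega> (\<lambda>x. u n i t x - c i t x) \<le> K"
    and lim: "\<And>i. i \<in> I \<Longrightarrow> (\<lambda>n. bochner_L2_norm T (L2_norm \<Omega>) (\<lambda>t x. u n i t x - c i t x)) \<longlonglongrightarrow> 0"
  shows "\<exists>r. strict_mono r \<and> (AE t in lebesgue_on {0<..<T}. \<forall>i\<in>I. (\<lambda>n. L2_norm \<Omega> (\<lambda>x. u (r n) i t x - c i t x)) \<longlonglongrightarrow> 0)"
proof -
  let ?M = "lebesgue_on {0<..<T}"
  have fin: "finite_measure ?M" by (intro finite_measure_lebesgue_on_bounded) auto
  define f where "f n i t = L2_norm \<Omega> (\<lambda>x. u n i t x - c i t x)" for n i t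
  have f0: "0 \<le> f n i t" for n i t by (simp add: f_def L2_norm_nonneg)
  have [measurable]: "i \<in> I \<Longrightarrow> f n i \<in> borel_measurable ?M" for n i
    unfolding f_def using L2_dist_measurable[OF u c] by simp
  have int: "integrable ?M (\<lambda>t. (f n i t)\<^sup>2)" if "i \<in> I" for n i
  proof (rule finite_measure.integrable_const_bound[OF fin])
    show "AE t in ?M. norm ((f n i t)\<^sup>2) \<le> K\<^sup>2"
      using K[OF that, of n]
    proof eventually_elim
      case (elim t)
      then show ?case using f0[of n i t] power_mono[of "f n i t" K 2] by (simp add: f_def)
    qed
  qed (use that in measurable)
  define F where "F n t = (\<Sum>i\<in>I. (f n i t)\<^sup>2)" for n t
  have "(\<lambda>n. LINT t|?M. (f n i t)\<^sup>2) \<longlonglongrightarrow> 0" if "i \<in> I" for i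
  proof -
    have "(\<lambda>n. (bochner_L2_norm T (L2_norm \<Omega>) (\<lambda>t x. u n i t x - c i t x))\<^sup>2) \<longlonglongrightarrow> 0\<^sup>2"
      by (intro tendsto_power lim that)
    moreover have "(bochner_L2_norm T (L2_norm \<Omega>) (\<lambda>t x. u n i t x - c i t x))\<^sup>2 = (LINT t|?M. (f n i t)\<^sup>2)" for n
      unfolding bochner_L2_norm_def f_def by (rule real_sqrt_pow2) simp
    ultimately show ?thesis by simp
  qed
  then have "(\<lambda>n. \<Sum>i\<in>I. LINT t|?M. (f n i t)\<^sup>2) \<longlonglongrightarrow> (\<Sum>i\<in>I. 0)" by (intro tendsto_sum)
  moreover have "(LINT t|?M. norm (F n t)) = (\<Sum>i\<in>I. LINT t|?M. (f n i t)\<^sup>2)" for n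
    using int by (simp add: F_def sum_nonneg)
  ultimately have "(\<lambda>n. LINT t|?M. norm (F n t)) \<longlonglongrightarrow> 0" by simp
  moreover have "integrable ?M (F n)" for n unfolding F_def using int by auto
  ultimately obtain r where r: "strict_mono r" "AE t in ?M. (\<lambda>n. F (r n) t) \<longlonglongrightarrow> 0"
    using tendsto_L1_AE_subseq[of ?M F] by blast
  have "AE t in ?M. \<forall>i\<in>I. (\<lambda>n. f (r n) i t) \<longlonglongrightarrow> 0"
    using r(2)
  proof eventually_elim
    case (elim t)
    show ?case
    proof
      fix i assume i: "i \<in> I"
      have "(\<lambda>n. sqrt (F (r n) t)) \<longlonglongrightarrow> sqrt 0" using elim by (rule tendsto_real_sqrt)
      moreover have "f (r n) i t \<le> sqrt (F (r n) t)" for n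
      proof (rule real_le_rsqrt)
        show "(f (r n) i t)\<^sup>2 \<le> F (r n) t" unfolding F_def using i I by (intro member_le_sum) auto
      qed
      ultimately show "(\<lambda>n. f (r n) i t) \<longlonglongrightarrow> 0"
        using f0 by (intro tendsto_sandwich[of "\<lambda>_. 0" "\<lambda>n. f (r n) i t" _ "\<lambda>n. sqrt (F (r n) t)"]) auto
    qed
  qed
  then show ?thesis using r(1) unfolding f_def by blast
qed

text \<open>
  Used for the limit of the scheme and for the limit in the initial data; \<open>m'\<close> and \<open>B'\<close> are the
  averages and bounds of the approximations. Convergence of the last component, which is one minus
  the sum of the others, follows from that of the first \<open>N\<close>.
\<close>

lemma L2_limit_bound:
  fixes u :: "nat \<Rightarrow> nat \<Rightarrow> real \<Rightarrow> 'a::euclidean_space \<Rightarrow> real"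
  assumes \<Omega>: "open \<Omega>" "bounded \<Omega>"
    and u: "\<And>n i. i < N \<Longrightarrow> strongly_measurable \<Omega> T (u n i)" and c: "\<And>i. i < N \<Longrightarrow> strongly_measurable \<Omega> T (c i)"
    and uL2: "\<And>n i t. i \<le> N \<Longrightarrow> 0 < t \<Longrightarrow> u n i t \<in> L2 \<Omega>" and cL2: "\<And>i t. i \<le> N \<Longrightarrow> 0 < t \<Longrightarrow> c i t \<in> L2 \<Omega>"
    and uN: "\<And>n t. 0 < t \<Longrightarrow> AE x in lebesgue_on \<Omega>. u n N t x = 1 - (\<Sum>i<N. u n i t x)"
    and cN: "\<And>t. 0 < t \<Longrightarrow> AE x in lebesgue_on \<Omega>. c N t x = 1 - (\<Sum>i<N. c i t x)"
    and K: "\<And>n i. i < N \<Longrightarrow> AE t in lebesgue_on {0<..<T}. L2_norm \<Omega> (\<lambda>x. u n i t x - c i t x) \<le> K"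
    and lim: "\<And>i. i < N \<Longrightarrow> (\<lambda>n. bochner_L2_norm T (L2_norm \<Omega>) (\<lambda>t x. u n i t x - c i t x)) \<longlonglongrightarrow> 0"
    and bnd: "\<And>n i t. i \<le> N \<Longrightarrow> 0 < t \<Longrightarrow> t < T \<Longrightarrow> L1_norm \<Omega> (\<lambda>x. u n i t x - m' n i) \<le> B' n t"
    and m: "\<And>i. i \<le> N \<Longrightarrow> (\<lambda>n. m' n i) \<longlonglongrightarrow> m i" and B: "\<And>t. 0 < t \<Longrightarrow> t < T \<Longrightarrow> (\<lambda>n. B' n t) \<longlonglongrightarrow> B t"
  shows "AE t in lebesgue_on {0<..<T}. \<forall>i\<le>N. L1_norm \<Omega> (\<lambda>x. c i t x - m i) \<le> B t"
proof -
  let ?M = "lebesgue_on \<Omega>" and ?v = "measure lebesgue \<Omega>"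
  have b: "\<Omega> \<in> sets borel" using \<Omega> by simp
  have sub: "\<exists>r. strict_mono r \<and> (AE t in lebesgue_on {0<..<T}. \<forall>i\<in>{..<N}. (\<lambda>n. L2_norm \<Omega> (\<lambda>x. u (r n) i t x - c i t x)) \<longlonglongrightarrow> 0)"
    by (rule L2_AE_subsequence[of _ _ _ u c K]) (use u c K lim in simp_all)
  then obtain r where r: "strict_mono r" "AE t in lebesgue_on {0<..<T}. \<forall>i\<in>{..<N}. (\<lambda>n. L2_norm \<Omega> (\<lambda>x. u (r n) i t x - c i t x)) \<longlonglongrightarrow> 0"
    by (elim exE conjE)
  show ?thesis
    using r(2) AE_space
  proof eventually_elim
    case (elim t)
    then have t: "0 < t" "t < T" by auto
    define d where "d n i = L1_norm \<Omega> (\<lambda>x. c i t x - u (r n) i t x)" for n i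
    have d0: "0 \<le> d n i" for n i by (simp add: d_def L1_norm_def)
    have int: "integrable ?M (c i t)" "integrable ?M (u n i t)" if "i \<le> N" for n i
      using L2_integrable[OF \<Omega>(2) b cL2[OF that t(1)]] L2_integrable[OF \<Omega>(2) b uL2[OF that t(1)]] by auto
    have const: "integrable ?M (\<lambda>x. a)" for a :: real
      by (rule finite_measure.integrable_const[OF finite_measure_lebesgue_on_bounded[OF b \<Omega>(2)]])
    have d1: "(\<lambda>n. d n i) \<longlonglongrightarrow> 0" if i: "i < N" for i
    proof -
      have "d n i \<le> sqrt ?v * L2_norm \<Omega> (\<lambda>x. u (r n) i t x - c i t x)" for n
        unfolding d_def L2_norm_minus_commute[of \<Omega> "u (r n) i t"]
        using i by (intro L1_norm_le_L2_norm[OF \<Omega>] L2_diff cL2 uL2 t) auto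
      moreover have "(\<lambda>n. sqrt ?v * L2_norm \<Omega> (\<lambda>x. u (r n) i t x - c i t x)) \<longlonglongrightarrow> sqrt ?v * 0"
        by (rule tendsto_mult_left) (use elim(1) i in blast)
      ultimately show ?thesis
        using d0 by (intro tendsto_sandwich[of "\<lambda>_. 0" "\<lambda>n. d n i" _ "\<lambda>n. sqrt ?v * L2_norm \<Omega> (\<lambda>x. u (r n) i t x - c i t x)"]) auto
    qed
    have dN: "d n N \<le> (\<Sum>i<N. d n i)" for n
    proof -
      have "AE x in ?M. \<bar>c N t x - u (r n) N t x\<bar> \<le> (\<Sum>i<N. \<bar>c i t x - u (r n) i t x\<bar>)"
        using cN[OF t(1)] uN[OF t(1), of "r n"]
      proof eventually_elim
        case (elim x)
        have "\<bar>c N t x - u (r n) N t x\<bar> = \<bar>\<Sum>i<N. c i t x - u (r n) i t x\<bar>"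
          unfolding elim sum_subtractf by simp
        then show ?case by (simp only: sum_abs)
      qed
      then have "d n N \<le> (LINT x|?M. (\<Sum>i<N. \<bar>c i t x - u (r n) i t x\<bar>))"
        unfolding d_def L1_norm_def using int by (intro integral_mono_AE) auto
      also have "\<dots> = (\<Sum>i<N. d n i)"
        unfolding d_def L1_norm_def by (rule Bochner_Integration.integral_sum) (use int in auto)
      finally show ?thesis .
    qed
    have d2: "(\<lambda>n. d n i) \<longlonglongrightarrow> 0" if i: "i \<le> N" for i
    proof (cases "i = N")
      case True
      have "(\<lambda>n. \<Sum>i<N. d n i) \<longlonglongrightarrow> (\<Sum>i<N. 0)" by (intro tendsto_sum d1) auto
      then show ?thesis unfolding True
        using d0 dN by (intro tendsto_sandwich[of "\<lambda>_. 0" "\<lambda>n. d n N" _ "\<lambda>n. \<Sum>i<N. d n i"]) auto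
    qed (use d1 i in auto)
    show ?case
    proof (intro allI impI)
      fix i assume i: "i \<le> N"
      have le: "L1_norm \<Omega> (\<lambda>x. c i t x - m i) \<le> d n i + B' (r n) t + \<bar>m' (r n) i - m i\<bar> * ?v" for n
      proof -
        have "L1_norm \<Omega> (\<lambda>x. c i t x - m i) = L1_norm \<Omega> (\<lambda>x. (c i t x - u (r n) i t x) + ((u (r n) i t x - m' (r n) i) + (m' (r n) i - m i)))"
          by simp
        also have "\<dots> \<le> d n i + L1_norm \<Omega> (\<lambda>x. (u (r n) i t x - m' (r n) i) + (m' (r n) i - m i))"
          unfolding d_def using int[OF i] const by (intro L1_norm_triangle) auto
        also have "L1_norm \<Omega> (\<lambda>x. (u (r n) i t x - m' (r n) i) + (m' (r n) i - m i)) \<le>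
            L1_norm \<Omega> (\<lambda>x. u (r n) i t x - m' (r n) i) + L1_norm \<Omega> (\<lambda>x. m' (r n) i - m i)"
          using int[OF i] const by (intro L1_norm_triangle) auto
        also have "L1_norm \<Omega> (\<lambda>x. m' (r n) i - m i) = \<bar>m' (r n) i - m i\<bar> * ?v"
          unfolding L1_norm_def by (rule integral_const_lebesgue_on[OF b])
        finally show ?thesis using bnd[OF i t, of "r n"] by linarith
      qed
      have "(\<lambda>n. d n i + B' (r n) t + \<bar>m' (r n) i - m i\<bar> * ?v) \<longlonglongrightarrow> 0 + B t + \<bar>m i - m i\<bar> * ?v"
        using LIMSEQ_subseq_LIMSEQ[OF B[OF t] r(1)] LIMSEQ_subseq_LIMSEQ[OF m[OF i] r(1)]
        by (intro tendsto_intros d2[OF i]) (simp_all add: o_def)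
      then show "L1_norm \<Omega> (\<lambda>x. c i t x - m i) \<le> B t"
        using le by (intro LIMSEQ_le_const[of "\<lambda>n. d n i + B' (r n) t + \<bar>m' (r n) i - m i\<bar> * ?v"]) auto
    qed
  qed
qed

lemma L2_norm_le_H2_norm: "L2_norm \<Omega> u \<le> H2_norm \<Omega> u"
proof -
  have "sqrt ((L2_norm \<Omega> u)\<^sup>2) \<le> H2_norm \<Omega> u"
    unfolding H2_norm_def by (intro real_sqrt_le_mono) (simp add: sum_nonneg)
  then show ?thesis by (simp add: L2_norm_nonneg)
qed

lemma Neumann_dual_norm_bound:
  assumes "f \<in> L2 \<Omega>" "u \<in> Neumann_H2 \<Omega>" "H2_norm \<Omega> u \<le> 1"
  shows "\<bar>LINT x|lebesgue_on \<Omega>. f x * u x\<bar> \<le> Neumann_dual_norm \<Omega> (L2_embed \<Omega> f)"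
proof -
  have "bdd_above ((\<lambda>u. \<bar>L2_embed \<Omega> f u\<bar>) ` {u \<in> Neumann_H2 \<Omega>. H2_norm \<Omega> u \<le> 1})"
  proof (rule bdd_aboveI2)
    fix v assume v: "v \<in> {u \<in> Neumann_H2 \<Omega>. H2_norm \<Omega> u \<le> 1}"
    then have "\<bar>L2_embed \<Omega> f v\<bar> \<le> L2_norm \<Omega> f * L2_norm \<Omega> v"
      unfolding L2_embed_def using Neumann_H2_L2 by (intro L2_cauchy_schwarz[OF assms(1)]) auto
    also have "\<dots> \<le> L2_norm \<Omega> f * 1"
      using v L2_norm_le_H2_norm[of \<Omega> v] by (intro mult_left_mono) (auto simp: L2_norm_nonneg)
    finally show "\<bar>L2_embed \<Omega> f v\<bar> \<le> L2_norm \<Omega> f" by simp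
  qed
  then have "\<bar>L2_embed \<Omega> f u\<bar> \<le> Neumann_dual_norm \<Omega> (L2_embed \<Omega> f)"
    unfolding Neumann_dual_norm_def using assms by (intro cSUP_upper) auto
  then show ?thesis by (simp add: L2_embed_def)
qed

text \<open>
  Convergence against test functions follows from the dual norm, by scaling them into the unit
  ball of \<open>Neumann_H2 \<Omega>\<close>. Domination makes the class of admissible multipliers closed under
  bounded pointwise limits, uniformly in \<open>n\<close>.
\<close>

lemma dual_convergence_weak:
  fixes \<Omega> :: "'a::euclidean_space set" and h :: "nat \<Rightarrow> 'a \<Rightarrow> real"
  assumes \<Omega>: "open \<Omega>" "bounded \<Omega>" and h: "\<And>n. h n \<in> L2 \<Omega>"
    and dual: "(\<lambda>n. Neumann_dual_norm \<Omega> (L2_embed \<Omega> (h n))) \<longlonglongrightarrow> 0"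
    and dom: "integrable (lebesgue_on \<Omega>) d" "\<And>n. AE x in lebesgue_on \<Omega>. \<bar>h n x\<bar> \<le> d x"
    and A: "A \<in> sets borel"
  shows "(\<lambda>n. LINT x|lebesgue_on \<Omega>. h n x * indicator (A \<inter> \<Omega>) x) \<longlonglongrightarrow> 0"
proof -
  let ?M = "lebesgue_on \<Omega>"
  have b: "\<Omega> \<in> sets borel" using \<Omega> by simp
  define P where "P \<psi> \<longleftrightarrow> \<psi> \<in> borel_measurable borel \<and> (\<exists>K. \<forall>x. \<bar>\<psi> x\<bar> \<le> K) \<and> (\<lambda>n. LINT x|?M. h n x * \<psi> x) \<longlonglongrightarrow> 0" for \<psi> :: "'a \<Rightarrow> real"
  have hi: "integrable ?M (\<lambda>x. h n x * \<psi> x)" if "\<psi> \<in> borel_measurable borel" "\<And>x. \<bar>\<psi> x\<bar> \<le> K" for n \<psi> K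
    using L2_integrable[OF \<Omega>(2) b h] borel_measurable_lebesgue_on[OF that(1)] that(2) by (rule integrable_mult_bounded)
  have "P (indicator (A \<inter> \<Omega>))"
  proof (rule test_functions_generate[OF \<Omega>(1) _ _ _ A])
    fix \<phi> :: "'a \<Rightarrow> real" assume \<phi>: "\<phi> \<in> test_functions \<Omega>"
    obtain \<delta> where \<delta>: "\<delta> > 0" "H2_norm \<Omega> (\<lambda>x. \<delta> * \<phi> x) \<le> 1" using H2_norm_test_function_scale[OF \<Omega> \<phi>] by blast
    have "(\<lambda>x. \<delta> * \<phi> x + 0 * \<phi> x) \<in> test_functions \<Omega>" by (rule test_function_lincomb[OF \<phi> \<phi>])
    then have nu: "(\<lambda>x. \<delta> * \<phi> x) \<in> Neumann_H2 \<Omega>" using test_function_Neumann_H2[OF \<Omega>] by simp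
    have "\<bar>LINT x|?M. h n x * \<phi> x\<bar> \<le> Neumann_dual_norm \<Omega> (L2_embed \<Omega> (h n)) / \<delta>" for n
    proof -
      have "\<bar>LINT x|?M. h n x * (\<delta> * \<phi> x)\<bar> \<le> Neumann_dual_norm \<Omega> (L2_embed \<Omega> (h n))"
        by (rule Neumann_dual_norm_bound[OF h nu \<delta>(2)])
      moreover have "(LINT x|?M. h n x * (\<delta> * \<phi> x)) = \<delta> * (LINT x|?M. h n x * \<phi> x)"
        by (simp add: mult.left_commute)
      ultimately show ?thesis using \<delta>(1) by (simp add: abs_mult field_simps)
    qed
    moreover have "(\<lambda>n. Neumann_dual_norm \<Omega> (L2_embed \<Omega> (h n)) / \<delta>) \<longlonglongrightarrow> 0 / \<delta>"
      using \<delta>(1) by (intro tendsto_divide dual tendsto_const) auto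
    ultimately have "(\<lambda>n. LINT x|?M. h n x * \<phi> x) \<longlonglongrightarrow> 0"
      by (intro Lim_null_comparison[of "\<lambda>n. LINT x|?M. h n x * \<phi> x" "\<lambda>n. Neumann_dual_norm \<Omega> (L2_embed \<Omega> (h n)) / \<delta>"]) auto
    then show "P \<phi>" unfolding P_def using test_function_borel[OF \<phi>] test_function_bounded[OF \<phi>] by blast
  next
    fix f g :: "'a \<Rightarrow> real" and a b' :: real
    assume "P f" "P g"
    then obtain K K' where f: "f \<in> borel_measurable borel" "\<And>x. \<bar>f x\<bar> \<le> K" "(\<lambda>n. LINT x|?M. h n x * f x) \<longlonglongrightarrow> 0"
      and g: "g \<in> borel_measurable borel" "\<And>x. \<bar>g x\<bar> \<le> K'" "(\<lambda>n. LINT x|?M. h n x * g x) \<longlonglongrightarrow> 0"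
      unfolding P_def by blast
    have "\<bar>a * f x + b' * g x\<bar> \<le> \<bar>a\<bar> * K + \<bar>b'\<bar> * K'" for x
    proof -
      have "\<bar>a * f x + b' * g x\<bar> \<le> \<bar>a\<bar> * \<bar>f x\<bar> + \<bar>b'\<bar> * \<bar>g x\<bar>" unfolding abs_mult[symmetric] by (rule abs_triangle_ineq)
      also have "\<dots> \<le> \<bar>a\<bar> * K + \<bar>b'\<bar> * K'" using f(2) g(2) by (intro add_mono mult_left_mono) auto
      finally show ?thesis .
    qed
    moreover have "(LINT x|?M. h n x * (a * f x + b' * g x)) = a * (LINT x|?M. h n x * f x) + b' * (LINT x|?M. h n x * g x)" for n
    proof -
      have "(LINT x|?M. h n x * (a * f x + b' * g x)) = (LINT x|?M. a * (h n x * f x) + b' * (h n x * g x))"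
        by (intro Bochner_Integration.integral_cong refl) (simp add: algebra_simps)
      then show ?thesis using hi[OF f(1,2)] hi[OF g(1,2)] by simp
    qed
    moreover have "(\<lambda>n. a * (LINT x|?M. h n x * f x) + b' * (LINT x|?M. h n x * g x)) \<longlonglongrightarrow> a * 0 + b' * 0"
      by (intro tendsto_intros f g)
    ultimately show "P (\<lambda>x. a * f x + b' * g x)"
      unfolding P_def using f(1) g(1) by auto
  next
    fix f :: "nat \<Rightarrow> 'a \<Rightarrow> real" and g :: "'a \<Rightarrow> real"
    assume Pf: "\<And>k. P (f k)" and f1: "\<And>k x. \<bar>f k x\<bar> \<le> 1" and fg: "\<And>x. (\<lambda>k. f k x) \<longlonglongrightarrow> g x"
    have fm: "f k \<in> borel_measurable borel" for k using Pf[of k] by (simp add: P_def)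
    have gm: "g \<in> borel_measurable borel" by (rule borel_measurable_LIMSEQ_real[OF fg fm])
    have g1: "\<bar>g x\<bar> \<le> 1" for x
      by (rule LIMSEQ_le_const2[OF tendsto_rabs[OF fg[of x]]]) (use f1 in auto)
    have fmM: "f k \<in> borel_measurable ?M" "g \<in> borel_measurable ?M" for k
      using borel_measurable_lebesgue_on fm gm by blast+
    have dm: "d \<in> borel_measurable ?M" using dom(1) by simp
    have d0: "AE x in ?M. 0 \<le> d x" using dom(2)[of 0] by eventually_elim linarith
    have "(\<lambda>k. LINT x|?M. d x * \<bar>g x - f k x\<bar>) \<longlonglongrightarrow> (LINT x|?M. 0)"
    proof (rule integral_dominated_convergence[where w = "\<lambda>x. 2 * d x"])
      show "AE x in ?M. (\<lambda>k. d x * \<bar>g x - f k x\<bar>) \<longlonglongrightarrow> 0"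
      proof (rule AE_I2)
        fix x
        have "(\<lambda>k. d x * \<bar>g x - f k x\<bar>) \<longlonglongrightarrow> d x * \<bar>g x - g x\<bar>" by (intro tendsto_intros fg)
        then show "(\<lambda>k. d x * \<bar>g x - f k x\<bar>) \<longlonglongrightarrow> 0" by simp
      qed
      fix k
      show "AE x in ?M. norm (d x * \<bar>g x - f k x\<bar>) \<le> 2 * d x"
        using d0
      proof eventually_elim
        case (elim x)
        have "\<bar>g x - f k x\<bar> \<le> 2" using g1[of x] f1[of k x] by linarith
        then have "d x * \<bar>g x - f k x\<bar> \<le> d x * 2" using elim by (intro mult_left_mono)
        then show ?case using elim by (simp add: abs_mult)
      qed
    qed (use dm fmM dom(1) in auto)
    then have E: "(\<lambda>k. LINT x|?M. d x * \<bar>g x - f k x\<bar>) \<longlonglongrightarrow> 0" by simp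
    have "(\<lambda>n. LINT x|?M. h n x * g x) \<longlonglongrightarrow> 0"
    proof (rule LIMSEQ_I)
      fix e :: real assume e: "0 < e"
      obtain k where k: "(LINT x|?M. d x * \<bar>g x - f k x\<bar>) < e / 2"
        using order_tendstoD(2)[OF E, of "e / 2"] e unfolding eventually_sequentially by auto
      have "(\<lambda>n. LINT x|?M. h n x * f k x) \<longlonglongrightarrow> 0" using Pf[of k] by (simp add: P_def)
      then obtain n0 where n0: "\<And>n. n \<ge> n0 \<Longrightarrow> \<bar>LINT x|?M. h n x * f k x\<bar> < e / 2"
        using LIMSEQ_D[of _ 0 "e / 2"] e by fastforce
      have "\<bar>LINT x|?M. h n x * g x\<bar> < e" if "n \<ge> n0" for n
      proof -
        have "(LINT x|?M. h n x * g x) - (LINT x|?M. h n x * f k x) = (LINT x|?M. h n x * g x - h n x * f k x)"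
          using hi[OF gm g1] hi[OF fm f1] by simp
        also have "\<bar>\<dots>\<bar> \<le> (LINT x|?M. \<bar>h n x * g x - h n x * f k x\<bar>)" by (rule integral_abs_bound)
        also have "\<dots> \<le> (LINT x|?M. d x * \<bar>g x - f k x\<bar>)"
        proof (rule integral_mono_AE)
          show "integrable ?M (\<lambda>x. \<bar>h n x * g x - h n x * f k x\<bar>)" using hi[OF gm g1] hi[OF fm f1] by simp
          show "integrable ?M (\<lambda>x. d x * \<bar>g x - f k x\<bar>)"
          proof (rule integrable_mult_bounded[OF dom(1), where K = 2])
            show "(\<lambda>x. \<bar>g x - f k x\<bar>) \<in> borel_measurable ?M" using fmM by simp
            show "\<bar>\<bar>g x - f k x\<bar>\<bar> \<le> 2" for x using g1[of x] f1[of k x] by linarith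
          qed
          show "AE x in ?M. \<bar>h n x * g x - h n x * f k x\<bar> \<le> d x * \<bar>g x - f k x\<bar>"
            using dom(2)[of n]
            by eventually_elim (simp add: right_diff_distrib[symmetric] abs_mult mult_right_mono)
        qed
        finally show ?thesis using n0[OF that] k by linarith
      qed
      then show "\<exists>no. \<forall>n\<ge>no. norm ((LINT x|?M. h n x * g x) - 0) < e" by auto
    qed
    then show "P g" unfolding P_def using gm g1 by blast
  qed
  then show ?thesis by (simp add: P_def)
qed

text \<open>
  Times at which the bound and \<open>0 \<le> c i \<le> 1\<close> hold are dense. Along such times converging to \<open>t\<close>,
  the integrals against the sign function of \<open>c i t - m i\<close> converge, and each of them is at most
  the \<open>L1\<close> norm.
\<close>

lemma weak_solution_every_time:
  fixes \<Omega> :: "'a::euclidean_space set"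
  assumes \<Omega>: "open \<Omega>" "bounded \<Omega>" and ws: "weak_solution \<Omega> N D c0 c"
    and bound: "\<And>T. AE t in lebesgue_on {0<..<T}. \<forall>i\<le>N. L1_norm \<Omega> (\<lambda>x. c i t x - m i) \<le> B t"
    and B: "\<And>t. isCont B t" and i: "i \<le> N" and t: "0 \<le> t"
  shows "L1_norm \<Omega> (\<lambda>x. c i t x - m i) \<le> B t"
proof -
  let ?M = "lebesgue_on \<Omega>"
  have b: "\<Omega> \<in> sets borel" using \<Omega> by simp
  have cL2: "c i s \<in> L2 \<Omega>" if "0 \<le> s" for s using ws i that by (simp add: weak_solution_def)
  have ci: "integrable ?M (c i s)" if "0 \<le> s" for s by (rule L2_integrable[OF \<Omega>(2) b cL2[OF that]])
  have const: "integrable ?M (\<lambda>x. a)" for a :: real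
    by (rule finite_measure.integrable_const[OF finite_measure_lebesgue_on_bounded[OF b \<Omega>(2)]])
  define good where "good s \<longleftrightarrow> L1_norm \<Omega> (\<lambda>x. c i s x - m i) \<le> B s \<and> (AE x in ?M. 0 \<le> c i s x \<and> c i s x \<le> 1)" for s
  have c01: "AE s in lebesgue_on {0<..}. AE x in ?M. \<forall>i\<le>N. 0 \<le> c i s x \<and> c i s x \<le> 1"
    using ws by (simp add: weak_solution_def)
  have "\<exists>s. t < s \<and> s < t + e \<and> good s" if e: "e > 0" for e
  proof (rule ccontr)
    assume no: "\<nexists>s. t < s \<and> s < t + e \<and> good s"
    have "AE s in lebesgue. s \<in> {0<..<t + e} \<longrightarrow> (\<forall>i\<le>N. L1_norm \<Omega> (\<lambda>x. c i s x - m i) \<le> B s)"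
      using bound[of "t + e"] by (subst (asm) AE_restrict_space_iff) auto
    moreover have "AE s in lebesgue. s \<in> {0<..} \<longrightarrow> (AE x in ?M. \<forall>i\<le>N. 0 \<le> c i s x \<and> c i s x \<le> 1)"
      using c01 by (subst (asm) AE_restrict_space_iff) auto
    ultimately have "AE s in lebesgue. s \<in> {t<..<t + e} \<longrightarrow> s \<in> {}"
    proof eventually_elim
      case (elim s)
      show ?case
      proof
        assume s: "s \<in> {t<..<t + e}"
        then have "s \<in> {0<..<t + e}" "s \<in> {0<..}" using t by auto
        then have "L1_norm \<Omega> (\<lambda>x. c i s x - m i) \<le> B s" "AE x in ?M. 0 \<le> c i s x \<and> c i s x \<le> 1"
          using elim i by (auto elim!: eventually_mono)
        then have "good s" by (simp add: good_def)
        then show "s \<in> {}" using no s by auto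
      qed
    qed
    from mem_closed_if_AE_lebesgue_open[OF _ _ this, of "t + e / 2"] show False using e by auto
  qed
  then have "\<exists>s. t < s \<and> s < t + 1 / real (Suc n) \<and> good s" for n by simp
  then obtain s where s: "\<And>n. t < s n" "\<And>n. s n < t + 1 / real (Suc n)" "\<And>n. good (s n)" by metis
  have st: "s \<longlonglongrightarrow> t"
  proof (rule tendsto_sandwich[of "\<lambda>_. t" s _ "\<lambda>n. t + 1 / real (Suc n)"])
    have "(\<lambda>n. t + 1 / real (Suc n)) \<longlonglongrightarrow> t + 0"
      by (intro tendsto_add tendsto_const LIMSEQ_inverse_real_of_nat[unfolded inverse_eq_divide])
    then show "(\<lambda>n. t + 1 / real (Suc n)) \<longlonglongrightarrow> t" by simp
  qed (use s in \<open>auto simp: less_imp_le\<close>)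
  have s0: "0 \<le> s n" for n using s(1)[of n] t by simp
  have "filterlim s (at t within {0..}) sequentially"
    unfolding filterlim_at using st s(1) s0 by (auto simp: less_imp_neq[symmetric] intro!: always_eventually)
  moreover have "((\<lambda>s. Neumann_dual_norm \<Omega> (L2_embed \<Omega> (\<lambda>x. c i s x - c i t x))) \<longlongrightarrow> 0) (at t within {0..})"
    using ws i t by (simp add: weak_solution_def)
  ultimately have dual: "(\<lambda>n. Neumann_dual_norm \<Omega> (L2_embed \<Omega> (\<lambda>x. c i (s n) x - c i t x))) \<longlonglongrightarrow> 0"
    by (rule filterlim_compose[rotated])
  define h where "h n x = c i (s n) x - c i t x" for n x
  have hL2: "h n \<in> L2 \<Omega>" for n unfolding h_def[abs_def] by (rule L2_diff[OF cL2[OF s0] cL2[OF t]])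
  have weak: "(\<lambda>n. LINT x|?M. h n x * indicator (A \<inter> \<Omega>) x) \<longlonglongrightarrow> 0" if "A \<in> sets borel" for A
  proof (rule dual_convergence_weak[OF \<Omega> hL2 _ _ _ that])
    show "(\<lambda>n. Neumann_dual_norm \<Omega> (L2_embed \<Omega> (h n))) \<longlonglongrightarrow> 0" using dual by (simp add: h_def[abs_def])
    show "integrable ?M (\<lambda>x. 1 + \<bar>c i t x\<bar>)" using ci[OF t] const by auto
    fix n
    have "AE x in ?M. 0 \<le> c i (s n) x \<and> c i (s n) x \<le> 1" using s(3) by (simp add: good_def)
    then show "AE x in ?M. \<bar>h n x\<bar> \<le> 1 + \<bar>c i t x\<bar>" unfolding h_def by eventually_elim linarith
  qed
  obtain c1 where c1: "c1 \<in> borel_measurable borel" "AE x in ?M. c i t x = c1 x"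
    using lebesgue_on_borel_version[OF b L2D(1)[OF cL2[OF t]]] by blast
  \<comment> \<open>A Borel representative is used, so that the set where \<open>c i t - m i\<close> is nonnegative is a Borel
    set.\<close>
  define A where "A = {x. m i \<le> c1 x}"
  have A: "A \<in> sets borel" "- A \<in> sets borel" using c1(1) by (auto simp: A_def)
  define sg :: "'a \<Rightarrow> real" where "sg x = indicator (A \<inter> \<Omega>) x - indicator (- A \<inter> \<Omega>) x" for x
  have sg1: "\<bar>sg x\<bar> \<le> 1" for x by (auto simp: sg_def indicator_def)
  have "sg \<in> borel_measurable borel" unfolding sg_def using A b by measurable
  then have sgm: "sg \<in> borel_measurable ?M" by (rule borel_measurable_lebesgue_on)
  have sgi: "integrable ?M (\<lambda>x. f x * sg x)" if "integrable ?M f" for f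
    by (rule integrable_mult_bounded[OF that sgm sg1])
  have hi: "integrable ?M (h n)" for n by (rule L2_integrable[OF \<Omega>(2) b hL2])
  have ii: "integrable ?M (\<lambda>x. h n x * indicator (A' \<inter> \<Omega>) x)" if "A' \<in> sets borel" for n A'
  proof (rule integrable_mult_bounded[OF hi, where K = 1])
    show "(indicator (A' \<inter> \<Omega>) :: 'a \<Rightarrow> real) \<in> borel_measurable ?M"
      using that b by (intro borel_measurable_lebesgue_on) auto
  qed (simp add: indicator_def)
  have "(LINT x|?M. h n x * sg x) = (LINT x|?M. h n x * indicator (A \<inter> \<Omega>) x) - (LINT x|?M. h n x * indicator (- A \<inter> \<Omega>) x)" for n
    using ii[OF A(1)] ii[OF A(2)] by (simp add: sg_def right_diff_distrib)
  then have hs: "(\<lambda>n. LINT x|?M. h n x * sg x) \<longlonglongrightarrow> 0"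
    using tendsto_diff[OF weak[OF A(1)] weak[OF A(2)]] by simp
  have le: "L1_norm \<Omega> (\<lambda>x. c i t x - m i) \<le> B (s n) - (LINT x|?M. h n x * sg x)" for n
  proof -
    have "L1_norm \<Omega> (\<lambda>x. c i t x - m i) = (LINT x|?M. (c i t x - m i) * sg x)"
      unfolding L1_norm_def
    proof (rule integral_cong_AE)
      show "(\<lambda>x. \<bar>c i t x - m i\<bar>) \<in> borel_measurable ?M" using ci[OF t] by auto
      show "(\<lambda>x. (c i t x - m i) * sg x) \<in> borel_measurable ?M" using ci[OF t] sgm by auto
      show "AE x in ?M. \<bar>c i t x - m i\<bar> = (c i t x - m i) * sg x"
        using c1(2) AE_space by eventually_elim (auto simp: sg_def A_def indicator_def)
    qed
    also have "\<dots> = (LINT x|?M. (c i (s n) x - m i) * sg x - h n x * sg x)"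
      by (intro Bochner_Integration.integral_cong refl) (simp add: h_def algebra_simps)
    also have "\<dots> = (LINT x|?M. (c i (s n) x - m i) * sg x) - (LINT x|?M. h n x * sg x)"
      by (rule Bochner_Integration.integral_diff[OF sgi[OF Bochner_Integration.integrable_diff[OF ci[OF s0] const]] sgi[OF hi]])
    also have "(LINT x|?M. (c i (s n) x - m i) * sg x) \<le> L1_norm \<Omega> (\<lambda>x. c i (s n) x - m i)"
      unfolding L1_norm_def
    proof (rule integral_mono)
      show "integrable ?M (\<lambda>x. (c i (s n) x - m i) * sg x)"
        by (rule sgi[OF Bochner_Integration.integrable_diff[OF ci[OF s0] const]])
      show "integrable ?M (\<lambda>x. \<bar>c i (s n) x - m i\<bar>)" using ci[OF s0] const by auto
      fix x
      have "\<bar>c i (s n) x - m i\<bar> * \<bar>sg x\<bar> \<le> \<bar>c i (s n) x - m i\<bar> * 1" using sg1 by (intro mult_left_mono) auto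
      then show "(c i (s n) x - m i) * sg x \<le> \<bar>c i (s n) x - m i\<bar>" unfolding abs_mult[symmetric] mult_1_right by (rule abs_le_D1)
    qed
    also have "L1_norm \<Omega> (\<lambda>x. c i (s n) x - m i) \<le> B (s n)" using s(3) by (simp add: good_def)
    finally show ?thesis by simp
  qed
  have "(\<lambda>n. B (s n) - (LINT x|?M. h n x * sg x)) \<longlonglongrightarrow> B t - 0"
    by (intro tendsto_diff hs isCont_tendsto_compose[OF B st])
  then show ?thesis using le by (intro LIMSEQ_le_const[of "\<lambda>n. B (s n) - (LINT x|?M. h n x * sg x)"]) auto
qed

section \<open>Decay of the constructed solutions\<close>

lemma AE_empty_interval: "\<not> T > 0 \<Longrightarrow> AE t in lebesgue_on {0<..<T::real}. P t"
proof (rule AE_I2)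
  fix t assume "\<not> T > 0" "t \<in> space (lebesgue_on {0<..<T})"
  then have "0 < t" "t < T" "\<not> T > 0" by auto
  then show "P t" by linarith
qed

lemma weak_solution_strongly_measurable:
  assumes "weak_solution \<Omega> N D c0 c" "i \<le> N"
  shows "strongly_measurable \<Omega> T (c i)"
proof (cases "T > 0")
  case True
  then have "c i \<in> bochner_L2 T (H1 \<Omega>) (H1_norm \<Omega>)" using assms by (simp add: weak_solution_def)
  then show ?thesis by (rule bochner_H1_strongly_measurable)
next
  case False
  then have "{0<..<T} = {}" by auto
  then have "AE t in lebesgue_on {0<..<T}. P t" for P by (intro AE_I2) simp
  then show ?thesis unfolding strongly_measurable_def \<open>{0<..<T} = {}\<close>
    by (intro exI[of _ "\<lambda>n t x. 0"]) simp
qed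

lemma L2_norm_diff_unit_interval:
  assumes \<Omega>: "open \<Omega>" "bounded \<Omega>" and fg: "f \<in> L2 \<Omega>" "g \<in> L2 \<Omega>"
    and "AE x in lebesgue_on \<Omega>. 0 \<le> f x \<and> f x \<le> 1" "AE x in lebesgue_on \<Omega>. 0 \<le> g x \<and> g x \<le> 1"
  shows "L2_norm \<Omega> (\<lambda>x. f x - g x) \<le> sqrt (measure lebesgue \<Omega>)"
proof -
  have b: "\<Omega> \<in> sets borel" using \<Omega> by simp
  have "(LINT x|lebesgue_on \<Omega>. (f x - g x)\<^sup>2) \<le> (LINT x|lebesgue_on \<Omega>. 1)"
  proof (rule integral_mono_AE)
    show "integrable (lebesgue_on \<Omega>) (\<lambda>x. (f x - g x)\<^sup>2)" by (rule L2D(2)[OF L2_diff[OF fg]])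
    show "integrable (lebesgue_on \<Omega>) (\<lambda>x. 1 :: real)"
      by (rule finite_measure.integrable_const[OF finite_measure_lebesgue_on_bounded[OF b \<Omega>(2)]])
    show "AE x in lebesgue_on \<Omega>. (f x - g x)\<^sup>2 \<le> 1"
      using assms(5,6)
    proof eventually_elim
      case (elim x)
      then have "\<bar>f x - g x\<bar> \<le> 1" by linarith
      then show ?case by (simp add: abs_square_le_1)
    qed
  qed
  then show ?thesis using integral_const_lebesgue_on[OF b, of 1] by (simp add: L2_norm_def)
qed

lemma weak_solution_unit_interval:
  assumes "weak_solution \<Omega> N D c0 c" "i \<le> N"
  shows "AE t in lebesgue_on {0<..<T}. AE x in lebesgue_on \<Omega>. 0 \<le> c i t x \<and> c i t x \<le> 1"
proof -
  have "AE t in lebesgue_on {0<..}. AE x in lebesgue_on \<Omega>. \<forall>i\<le>N. 0 \<le> c i t x \<and> c i t x \<le> 1"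
    using assms by (simp add: weak_solution_def)
  then have "AE t in lebesgue. t \<in> {0<..} \<longrightarrow> (AE x in lebesgue_on \<Omega>. \<forall>i\<le>N. 0 \<le> c i t x \<and> c i t x \<le> 1)"
    by (subst (asm) AE_restrict_space_iff) auto
  then have "AE t in lebesgue. t \<in> {0<..<T} \<longrightarrow> (AE x in lebesgue_on \<Omega>. 0 \<le> c i t x \<and> c i t x \<le> 1)"
  proof eventually_elim
    case (elim t)
    show ?case
    proof
      assume "t \<in> {0<..<T}"
      then have "AE x in lebesgue_on \<Omega>. \<forall>i\<le>N. 0 \<le> c i t x \<and> c i t x \<le> 1" using elim by auto
      then show "AE x in lebesgue_on \<Omega>. 0 \<le> c i t x \<and> c i t x \<le> 1"
        by eventually_elim (use assms(2) in blast)
    qed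
  qed
  then show ?thesis by (subst AE_restrict_space_iff) auto
qed

context diffusion_coefficients
begin

text \<open>
  The bound for the scheme is available as soon as \<open>\<tau>\<close> is small, so the sequence is shifted by
  some \<open>n0\<close>.
\<close>

theorem positive_data_decay:
  fixes \<Omega> :: "'a::euclidean_space set"
  assumes domain: "bounded_C11_domain \<Omega>" and LS: "log_sobolev \<Omega> C" "C > 0"
    and constr: "constructed_from_positive_data \<Omega> N D \<eta> c0 c" and i: "i \<le> N" and t: "t \<ge> 0"
  shows "L1_norm \<Omega> (\<lambda>x. c i t x - average \<Omega> (c0 i)) \<le>
    sqrt (2 * measure lebesgue \<Omega> * (exp (- (2 / (C * dmax)) / 2 * t) * relative_entropy \<Omega> N c0 c0))"
proof -
  have \<Omega>: "open \<Omega>" "bounded \<Omega>" using domain by (auto simp: bounded_C11_domain_def)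
  let ?\<kappa> = "2 / (C * dmax)" and ?v = "measure lebesgue \<Omega>" and ?H = "relative_entropy \<Omega> N c0 c0"
  from constr obtain \<epsilon> \<tau> w where
    disc: "\<And>n::nat. 0 < \<epsilon> n \<and> 0 < \<tau> n \<and> discrete_solution \<Omega> N D c0 (\<epsilon> n) (\<tau> n) (w n)"
    and lims: "\<epsilon> \<longlonglongrightarrow> 0" "\<tau> \<longlonglongrightarrow> 0"
    and conv: "\<And>T i. T > 0 \<Longrightarrow> i < N \<Longrightarrow> converges_on \<Omega> T (\<lambda>n. step_conc N (\<tau> n) (w n) i)
             (\<lambda>n. discrete_time_deriv \<Omega> N (\<tau> n) (w n) i) (c i)"
    unfolding constructed_from_positive_data_def by blast
  have ws: "weak_solution \<Omega> N D c0 c" using constr by (simp add: constructed_from_positive_data_def)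
  have sch: "scheme N D \<Omega> c0 C \<eta> (\<epsilon> n) (\<tau> n) (w n)" for n
    by unfold_locales (use domain LS disc[of n] constr in \<open>auto simp: constructed_from_positive_data_def\<close>)
  have "(\<lambda>n. ?\<kappa> * \<tau> n) \<longlonglongrightarrow> ?\<kappa> * 0" by (intro tendsto_intros lims)
  then have "eventually (\<lambda>n. ?\<kappa> * \<tau> n < 1) sequentially" "eventually (\<lambda>n. \<tau> n < 1) sequentially"
    using lims(2) by (auto intro: order_tendstoD(2))
  then have "eventually (\<lambda>n. ?\<kappa> * \<tau> n < 1 \<and> \<tau> n < 1) sequentially" by eventually_elim simp
  then obtain n0 where n0: "\<And>n. n \<ge> n0 \<Longrightarrow> ?\<kappa> * \<tau> n < 1 \<and> \<tau> n < 1"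
    unfolding eventually_sequentially by blast
  define u where "u n i = step_conc N (\<tau> (n + n0)) (w (n + n0)) i" for n i
  have u: "u n i t = (\<lambda>x. scheme.c N (w (n + n0)) (step_index (\<tau> (n + n0)) t) i x)" for n i t
    by (simp add: u_def step_conc_def[abs_def] scheme.c_def[OF sch] fun_eq_iff)
  have uL2: "u n i t \<in> L2 \<Omega>" if "i \<le> N" for n i t
    unfolding u using scheme.c_L2[OF sch that] by simp
  define B where "B t = sqrt (2 * ?v * (exp (- ?\<kappa> / 2 * t) * ?H))" for t
  have "AE t in lebesgue_on {0<..<T}. \<forall>i\<le>N. L1_norm \<Omega> (\<lambda>x. c i t x - average \<Omega> (c0 i)) \<le> B t" if T: "T > 0" for T
  proof (rule L2_limit_bound[OF \<Omega>, where u = u and K = "sqrt ?v" and m' = "\<lambda>n i. average \<Omega> (c0 i)"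
      and B' = "\<lambda>n t. sqrt (2 * ?v * (exp (- ?\<kappa> / 2 * t) * ?H + scheme_defect N \<Omega> c0 ?\<kappa> (T + 1) (\<epsilon> (n + n0))))"])
    show "strongly_measurable \<Omega> T (u n i)" if "i < N" for n i
    proof -
      have "strongly_measurable \<Omega> T (\<lambda>t. (\<lambda>k x. scheme.c N (w (n + n0)) k i x) (step_index (\<tau> (n + n0)) t))"
        using scheme.c_L2[OF sch, of i] that disc by (intro step_strongly_measurable) auto
      then show ?thesis by (simp add: u[abs_def])
    qed
    show "strongly_measurable \<Omega> T (c i)" if "i < N" for i
      using weak_solution_strongly_measurable[OF ws] that by simp
    show "u n i t \<in> L2 \<Omega>" if "i \<le> N" for n i t by (rule uL2[OF that])
    show "c i t \<in> L2 \<Omega>" if "i \<le> N" "0 < t" for i t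
      using ws that by (simp add: weak_solution_def)
    show "AE x in lebesgue_on \<Omega>. u n N t x = 1 - (\<Sum>i<N. u n i t x)" for n t
      by (simp add: u_def step_conc_def conc_last_sum)
    show "AE x in lebesgue_on \<Omega>. c N t x = 1 - (\<Sum>i<N. c i t x)" if "0 < t" for t
      using ws that by (simp add: weak_solution_def)
    show "AE t in lebesgue_on {0<..<T}. L2_norm \<Omega> (\<lambda>x. u n i t x - c i t x) \<le> sqrt ?v" if "i < N" for n i
      using weak_solution_unit_interval[OF ws less_imp_le[OF that]] AE_space
    proof eventually_elim
      case (elim t)
      have "c i t \<in> L2 \<Omega>" using ws elim(2) that by (simp add: weak_solution_def)
      moreover have "AE x in lebesgue_on \<Omega>. 0 \<le> u n i t x \<and> u n i t x \<le> 1"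
        using scheme.c_pos[OF sch less_imp_le[OF that]] scheme.c_le_1[OF sch less_imp_le[OF that]]
        unfolding u by (simp add: less_imp_le)
      ultimately show ?case
        using uL2[OF less_imp_le[OF that]] elim(1) by (intro L2_norm_diff_unit_interval[OF \<Omega>])
    qed
    show "(\<lambda>n. bochner_L2_norm T (L2_norm \<Omega>) (\<lambda>t x. u n i t x - c i t x)) \<longlonglongrightarrow> 0" if "i < N" for i
      using conv[OF T that] unfolding u_def converges_on_def
      by (intro LIMSEQ_ignore_initial_segment[of "\<lambda>n. bochner_L2_norm T (L2_norm \<Omega>) (\<lambda>t x. step_conc N (\<tau> n) (w n) i t x - c i t x)"]) (elim conjE)
    show "L1_norm \<Omega> (\<lambda>x. u n i t x - average \<Omega> (c0 i)) \<le>
        sqrt (2 * ?v * (exp (- ?\<kappa> / 2 * t) * ?H + scheme_defect N \<Omega> c0 ?\<kappa> (T + 1) (\<epsilon> (n + n0))))"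
      if "i \<le> N" "0 < t" "t < T" for n i t
      unfolding u_def using n0[of "n + n0"] that by (intro scheme.scheme_bound[OF sch]) auto
    show "(\<lambda>n. average \<Omega> (c0 i)) \<longlonglongrightarrow> average \<Omega> (c0 i)" for i by simp
    fix t
    have "(\<lambda>n. sqrt (2 * ?v * (exp (- ?\<kappa> / 2 * t) * ?H + scheme_defect N \<Omega> c0 ?\<kappa> (T + 1) (\<epsilon> (n + n0))))) \<longlonglongrightarrow>
      sqrt (2 * ?v * (exp (- ?\<kappa> / 2 * t) * ?H + 0))"
      by (intro tendsto_real_sqrt tendsto_mult_left tendsto_add tendsto_const scheme_defect_tendsto LIMSEQ_ignore_initial_segment lims)
    then show "(\<lambda>n. sqrt (2 * ?v * (exp (- ?\<kappa> / 2 * t) * ?H + scheme_defect N \<Omega> c0 ?\<kappa> (T + 1) (\<epsilon> (n + n0))))) \<longlonglongrightarrow> B t"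
      by (simp add: B_def)
  qed
  moreover note AE_empty_interval
  ultimately have "AE t in lebesgue_on {0<..<T}. \<forall>i\<le>N. L1_norm \<Omega> (\<lambda>x. c i t x - average \<Omega> (c0 i)) \<le> B t" for T
    by blast
  moreover have "isCont B t" for t unfolding B_def by (intro continuous_intros)
  ultimately have "L1_norm \<Omega> (\<lambda>x. c i t x - average \<Omega> (c0 i)) \<le> B t"
    by (intro weak_solution_every_time[OF \<Omega> ws _ _ i t, where m = "\<lambda>i. average \<Omega> (c0 i)"])
  then show ?thesis unfolding B_def .
qed

end

lemma initial_data_unit_interval:
  assumes "initial_data \<Omega> N c0"
  shows "AE x in lebesgue_on \<Omega>. \<forall>i\<le>N. 0 \<le> c0 i x \<and> c0 i x \<le> 1"
proof -
  have "AE x in lebesgue_on \<Omega>. (\<forall>i<N. 0 \<le> c0 i x) \<and> (\<Sum>i<N. c0 i x) \<le> 1 \<and> c0 N x = 1 - (\<Sum>i<N. c0 i x)"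
    using assms by (simp add: initial_data_def)
  then show ?thesis
  proof eventually_elim
    case (elim x)
    have "c0 i x \<le> (\<Sum>i<N. c0 i x)" if "i < N" for i
      using elim that by (intro member_le_sum) auto
    moreover have "0 \<le> (\<Sum>i<N. c0 i x)" using elim by (intro sum_nonneg) auto
    ultimately have "0 \<le> c0 i x \<and> c0 i x \<le> 1" if "i < N \<or> i = N" for i
      using that elim by force
    then show ?case by (simp add: le_less)
  qed
qed

text \<open>
  Continuity of \<open>y ln (y / t)\<close> including \<open>y = 0\<close>, where it follows from \<open>|y ln y| \<le> 2 sqrt y\<close>.
\<close>

lemma x_ln_ratio_tendsto:
  fixes y :: "nat \<Rightarrow> real"
  assumes y: "y \<longlonglongrightarrow> l" "\<And>n. 0 \<le> y n" "\<And>n. y n \<le> 1" and t: "t \<longlonglongrightarrow> s" "0 < s" "\<And>n. 0 < t n"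
  shows "(\<lambda>n. y n * ln (y n / t n)) \<longlonglongrightarrow> l * ln (l / s)"
proof (cases "l = 0")
  case False
  have "0 \<le> l" by (rule LIMSEQ_le_const[OF y(1)]) (use y(2) in auto)
  then have "0 < l / s" using False t(2) by simp
  then show ?thesis using t(2) by (intro tendsto_intros y(1) t(1)) auto
next
  case True
  have b: "\<bar>y n * ln (y n / t n)\<bar> \<le> 2 * sqrt (y n) + y n * \<bar>ln (t n)\<bar>" for n
  proof (cases "y n = 0")
    case False
    then have p: "0 < y n" using y(2)[of n] by simp
    have "y n * ln (y n) = 2 * sqrt (y n) * (sqrt (y n) * ln (sqrt (y n)))"
      using p by (simp add: ln_sqrt mult.assoc[symmetric])
    also have "\<bar>\<dots>\<bar> = 2 * sqrt (y n) * \<bar>sqrt (y n) * ln (sqrt (y n))\<bar>"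
      using p by (simp add: abs_mult)
    also have "\<dots> \<le> 2 * sqrt (y n) * 1"
      using p y(3)[of n] abs_x_ln_x_le_1[of "sqrt (y n)"] by (intro mult_left_mono) auto
    finally have 1: "\<bar>y n * ln (y n)\<bar> \<le> 2 * sqrt (y n)" by simp
    have "y n * ln (y n / t n) = y n * ln (y n) - y n * ln (t n)"
      using p t(3)[of n] by (simp add: ln_div right_diff_distrib)
    also have "\<bar>\<dots>\<bar> \<le> \<bar>y n * ln (y n)\<bar> + \<bar>y n * ln (t n)\<bar>" by (rule abs_triangle_ineq4)
    also have "\<bar>y n * ln (t n)\<bar> = y n * \<bar>ln (t n)\<bar>" using p by (simp add: abs_mult)
    finally show ?thesis using 1 by linarith
  qed simp
  have "(\<lambda>n. 2 * sqrt (y n) + y n * \<bar>ln (t n)\<bar>) \<longlonglongrightarrow> 2 * sqrt l + l * \<bar>ln s\<bar>"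
    using t(2) by (intro tendsto_intros y(1) t(1)) auto
  then have "(\<lambda>n. y n * ln (y n / t n)) \<longlonglongrightarrow> 0"
    using b True by (intro Lim_null_comparison[of "\<lambda>n. y n * ln (y n / t n)" "\<lambda>n. 2 * sqrt (y n) + y n * \<bar>ln (t n)\<bar>"]) auto
  then show ?thesis using True by simp
qed

lemma relative_entropy_tendsto:
  fixes \<Omega> :: "'a::euclidean_space set"
  assumes \<Omega>: "open \<Omega>" "bounded \<Omega>"
    and init: "initial_data \<Omega> N c0" "\<And>n. initial_data \<Omega> N (c0' n)"
    and pos: "\<And>i. i \<le> N \<Longrightarrow> 0 < average \<Omega> (c0 i)" "\<And>n i. i \<le> N \<Longrightarrow> 0 < average \<Omega> (c0' n i)"
    and lim: "AE x in lebesgue_on \<Omega>. \<forall>i\<le>N. (\<lambda>n. c0' n i x) \<longlonglongrightarrow> c0 i x"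
  shows "i \<le> N \<Longrightarrow> (\<lambda>n. average \<Omega> (c0' n i)) \<longlonglongrightarrow> average \<Omega> (c0 i)"
    and "(\<lambda>n. relative_entropy \<Omega> N (c0' n) (c0' n)) \<longlonglongrightarrow> relative_entropy \<Omega> N c0 c0"
proof -
  let ?M = "lebesgue_on \<Omega>"
  have b: "\<Omega> \<in> sets borel" using \<Omega> by simp
  have fin: "finite_measure ?M" by (rule finite_measure_lebesgue_on_bounded[OF b \<Omega>(2)])
  have const: "integrable ?M (\<lambda>x. a)" for a :: real by (rule finite_measure.integrable_const[OF fin])
  have cm: "c0 i \<in> borel_measurable ?M" "c0' n i \<in> borel_measurable ?M" if "i \<le> N" for n i
    using init that by (simp_all add: initial_data_def)
  have U: "AE x in ?M. \<forall>n. \<forall>i\<le>N. 0 \<le> c0' n i x \<and> c0' n i x \<le> 1"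
    by (rule AE_all_countable[THEN iffD2], rule allI, rule initial_data_unit_interval[OF init(2)])
  have A: "(\<lambda>n. average \<Omega> (c0' n i)) \<longlonglongrightarrow> average \<Omega> (c0 i)" if i: "i \<le> N" for i
  proof -
    have "(\<lambda>n. LINT x|?M. c0' n i x) \<longlonglongrightarrow> (LINT x|?M. c0 i x)"
    proof (rule integral_dominated_convergence[where w = "\<lambda>x. 1"])
      show "AE x in ?M. (\<lambda>n. c0' n i x) \<longlonglongrightarrow> c0 i x" using lim by eventually_elim (use i in simp)
      show "AE x in ?M. norm (c0' n i x) \<le> 1" for n
        using U by eventually_elim (use i in simp)
    qed (use cm[OF i] const in auto)
    then show ?thesis unfolding average_def divide_inverse by (intro tendsto_mult_right)
  qed
  then show "i \<le> N \<Longrightarrow> (\<lambda>n. average \<Omega> (c0' n i)) \<longlonglongrightarrow> average \<Omega> (c0 i)" .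
  show "(\<lambda>n. relative_entropy \<Omega> N (c0' n) (c0' n)) \<longlonglongrightarrow> relative_entropy \<Omega> N c0 c0"
    unfolding relative_entropy_def
  proof (rule tendsto_sum)
    fix i assume "i \<in> {..N}"
    then have i: "i \<le> N" by simp
    have "(\<lambda>n. ln (average \<Omega> (c0' n i))) \<longlonglongrightarrow> ln (average \<Omega> (c0 i))"
      using pos(1)[OF i] by (intro tendsto_ln A i) simp
    then have "Bseq (\<lambda>n. ln (average \<Omega> (c0' n i)))" by (intro convergent_imp_Bseq convergentI)
    then obtain K where K: "\<And>n. \<bar>ln (average \<Omega> (c0' n i))\<bar> \<le> K" unfolding Bseq_def real_norm_def by blast
    note [measurable] = cm[OF i]
    show "(\<lambda>n. LINT x|?M. c0' n i x * ln (c0' n i x / average \<Omega> (c0' n i))) \<longlonglongrightarrow> (LINT x|?M. c0 i x * ln (c0 i x / average \<Omega> (c0 i)))"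
    proof (rule integral_dominated_convergence[where w = "\<lambda>x. 1 + K"])
      show "AE x in ?M. (\<lambda>n. c0' n i x * ln (c0' n i x / average \<Omega> (c0' n i))) \<longlonglongrightarrow> c0 i x * ln (c0 i x / average \<Omega> (c0 i))"
        using lim U
      proof eventually_elim
        case (elim x)
        show ?case using elim i by (intro x_ln_ratio_tendsto A pos) auto
      qed
      fix n
      show "AE x in ?M. norm (c0' n i x * ln (c0' n i x / average \<Omega> (c0' n i))) \<le> 1 + K"
        using U
      proof eventually_elim
        case (elim x)
        then have c: "0 \<le> c0' n i x" "c0' n i x \<le> 1" using i by auto
        let ?a = "average \<Omega> (c0' n i)"
        have "c0' n i x * ln (c0' n i x / ?a) = c0' n i x * ln (c0' n i x) - c0' n i x * ln ?a"
          using c pos(2)[OF i, of n] by (cases "c0' n i x = 0") (simp_all add: ln_div right_diff_distrib)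
        also have "\<bar>\<dots>\<bar> \<le> \<bar>c0' n i x * ln (c0' n i x)\<bar> + \<bar>c0' n i x * ln ?a\<bar>" by (rule abs_triangle_ineq4)
        also have "\<dots> \<le> 1 + 1 * K"
        proof (rule add_mono)
          show "\<bar>c0' n i x * ln (c0' n i x)\<bar> \<le> 1" by (rule abs_x_ln_x_le_1[OF c])
          show "\<bar>c0' n i x * ln ?a\<bar> \<le> 1 * K"
            unfolding abs_mult[of _ "ln ?a"] abs_of_nonneg[OF c(1)]
            by (rule mult_mono[OF c(2) K zero_le_one abs_ge_zero])
        qed
        finally show ?case unfolding real_norm_def mult_1 .
      qed
    next
      show "(\<lambda>x. c0 i x * ln (c0 i x / average \<Omega> (c0 i))) \<in> borel_measurable ?M"
        "(\<lambda>x. c0' n i x * ln (c0' n i x / average \<Omega> (c0' n i))) \<in> borel_measurable ?M" for n by measurable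
      show "integrable ?M (\<lambda>x. 1 + K)" by (rule const)
    qed
  qed
qed

lemma average_initial_pos:
  fixes \<Omega> :: "'a::euclidean_space set"
  assumes \<Omega>: "open \<Omega>" "bounded \<Omega>" "\<Omega> \<noteq> {}" and init: "initial_data \<Omega> N c0" and L1: "0 < L1_norm \<Omega> (c0 i)" and i: "i \<le> N"
  shows "0 < average \<Omega> (c0 i)"
proof -
  have "AE x in lebesgue_on \<Omega>. \<bar>c0 i x\<bar> = c0 i x"
    using initial_data_unit_interval[OF init] by eventually_elim (use i in simp)
  moreover have "c0 i \<in> borel_measurable (lebesgue_on \<Omega>)" using init i by (simp add: initial_data_def)
  ultimately have "L1_norm \<Omega> (c0 i) = (LINT x|lebesgue_on \<Omega>. c0 i x)"
    unfolding L1_norm_def by (intro integral_cong_AE) auto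
  then show ?thesis using L1 measure_open_pos[OF \<Omega>(1,3,2)] by (simp add: average_def)
qed

lemma average_positive_data:
  fixes \<Omega> :: "'a::euclidean_space set"
  assumes \<Omega>: "open \<Omega>" "bounded \<Omega>" "\<Omega> \<noteq> {}" and init: "initial_data \<Omega> N c0" and i: "i \<le> N"
    and \<eta>: "0 < \<eta>" "AE x in lebesgue_on \<Omega>. \<eta> \<le> c0 i x"
  shows "0 < average \<Omega> (c0 i)"
proof (rule average_initial_pos[OF \<Omega> init _ i])
  let ?M = "lebesgue_on \<Omega>"
  have b: "\<Omega> \<in> sets borel" using \<Omega> by simp
  note fin = finite_measure_lebesgue_on_bounded[OF b \<Omega>(2)]
  have cm: "c0 i \<in> borel_measurable ?M" using init i by (simp add: initial_data_def)
  have "0 < \<eta> * measure lebesgue \<Omega>" using \<eta>(1) measure_open_pos[OF \<Omega>(1,3,2)] by simp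
  also have "\<dots> = (LINT x|?M. \<eta>)" by (rule integral_const_lebesgue_on[OF b, symmetric])
  also have "\<dots> \<le> L1_norm \<Omega> (c0 i)"
    unfolding L1_norm_def
  proof (rule integral_mono_AE)
    show "integrable ?M (\<lambda>x. \<eta>)" by (rule finite_measure.integrable_const[OF fin])
    show "integrable ?M (\<lambda>x. \<bar>c0 i x\<bar>)"
    proof (rule finite_measure.integrable_const_bound[OF fin, where B = 1])
      show "AE x in ?M. norm \<bar>c0 i x\<bar> \<le> 1"
        using initial_data_unit_interval[OF init] by eventually_elim (use i in simp)
    qed (use cm in simp)
    show "AE x in ?M. \<eta> \<le> \<bar>c0 i x\<bar>" using \<eta>(2) by eventually_elim simp
  qed
  finally show "0 < L1_norm \<Omega> (c0 i)" .
qed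

context diffusion_coefficients
begin

text \<open>
  The rate and the constant of the bound for positive data do not depend on the lower bound of the
  data.
\<close>

theorem general_data_decay:
  fixes \<Omega> :: "'a::euclidean_space set"
  assumes domain: "bounded_C11_domain \<Omega>" and LS: "log_sobolev \<Omega> C" "C > 0"
    and constr: "constructed_from_general_data \<Omega> N D c0 c" and L1: "\<And>i. i \<le> N \<Longrightarrow> 0 < L1_norm \<Omega> (c0 i)"
    and i: "i \<le> N" and t: "t \<ge> 0"
  shows "L1_norm \<Omega> (\<lambda>x. c i t x - average \<Omega> (c0 i)) \<le>
    sqrt (2 * measure lebesgue \<Omega> * (exp (- (2 / (C * dmax)) / 2 * t) * relative_entropy \<Omega> N c0 c0))"
proof -
  have \<Omega>: "open \<Omega>" "bounded \<Omega>" "\<Omega> \<noteq> {}" using domain by (auto simp: bounded_C11_domain_def)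
  let ?\<kappa> = "2 / (C * dmax)" and ?v = "measure lebesgue \<Omega>"
  from constr obtain \<eta> c0' c' where
    constr': "\<And>n::nat. constructed_from_positive_data \<Omega> N D (\<eta> n) (c0' n) (c' n)"
    and lim: "AE x in lebesgue_on \<Omega>. \<forall>i\<le>N. (\<lambda>n. c0' n i x) \<longlonglongrightarrow> c0 i x"
    and conv: "\<And>T i. T > 0 \<Longrightarrow> i < N \<Longrightarrow> converges_on \<Omega> T (\<lambda>n. c' n i) (\<lambda>n. time_deriv \<Omega> (c' n i)) (c i)"
    unfolding constructed_from_general_data_def by blast
  have ws: "weak_solution \<Omega> N D c0 c" and init: "initial_data \<Omega> N c0"
    using constr by (simp_all add: constructed_from_general_data_def)
  have ws': "weak_solution \<Omega> N D (c0' n) (c' n)" and init': "initial_data \<Omega> N (c0' n)"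
    and \<eta>: "0 < \<eta> n" "\<And>i. i \<le> N \<Longrightarrow> AE x in lebesgue_on \<Omega>. \<eta> n \<le> c0' n i x" for n
    using constr'[of n] by (simp_all add: constructed_from_positive_data_def)
  have pos: "0 < average \<Omega> (c0 i)" if "i \<le> N" for i
    by (rule average_initial_pos[OF \<Omega> init L1[OF that] that])
  have pos': "0 < average \<Omega> (c0' n i)" if "i \<le> N" for n i
    by (rule average_positive_data[OF \<Omega> init' that \<eta>(1) \<eta>(2)[OF that]])
  have rel1: "(\<lambda>n. average \<Omega> (c0' n i)) \<longlonglongrightarrow> average \<Omega> (c0 i)" if "i \<le> N" for i
    by (rule relative_entropy_tendsto(1)[OF \<Omega>(1,2) init init' _ _ lim that]) (rule pos pos', assumption)+
  have rel2: "(\<lambda>n. relative_entropy \<Omega> N (c0' n) (c0' n)) \<longlonglongrightarrow> relative_entropy \<Omega> N c0 c0"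
    by (rule relative_entropy_tendsto(2)[OF \<Omega>(1,2) init init' _ _ lim]) (rule pos pos', assumption)+
  define B where "B t = sqrt (2 * ?v * (exp (- ?\<kappa> / 2 * t) * relative_entropy \<Omega> N c0 c0))" for t
  have "AE t in lebesgue_on {0<..<T}. \<forall>i\<le>N. L1_norm \<Omega> (\<lambda>x. c i t x - average \<Omega> (c0 i)) \<le> B t" if T: "T > 0" for T
  proof (rule L2_limit_bound[OF \<Omega>(1,2), where u = c' and K = "sqrt ?v" and m' = "\<lambda>n i. average \<Omega> (c0' n i)"
      and B' = "\<lambda>n t. sqrt (2 * ?v * (exp (- ?\<kappa> / 2 * t) * relative_entropy \<Omega> N (c0' n) (c0' n)))"])
    show "strongly_measurable \<Omega> T (c' n i)" if "i < N" for n i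
      by (rule weak_solution_strongly_measurable[OF ws' less_imp_le[OF that]])
    show "strongly_measurable \<Omega> T (c i)" if "i < N" for i
      by (rule weak_solution_strongly_measurable[OF ws less_imp_le[OF that]])
    show "c' n i t \<in> L2 \<Omega>" if "i \<le> N" "0 < t" for n i t
      using ws'[of n] that by (simp add: weak_solution_def)
    show "c i t \<in> L2 \<Omega>" if "i \<le> N" "0 < t" for i t
      using ws that by (simp add: weak_solution_def)
    show "AE x in lebesgue_on \<Omega>. c' n N t x = 1 - (\<Sum>i<N. c' n i t x)" if "0 < t" for n t
      using ws'[of n] that by (simp add: weak_solution_def)
    show "AE x in lebesgue_on \<Omega>. c N t x = 1 - (\<Sum>i<N. c i t x)" if "0 < t" for t
      using ws that by (simp add: weak_solution_def)
    show "AE t in lebesgue_on {0<..<T}. L2_norm \<Omega> (\<lambda>x. c' n i t x - c i t x) \<le> sqrt ?v" if "i < N" for n i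
      using weak_solution_unit_interval[OF ws less_imp_le[OF that]] weak_solution_unit_interval[OF ws'[of n] less_imp_le[OF that]] AE_space
    proof eventually_elim
      case (elim t)
      have "c i t \<in> L2 \<Omega>" "c' n i t \<in> L2 \<Omega>" using ws ws'[of n] elim(3) that by (simp_all add: weak_solution_def)
      then show ?case using elim(1,2) by (intro L2_norm_diff_unit_interval[OF \<Omega>(1,2)])
    qed
    show "(\<lambda>n. bochner_L2_norm T (L2_norm \<Omega>) (\<lambda>t x. c' n i t x - c i t x)) \<longlonglongrightarrow> 0" if "i < N" for i
      using conv[OF T that] unfolding converges_on_def by (rule conjunct1)
    show "L1_norm \<Omega> (\<lambda>x. c' n i t x - average \<Omega> (c0' n i)) \<le>
        sqrt (2 * ?v * (exp (- ?\<kappa> / 2 * t) * relative_entropy \<Omega> N (c0' n) (c0' n)))"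
      if "i \<le> N" "0 < t" "t < T" for n i t
      using that by (intro positive_data_decay[OF domain LS constr']) auto
    show "(\<lambda>n. average \<Omega> (c0' n i)) \<longlonglongrightarrow> average \<Omega> (c0 i)" if "i \<le> N" for i by (rule rel1[OF that])
    show "(\<lambda>n. sqrt (2 * ?v * (exp (- ?\<kappa> / 2 * t) * relative_entropy \<Omega> N (c0' n) (c0' n)))) \<longlonglongrightarrow> B t" for t
      unfolding B_def by (intro tendsto_real_sqrt tendsto_mult_left rel2)
  qed
  then have "AE t in lebesgue_on {0<..<T}. \<forall>i\<le>N. L1_norm \<Omega> (\<lambda>x. c i t x - average \<Omega> (c0 i)) \<le> B t" for T
    using AE_empty_interval by blast
  moreover have "isCont B t" for t unfolding B_def by (intro continuous_intros)
  ultimately have "L1_norm \<Omega> (\<lambda>x. c i t x - average \<Omega> (c0 i)) \<le> B t"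
    by (intro weak_solution_every_time[OF \<Omega>(1,2) ws _ _ i t, where m = "\<lambda>i. average \<Omega> (c0 i)"])
  then show ?thesis unfolding B_def .
qed

end

theorem theorem2:
  fixes \<Omega> :: "'a::euclidean_space set"
  assumes "DIM('a) \<le> 3"
    and "bounded_C11_domain \<Omega>"
  shows "\<exists>C>0. \<forall>N D.
    N \<ge> 2 \<and> D \<in> carrier_mat (N + 1) (N + 1) \<and> transpose_mat D = D \<and>
    (\<forall>i\<le>N. \<forall>j\<le>N. i \<noteq> j \<longrightarrow> D $$ (i, j) > 0) \<longrightarrow>
    (\<exists>lam>0. \<forall>c0 c.
      initial_data \<Omega> N c0 \<and> (MIN i\<in>{..N}. L1_norm \<Omega> (c0 i)) > 0 \<and>
      constructed_weak_solution \<Omega> N D c0 c \<longrightarrow>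
      (\<forall>i\<le>N. \<forall>t\<ge>0.
        L1_norm \<Omega> (\<lambda>x. c i t x - average \<Omega> (c0 i))
          \<le> C * exp (- lam * t) * sqrt (relative_entropy \<Omega> N c0 c0)))"
proof -
  have \<Omega>: "open \<Omega>" "bounded \<Omega>" "\<Omega> \<noteq> {}" using assms by (auto simp: bounded_C11_domain_def)
  let ?v = "measure lebesgue \<Omega>"
  obtain K where K: "K > 0" "log_sobolev \<Omega> K"
    using log_sobolev_C11_domain[OF assms(2)] by blast
  have C: "0 < sqrt (2 * ?v)" using measure_open_pos[OF \<Omega>(1,3,2)] by simp
  show ?thesis
  proof (rule exI[of _ "sqrt (2 * ?v)"], intro conjI allI impI C)
    fix N and D :: "real Matrix.mat"
    assume ND: "N \<ge> 2 \<and> D \<in> carrier_mat (N + 1) (N + 1) \<and> transpose_mat D = D \<and>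
      (\<forall>i\<le>N. \<forall>j\<le>N. i \<noteq> j \<longrightarrow> D $$ (i, j) > 0)"
    interpret diffusion_coefficients N D
    proof
      show "1 \<le> N" using ND by simp
      fix i j assume ij: "i \<le> N" "j \<le> N"
      then have "transpose_mat D $$ (j, i) = D $$ (i, j)" using ND by (subst index_transpose_mat) auto
      then show "D $$ (i, j) = D $$ (j, i)" using ND by simp
    qed (use ND in auto)
    let ?lam = "1 / (2 * (K * dmax))"
    show "\<exists>lam>0. \<forall>c0 c.
      initial_data \<Omega> N c0 \<and> (MIN i\<in>{..N}. L1_norm \<Omega> (c0 i)) > 0 \<and>
      constructed_weak_solution \<Omega> N D c0 c \<longrightarrow>
      (\<forall>i\<le>N. \<forall>t\<ge>0.
        L1_norm \<Omega> (\<lambda>x. c i t x - average \<Omega> (c0 i))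
          \<le> sqrt (2 * ?v) * exp (- lam * t) * sqrt (relative_entropy \<Omega> N c0 c0))"
    proof (rule exI[of _ ?lam], intro conjI allI impI)
      show "0 < ?lam" using K(1) dmax_pos by simp
      fix c0 :: "nat \<Rightarrow> 'a \<Rightarrow> real" and c i and t :: real
      assume A: "initial_data \<Omega> N c0 \<and> (MIN i\<in>{..N}. L1_norm \<Omega> (c0 i)) > 0 \<and> constructed_weak_solution \<Omega> N D c0 c"
        and i: "i \<le> N" and t: "0 \<le> t"
      have L1: "0 < L1_norm \<Omega> (c0 i)" if "i \<le> N" for i
        using A that by (auto simp: Min_gr_iff)
      have "L1_norm \<Omega> (\<lambda>x. c i t x - average \<Omega> (c0 i)) \<le>
          sqrt (2 * ?v * (exp (- (2 / (K * dmax)) / 2 * t) * relative_entropy \<Omega> N c0 c0))"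
      proof -
        have "(\<exists>\<eta>. constructed_from_positive_data \<Omega> N D \<eta> c0 c) \<or> constructed_from_general_data \<Omega> N D c0 c"
          using A unfolding constructed_weak_solution_def by (elim conjE)
        then show ?thesis
        proof (elim disjE exE)
          fix \<eta> assume "constructed_from_positive_data \<Omega> N D \<eta> c0 c"
          then show ?thesis by (rule positive_data_decay[OF assms(2) K(2,1) _ i t])
        next
          assume "constructed_from_general_data \<Omega> N D c0 c"
          then show ?thesis by (rule general_data_decay[OF assms(2) K(2,1) _ L1 i t])
        qed
      qed
      also have "exp (- (2 / (K * dmax)) / 2 * t) = (exp (- ?lam * t))\<^sup>2"
      proof -
        have "- (2 / x) / 2 * t = 2 * (- (1 / (2 * x)) * t)" for x :: real
          by (cases "x = 0") (auto simp: field_simps)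
        then show ?thesis by (simp only: exp_double)
      qed
      also have "sqrt (2 * ?v * ((exp (- ?lam * t))\<^sup>2 * relative_entropy \<Omega> N c0 c0)) =
          sqrt (2 * ?v) * exp (- ?lam * t) * sqrt (relative_entropy \<Omega> N c0 c0)"
        by (simp only: real_sqrt_mult real_sqrt_abs abs_exp_cancel mult.assoc)
      finally show "L1_norm \<Omega> (\<lambda>x. c i t x - average \<Omega> (c0 i))
          \<le> sqrt (2 * ?v) * exp (- ?lam * t) * sqrt (relative_entropy \<Omega> N c0 c0)" .
    qed
  qed
qed

end
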